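(* Let $R,C,T,k,V_{\mathrm{meas}}>0$, $\tau=RC$, $\sigma=2kTR/V_{\mathrm{meas}}$. Consider $$\tau v(t)=\tau v(0)+\int_0^t\big(R\,i(t')-v(t')\big)\,dt'+\sqrt{2kTR}\,B(t),\qquad Y(t)=\frac{1}{\sqrt{V_{\mathrm{meas}}}}\int_0^t v(t')\,dt'+B_{\mathrm{meas}}(t),$$ where $v(0)\sim N(0,kT/C)$, $B$ and $B_{\mathrm{meas}}$ are standard Brownian motions, $v(0),B,B_{\mathrm{meas}}$ are independent, and $i$ is an admissible control. Then for every $t\ge0$ the transfer entropy $I_c(t):=I\big((v(0),(B)_0^t);(Y)_0^t\big)$ is $$I_c(t)=\frac{1}{2V_{\mathrm{meas}}}\int_0^t\big\langle[v(t')-\hat v(t')]^2\big\rangle\,dt'=\frac{\sigma}{4\tau}\int_0^t\frac{T_{\min}(t')}{T}\,dt',$$ where $\hat v(t)$ is the conditional mean of $v(t)$ given $(Y)_0^t$ and $T_{\min}$ solves $$\tau\dot T_{\min}=2(T-T_{\min})-\frac{\sigma T_{\min}^2}{2T},\qquad T_{\min}(0)=T.$$ In particular $I_c(t)$ does not depend on the choice of the admissible control $i$.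
   Context: Here $\langle\cdot\rangle$ denotes expectation and $(Z)_0^t$ denotes the path $\{Z(t'):0\le t'\le t\}$. Admissible control: $i(t)=f_t(Y)$, where $f$ is a measurable non-anticipative functional ($f_t(Y)$ depends only on $(Y)_0^t$), such that the system has a unique strong solution and, for every $t$, $\sup_{t'\le t}\langle v(t')^2\rangle<\infty$ and $\int_0^t\langle i(t')^2\rangle dt'<\infty$. Nonlinear controls are allowed. Mutual information (in nats) between random elements $\theta,\xi$: $I(\theta;\xi)=\int\ln\frac{d\mathbb P_{\theta\xi}}{d(\mathbb P_\theta\otimes\mathbb P_\xi)}\,d\mathbb P_{\theta\xi}$ (and $+\infty$ if $\mathbb P_{\theta\xi}$ is not absolutely continuous with respect to $\mathbb P_\theta\otimes\mathbb P_\xi$). *)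

theory Defs
  imports "HOL-Probability.Probability"
begin

text \<open>
  Processes have type \<open>real \<Rightarrow> 'a \<Rightarrow> real\<close> (time first) and are only looked at for times
  \<open>t \<ge> 0\<close>.  The restriction of \<open>Z\<close> to a time set \<open>J\<close> is a random element of the product space
  \<open>path_space J\<close>; for processes with continuous paths its cylinder sigma-algebra generates the
  same events as the Borel sigma-algebra of the space of continuous functions.
\<close>

definition path :: "(real \<Rightarrow> 'a \<Rightarrow> real) \<Rightarrow> real set \<Rightarrow> 'a \<Rightarrow> real \<Rightarrow> real" where
  "path Z J \<omega> = (\<lambda>s\<in>J. Z s \<omega>)"

abbreviation path_space :: "real set \<Rightarrow> (real \<Rightarrow> real) measure" where
  "path_space J \<equiv> PiM J (\<lambda>_. borel)"

definition cont_path_space :: "(real \<Rightarrow> real) measure" where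
  "cont_path_space = restrict_space (path_space {0..}) {y. continuous_on {0..} y}"

definition standard_brownian_motion :: "'a measure \<Rightarrow> (real \<Rightarrow> 'a \<Rightarrow> real) \<Rightarrow> bool" where
  "standard_brownian_motion M B \<longleftrightarrow>
     (\<forall>t\<ge>0. B t \<in> borel_measurable M) \<and>
     (AE \<omega> in M. B 0 \<omega> = 0) \<and>
     (\<forall>s t. 0 \<le> s \<and> s < t \<longrightarrow>
        distributed M lborel (\<lambda>\<omega>. B t \<omega> - B s \<omega>) (normal_density 0 (sqrt (t - s)))) \<and>
     (\<forall>(n::nat) p. 0 \<le> p 0 \<and> (\<forall>j<n. p j \<le> p (Suc j)) \<longrightarrow>
        prob_space.indep_vars M (\<lambda>_. borel) (\<lambda>j \<omega>. B (p (Suc j)) \<omega> - B (p j) \<omega>) {..<n}) \<and>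
     (AE \<omega> in M. continuous_on {0..} (\<lambda>t. B t \<omega>))"

text \<open>
  Joint independence of one random variable and two processes.  The three random elements do not
  have a common type, so independence is stated for the sigma-algebras they generate.
\<close>

definition indep_drivers ::
  "'a measure \<Rightarrow> ('a \<Rightarrow> real) \<Rightarrow> (real \<Rightarrow> 'a \<Rightarrow> real) \<Rightarrow> (real \<Rightarrow> 'a \<Rightarrow> real) \<Rightarrow> bool" where
  "indep_drivers M v0 B Bm \<longleftrightarrow>
     prob_space.indep_sets M
       (\<lambda>j. [sets (vimage_algebra (space M) v0 borel),
             sets (vimage_algebra (space M) (path B {0..}) (path_space {0..})),
             sets (vimage_algebra (space M) (path Bm {0..}) (path_space {0..}))] ! j)
       {..<3::nat}"

text \<open>
  The sigma-algebra generated by \<open>v0\<close> and by \<open>B\<close>, \<open>Bm\<close> up to time \<open>t\<close>, augmented by the null sets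
  of \<open>M\<close>.
\<close>

definition driver_filtration ::
  "'a measure \<Rightarrow> ('a \<Rightarrow> real) \<Rightarrow> (real \<Rightarrow> 'a \<Rightarrow> real) \<Rightarrow> (real \<Rightarrow> 'a \<Rightarrow> real) \<Rightarrow> real \<Rightarrow> 'a measure" where
  "driver_filtration M v0 B Bm t =
     sigma (space M)
       (sets (vimage_algebra (space M) v0 borel) \<union>
        sets (vimage_algebra (space M) (path B {0..t}) (path_space {0..t})) \<union>
        sets (vimage_algebra (space M) (path Bm {0..t}) (path_space {0..t})) \<union>
        null_sets M)"

text \<open>
  A control functional maps a time and a continuous observation path to a control value.
\<close>

definition nonanticipative_functional :: "(real \<Rightarrow> (real \<Rightarrow> real) \<Rightarrow> real) \<Rightarrow> bool" where
  "nonanticipative_functional f \<longleftrightarrow>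
     (\<lambda>(t, y). f t y) \<in> borel_measurable (restrict_space borel {0..} \<Otimes>\<^sub>M cont_path_space) \<and>
     (\<forall>t\<ge>0. \<forall>y\<in>space cont_path_space. \<forall>y'\<in>space cont_path_space.
        (\<forall>s\<in>{0..t}. y s = y' s) \<longrightarrow> f t y = f t y')"

definition control ::
  "(real \<Rightarrow> (real \<Rightarrow> real) \<Rightarrow> real) \<Rightarrow> (real \<Rightarrow> 'a \<Rightarrow> real) \<Rightarrow> real \<Rightarrow> 'a \<Rightarrow> real" where
  "control f Y t \<omega> = f t (path Y {0..} \<omega>)"

text \<open>
  The noise is additive, so the system is a pathwise integral equation and needs no stochastic
  integral.  The integrability of the drift is part of the equation, since the Bochner integral of
  a non-integrable function is 0 by convention.
\<close>

definition strong_solution ::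
  "'a measure \<Rightarrow> real \<Rightarrow> real \<Rightarrow> real \<Rightarrow> real \<Rightarrow> real \<Rightarrow>
   ('a \<Rightarrow> real) \<Rightarrow> (real \<Rightarrow> 'a \<Rightarrow> real) \<Rightarrow> (real \<Rightarrow> 'a \<Rightarrow> real) \<Rightarrow>
   (real \<Rightarrow> (real \<Rightarrow> real) \<Rightarrow> real) \<Rightarrow> (real \<Rightarrow> 'a \<Rightarrow> real) \<Rightarrow> (real \<Rightarrow> 'a \<Rightarrow> real) \<Rightarrow> bool" where
  "strong_solution M R C T k Vmeas v0 B Bm f v Y \<longleftrightarrow>
     (\<forall>\<omega>\<in>space M. continuous_on {0..} (\<lambda>t. v t \<omega>) \<and> continuous_on {0..} (\<lambda>t. Y t \<omega>)) \<and>
     (\<forall>t\<ge>0. v t \<in> borel_measurable (driver_filtration M v0 B Bm t) \<and>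
            Y t \<in> borel_measurable (driver_filtration M v0 B Bm t)) \<and>
     (AE \<omega> in M. v 0 \<omega> = v0 \<omega> \<and>
        (\<forall>t\<ge>0.
           set_integrable lborel {0..t} (\<lambda>s. R * control f Y s \<omega> - v s \<omega>) \<and>
           R * C * v t \<omega> = R * C * v 0 \<omega> + (LBINT s:{0..t}. R * control f Y s \<omega> - v s \<omega>)
                            + sqrt (2 * k * T * R) * B t \<omega> \<and>
           Y t \<omega> = 1 / sqrt Vmeas * (LBINT s:{0..t}. v s \<omega>) + Bm t \<omega>))"

definition admissible_control ::
  "'a measure \<Rightarrow> real \<Rightarrow> real \<Rightarrow> real \<Rightarrow> real \<Rightarrow> real \<Rightarrow>
   ('a \<Rightarrow> real) \<Rightarrow> (real \<Rightarrow> 'a \<Rightarrow> real) \<Rightarrow> (real \<Rightarrow> 'a \<Rightarrow> real) \<Rightarrow>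
   (real \<Rightarrow> (real \<Rightarrow> real) \<Rightarrow> real) \<Rightarrow> bool" where
  "admissible_control M R C T k Vmeas v0 B Bm f \<longleftrightarrow>
     nonanticipative_functional f \<and>
     (\<exists>v Y. strong_solution M R C T k Vmeas v0 B Bm f v Y \<and>
        (\<forall>v' Y'. strong_solution M R C T k Vmeas v0 B Bm f v' Y' \<longrightarrow>
           (AE \<omega> in M. \<forall>t\<ge>0. v' t \<omega> = v t \<omega> \<and> Y' t \<omega> = Y t \<omega>)) \<and>
        (\<forall>t\<ge>0.
           (SUP s\<in>{0..t}. \<integral>\<^sup>+\<omega>. ennreal ((v s \<omega>)\<^sup>2) \<partial>M) < \<infinity> \<and>
           (\<integral>\<^sup>+s\<in>{0..t}. (\<integral>\<^sup>+\<omega>. ennreal ((control f Y s \<omega>)\<^sup>2) \<partial>M) \<partial>lborel) < \<infinity>))"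

text \<open>
  Mutual information in nats with values in the extended reals.  The library's
  \<open>mutual_information\<close> is real-valued: it does not give \<open>\<infinity>\<close> when absolute continuity or
  integrability fails.  The negative part of the integrand always has a finite integral, so the
  difference below is well defined.
\<close>

definition mutual_info_nats ::
  "'a measure \<Rightarrow> 'b measure \<Rightarrow> 'c measure \<Rightarrow> ('a \<Rightarrow> 'b) \<Rightarrow> ('a \<Rightarrow> 'c) \<Rightarrow> ereal" where
  "mutual_info_nats M S U \<theta> \<xi> =
     (let P = distr M (S \<Otimes>\<^sub>M U) (\<lambda>\<omega>. (\<theta> \<omega>, \<xi> \<omega>));
          Q = distr M S \<theta> \<Otimes>\<^sub>M distr M U \<xi>;
          g = (\<lambda>z. ln (enn2real (RN_deriv Q P z)))
      in if absolutely_continuous Q P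
         then enn2ereal (\<integral>\<^sup>+z. ennreal (g z) \<partial>P) - enn2ereal (\<integral>\<^sup>+z. ennreal (- g z) \<partial>P)
         else \<infinity>)"

definition transfer_entropy ::
  "'a measure \<Rightarrow> ('a \<Rightarrow> real) \<Rightarrow> (real \<Rightarrow> 'a \<Rightarrow> real) \<Rightarrow> (real \<Rightarrow> 'a \<Rightarrow> real) \<Rightarrow> real \<Rightarrow> ereal" where
  "transfer_entropy M v0 B Y t =
     mutual_info_nats M (borel \<Otimes>\<^sub>M path_space {0..t}) (path_space {0..t})
       (\<lambda>\<omega>. (v0 \<omega>, path B {0..t} \<omega>)) (path Y {0..t})"

definition cond_mean ::
  "'a measure \<Rightarrow> (real \<Rightarrow> 'a \<Rightarrow> real) \<Rightarrow> (real \<Rightarrow> 'a \<Rightarrow> real) \<Rightarrow> real \<Rightarrow> 'a \<Rightarrow> real" where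
  "cond_mean M v Y t =
     real_cond_exp M (vimage_algebra (space M) (path Y {0..t}) (path_space {0..t})) (v t)"

definition Tmin_equation :: "real \<Rightarrow> real \<Rightarrow> real \<Rightarrow> (real \<Rightarrow> real) \<Rightarrow> bool" where
  "Tmin_equation \<tau> \<sigma> T Tmin \<longleftrightarrow>
     Tmin 0 = T \<and>
     (\<forall>t\<ge>0. \<exists>D. (Tmin has_real_derivative D) (at t within {0..}) \<and>
        \<tau> * D = 2 * (T - Tmin t) - \<sigma> * (Tmin t)\<^sup>2 / (2 * T))"

end

(*
  Solving the linear equations pathwise gives v = u + b and Y = Ys + h, where (u, Ys) is the
  uncontrolled Ornstein-Uhlenbeck channel and b, h are functionals of Y; so Ys is a function of Y.
  Conversely, Y is a function of Ys by uniqueness of the strong solution: freeze the signal at a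
  typical realisation; since a smooth shift of the measurement noise preserves null sets, the
  frozen solution map, driven by Ys, solves the equation again.  Entropy and estimation error are
  therefore those of the uncontrolled channel, for every control.

  There the filter is a Wiener integral of Ys, and its error variance P = k T_min / C solves the
  Riccati equation.  The entropy is pinned by the Donsker-Varadhan principle: comparison with a
  predictable Gaussian channel on ever finer partitions gives
  E_joint f <= (1/2V) int P + ln E_product (exp f) for all bounded f, and explicit log-likelihood
  ratios psi with E_product (exp psi) = 1 attain this bound up to epsilon.
*)
theory Submission
 imports Defs
begin

text \<open>The control is merely measurable in the observed path, so no density for the law of
  \<open>Y\<close> is at hand; the only hold on the controlled system is uniqueness among adapted
  solutions. Hence no likelihood of \<open>Y\<close> is computed: the two channels are related by
  maps of observation paths that leave the signal untouched.

  In the linear channel the marginal density of the observations is not explicit either. In the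
  upper bound it occurs twice with opposite signs and cancels, which leaves the divergence from an
  arbitrary output law; the predictable Gaussian law chosen there has means close to the filter, and
  the excess vanishes with the mesh. In the lower bound the innovations are exactly independent of
  the past, so the test functions are exactly normalised.

  All integrands are deterministic and smooth on their range, so Wiener integrals are pathwise
  limits of sums, covariances are limits of finite sums, and the Riccati equation enters through
  explicit antiderivatives. That a shift of the noise preserves null sets follows from the same
  variational inequality, with a bound on the energy of the shift as its constant.\<close>

lemmas hk_integral_add = Henstock_Kurzweil_Integration.integral_add
lemmas hk_integral_combine = Henstock_Kurzweil_Integration.integral_combine
lemmas hk_integral_cong = Henstock_Kurzweil_Integration.integral_cong
lemmas hk_integral_diff = Henstock_Kurzweil_Integration.integral_diff
lemmas hk_integral_mult_right = Henstock_Kurzweil_Integration.integral_mult_right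
lemmas hk_integral_nonneg = Henstock_Kurzweil_Integration.integral_nonneg

abbreviation "vecs n \<equiv> PiM {..<n::nat} (\<lambda>_. borel)"
abbreviation "sigs I \<equiv> borel \<Otimes>\<^sub>M path_space I"
abbreviation "gap p i \<equiv> p (Suc i) - p i"
abbreviation incs :: "nat \<Rightarrow> (nat \<Rightarrow> real) \<Rightarrow> (real \<Rightarrow> 'a \<Rightarrow> real) \<Rightarrow> 'a \<Rightarrow> nat \<Rightarrow> real" where
 "incs n p Y w \<equiv> \<lambda>i\<in>{..<n}. Y (p (Suc i)) w - Y (p i) w"
abbreviation "cell n j \<equiv> {real j / 2^n..real (Suc j) / 2^n}"

section \<open>Fourier uniqueness and factorisation\<close>

text \<open>The positive and negative parts of \<open>W\<close> have equal mass, so after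
  normalisation both are probability densities; their images under \<open>Z\<close> have the same
  characteristic function and coincide by Levy's uniqueness theorem.\<close>

lemma (in prob_space) fourier_zero_1d:
 fixes W Z :: "'a \<Rightarrow> real"
 assumes W: "integrable M W" and Z: "Z \<in> borel_measurable M"
  and c: "\<And>c. (LINT w|M. W w * cos (c * Z w)) = 0"
  and s: "\<And>c. (LINT w|M. W w * sin (c * Z w)) = 0"
  and A: "A \<in> sets borel"
 shows "(LINT w|M. W w * indicator A (Z w)) = 0"
proof -
 note [measurable] = Z A
 define Wp Wm where "Wp = (\<lambda>w. max 0 (W w))" and "Wm = (\<lambda>w. max 0 (- W w))"
 have [measurable]: "W \<in> borel_measurable M" using W by auto
 have ip: "integrable M Wp" "integrable M Wm"
  using W by (auto simp: Wp_def Wm_def)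
 have [measurable]: "Wp \<in> borel_measurable M" "Wm \<in> borel_measurable M"
  using ip by auto
 have nn: "Wp w \<ge> 0" "Wm w \<ge> 0" for w by (auto simp: Wp_def Wm_def)
 have Weq: "W w = Wp w - Wm w" for w by (auto simp: Wp_def Wm_def)
 have ipf: "integrable M (\<lambda>w. Wp w * f (Z w))" "integrable M (\<lambda>w. Wm w * f (Z w))"
  if "f \<in> borel_measurable borel" "\<And>x. \<bar>f x\<bar> \<le> 1" for f :: "real \<Rightarrow> real"
 proof -
  have [measurable]: "f \<in> borel_measurable borel" by fact
  show "integrable M (\<lambda>w. Wp w * f (Z w))"
   by (rule Bochner_Integration.integrable_bound[OF ip(1)])
    (use that(2) nn in \<open>auto simp: abs_mult intro!: AE_I2 mult_left_le\<close>)
  show "integrable M (\<lambda>w. Wm w * f (Z w))"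
   by (rule Bochner_Integration.integrable_bound[OF ip(2)])
    (use that(2) nn in \<open>auto simp: abs_mult intro!: AE_I2 mult_left_le\<close>)
 qed
 have split: "(LINT w|M. W w * f (Z w)) = (LINT w|M. Wp w * f (Z w)) - (LINT w|M. Wm w * f (Z w))"
  if "f \<in> borel_measurable borel" "\<And>x. \<bar>f x\<bar> \<le> 1" for f :: "real \<Rightarrow> real"
  unfolding Weq left_diff_distrib using ipf[OF that] by (rule Bochner_Integration.integral_diff)
 define m where "m = (LINT w|M. Wp w)"
 \<comment> \<open>Frequency 0 in the cosine hypothesis says that \<open>W\<close> has integral 0,
   which balances the two masses.\<close>
 have m2: "m = (LINT w|M. Wm w)"
  using c[of 0] split[of "\<lambda>x. cos (0 * x)"] by (simp add: m_def)
 show ?thesis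
 proof (cases "m = 0")
  case True
  have "AE w in M. Wp w = 0" "AE w in M. Wm w = 0"
   using True m2 integral_nonneg_eq_0_iff_AE[OF ip(1)] integral_nonneg_eq_0_iff_AE[OF ip(2)] nn
   by (auto simp: m_def)
  then have "AE w in M. W w * indicator A (Z w) = 0" by eventually_elim (simp add: Weq)
  then show ?thesis by (rule integral_eq_zero_AE)
 next
  case False
  have m: "m > 0" using False nn by (simp add: m_def order_less_le)
  define D where "D = (\<lambda>V. distr (density M (\<lambda>w. ennreal (V w / m))) borel Z)"
  have D: "real_distribution (D V)"
   and Dint: "\<And>g::real \<Rightarrow> real. g \<in> borel_measurable borel \<Longrightarrow> (\<integral>x. g x \<partial>D V) = (LINT w|M. V w * g (Z w)) / m"
   and Dint': "\<And>g::real \<Rightarrow> complex. g \<in> borel_measurable borel \<Longrightarrow> (\<integral>x. g x \<partial>D V) = (LINT w|M. (V w / m) *\<^sub>R g (Z w))"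
   if V: "integrable M V" "\<And>w. V w \<ge> 0" "(LINT w|M. V w) = m" for V
  proof -
   have [measurable]: "V \<in> borel_measurable M" using V by auto
   have "prob_space (density M (\<lambda>w. ennreal (V w / m)))"
   proof
    have "(\<integral>\<^sup>+w. ennreal (V w / m) \<partial>M) = ennreal (LINT w|M. V w / m)"
     by (rule nn_integral_eq_integral) (use V m in auto)
    also have "... = 1" using V m by simp
    finally show "emeasure (density M (\<lambda>w. ennreal (V w / m))) (space (density M (\<lambda>w. ennreal (V w / m)))) = 1"
     by (simp add: emeasure_density cong: nn_integral_cong)
   qed
   then have "prob_space (D V)" unfolding D_def by (rule prob_space.prob_space_distr) simp
   then show "real_distribution (D V)"
    by (simp add: real_distribution_def real_distribution_axioms_def D_def)
   show "(\<integral>x. g x \<partial>D V) = (LINT w|M. V w * g (Z w)) / m" if [measurable]: "g \<in> borel_measurable borel" for g :: "real \<Rightarrow> real"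
    unfolding D_def using V m by (subst integral_distr) (auto simp: integral_density)
   show "(\<integral>x. g x \<partial>D V) = (LINT w|M. (V w / m) *\<^sub>R g (Z w))" if [measurable]: "g \<in> borel_measurable borel" for g :: "real \<Rightarrow> complex"
    unfolding D_def using V m by (subst integral_distr) (auto simp: integral_density)
  qed
  have char: "char (D V) t = of_real ((LINT w|M. V w * cos (t * Z w)) / m) + \<i> * of_real ((LINT w|M. V w * sin (t * Z w)) / m)"
   if V: "integrable M V" "\<And>w. V w \<ge> 0" "(LINT w|M. V w) = m" for V t
  proof -
   interpret d: real_distribution "D V" by (rule D[OF V])
   have i: "integrable (D V) (\<lambda>x. iexp (t * x))" by (rule d.integrable_iexp) auto
   have "Re (char (D V) t) = (\<integral>x. cos (t * x) \<partial>D V)" "Im (char (D V) t) = (\<integral>x. sin (t * x) \<partial>D V)"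
    using integral_Re[OF i] integral_Im[OF i] by (simp_all add: char_def Re_exp Im_exp)
   then show ?thesis
    using Dint[OF V, of "\<lambda>x. cos (t * x)"] Dint[OF V, of "\<lambda>x. sin (t * x)"]
    by (simp add: complex_eq_iff)
  qed
  have "char (D Wp) = char (D Wm)"
  proof
   fix t
   have "(LINT w|M. Wp w * cos (t * Z w)) = (LINT w|M. Wm w * cos (t * Z w))"
    using split[of "\<lambda>x. cos (t * x)"] c[of t] by simp
   moreover have "(LINT w|M. Wp w * sin (t * Z w)) = (LINT w|M. Wm w * sin (t * Z w))"
    using split[of "\<lambda>x. sin (t * x)"] s[of t] by simp
   ultimately show "char (D Wp) t = char (D Wm) t"
    using char[OF ip(1)] char[OF ip(2)] nn m2 by (simp add: m_def)
  qed
  then have "D Wp = D Wm"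
   using D[OF ip(1)] D[OF ip(2)] nn m2 by (intro Levy_uniqueness) (auto simp: m_def)
  then have "(LINT w|M. Wp w * indicator A (Z w)) / m = (LINT w|M. Wm w * indicator A (Z w)) / m"
   using Dint[OF ip(1), of "indicator A"] Dint[OF ip(2), of "indicator A"] nn m2 by (simp add: m_def)
  then show ?thesis using split[of "indicator A"] m by (simp add: indicator_def)
 qed
qed

text \<open>Product-to-sum formulas turn a weight \<open>W cos\<close> or \<open>W sin\<close> of
  the coordinates in \<open>J\<close>, tested against a frequency of the new coordinate, into the
  hypotheses for \<open>insert i J\<close>. The one-dimensional case then lets the indicator of the
  new coordinate be absorbed into the weight, which is why \<open>W\<close> is generalised in the
  induction.\<close>

lemma (in prob_space) fourier_zero_finite:
 fixes W :: "'a \<Rightarrow> real" and Z :: "'i \<Rightarrow> 'a \<Rightarrow> real"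
 assumes "finite J" "integrable M W" "\<And>j. j \<in> J \<Longrightarrow> Z j \<in> borel_measurable M"
  and "\<And>c. (LINT w|M. W w * cos (\<Sum>j\<in>J. c j * Z j w)) = 0"
  and "\<And>c. (LINT w|M. W w * sin (\<Sum>j\<in>J. c j * Z j w)) = 0"
  and "\<And>j. j \<in> J \<Longrightarrow> A j \<in> sets borel"
 shows "(LINT w|M. W w * (\<Prod>j\<in>J. indicator (A j) (Z j w))) = 0"
 using assms
proof (induction J arbitrary: W rule: finite_induct)
 case empty
 then show ?case using empty.prems(3)[of "\<lambda>_. 0"] by simp
next
 case (insert i J)
 have [measurable]: "\<And>j. j \<in> J \<Longrightarrow> Z j \<in> borel_measurable M" "Z i \<in> borel_measurable M" "A i \<in> sets borel"
  "W \<in> borel_measurable M"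
  using insert.prems by auto
 have bdd: "integrable M (\<lambda>w. W w * f w)" if "f \<in> borel_measurable M" "\<And>x. \<bar>f x\<bar> \<le> 1" for f
  by (rule Bochner_Integration.integrable_bound[OF insert.prems(1)])
   (use that in \<open>auto simp: abs_mult intro!: AE_I2 mult_left_le\<close>)
 have upd: "(\<Sum>j\<in>insert i J. (c(i := b)) j * Z j w) = b * Z i w + (\<Sum>j\<in>J. c j * Z j w)" for c b w
  using insert.hyps by (simp add: sum.insert) (rule sum.cong, auto)
 have C: "(LINT w|M. W w * cos (b * Z i w + (\<Sum>j\<in>J. c j * Z j w))) = 0" for b c
  using insert.prems(3)[of "c(i := b)"] unfolding upd .
 have S: "(LINT w|M. W w * sin (b * Z i w + (\<Sum>j\<in>J. c j * Z j w))) = 0" for b c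
  using insert.prems(4)[of "c(i := b)"] unfolding upd .
 have int: "integrable M (\<lambda>w. W w * cos (b * Z i w + (\<Sum>j\<in>J. c j * Z j w)))"
  "integrable M (\<lambda>w. W w * sin (b * Z i w + (\<Sum>j\<in>J. c j * Z j w)))" for b c
  by (auto intro!: bdd)
 have cc: "W w * cos x * cos y = (W w * cos (y + x) + W w * cos ((- y) + x)) / 2" for w x y
  by (simp add: cos_add cos_diff algebra_simps)
 have cs: "W w * cos x * sin y = (W w * sin (y + x) - W w * sin ((- y) + x)) / 2" for w x y
  by (simp add: sin_add sin_diff algebra_simps)
 have sc: "W w * sin x * cos y = (W w * sin (y + x) + W w * sin ((- y) + x)) / 2" for w x y
  by (simp add: sin_add sin_diff algebra_simps)
 have ss: "W w * sin x * sin y = (W w * cos ((- y) + x) - W w * cos (y + x)) / 2" for w x y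
  by (simp add: cos_add cos_diff algebra_simps)
 have neg: "- (b * Z i w) = (- b) * Z i w" for b w by simp
 have K1: "(LINT w|M. W w * cos (\<Sum>j\<in>J. c j * Z j w) * indicator (A i) (Z i w)) = 0" for c
 proof (rule fourier_zero_1d)
  show "integrable M (\<lambda>w. W w * cos (\<Sum>j\<in>J. c j * Z j w))" by (auto intro!: bdd)
  show "(LINT w|M. W w * cos (\<Sum>j\<in>J. c j * Z j w) * cos (b * Z i w)) = 0" for b
   unfolding cc neg using C[of b c] C[of "-b" c] int(1)[of b c] int(1)[of "-b" c] by simp
  show "(LINT w|M. W w * cos (\<Sum>j\<in>J. c j * Z j w) * sin (b * Z i w)) = 0" for b
   unfolding cs neg using S[of b c] S[of "-b" c] int(2)[of b c] int(2)[of "-b" c] by simp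
 qed auto
 have K2: "(LINT w|M. W w * sin (\<Sum>j\<in>J. c j * Z j w) * indicator (A i) (Z i w)) = 0" for c
 proof (rule fourier_zero_1d)
  show "integrable M (\<lambda>w. W w * sin (\<Sum>j\<in>J. c j * Z j w))" by (auto intro!: bdd)
  show "(LINT w|M. W w * sin (\<Sum>j\<in>J. c j * Z j w) * cos (b * Z i w)) = 0" for b
   unfolding sc neg using S[of b c] S[of "-b" c] int(2)[of b c] int(2)[of "-b" c] by simp
  show "(LINT w|M. W w * sin (\<Sum>j\<in>J. c j * Z j w) * sin (b * Z i w)) = 0" for b
   unfolding ss neg using C[of b c] C[of "-b" c] int(1)[of b c] int(1)[of "-b" c] by simp
 qed auto
 have "(LINT w|M. (W w * indicator (A i) (Z i w)) * (\<Prod>j\<in>J. indicator (A j) (Z j w))) = 0"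
 proof (rule insert.IH)
  show "integrable M (\<lambda>w. W w * indicator (A i) (Z i w))"
   by (rule bdd) (auto simp: indicator_def)
  show "(LINT w|M. W w * indicator (A i) (Z i w) * cos (\<Sum>j\<in>J. c j * Z j w)) = 0" for c
   using K1[of c] by (simp add: mult.assoc mult.commute mult.left_commute)
  show "(LINT w|M. W w * indicator (A i) (Z i w) * sin (\<Sum>j\<in>J. c j * Z j w)) = 0" for c
   using K2[of c] by (simp add: mult.assoc mult.commute mult.left_commute)
 qed (use insert.prems in auto)
 then show ?case using insert.hyps by (simp add: mult.assoc)
qed

text \<open>The finite case settles cylinder sets, an intersection-stable generator. The class of
  sets where the integral vanishes is closed under complements and disjoint unions, the latter by
  dominated convergence with majorant \<open>|W|\<close>.\<close>

lemma (in prob_space) fourier_zero: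
 fixes W :: "'a \<Rightarrow> real" and Z :: "'i \<Rightarrow> 'a \<Rightarrow> real"
 assumes W: "integrable M W" and Z: "\<And>i. i \<in> I \<Longrightarrow> Z i \<in> borel_measurable M"
  and c: "\<And>J c. finite J \<Longrightarrow> J \<subseteq> I \<Longrightarrow> (LINT w|M. W w * cos (\<Sum>j\<in>J. c j * Z j w)) = 0"
  and s: "\<And>J c. finite J \<Longrightarrow> J \<subseteq> I \<Longrightarrow> (LINT w|M. W w * sin (\<Sum>j\<in>J. c j * Z j w)) = 0"
  and A: "A \<in> sets (PiM I (\<lambda>_. borel))"
 shows "(LINT w|M. W w * indicator A (\<lambda>i\<in>I. Z i w)) = 0"
proof -
 have ZM[measurable]: "(\<lambda>w. \<lambda>i\<in>I. Z i w) \<in> measurable M (PiM I (\<lambda>_. borel))"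
  by (rule measurable_restrict) (rule Z)
 have [measurable]: "W \<in> borel_measurable M" using W by auto
 have bdd: "integrable M (\<lambda>w. W w * f w)" if "f \<in> borel_measurable M" "\<And>x. \<bar>f x\<bar> \<le> 1" for f
  by (rule Bochner_Integration.integrable_bound[OF W])
   (use that in \<open>auto simp: abs_mult intro!: mult_left_le\<close>)
 have X: "(\<lambda>i\<in>I. Z i w) \<in> (\<Pi>\<^sub>E i\<in>I. space borel)" for w by auto
 have "A \<in> sigma_sets (\<Pi>\<^sub>E i\<in>I. space borel) (prod_algebra I (\<lambda>_. borel :: real measure))"
  using A by (simp add: sets_PiM)
 then show ?thesis
 proof (induction rule: sigma_sets_induct_disjoint[OF Int_stable_prod_algebra prod_algebra_sets_into_space, consumes 1, case_names basic empty compl union])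
  case (basic E)
  then obtain J F where J: "finite J" "J \<subseteq> I" "F \<in> J \<rightarrow> sets borel" and E: "E = prod_emb I (\<lambda>_. borel) J (Pi\<^sub>E J F)"
   by (auto elim!: prod_algebraE)
  have ind: "indicator E (\<lambda>i\<in>I. Z i w) = (\<Prod>j\<in>J. indicator (F j) (Z j w) :: real)" for w
  proof -
   have *: "(\<lambda>i\<in>I. Z i w) \<in> E \<longleftrightarrow> (\<forall>j\<in>J. Z j w \<in> F j)"
    using J(2) unfolding E prod_emb_iff
    by (auto simp: PiE_iff subset_eq extensional_def)
   show ?thesis
   proof (cases "\<forall>j\<in>J. Z j w \<in> F j")
    case True then show ?thesis using * by (simp add: indicator_def)
   next
    case False
    then have "(\<Prod>j\<in>J. indicator (F j) (Z j w) :: real) = 0" using J(1) by (intro prod_zero) (auto simp: indicator_def)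
    then show ?thesis using * False by (auto simp: indicator_def)
   qed
  qed
  show ?case unfolding ind
   by (rule fourier_zero_finite) (use J W Z c s in auto)
 next
  case empty then show ?case by simp
 next
  case (compl E)
  then have [measurable]: "E \<in> sets (PiM I (\<lambda>_. borel))" by (simp add: sets_PiM)
  have "(LINT w|M. W w * indicator ((\<Pi>\<^sub>E i\<in>I. space borel) - E) (\<lambda>i\<in>I. Z i w))
    = (LINT w|M. W w - W w * indicator E (\<lambda>i\<in>I. Z i w))"
   using X by (intro Bochner_Integration.integral_cong) (auto simp: indicator_def)
  also have "... = (LINT w|M. W w) - (LINT w|M. W w * indicator E (\<lambda>i\<in>I. Z i w))"
   by (rule Bochner_Integration.integral_diff[OF W bdd]) (auto simp: indicator_def)
  also have "... = 0" using compl.IH c[of "{}"] by (simp add: restrict_def)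
  finally show ?case .
 next
  case (union E)
  then have Es[measurable]: "\<And>i. E i \<in> sets (PiM I (\<lambda>_. borel))" by (auto simp: sets_PiM)
  then have [measurable]: "(\<Union>i. E i) \<in> sets (PiM I (\<lambda>_. borel))" by auto
  have sums: "(\<lambda>i. indicator (E i) x) sums (indicator (\<Union>i. E i) x :: real)" for x
   by (rule indicator_sums) (use union.hyps(1) in \<open>auto simp: disjoint_family_on_def\<close>)
  have bd: "\<bar>\<Sum>i<n. indicator (E i) x\<bar> \<le> (1::real)" for n x
  proof -
   have "(\<Sum>i<n. indicator (E i) x) \<le> (indicator (\<Union>i. E i) x :: real)"
    using sums[of x] sum_le_suminf[of "\<lambda>i. indicator (E i) x :: real" "{..<n}"] by (simp add: sums_iff)
   moreover have "0 \<le> (\<Sum>i<n. indicator (E i) x :: real)" by (auto intro: sum_nonneg)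
   moreover have "indicator (\<Union>i. E i) x \<le> (1::real)" by (rule indicator_le_1)
   ultimately show ?thesis by linarith
  qed
  have "(\<lambda>n. \<integral>w. W w * (\<Sum>i<n. indicator (E i) (\<lambda>i\<in>I. Z i w)) \<partial>M)
   \<longlonglongrightarrow> (LINT w|M. W w * indicator (\<Union>i. E i) (\<lambda>i\<in>I. Z i w))"
  proof (rule integral_dominated_convergence[where w="\<lambda>w. \<bar>W w\<bar>"])
   show "AE w in M. (\<lambda>n. W w * (\<Sum>i<n. indicator (E i) (\<lambda>i\<in>I. Z i w)))
    \<longlonglongrightarrow> W w * indicator (\<Union>i. E i) (\<lambda>i\<in>I. Z i w)"
    using sums by (auto intro!: tendsto_mult simp: sums_def)
   show "AE w in M. norm (W w * (\<Sum>i<n. indicator (E i) (\<lambda>i\<in>I. Z i w))) \<le> \<bar>W w\<bar>" for n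
    using bd by (auto simp: abs_mult intro!: mult_left_le)
  qed (use W in auto)
  moreover have "(LINT w|M. W w * (\<Sum>i<n. indicator (E i) (\<lambda>i\<in>I. Z i w))) = 0" for n
  proof -
   have "(LINT w|M. W w * (\<Sum>i<n. indicator (E i) (\<lambda>i\<in>I. Z i w)))
     = (\<Sum>i<n. \<integral>w. W w * indicator (E i) (\<lambda>i\<in>I. Z i w) \<partial>M)"
    unfolding sum_distrib_left
   proof (rule Bochner_Integration.integral_sum)
    show "integrable M (\<lambda>w. W w * indicator (E i) (\<lambda>i\<in>I. Z i w))" for i
    proof (rule bdd)
     show "(\<lambda>w. indicator (E i) (\<lambda>i\<in>I. Z i w)) \<in> borel_measurable M"
      by (rule measurable_compose[OF ZM borel_measurable_indicator[OF Es]])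
     show "\<bar>indicator (E i) x\<bar> \<le> (1::real)" for x by (simp add: indicator_def)
    qed
   qed
   also have "... = 0" by (rule sum.neutral) (use union.IH in blast)
   finally show ?thesis .
  qed
  ultimately have "(\<lambda>n. 0::real) \<longlonglongrightarrow> (LINT w|M. W w * indicator (\<Union>i. E i) (\<lambda>i\<in>I. Z i w))"
   by (simp only:)
  then show ?case by (simp only: LIMSEQ_const_iff)
 qed
qed

text \<open>A Doob-Dynkin factorisation up to null sets, made for sigma-algebras augmented by null
  sets: events of \<open>N\<close> are preimages under \<open>T\<close> only almost everywhere.
  Level sets of simple approximations are replaced one by one, and \<open>lim\<close> gives a
  measurable function even where the replaced sequence diverges.\<close>

lemma AE_factor:
 fixes X :: "'a \<Rightarrow> real"
 assumes T: "T \<in> measurable M S" and sp: "space N = space M"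
  and N: "\<And>A. A \<in> sets N \<Longrightarrow> \<exists>E\<in>sets S. AE w in M. w \<in> A \<longleftrightarrow> T w \<in> E"
  and X: "X \<in> borel_measurable N"
 shows "\<exists>F\<in>borel_measurable S. AE w in M. X w = F (T w)"
proof -
 obtain u where u: "\<And>n. simple_function N (u n)" "\<And>w. w \<in> space N \<Longrightarrow> (\<lambda>n. u n w) \<longlonglongrightarrow> X w"
  using borel_measurable_implies_sequence_metric[OF X, of 0] by metis
 have "\<exists>E\<in>sets S. AE w in M. w \<in> u n -` {y} \<inter> space N \<longleftrightarrow> T w \<in> E" for n y
  using N[OF simple_functionD(2)[OF u(1)]] .
 then obtain E where E: "\<And>n y. E n y \<in> sets S" "\<And>n y. AE w in M. w \<in> u n -` {y} \<inter> space N \<longleftrightarrow> T w \<in> E n y"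
  by metis
 define F where "F n x = (\<Sum>y\<in>u n ` space N. y * indicator (E n y) x)" for n x
 have [measurable]: "F n \<in> borel_measurable S" for n
  unfolding F_def using E(1) by measurable
 have "AE w in M. \<forall>n. \<forall>y\<in>u n ` space N. w \<in> u n -` {y} \<inter> space N \<longleftrightarrow> T w \<in> E n y"
  unfolding AE_all_countable
  by (intro allI AE_finite_allI E(2) simple_functionD(1)[OF u(1)])
 then have "AE w in M. X w = lim (\<lambda>n. F n (T w))"
 proof (rule AE_mp, intro AE_I2 impI)
  fix w assume w: "w \<in> space M" and *: "\<forall>n. \<forall>y\<in>u n ` space N. w \<in> u n -` {y} \<inter> space N \<longleftrightarrow> T w \<in> E n y"
  have "F n (T w) = u n w" for n
  proof -
   have "F n (T w) = (\<Sum>y\<in>u n ` space N. if y = u n w then y else 0)"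
    unfolding F_def
   proof (intro sum.cong refl)
    fix y assume "y \<in> u n ` space N"
    with * w sp have "T w \<in> E n y \<longleftrightarrow> u n w = y" by (metis vimage_singleton_eq IntE IntI)
    then show "y * indicator (E n y) (T w) = (if y = u n w then y else 0)" by (auto simp: indicator_def)
   qed
   also have "... = u n w" using simple_functionD(1)[OF u(1)] w sp by (simp add: sum.delta)
   finally show ?thesis .
  qed
  then show "X w = lim (\<lambda>n. F n (T w))" using u(2)[of w] w sp limI[of "\<lambda>n. u n w" "X w"] by simp
 qed
 then show ?thesis by (intro bexI[of _ "\<lambda>x. lim (\<lambda>n. F n x)"]) auto
qed

text \<open>Rounding the time up to a dyadic grid leaves countably many values, for which the
  composition is measurable; continuity of the paths recovers the process in the limit. The clamp at
  0 keeps the grid inside the times where \<open>X\<close> is known to be measurable.\<close>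

lemma borel_measurable_joint:
 fixes X :: "real \<Rightarrow> 'a \<Rightarrow> real"
 assumes X: "\<And>s. s \<ge> 0 \<Longrightarrow> X s \<in> borel_measurable M"
  and c: "\<And>w. w \<in> space M \<Longrightarrow> continuous_on {0..} (\<lambda>s. X s w)"
 shows "(\<lambda>(s, w). indicator {0..} s * X s w) \<in> borel_measurable (borel \<Otimes>\<^sub>M M)"
proof -
 define d where "d n s = max 0 (real_of_int \<lceil>s * 2^n\<rceil> / 2^n)" for n :: nat and s :: real
 show ?thesis
 proof (rule borel_measurable_LIMSEQ_metric[where f="\<lambda>n (s, w). indicator {0..} s * X (d n s) w"])
 show "(\<lambda>(s, w). indicator {0..} s * X (d n s) w) \<in> borel_measurable (borel \<Otimes>\<^sub>M M)" for n
 proof -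
  have "(\<lambda>z. X (max 0 (real_of_int \<lceil>fst z * (2::real)^n\<rceil> / 2^n)) (snd z)) \<in> borel_measurable (borel \<Otimes>\<^sub>M M)"
  proof (rule measurable_compose_countable[where f="\<lambda>i z. X (max 0 (real_of_int i / 2^n)) (snd z)" and g="\<lambda>z. \<lceil>fst z * (2::real)^n\<rceil>"])
   show "(\<lambda>z. X (max 0 (real_of_int i / 2^n)) (snd z)) \<in> borel_measurable (borel \<Otimes>\<^sub>M M)" for i
    using X[of "max 0 (real_of_int i / 2^n)"] by measurable
   show "(\<lambda>z. \<lceil>fst z * (2::real)^n\<rceil>) \<in> measurable (borel \<Otimes>\<^sub>M M) (count_space UNIV)"
    by measurable
  qed
  then show ?thesis unfolding d_def case_prod_beta by measurable
 qed
 fix z :: "real \<times> 'a" assume "z \<in> space (borel \<Otimes>\<^sub>M M)"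
 then have z: "snd z \<in> space M" by (auto simp: space_pair_measure)
 show "(\<lambda>n. case z of (s, w) \<Rightarrow> indicator {0..} s * X (d n s) w) \<longlonglongrightarrow> (case z of (s, w) \<Rightarrow> indicator {0..} s * X s w)"
 proof (cases "fst z \<ge> 0")
  case True
  have "(\<lambda>n. d n (fst z)) \<longlonglongrightarrow> fst z"
  proof (rule tendsto_sandwich[of "\<lambda>_. fst z" _ _ "\<lambda>n. fst z + (1/2)^n"])
   have "fst z \<le> d n (fst z) \<and> d n (fst z) \<le> fst z + (1/2)^n" for n
   proof -
    have "fst z * 2^n \<le> real_of_int \<lceil>fst z * 2^n\<rceil>" "real_of_int \<lceil>fst z * 2^n\<rceil> \<le> fst z * 2^n + 1" by linarith+
    then have "fst z \<le> real_of_int \<lceil>fst z * 2^n\<rceil> / 2^n" "real_of_int \<lceil>fst z * 2^n\<rceil> / 2^n \<le> fst z + (1/2)^n"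
     by (auto simp: field_simps power_one_over)
    then show ?thesis using True by (auto simp: d_def)
   qed
   then show "\<forall>\<^sub>F n in sequentially. fst z \<le> d n (fst z)" "\<forall>\<^sub>F n in sequentially. d n (fst z) \<le> fst z + (1/2)^n" by auto
   have "(\<lambda>n. fst z + (1/2::real)^n) \<longlonglongrightarrow> fst z + 0" by (intro tendsto_add tendsto_const LIMSEQ_power_zero) auto
   then show "(\<lambda>n. fst z + (1/2::real)^n) \<longlonglongrightarrow> fst z" by simp
  qed simp
  then have "(\<lambda>n. X (d n (fst z)) (snd z)) \<longlonglongrightarrow> X (fst z) (snd z)"
   using c[OF z] True by (auto simp: continuous_on_sequentially d_def comp_def)
  then show ?thesis using True by (simp add: case_prod_beta)
 qed (simp add: case_prod_beta)
 qed
qed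

section \<open>The Donsker-Varadhan characterisation of mutual information\<close>

text \<open>One set of the algebra has to approximate in both measures at once, because the
  variational inequality weighs an integral under \<open>P\<close> against one under
  \<open>Q\<close>. The sets with this property contain the algebra and are closed under complements
  and countable unions.\<close>

lemma approx_algebra:
 assumes "prob_space P" "prob_space Q" and sP: "sets P = sets N" and sQ: "sets Q = sets N"
  and alg: "algebra (space N) \<A>" and sub: "\<A> \<subseteq> sets N"
  and A: "A \<in> sigma_sets (space N) \<A>" and "\<epsilon> > 0"
 shows "\<exists>A'\<in>\<A>. measure P ((A - A') \<union> (A' - A)) + measure Q ((A - A') \<union> (A' - A)) < \<epsilon>"
proof -
 interpret P: prob_space P by fact
 interpret Q: prob_space Q by fact
 interpret alg: algebra "space N" \<A> by fact
 define d where "d A A' = measure P ((A - A') \<union> (A' - A)) + measure Q ((A - A') \<union> (A' - A))" for A A'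
 have sig: "sigma_sets (space N) \<A> \<subseteq> sets N" using sub by (rule sets.sigma_sets_subset)
 have "\<forall>\<epsilon>>0. \<exists>A'\<in>\<A>. d A A' < \<epsilon>"
  using A
 proof (induction rule: sigma_sets.induct)
  case (Basic a)
  then show ?case by (intro allI impI bexI[of _ a]) (auto simp: d_def)
 next
  case Empty
  then show ?case by (intro allI impI bexI[of _ "{}"]) (auto simp: d_def)
 next
  case (Compl a)
  show ?case
  proof (intro allI impI)
   fix \<epsilon> :: real assume "\<epsilon> > 0"
   then obtain A' where A': "A' \<in> \<A>" "d a A' < \<epsilon>" using Compl.IH by auto
   have "a \<subseteq> space N" "A' \<subseteq> space N" using sig Compl.hyps sub A' sets.sets_into_space by blast+
   then have "(space N - a) - (space N - A') = A' - a" "(space N - A') - (space N - a) = a - A'" by auto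
   then have "d (space N - a) (space N - A') = d a A'" by (simp add: d_def Un_commute)
   then show "\<exists>A'\<in>\<A>. d (space N - a) A' < \<epsilon>" using A' by (intro bexI[of _ "space N - A'"]) auto
  qed
 next
  case (Union a)
  show ?case
  proof (intro allI impI)
   fix \<epsilon> :: real assume \<epsilon>: "\<epsilon> > 0"
   have aN: "a i \<in> sets N" for i using Union.hyps sig by auto
   define U where "U n = (\<Union>i<n. a i)" for n
   have UN: "U n \<in> sets N" for n using aN by (auto simp: U_def)
   have UU: "(\<Union>i. a i) \<in> sets N" using aN by auto
   have lim: "(\<lambda>n. measure R ((\<Union>i. a i) - U n)) \<longlonglongrightarrow> 0" if "prob_space R" "sets R = sets N" for R
   proof -
    interpret R: prob_space R by fact
    have "(\<lambda>n. measure R ((\<Union>i. a i) - U n)) \<longlonglongrightarrow> measure R (\<Inter>n. (\<Union>i. a i) - U n)"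
    proof (rule R.finite_Lim_measure_decseq)
     show "decseq (\<lambda>n. (\<Union>i. a i) - U n)" by (rule decseq_SucI) (auto simp: U_def lessThan_Suc)
    qed (use UN UU that in auto)
    moreover have "(\<Inter>n. (\<Union>i. a i) - U n) = {}" by (auto simp: U_def)
    ultimately show ?thesis by (simp only: measure_empty)
   qed
   have "(\<lambda>n. measure P ((\<Union>i. a i) - U n) + measure Q ((\<Union>i. a i) - U n)) \<longlonglongrightarrow> 0 + 0"
    by (intro tendsto_add lim assms)
   then have "\<forall>\<^sub>F n in sequentially. measure P ((\<Union>i. a i) - U n) + measure Q ((\<Union>i. a i) - U n) < \<epsilon> / 2"
    using \<epsilon> by (intro order_tendstoD(2)) auto
   then obtain n where n: "measure P ((\<Union>i. a i) - U n) + measure Q ((\<Union>i. a i) - U n) < \<epsilon> / 2"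
    by (auto simp: eventually_sequentially)
   \<comment> \<open>Dividing by \<open>n + 1\<close> keeps the quotient meaningful for
     \<open>n = 0\<close> and the sum of \<open>n\<close> such errors strictly below
     \<open>\<epsilon> / 2\<close>.\<close>
   have "\<exists>A'\<in>\<A>. d (a i) A' < \<epsilon> / (2 * (real n + 1))" for i using Union.IH[of i] \<epsilon> by simp
   then obtain b where b: "\<And>i. b i \<in> \<A>" "\<And>i. d (a i) (b i) < \<epsilon> / (2 * (real n + 1))" by metis
   have bN: "b i \<in> sets N" for i using b sub by auto
   define B where "B = (\<Union>i<n. b i)"
   have BN: "B \<in> sets N" using bN by (auto simp: B_def)
   let ?S = "\<lambda>i. (a i - b i) \<union> (b i - a i)"
   have le: "measure R (((\<Union>i. a i) - B) \<union> (B - (\<Union>i. a i))) \<le> measure R ((\<Union>i. a i) - U n) + (\<Sum>i<n. measure R (?S i))"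
    if "prob_space R" "sets R = sets N" for R
   proof -
    interpret R: prob_space R by fact
    have "measure R (((\<Union>i. a i) - B) \<union> (B - (\<Union>i. a i))) \<le> measure R (((\<Union>i. a i) - U n) \<union> (\<Union>i<n. ?S i))"
     using UU UN aN bN that by (intro R.finite_measure_mono) (auto simp: U_def B_def)
    also have "... \<le> measure R ((\<Union>i. a i) - U n) + measure R (\<Union>i<n. ?S i)"
     using UU UN aN bN that by (intro measure_Un_le) auto
    also have "measure R (\<Union>i<n. ?S i) \<le> (\<Sum>i<n. measure R (?S i))"
     using aN bN that by (intro measure_UNION_le) auto
    finally show ?thesis by simp
   qed
   have "d (\<Union>i. a i) B \<le> \<epsilon> / 2 + (\<Sum>i<n. d (a i) (b i))"
    using le[OF assms(1) sP] le[OF assms(2) sQ] n by (simp add: d_def sum.distrib)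
   also have "(\<Sum>i<n. d (a i) (b i)) \<le> (\<Sum>i<n. \<epsilon> / (2 * (real n + 1)))"
    using b(2) by (intro sum_mono less_imp_le)
   also have "... < \<epsilon> / 2" using \<epsilon> by (simp add: field_simps)
   finally show "\<exists>A'\<in>\<A>. d (\<Union>i. a i) A' < \<epsilon>"
    using b(1) by (intro bexI[of _ B]) (auto simp: B_def)
  qed
 qed
 then show ?thesis using \<open>\<epsilon> > 0\<close> by (simp add: d_def)
qed

text \<open>\<open>\<rho> F\<close> forgets all coordinates outside the finite set \<open>F\<close>.
  Level sets of \<open>g\<close> are approximated in \<open>P\<close> and \<open>Q\<close> together
  by sets that some \<open>\<rho> F\<close> leaves invariant; since all functions stay uniformly
  bounded, both sides of the inequality are continuous under this convergence.\<close>

lemma dv_extend: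
 fixes \<rho> :: "'i set \<Rightarrow> 'x \<Rightarrow> 'x" and g :: "'x \<Rightarrow> real"
 assumes P: "prob_space P" "prob_space Q" and sP: "sets P = sets N" and sQ: "sets Q = sets N"
  and \<rho>: "\<And>F. finite F \<Longrightarrow> F \<subseteq> I \<Longrightarrow> \<rho> F \<in> measurable N N"
  and \<rho>2: "\<And>F F' z. F \<subseteq> F' \<Longrightarrow> finite F' \<Longrightarrow> F' \<subseteq> I \<Longrightarrow> z \<in> space N \<Longrightarrow> \<rho> F (\<rho> F' z) = \<rho> F z"
  and gen: "sets N \<subseteq> sigma_sets (space N) {A \<in> sets N. \<exists>F. finite F \<and> F \<subseteq> I \<and> (\<forall>z\<in>space N. \<rho> F z \<in> A \<longleftrightarrow> z \<in> A)}"
  and H: "\<And>F f K. finite F \<Longrightarrow> F \<subseteq> I \<Longrightarrow> f \<in> borel_measurable N \<Longrightarrow> (\<And>z. \<bar>f z\<bar> \<le> K) \<Longrightarrow>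
    (LINT z|P. f (\<rho> F z)) \<le> C + ln (LINT z|Q. exp (f (\<rho> F z)))"
  and g[measurable]: "g \<in> borel_measurable N" and gK: "\<And>z. \<bar>g z\<bar> \<le> K"
 shows "(LINT z|P. g z) \<le> C + ln (LINT z|Q. exp (g z))"
proof -
 interpret P: prob_space P by fact
 interpret Q: prob_space Q by fact
 note [measurable_cong] = sP sQ
 define \<A> where "\<A> = {A \<in> sets N. \<exists>F. finite F \<and> F \<subseteq> I \<and> (\<forall>z\<in>space N. \<rho> F z \<in> A \<longleftrightarrow> z \<in> A)}"
 have up: "\<forall>z\<in>space N. \<rho> F' z \<in> A \<longleftrightarrow> z \<in> A"
  if "\<forall>z\<in>space N. \<rho> F z \<in> A \<longleftrightarrow> z \<in> A" "F \<subseteq> F'" "finite F'" "F' \<subseteq> I" for F F' A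
 proof
  fix z assume z: "z \<in> space N"
  then have "\<rho> F' z \<in> space N" using measurable_space[OF \<rho>] that by auto
  then have "\<rho> F' z \<in> A \<longleftrightarrow> \<rho> F (\<rho> F' z) \<in> A" using that by simp
  then show "\<rho> F' z \<in> A \<longleftrightarrow> z \<in> A" using that z \<rho>2 by simp
 qed
 have alg: "algebra (space N) \<A>"
  unfolding algebra_iff_Un
 proof (intro conjI ballI)
  show "\<A> \<subseteq> Pow (space N)" using sets.sets_into_space by (auto simp: \<A>_def)
  show "{} \<in> \<A>" by (auto simp: \<A>_def)
  show "space N - a \<in> \<A>" if ab: "a \<in> \<A>" for a
  proof -
   obtain F where "a \<in> sets N" "finite F" "F \<subseteq> I" "\<forall>z\<in>space N. \<rho> F z \<in> a \<longleftrightarrow> z \<in> a" using ab unfolding \<A>_def by blast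
   moreover from this have "\<forall>z\<in>space N. \<rho> F z \<in> space N - a \<longleftrightarrow> z \<in> space N - a"
    using measurable_space[OF \<rho>] by auto
   ultimately show ?thesis unfolding \<A>_def by blast
  qed
  show "a \<union> b \<in> \<A>" if ab: "a \<in> \<A>" "b \<in> \<A>" for a b
  proof -
   obtain F where F: "a \<in> sets N" "finite F" "F \<subseteq> I" "\<forall>z\<in>space N. \<rho> F z \<in> a \<longleftrightarrow> z \<in> a" using ab unfolding \<A>_def by blast
   obtain F' where F': "b \<in> sets N" "finite F'" "F' \<subseteq> I" "\<forall>z\<in>space N. \<rho> F' z \<in> b \<longleftrightarrow> z \<in> b" using ab unfolding \<A>_def by blast
   have "\<forall>z\<in>space N. \<rho> (F \<union> F') z \<in> a \<union> b \<longleftrightarrow> z \<in> a \<union> b"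
    using up[OF F(4), of "F \<union> F'"] up[OF F'(4), of "F \<union> F'"] F F' by simp
   then show ?thesis using F F' unfolding \<A>_def by (intro CollectI conjI exI[of _ "F \<union> F'"]) auto
  qed
 qed
 have K0: "K \<ge> 0" using gK[of undefined] by linarith
 \<comment> \<open>One unit of room beyond \<open>K\<close>: the rounded values of \<open>g\<close>
   lie within it, so the truncation of \<open>h\<close> at \<open>K'\<close> does not change
   them.\<close>
 define K' where "K' = K + 1"
 have approx: "\<exists>h. h \<in> borel_measurable N \<and> (\<forall>z. \<bar>h z\<bar> \<le> K') \<and> (LINT z|P. h z) \<le> C + ln (LINT z|Q. exp (h z)) \<and>
   (LINT z|P. \<bar>g z - h z\<bar>) \<le> \<epsilon> \<and> (LINT z|Q. \<bar>g z - h z\<bar>) \<le> \<epsilon>" if \<epsilon>: "\<epsilon> > 0" "\<epsilon> < 1" for \<epsilon>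
 proof -
  define m where "m = nat \<lceil>2 / \<epsilon>\<rceil>"
  have m: "real m \<ge> 2 / \<epsilon>" unfolding m_def by linarith
  have m0: "real m > 0" using m \<epsilon> by (smt (verit) divide_pos_pos)
  define J where "J = {- \<lceil>K * m\<rceil> - 1 .. \<lceil>K * m\<rceil> + 1}"
  define L where "L = (\<lambda>j::int. {z \<in> space N. \<lfloor>g z * m\<rfloor> = j})"
  have L: "L j \<in> sets N" for j unfolding L_def by measurable
  \<comment> \<open>The tolerance makes the \<open>card J\<close> mismatch sets, on each of which
    \<open>g\<close> and \<open>h\<close> may differ by \<open>2 * K'\<close>, cost at most
    \<open>\<epsilon> / 2\<close> together; the grid width \<open>1 / m\<close> accounts for the
    other half.\<close>
  have "\<exists>A'\<in>\<A>. measure P ((L j - A') \<union> (A' - L j)) + measure Q ((L j - A') \<union> (A' - L j)) < \<epsilon> / (4 * K' * (card J + 1))" for j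
   by (rule approx_algebra[OF P sP sQ alg]) (use L gen \<epsilon> K0 in \<open>auto simp: \<A>_def K'_def\<close>)
  then obtain D where D: "\<And>j. D j \<in> \<A>"
   "\<And>j. measure P ((L j - D j) \<union> (D j - L j)) + measure Q ((L j - D j) \<union> (D j - L j)) < \<epsilon> / (4 * K' * (card J + 1))" by metis
  have DN[measurable]: "D j \<in> sets N" for j using D(1)[of j] by (simp add: \<A>_def)
  have "\<exists>F. finite F \<and> F \<subseteq> I \<and> (\<forall>z\<in>space N. \<rho> F z \<in> D j \<longleftrightarrow> z \<in> D j)" for j using D(1)[of j] by (simp add: \<A>_def)
  then obtain F where F: "\<And>j. finite (F j)" "\<And>j. F j \<subseteq> I" "\<And>j. \<forall>z\<in>space N. \<rho> (F j) z \<in> D j \<longleftrightarrow> z \<in> D j" by metis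
  define G where "G = (\<Union>j\<in>J. F j)"
  have G: "finite G" "G \<subseteq> I" using F by (auto simp: G_def J_def)
  have GD: "\<rho> G z \<in> D j \<longleftrightarrow> z \<in> D j" if "z \<in> space N" "j \<in> J" for z j
   using up[OF F(3), of j G] that G by (auto simp: G_def)
  define h where "h z = max (-K') (min K' (\<Sum>j\<in>J. (j / m) * indicator (D j) z))" for z
  have [measurable]: "h \<in> borel_measurable N" unfolding h_def by measurable
  have hK: "\<bar>h z\<bar> \<le> K'" for z using K0 by (auto simp: h_def K'_def)
  have hG: "h (\<rho> G z) = h z" if "z \<in> space N" for z
  proof -
   have "(\<Sum>j\<in>J. (j / m) * indicator (D j) (\<rho> G z)) = (\<Sum>j\<in>J. (j / m) * indicator (D j) z)"
    using GD[OF that] by (intro sum.cong) (auto simp: indicator_def)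
   then show ?thesis by (simp add: h_def)
  qed
  have DV: "(LINT z|P. h z) \<le> C + ln (LINT z|Q. exp (h z))"
  proof -
   have "(LINT z|P. h (\<rho> G z)) \<le> C + ln (LINT z|Q. exp (h (\<rho> G z)))"
    by (rule H[OF G]) (use hK in auto)
   moreover have "(LINT z|P. h (\<rho> G z)) = (LINT z|P. h z)" "(LINT z|Q. exp (h (\<rho> G z))) = (LINT z|Q. exp (h z))"
    using hG sets_eq_imp_space_eq[OF sP] sets_eq_imp_space_eq[OF sQ]
    by (auto intro!: Bochner_Integration.integral_cong)
   ultimately show ?thesis by simp
  qed
  let ?S = "\<lambda>j. (L j - D j) \<union> (D j - L j)"
  have bound: "\<bar>g z - h z\<bar> \<le> 1 / m + (\<Sum>j\<in>J. 2 * K' * indicator (?S j) z)" if z: "z \<in> space N" for z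
  proof (cases "\<exists>j\<in>J. z \<in> ?S j")
   case True
   then obtain j where j: "j \<in> J" "z \<in> ?S j" by auto
   have "2 * K' * indicator (?S j) z \<le> (\<Sum>j\<in>J. 2 * K' * indicator (?S j) z)"
    using j K0 by (intro member_le_sum) (auto simp: J_def K'_def)
   then have "2 * K' \<le> (\<Sum>j\<in>J. 2 * K' * indicator (?S j) z)" using j by simp
   moreover have "\<bar>g z - h z\<bar> \<le> 2 * K'" using hK[of z] gK[of z] by (auto simp: K'_def)
   ultimately show ?thesis using m0 by (smt (verit) divide_pos_pos)
  next
   case False
   define j where "j = \<lfloor>g z * m\<rfloor>"
   have "\<bar>g z * m\<bar> \<le> K * m" using gK[of z] m0 by (simp add: abs_mult)
   then have jJ: "j \<in> J" unfolding J_def j_def by auto linarith+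
   have "(\<Sum>i\<in>J. (i / m) * indicator (D i) z) = (\<Sum>i\<in>J. if i = j then j / m else 0)"
   proof (intro sum.cong refl)
    fix i assume "i \<in> J"
    then have "z \<in> D i \<longleftrightarrow> z \<in> L i" using False by blast
    also have "... \<longleftrightarrow> i = j" using z by (simp only: L_def j_def mem_Collect_eq) (metis)
    finally show "(i / m) * indicator (D i) z = (if i = j then j / m else 0)" by (simp add: indicator_def)
   qed
   also have "... = j / m" using jJ by (simp add: J_def)
   finally have s: "(\<Sum>i\<in>J. (i / m) * indicator (D i) z) = j / m" .
   have "j \<le> g z * m" "g z * m \<le> j + 1" unfolding j_def by linarith+
   then have "\<bar>g z * m - j\<bar> / m \<le> 1 / m" using m0 by (intro divide_right_mono) auto
   moreover have "\<bar>g z - j / m\<bar> = \<bar>g z * m - j\<bar> / m" using m0 by (simp add: field_simps flip: abs_div_pos)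
   ultimately have *: "\<bar>g z - j / m\<bar> \<le> 1 / m" by simp
   have "1 / real m \<le> \<epsilon> / 2" using m m0 \<epsilon> by (simp add: field_simps)
   then have "\<bar>real_of_int j / m\<bar> \<le> K'" using * gK[of z] \<epsilon> unfolding K'_def by linarith
   then have "j / m \<le> K'" "- K' \<le> j / m" by linarith+
   then have "h z = j / m" by (simp only: h_def s min_absorb2 max_absorb2)
   then show ?thesis using * K0 sum_nonneg[of J "\<lambda>j. 2 * K' * indicator (?S j) z"] by (auto simp: K'_def)
  qed
  have L1: "(LINT z|R. \<bar>g z - h z\<bar>) \<le> \<epsilon>"
   if R: "prob_space R" "sets R = sets N" "\<And>j. measure R (?S j) \<le> \<epsilon> / (4 * K' * (card J + 1))" for R
  proof -
   interpret R: prob_space R by fact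
   note [measurable_cong] = R(2)
   have [measurable]: "L j \<in> sets N" for j by fact
   have "1 / real m \<le> \<epsilon> / 2" using m m0 \<epsilon> by (simp add: field_simps)
   have iS: "integrable R (\<lambda>z. indicator (?S j) z :: real)" for j
    by (rule R.integrable_const_bound[where B=1]) auto
   have "(LINT z|R. \<bar>g z - h z\<bar>) \<le> (LINT z|R. 1 / m + (\<Sum>j\<in>J. 2 * K' * indicator (?S j) z))"
   proof (rule integral_mono)
    show "integrable R (\<lambda>z. \<bar>g z - h z\<bar>)"
     by (rule R.integrable_const_bound[where B="K + K'"])
      (use hK gK in \<open>auto intro!: AE_I2 order_trans[OF abs_triangle_ineq4] add_mono\<close>)
    show "\<bar>g z - h z\<bar> \<le> 1 / m + (\<Sum>j\<in>J. 2 * K' * indicator (?S j) z)" if "z \<in> space R" for z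
     using bound that sets_eq_imp_space_eq[OF R(2)] by simp
   qed (intro Bochner_Integration.integrable_add Bochner_Integration.integrable_sum integrable_mult_right iS R.integrable_const)
   also have "... = 1 / m + (\<Sum>j\<in>J. 2 * K' * measure R (?S j))"
    by (subst Bochner_Integration.integral_add)
     (simp_all add: R.prob_space Bochner_Integration.integral_sum iS)
   also have "(\<Sum>j\<in>J. 2 * K' * measure R (?S j)) \<le> (\<Sum>j\<in>J. 2 * K' * (\<epsilon> / (4 * K' * (card J + 1))))"
    using R(3) K0 by (intro sum_mono mult_left_mono) (auto simp: K'_def)
   also have "... = card J * (\<epsilon> / (2 * (card J + 1)))"
   proof -
    have "K' > 0" using K0 by (simp add: K'_def)
    then show ?thesis by (simp add: divide_simps)
   qed
   also have "... \<le> \<epsilon> / 2" using \<epsilon> by (simp add: field_simps)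
   finally show ?thesis using \<open>1 / real m \<le> \<epsilon> / 2\<close> by simp
  qed
  show ?thesis
  proof (intro exI[of _ h] conjI allI hK DV L1[OF P(1) sP] L1[OF P(2) sQ])
   show "measure P (?S j) \<le> \<epsilon> / (4 * K' * (card J + 1))" "measure Q (?S j) \<le> \<epsilon> / (4 * K' * (card J + 1))" for j
    using D(2)[of j] measure_nonneg[of P "?S j"] measure_nonneg[of Q "?S j"] by linarith+
  qed simp
 qed
 have "\<exists>h. h \<in> borel_measurable N \<and> (\<forall>z. \<bar>h z\<bar> \<le> K') \<and> (LINT z|P. h z) \<le> C + ln (LINT z|Q. exp (h z)) \<and>
   (LINT z|P. \<bar>g z - h z\<bar>) \<le> 1 / (real n + 2) \<and> (LINT z|Q. \<bar>g z - h z\<bar>) \<le> 1 / (real n + 2)" for n :: nat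
  by (rule approx) auto
 from choice[OF allI, OF this] obtain h where h0: "\<forall>n::nat. h n \<in> borel_measurable N \<and> (\<forall>z. \<bar>h n z\<bar> \<le> K') \<and>
   (LINT z|P. h n z) \<le> C + ln (LINT z|Q. exp (h n z)) \<and>
   (LINT z|P. \<bar>g z - h n z\<bar>) \<le> 1 / (real n + 2) \<and> (LINT z|Q. \<bar>g z - h n z\<bar>) \<le> 1 / (real n + 2)" ..
 have h: "h n \<in> borel_measurable N" "\<bar>h n z\<bar> \<le> K'"
  "(LINT z|P. h n z) \<le> C + ln (LINT z|Q. exp (h n z))"
  "(LINT z|P. \<bar>g z - h n z\<bar>) \<le> 1 / (real n + 2)" "(LINT z|Q. \<bar>g z - h n z\<bar>) \<le> 1 / (real n + 2)" for n z
  using h0[rule_format, of n] by blast+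
 note [measurable] = h(1)
 have null: "(\<lambda>n. c * (1 / (real n + 2))) \<longlonglongrightarrow> 0" for c by real_asymp
 have iP: "integrable P g" "integrable P (h n)" for n
  by (rule P.integrable_const_bound; use gK h(2) in auto)+
 have iQ: "integrable Q (\<lambda>z. exp (g z))" "integrable Q (\<lambda>z. exp (h n z))" "integrable Q (\<lambda>z. g z - h n z)" for n
 proof -
  show "integrable Q (\<lambda>z. exp (g z))" by (rule Q.integrable_const_bound[where B="exp K"]) (use gK in \<open>auto simp: abs_le_iff\<close>)
  show "integrable Q (\<lambda>z. exp (h n z))" by (rule Q.integrable_const_bound[where B="exp K'"]) (use h(2) in \<open>auto simp: abs_le_iff\<close>)
  show "integrable Q (\<lambda>z. g z - h n z)"
   by (intro Bochner_Integration.integrable_diff Q.integrable_const_bound[where B="K"] Q.integrable_const_bound[where B="K'"]) (use gK h(2) in auto)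
 qed
 have lP: "(\<lambda>n. \<integral>z. h n z \<partial>P) \<longlonglongrightarrow> (LINT z|P. g z)"
 proof (rule LIM_zero_cancel, rule Lim_null_comparison[OF _ null[of 1]], intro always_eventually allI)
  fix n
  have "norm ((LINT z|P. h n z) - (LINT z|P. g z)) = \<bar>\<integral>z. g z - h n z \<partial>P\<bar>" using iP by simp
  also have "... \<le> (LINT z|P. \<bar>g z - h n z\<bar>)" by (rule integral_abs_bound)
  finally show "norm ((LINT z|P. h n z) - (LINT z|P. g z)) \<le> 1 * (1 / (real n + 2))" using h(4)[of n] by simp
 qed
 have lQ: "(\<lambda>n. \<integral>z. exp (h n z) \<partial>Q) \<longlonglongrightarrow> (LINT z|Q. exp (g z))"
 proof (rule LIM_zero_cancel, rule Lim_null_comparison[OF _ null[of "exp K'"]], intro always_eventually allI)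
  fix n
  have lip: "\<bar>exp a - exp b\<bar> \<le> exp K' * \<bar>a - b\<bar>" if "a \<le> K'" "b \<le> K'" for a b :: real
  proof -
   have *: "exp x - exp y \<le> exp K' * (x - y)" if "y \<le> x" "x \<le> K'" for x y :: real
   proof -
    have "exp x - exp y = exp x * (1 - exp (y - x))" by (simp add: exp_diff algebra_simps)
    also have "... \<le> exp x * (x - y)" by (rule mult_left_mono) (use exp_ge_add_one_self[of "y - x"] in linarith, simp)
    also have "... \<le> exp K' * (x - y)" using that by (intro mult_right_mono) auto
    finally show ?thesis .
   qed
   show ?thesis using *[of a b] *[of b a] that by (cases "a \<le> b") (auto simp: abs_if)
  qed
  have "norm ((LINT z|Q. exp (h n z)) - (LINT z|Q. exp (g z))) = \<bar>\<integral>z. exp (g z) - exp (h n z) \<partial>Q\<bar>" using iQ by simp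
  also have "... \<le> (LINT z|Q. \<bar>exp (g z) - exp (h n z)\<bar>)" by (rule integral_abs_bound)
  also have "... \<le> (LINT z|Q. exp K' * \<bar>g z - h n z\<bar>)"
  proof (intro integral_mono lip)
   show "g z \<le> K'" "h n z \<le> K'" for z using gK[of z] h(2)[of n z] by (auto simp: K'_def)
  qed (use iQ in auto)
  also have "... \<le> exp K' * (1 / (real n + 2))" using h(5)[of n] by (simp only: integral_mult_right_zero mult_le_cancel_left_pos exp_gt_zero)
  finally show "norm ((LINT z|Q. exp (h n z)) - (LINT z|Q. exp (g z))) \<le> exp K' * (1 / (real n + 2))" .
 qed
 have pos: "(LINT z|Q. exp (g z)) > 0"
 proof -
  have "exp (- K) = (LINT z|Q. exp (- K))" by (simp add: Q.prob_space)
  also have "... \<le> (LINT z|Q. exp (g z))" using gK iQ by (intro integral_mono) (auto simp: abs_le_iff minus_le_iff)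
  finally show ?thesis using exp_gt_zero[of "-K"] by linarith
 qed
 show ?thesis
  by (rule LIMSEQ_le[OF lP tendsto_add[OF tendsto_const tendsto_ln[OF lQ]]]) (use pos h(3) in auto)
qed

text \<open>The two hypotheses pin the divergence of \<open>P\<close> from \<open>Q\<close> from
  both sides. Testing \<open>upper\<close> with multiples of the indicator of a
  \<open>Q\<close>-null set forces absolute continuity; testing it with truncations of the log
  density yields integrability and the bound by \<open>C\<close>. In the other direction
  \<open>ln x \<le> x - 1\<close> shows that no normalised \<open>\<psi>\<close> has a larger mean
  than the log density.\<close>

lemma kl_eqI:
 assumes P: "prob_space P" and Q: "prob_space Q" and sP: "sets P = sets Q"
  and upper: "\<And>f K. f \<in> borel_measurable Q \<Longrightarrow> (\<And>z. \<bar>f z\<bar> \<le> K) \<Longrightarrow>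
    (LINT z|P. f z) \<le> C + ln (LINT z|Q. exp (f z))"
  and lower: "\<And>\<epsilon>. \<epsilon> > 0 \<Longrightarrow> \<exists>\<psi>. integrable P \<psi> \<and> (\<integral>\<^sup>+z. ennreal (exp (\<psi> z)) \<partial>Q) \<le> 1 \<and> C - \<epsilon> \<le> (LINT z|P. \<psi> z)"
 shows "absolutely_continuous Q P"
  and "enn2ereal (\<integral>\<^sup>+z. ennreal (ln (enn2real (RN_deriv Q P z))) \<partial>P)
   - enn2ereal (\<integral>\<^sup>+z. ennreal (- ln (enn2real (RN_deriv Q P z))) \<partial>P) = ereal C"
proof -
 interpret P: prob_space P by fact
 interpret Q: prob_space Q by fact
 note [measurable_cong] = sP
 show ac: "absolutely_continuous Q P"
  unfolding absolutely_continuous_def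
 proof
  fix A assume A: "A \<in> null_sets Q"
  then have [measurable]: "A \<in> sets Q" by auto
  have "AE z in Q. z \<notin> A" using A by (simp add: AE_not_in)
  have *: "t * measure P A \<le> C" if "t \<ge> 0" for t
  proof -
   have "(LINT z|P. t * indicator A z) \<le> C + ln (LINT z|Q. exp (t * indicator A z))"
    by (rule upper[where K=t]) (use that in \<open>auto simp: indicator_def\<close>)
   also have "(LINT z|Q. exp (t * indicator A z)) = (LINT z|Q. 1)"
   proof (rule integral_cong_AE)
    show "AE z in Q. exp (t * indicator A z) = 1"
     using \<open>AE z in Q. z \<notin> A\<close> by eventually_elim simp
   qed auto
   finally show ?thesis by (simp add: Q.prob_space)
  qed
  have "measure P A = 0"
  proof (rule ccontr)
   assume "measure P A \<noteq> 0"
   then have p: "measure P A > 0" by (simp add: zero_less_measure_iff)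
   have "(\<bar>C\<bar> + 1) / measure P A * measure P A \<le> C" by (rule *) (use p in auto)
   then show False using p by simp
  qed
  then show "A \<in> null_sets P" by (auto simp: P.emeasure_eq_measure null_sets_def)
 qed
 define L where "L z = enn2real (RN_deriv Q P z)" for z
 have Lm[measurable]: "L \<in> borel_measurable Q" unfolding L_def by measurable
 have L0: "L z \<ge> 0" for z by (simp add: L_def)
 have PQ: "P = density Q (\<lambda>z. ennreal (L z))"
 proof -
  have "AE z in Q. RN_deriv Q P z \<noteq> \<infinity>"
   by (rule Q.RN_deriv_finite[OF P.sigma_finite_measure_axioms ac sP])
  then have "AE z in Q. ennreal (L z) = RN_deriv Q P z"
   unfolding L_def by eventually_elim (auto simp: less_top)
  then have "density Q (\<lambda>z. ennreal (L z)) = density Q (RN_deriv Q P)"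
   by (intro density_cong) auto
  then show ?thesis using Q.density_RN_deriv[OF ac sP] by simp
 qed
 have nnP: "(\<integral>\<^sup>+z. h z \<partial>P) = (\<integral>\<^sup>+z. ennreal (L z) * h z \<partial>Q)" if "h \<in> borel_measurable Q" for h
  by (subst PQ, subst nn_integral_density) (use that in auto)
 have Lpos: "AE z in P. L z > 0"
 proof -
  have "AE z in Q. 0 < ennreal (L z) \<longrightarrow> L z > 0" by auto
  then have "AE z in density Q (\<lambda>z. ennreal (L z)). L z > 0" by (subst AE_density) auto
  then show ?thesis by (simp only: PQ[symmetric])
 qed
 have intL: "(\<integral>\<^sup>+z. ennreal (L z) \<partial>Q) = 1"
  using nnP[of "\<lambda>_. 1"] P.emeasure_space_1 by simp
 have iL: "integrable Q L" "(LINT z|Q. L z) = 1"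
  using intL L0 by (auto intro!: integrableI_nonneg simp: integral_eq_nn_integral)
 \<comment> \<open>For positive \<open>x\<close> the function \<open>- x ln x\<close> is at most
   \<open>1 - x\<close>, so the negative part of the log density always has a finite
   integral.\<close>
 have neg: "(\<integral>\<^sup>+z. ennreal (- ln (L z)) \<partial>P) \<le> 1"
 proof -
  have le1: "ennreal (L z) * ennreal (- ln (L z)) \<le> 1" for z
  proof (cases "L z > 0")
   case True
   have "- ln (L z) = ln (1 / L z)" using True by (simp add: ln_div)
   also have "... \<le> 1 / L z - 1" using True by (intro ln_le_minus_one) auto
   finally have "L z * (- ln (L z)) \<le> L z * (1 / L z - 1)" using True by (intro mult_left_mono) auto
   also have "... \<le> 1" using True by (simp add: field_simps)
   finally show ?thesis using L0 by (simp add: ennreal_mult'[symmetric] ennreal_le_1)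
  next
   case False then show ?thesis using L0[of z] by auto
  qed
  have "(\<integral>\<^sup>+z. ennreal (- ln (L z)) \<partial>P) = (\<integral>\<^sup>+z. ennreal (L z) * ennreal (- ln (L z)) \<partial>Q)"
   by (rule nnP) measurable
  also have "... \<le> (\<integral>\<^sup>+z. 1 \<partial>Q)" by (intro nn_integral_mono le1)
  finally show ?thesis using Q.emeasure_space_1 by simp
 qed
 define X where "X z = ln (L z)" for z
 have [measurable]: "X \<in> borel_measurable Q" unfolding X_def by measurable
 \<comment> \<open>At zeros of the density the value is set to \<open>- K\<close>, independently of
   what \<open>ln\<close> returns there; then \<open>exp (cl K z)\<close> never exceeds
   \<open>L z + exp (- K)\<close>.\<close>
 define cl where "cl K z = (if L z > 0 then max (- K) (min K (X z)) else - K)" for K z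
 have [measurable]: "cl K \<in> borel_measurable Q" for K unfolding cl_def by measurable
 have cl_le: "(LINT z|P. cl K z) \<le> C + exp (- K)" if "K \<ge> 0" for K
 proof -
  have b: "\<bar>cl K z\<bar> \<le> K" for z using that by (auto simp: cl_def)
  have ie: "integrable Q (\<lambda>z. exp (cl K z))"
   using b by (intro Q.integrable_const_bound[where B="exp K"]) (auto simp: abs_le_iff)
  have "exp (- K) = (LINT z|Q. exp (- K))" by (simp add: Q.prob_space)
  also have "... \<le> (LINT z|Q. exp (cl K z))"
   using b ie by (intro integral_mono) (auto simp: abs_le_iff minus_le_iff)
  finally have pos: "(LINT z|Q. exp (cl K z)) > 0" using exp_gt_zero[of "-K"] by linarith
  have "(LINT z|Q. exp (cl K z)) \<le> (LINT z|Q. L z + exp (- K))"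
  proof (rule integral_mono[OF ie])
   show "integrable Q (\<lambda>z. L z + exp (- K))" using iL by auto
   show "exp (cl K z) \<le> L z + exp (- K)" for z
   proof (cases "L z > 0")
    case True
    have "exp (cl K z) \<le> exp (max (- K) (X z))" using True that by (auto simp: cl_def)
    also have "... \<le> L z + exp (- K)" using True by (auto simp: X_def max_def)
    finally show ?thesis .
   qed (use L0[of z] in \<open>auto simp: cl_def\<close>)
  qed
  also have "... = 1 + exp (- K)" using iL by (simp add: Q.prob_space)
  finally have "ln (LINT z|Q. exp (cl K z)) \<le> ln (1 + exp (- K))" using pos by simp
  also have "... \<le> exp (- K)" by (rule ln_add_one_self_le_self) simp
  finally have "ln (LINT z|Q. exp (cl K z)) \<le> exp (- K)" .
  moreover have "(LINT z|P. cl K z) \<le> C + ln (LINT z|Q. exp (cl K z))" by (rule upper[OF _ b]) measurable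
  ultimately show ?thesis by linarith
 qed
 define Xp Xn where "Xp z = max 0 (X z)" and "Xn z = max 0 (- X z)" for z
 have [measurable]: "Xp \<in> borel_measurable Q" "Xn \<in> borel_measurable Q" unfolding Xp_def Xn_def by measurable
 have nn: "Xp z \<ge> 0" "Xn z \<ge> 0" for z by (auto simp: Xp_def Xn_def)
 have eXn: "ennreal (Xn z) = ennreal (- ln (L z))" for z
  by (auto simp: Xn_def X_def max_def ennreal_neg)
 have iXn: "integrable P Xn"
  using neg nn by (intro integrableI_nonneg) (auto simp: eXn intro: le_less_trans)
 define B where "B = \<bar>C\<bar> + 1 + (LINT z|P. Xn z)"
 have icl: "integrable P (cl K)" if "K \<ge> 0" for K
  by (rule P.integrable_const_bound[where B=K]) (use that in \<open>auto simp: cl_def\<close>)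
 have mB: "(\<integral>\<^sup>+z. ennreal (min (Xp z) (real n)) \<partial>P) \<le> ennreal B" for n
 proof -
  have i: "integrable P (\<lambda>z. min (Xp z) (real n))" "integrable P (\<lambda>z. min (Xn z) (real n))"
   by (rule P.integrable_const_bound[where B=n]; use nn in auto)+
  have "(LINT z|P. min (Xp z) (real n)) = (LINT z|P. cl n z + min (Xn z) (real n))"
   using Lpos by (intro integral_cong_AE) (auto elim!: eventually_mono simp: cl_def Xp_def Xn_def)
  also have "... = (LINT z|P. cl n z) + (LINT z|P. min (Xn z) (real n))"
   by (rule Bochner_Integration.integral_add[OF icl i(2)]) simp
  also have "(LINT z|P. min (Xn z) (real n)) \<le> (LINT z|P. Xn z)" by (rule integral_mono[OF i(2) iXn]) auto
  also have "(LINT z|P. cl n z) \<le> C + exp (- real n)" by (rule cl_le) simp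
  finally have "(LINT z|P. min (Xp z) (real n)) \<le> B" unfolding B_def by (smt (verit) exp_le_one_iff of_nat_0_le_iff)
  then show ?thesis using i(1) nn by (subst nn_integral_eq_integral) (auto simp: ennreal_leI)
 qed
 have iXp: "integrable P Xp"
 proof (rule integrableI_nonneg)
  have "(\<lambda>n. \<integral>\<^sup>+z. ennreal (min (Xp z) (real n)) \<partial>P) \<longlonglongrightarrow> (\<integral>\<^sup>+z. ennreal (Xp z) \<partial>P)"
  proof (rule nn_integral_LIMSEQ)
   show "incseq (\<lambda>n z. ennreal (min (Xp z) (real n)))"
    by (auto simp: incseq_def le_fun_def intro!: ennreal_leI)
   show "(\<lambda>n. ennreal (min (Xp z) (real n))) \<longlonglongrightarrow> ennreal (Xp z)" for z
   proof (rule tendsto_ennrealI, rule tendsto_eventually)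
    show "\<forall>\<^sub>F n in sequentially. min (Xp z) (real n) = Xp z"
     using eventually_ge_at_top[of "nat \<lceil>Xp z\<rceil>"] by eventually_elim (simp add: min_def; linarith)
   qed
  qed auto
  then have "(\<integral>\<^sup>+z. ennreal (Xp z) \<partial>P) \<le> ennreal B" by (rule LIMSEQ_le_const2) (use mB in auto)
  then show "(\<integral>\<^sup>+z. ennreal (Xp z) \<partial>P) < \<infinity>" by (auto intro: le_less_trans)
 qed (use nn in auto)
 have Xeq: "X z = Xp z - Xn z" for z by (auto simp: Xp_def Xn_def)
 have iX: "integrable P X" using iXp iXn by (subst Xeq[abs_def]) auto
 have upX: "(LINT z|P. X z) \<le> C"
 proof (rule LIMSEQ_le)
  show "(\<lambda>n. \<integral>z. cl (real n) z \<partial>P) \<longlonglongrightarrow> (LINT z|P. X z)"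
  proof (rule integral_dominated_convergence[where w="\<lambda>z. \<bar>X z\<bar>"])
   show "AE z in P. (\<lambda>n. cl (real n) z) \<longlonglongrightarrow> X z"
    using Lpos
   proof eventually_elim
    case (elim z)
    show ?case
    proof (rule tendsto_eventually)
     show "\<forall>\<^sub>F n in sequentially. cl (real n) z = X z"
      by (rule eventually_mono[OF eventually_ge_at_top[of "nat \<lceil>\<bar>X z\<bar>\<rceil>"]])
       (use elim in \<open>simp add: cl_def; linarith\<close>)
    qed
   qed
   show "AE z in P. norm (cl (real n) z) \<le> \<bar>X z\<bar>" for n
    using Lpos by eventually_elim (auto simp: cl_def)
  qed (use iX in auto)
  have "(\<lambda>n. C + exp (- real n)) \<longlonglongrightarrow> C + 0" by (intro tendsto_add tendsto_const) real_asymp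
  then show "(\<lambda>n. C + exp (- real n)) \<longlonglongrightarrow> C" by simp
  show "\<exists>N. \<forall>n\<ge>N. (LINT z|P. cl (real n) z) \<le> C + exp (- real n)" using cl_le by auto
 qed
 have loX: "C \<le> (LINT z|P. X z)"
 proof (rule field_le_epsilon)
  fix \<epsilon> :: real assume "\<epsilon> > 0"
  from lower[OF this] obtain \<psi> where \<psi>: "integrable P \<psi>" "(\<integral>\<^sup>+z. ennreal (exp (\<psi> z)) \<partial>Q) \<le> 1" "C - \<epsilon> \<le> (LINT z|P. \<psi> z)" by auto
  have [measurable]: "\<psi> \<in> borel_measurable Q" using \<psi>(1) borel_measurable_integrable measurable_cong_sets[OF sP refl] by blast
  have "(\<integral>\<^sup>+z. ennreal (exp (\<psi> z) / L z) \<partial>P) = (\<integral>\<^sup>+z. ennreal (L z) * ennreal (exp (\<psi> z) / L z) \<partial>Q)"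
   by (rule nnP) measurable
  \<comment> \<open>The passage to \<open>Q\<close> loses the mass of \<open>exp \<psi>\<close> on
    the zero set of the density, hence an inequality.\<close>
  also have "... \<le> (\<integral>\<^sup>+z. ennreal (exp (\<psi> z)) \<partial>Q)"
  proof (rule nn_integral_mono)
   fix z show "ennreal (L z) * ennreal (exp (\<psi> z) / L z) \<le> ennreal (exp (\<psi> z))"
    using L0[of z] by (cases "L z = 0") (auto simp: ennreal_mult''[symmetric])
  qed
  finally have le1: "(\<integral>\<^sup>+z. ennreal (exp (\<psi> z) / L z) \<partial>P) \<le> 1" using \<psi>(2) by (rule order_trans)
  then have i: "integrable P (\<lambda>z. exp (\<psi> z) / L z)"
   using L0 by (intro integrableI_nonneg) (auto intro: le_less_trans)
  have "ennreal (LINT z|P. exp (\<psi> z) / L z) \<le> 1"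
   using le1 i L0 by (subst nn_integral_eq_integral[symmetric]) auto
  then have i1: "(LINT z|P. exp (\<psi> z) / L z) \<le> 1" by (simp add: ennreal_le_1)
  have "(LINT z|P. \<psi> z - X z) \<le> (LINT z|P. exp (\<psi> z) / L z - 1)"
  proof (rule integral_mono_AE)
   show "AE z in P. \<psi> z - X z \<le> exp (\<psi> z) / L z - 1"
    using Lpos
   proof eventually_elim
    case (elim z)
    have "\<psi> z - X z = ln (exp (\<psi> z) / L z)" using elim by (simp add: X_def ln_div)
    also have "... \<le> exp (\<psi> z) / L z - 1" using elim by (intro ln_le_minus_one) auto
    finally show ?case .
   qed
  qed (use \<psi>(1) iX i in auto)
  also have "... \<le> 0" using i i1 by (simp add: P.prob_space)
  finally show "C \<le> (LINT z|P. X z) + \<epsilon>" using \<psi>(1,3) iX by simp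
 qed
 have eXp: "ennreal (Xp z) = ennreal (ln (L z))" for z
  by (auto simp: Xp_def X_def max_def ennreal_neg)
 have "(\<integral>\<^sup>+z. ennreal (ln (L z)) \<partial>P) = ennreal (LINT z|P. Xp z)"
  using iXp nn by (subst eXp[symmetric], subst nn_integral_eq_integral) auto
 moreover have "(\<integral>\<^sup>+z. ennreal (- ln (L z)) \<partial>P) = ennreal (LINT z|P. Xn z)"
  using iXn nn by (subst eXn[symmetric], subst nn_integral_eq_integral) auto
 moreover have "(LINT z|P. Xp z) - (LINT z|P. Xn z) = C"
  using upX loX iXp iXn by (simp add: Xeq)
 ultimately show "enn2ereal (\<integral>\<^sup>+z. ennreal (ln (enn2real (RN_deriv Q P z))) \<partial>P)
   - enn2ereal (\<integral>\<^sup>+z. ennreal (- ln (enn2real (RN_deriv Q P z))) \<partial>P) = ereal C"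
  using nn by (simp add: L_def[symmetric] enn2ereal_ennreal integral_nonneg_AE)
qed

lemma (in prob_space) mutual_info_nats_eqI:
 assumes \<theta>[measurable]: "\<theta> \<in> measurable M S" and \<xi>[measurable]: "\<xi> \<in> measurable M U"
  and upper: "\<And>f K. f \<in> borel_measurable (S \<Otimes>\<^sub>M U) \<Longrightarrow> (\<And>z. \<bar>f z\<bar> \<le> K) \<Longrightarrow>
    (LINT w|M. f (\<theta> w, \<xi> w)) \<le> C + ln (\<integral>z. exp (f z) \<partial>(distr M S \<theta> \<Otimes>\<^sub>M distr M U \<xi>))"
  and lower: "\<And>\<epsilon>. \<epsilon> > 0 \<Longrightarrow> \<exists>\<psi>\<in>borel_measurable (S \<Otimes>\<^sub>M U). integrable M (\<lambda>w. \<psi> (\<theta> w, \<xi> w)) \<and>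
    (\<integral>\<^sup>+z. ennreal (exp (\<psi> z)) \<partial>(distr M S \<theta> \<Otimes>\<^sub>M distr M U \<xi>)) \<le> 1 \<and> C - \<epsilon> \<le> (LINT w|M. \<psi> (\<theta> w, \<xi> w))"
 shows "mutual_info_nats M S U \<theta> \<xi> = ereal C"
proof -
 define P where "P = distr M (S \<Otimes>\<^sub>M U) (\<lambda>w. (\<theta> w, \<xi> w))"
 define Q where "Q = distr M S \<theta> \<Otimes>\<^sub>M distr M U \<xi>"
 interpret S: prob_space "distr M S \<theta>" by (rule prob_space_distr) simp
 interpret U: prob_space "distr M U \<xi>" by (rule prob_space_distr) simp
 interpret SU: pair_prob_space "distr M S \<theta>" "distr M U \<xi>" ..
 have sQ: "sets Q = sets (S \<Otimes>\<^sub>M U)" unfolding Q_def by (intro sets_pair_measure_cong) auto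
 have P: "prob_space P" unfolding P_def by (rule prob_space_distr) simp
 have Q: "prob_space Q" unfolding Q_def by unfold_locales
 have sP: "sets P = sets Q" by (simp add: P_def sQ)
 have ms: "borel_measurable Q = borel_measurable (S \<Otimes>\<^sub>M U)" by (rule measurable_cong_sets[OF sQ refl])
 note kl = kl_eqI[OF P Q sP, of C]
 have u: "(LINT z|P. f z) \<le> C + ln (LINT z|Q. exp (f z))" if "f \<in> borel_measurable Q" "\<And>z. \<bar>f z\<bar> \<le> K" for f K
  using upper[of f K] that unfolding P_def ms by (simp add: integral_distr Q_def)
 have l: "\<exists>\<psi>. integrable P \<psi> \<and> (\<integral>\<^sup>+z. ennreal (exp (\<psi> z)) \<partial>Q) \<le> 1 \<and> C - \<epsilon> \<le> (LINT z|P. \<psi> z)" if "\<epsilon> > 0" for \<epsilon>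
 proof -
  from lower[OF that] obtain \<psi> where [measurable]: "\<psi> \<in> borel_measurable (S \<Otimes>\<^sub>M U)"
   and "integrable M (\<lambda>w. \<psi> (\<theta> w, \<xi> w))" "(\<integral>\<^sup>+z. ennreal (exp (\<psi> z)) \<partial>Q) \<le> 1" "C - \<epsilon> \<le> (LINT w|M. \<psi> (\<theta> w, \<xi> w))"
   unfolding Q_def by blast
  then show ?thesis by (intro exI[of _ \<psi>]) (simp add: P_def integrable_distr_eq integral_distr)
 qed
 have "mutual_info_nats M S U \<theta> \<xi> = (if absolutely_continuous Q P
    then enn2ereal (\<integral>\<^sup>+z. ennreal (ln (enn2real (RN_deriv Q P z))) \<partial>P)
      - enn2ereal (\<integral>\<^sup>+z. ennreal (- ln (enn2real (RN_deriv Q P z))) \<partial>P) else \<infinity>)"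
  by (simp add: mutual_info_nats_def P_def Q_def Let_def)
 moreover have "absolutely_continuous Q P" by (rule kl(1)) (fact u, fact l)
 moreover have "enn2ereal (\<integral>\<^sup>+z. ennreal (ln (enn2real (RN_deriv Q P z))) \<partial>P)
      - enn2ereal (\<integral>\<^sup>+z. ennreal (- ln (enn2real (RN_deriv Q P z))) \<partial>P) = ereal C"
  by (rule kl(2)) (fact u, fact l)
 ultimately show ?thesis by simp
qed

section \<open>Gaussian vectors and channels with Gaussian noise\<close>

text \<open>Completing the square: the exponential factor turns the centred normal density into the
  one with mean \<open>g\<close>.\<close>

lemma normal_tilt:
 fixes D g :: real
 assumes D: "D > 0" and F[measurable]: "F \<in> borel_measurable borel"
 shows "(\<integral>\<^sup>+x. F x * ennreal (exp (g * x / D - g^2 / (2 * D))) \<partial>density lborel (normal_density 0 (sqrt D)))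
   = (\<integral>\<^sup>+x. F (x + g) \<partial>density lborel (normal_density 0 (sqrt D)))"
proof -
 have d: "normal_density 0 (sqrt D) x * exp (g * x / D - g^2 / (2 * D)) = normal_density 0 (sqrt D) (x - g)" for x
 proof -
  have "- x\<^sup>2 / (2 * D) + (g * x / D - g^2 / (2 * D)) = - (x - g)\<^sup>2 / (2 * D)"
   using D by (simp add: field_simps power2_eq_square)
  then show ?thesis using D unfolding normal_density_def by (simp add: exp_add[symmetric])
 qed
 have "(\<integral>\<^sup>+x. F x * ennreal (exp (g * x / D - g^2 / (2 * D))) \<partial>density lborel (normal_density 0 (sqrt D)))
   = (\<integral>\<^sup>+x. ennreal (normal_density 0 (sqrt D) x) * (F x * ennreal (exp (g * x / D - g^2 / (2 * D)))) \<partial>lborel)"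
  by (rule nn_integral_density) auto
 also have "... = (\<integral>\<^sup>+x. ennreal (normal_density 0 (sqrt D) (x - g)) * F x \<partial>lborel)"
  by (intro nn_integral_cong) (simp add: d[symmetric] ennreal_mult' mult_ac)
 also have "... = (\<integral>\<^sup>+x. ennreal (normal_density 0 (sqrt D) x) * F (x + g) \<partial>lborel)"
  using nn_integral_real_affine[of "\<lambda>x. ennreal (normal_density 0 (sqrt D) (x - g)) * F x" 1 g] by (simp add: add.commute)
 also have "... = (\<integral>\<^sup>+x. F (x + g) \<partial>density lborel (normal_density 0 (sqrt D)))"
  by (rule nn_integral_density[symmetric]) auto
 finally show ?thesis .
qed

definition gauss :: "nat \<Rightarrow> (nat \<Rightarrow> real) \<Rightarrow> (nat \<Rightarrow> real) measure" where
 "gauss n D = PiM {..<n} (\<lambda>i. density lborel (normal_density 0 (sqrt (D i))))"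

text \<open>The likelihood ratio of the Gaussian vector with means \<open>g\<close> and variances
  \<open>D\<close> against the centred one.\<close>

definition tilt :: "nat \<Rightarrow> (nat \<Rightarrow> real) \<Rightarrow> (nat \<Rightarrow> real) \<Rightarrow> (nat \<Rightarrow> real) \<Rightarrow> real" where
 "tilt n D g x = exp (\<Sum>i<n. g i * x i / D i - (g i)^2 / (2 * D i))"

lemma sets_gauss[measurable_cong]: "sets (gauss n D) = sets (vecs n)"
 unfolding gauss_def by (intro sets_PiM_cong) auto

lemma tilt_Suc: "tilt (Suc n) D g x = tilt n D g x * exp (g n * x n / D n - (g n)^2 / (2 * D n))"
 by (simp add: tilt_def exp_add)

lemma tilt_cong: "(\<And>i. i < n \<Longrightarrow> g i = g' i) \<Longrightarrow> (\<And>i. i < n \<Longrightarrow> x i = x' i) \<Longrightarrow> tilt n D g x = tilt n D g' x'"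
 by (auto simp: tilt_def intro!: sum.cong)

context
 fixes D :: "nat \<Rightarrow> real"
 assumes D: "\<And>i. D i > 0"
begin

lemma product_prob_normal: "product_prob_space (\<lambda>i. density lborel (normal_density 0 (sqrt (D i))))"
proof -
 interpret prob_space "density lborel (normal_density 0 (sqrt (D i)))" for i
  using D by (intro prob_space_normal_density) auto
 show ?thesis by unfold_locales
qed

lemma prob_space_gauss: "prob_space (gauss n D)"
 unfolding gauss_def by (rule prob_space_PiM) (use D in \<open>auto intro!: prob_space_normal_density\<close>)

lemma nn_integral_gauss_Suc:
 assumes [measurable]: "F \<in> borel_measurable (vecs (Suc n))"
 shows "(\<integral>\<^sup>+x. F x \<partial>gauss (Suc n) D)
   = (\<integral>\<^sup>+x. (\<integral>\<^sup>+y. F (x(n := y)) \<partial>density lborel (normal_density 0 (sqrt (D n)))) \<partial>gauss n D)"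
proof -
 interpret product_prob_space "\<lambda>i. density lborel (normal_density 0 (sqrt (D i)))"
  by (rule product_prob_normal)
 have F: "F \<in> borel_measurable (PiM (insert n {..<n}) (\<lambda>i. density lborel (normal_density 0 (sqrt (D i)))))"
  using assms unfolding lessThan_Suc by (subst measurable_cong_sets[OF sets_PiM_cong refl]) auto
 show ?thesis unfolding gauss_def lessThan_Suc
  by (rule product_nn_integral_insert[OF _ _ F]) auto
qed

lemma measurable_gauss_upd:
 assumes "F \<in> borel_measurable (vecs (Suc n))"
 shows "(\<lambda>(x, y). F (x(n := y))) \<in> borel_measurable (gauss n D \<Otimes>\<^sub>M borel)"
proof -
 have "(\<lambda>(x, y). x(n := y)) \<in> measurable (vecs n \<Otimes>\<^sub>M (borel :: real measure)) (PiM (insert n {..<n}) (\<lambda>_. borel))"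
  by (rule measurable_add_dim)
 then have "(\<lambda>z. F ((\<lambda>(x, y). x(n := y)) z)) \<in> borel_measurable (vecs n \<Otimes>\<^sub>M (borel :: real measure))"
  by (rule measurable_compose) (use assms in \<open>simp add: lessThan_Suc\<close>)
 then show ?thesis by (simp add: case_prod_beta cong: measurable_cong_sets)
qed

lemma gauss_shift:
 assumes "F \<in> borel_measurable (vecs n)"
 shows "(\<integral>\<^sup>+x. F x * ennreal (tilt n D g x) \<partial>gauss n D) = (\<integral>\<^sup>+x. F (\<lambda>i\<in>{..<n}. x i + g i) \<partial>gauss n D)"
 using assms
proof (induction n arbitrary: F)
 case 0
 show ?case
  using product_sigma_finite.nn_integral_empty[OF product_prob_space.axioms(1)[OF product_prob_normal]]
   prob_space.emeasure_space_1[OF prob_space_gauss[of 0]]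
  by (simp add: gauss_def tilt_def restrict_def)
next
 case (Suc n)
 let ?N = "density lborel (normal_density 0 (sqrt (D n)))"
 interpret N: prob_space ?N using D by (intro prob_space_normal_density) auto
 note [measurable] = Suc.prems
 have [measurable]: "(\<lambda>x. tilt (Suc n) D g x) \<in> borel_measurable (vecs (Suc n))"
  unfolding tilt_def by measurable
 have [measurable]: "(\<lambda>x. tilt n D g x) \<in> borel_measurable (gauss n D)"
  unfolding tilt_def by measurable
 note Fm = measurable_gauss_upd[OF Suc.prems]
 have Fm2: "(\<lambda>(x, y). F (x(n := y + g n))) \<in> borel_measurable (gauss n D \<Otimes>\<^sub>M borel)"
 proof -
  have "(\<lambda>z. (fst z, snd z + g n)) \<in> measurable (gauss n D \<Otimes>\<^sub>M borel) (gauss n D \<Otimes>\<^sub>M borel)" by measurable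
  from measurable_compose[OF this Fm] show ?thesis unfolding case_prod_beta fst_conv snd_conv .
 qed
 have Fx: "(\<lambda>y. F (x(n := y))) \<in> borel_measurable borel" if "x \<in> space (gauss n D)" for x
  using measurable_compose[OF measurable_Pair1'[OF that] Fm] unfolding case_prod_conv .
 define G where "G x = (\<integral>\<^sup>+y. F (x(n := y + g n)) \<partial>?N)" for x
 have Gm: "G \<in> borel_measurable (vecs n)"
 proof -
  have "(\<lambda>x. \<integral>\<^sup>+y. (\<lambda>(x, y). F (x(n := y + g n))) (x, y) \<partial>?N) \<in> borel_measurable (gauss n D)"
   by (rule N.borel_measurable_nn_integral) (use Fm2 in \<open>simp add: case_prod_beta cong: measurable_cong_sets\<close>)
  then show ?thesis unfolding G_def by (simp cong: measurable_cong_sets add: measurable_cong_sets[OF sets_gauss refl])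
 qed
 have "(\<integral>\<^sup>+x. F x * ennreal (tilt (Suc n) D g x) \<partial>gauss (Suc n) D)
  = (\<integral>\<^sup>+x. (\<integral>\<^sup>+y. F (x(n := y)) * ennreal (tilt (Suc n) D g (x(n := y))) \<partial>?N) \<partial>gauss n D)"
  by (rule nn_integral_gauss_Suc) measurable
 also have "... = (\<integral>\<^sup>+x. G x * ennreal (tilt n D g x) \<partial>gauss n D)"
 proof (rule nn_integral_cong)
  fix x assume x: "x \<in> space (gauss n D)"
  have "(\<integral>\<^sup>+y. F (x(n := y)) * ennreal (tilt (Suc n) D g (x(n := y))) \<partial>?N)
   = (\<integral>\<^sup>+y. ennreal (tilt n D g x) * (F (x(n := y)) * ennreal (exp (g n * y / D n - (g n)^2 / (2 * D n)))) \<partial>?N)"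
  proof (rule nn_integral_cong)
   fix y
   have "tilt (Suc n) D g (x(n := y)) = tilt n D g x * exp (g n * y / D n - (g n)^2 / (2 * D n))"
    unfolding tilt_Suc by (subst tilt_cong[of n g g "x(n := y)" x]) auto
   moreover have "0 \<le> tilt n D g x" by (simp add: tilt_def)
   ultimately show "F (x(n := y)) * ennreal (tilt (Suc n) D g (x(n := y))) =
     ennreal (tilt n D g x) * (F (x(n := y)) * ennreal (exp (g n * y / D n - (g n)^2 / (2 * D n))))"
    by (simp add: ennreal_mult mult_ac)
  qed
  also have "... = ennreal (tilt n D g x) * (\<integral>\<^sup>+y. F (x(n := y)) * ennreal (exp (g n * y / D n - (g n)^2 / (2 * D n))) \<partial>?N)"
   by (rule nn_integral_cmult) (use Fx[OF x] in measurable)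
  also have "(\<integral>\<^sup>+y. F (x(n := y)) * ennreal (exp (g n * y / D n - (g n)^2 / (2 * D n))) \<partial>?N) = G x"
   unfolding G_def by (rule normal_tilt[OF D Fx[OF x]])
  finally show "(\<integral>\<^sup>+y. F (x(n := y)) * ennreal (tilt (Suc n) D g (x(n := y))) \<partial>?N) = G x * ennreal (tilt n D g x)"
   by (simp only: mult.commute)
 qed
 also have "... = (\<integral>\<^sup>+x. G (\<lambda>i\<in>{..<n}. x i + g i) \<partial>gauss n D)"
  by (rule Suc.IH[OF Gm])
 also have "... = (\<integral>\<^sup>+x. (\<integral>\<^sup>+y. F (\<lambda>i\<in>{..<Suc n}. (x(n := y)) i + g i) \<partial>?N) \<partial>gauss n D)"
  unfolding G_def
  by (intro nn_integral_cong arg_cong[where f=F]) (auto simp: fun_eq_iff)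
 also have "... = (\<integral>\<^sup>+x. F (\<lambda>i\<in>{..<Suc n}. x i + g i) \<partial>gauss (Suc n) D)"
  by (rule nn_integral_gauss_Suc[symmetric]) measurable
 finally show ?case .
qed

text \<open>A discrete exponential martingale: the mean used at coordinate \<open>i\<close> depends
  on earlier coordinates only, so the last factor integrates to 1 while they are held fixed. The
  resulting density is the reference law of the output in the channel bound.\<close>

lemma gauss_predictable:
 assumes "\<And>i. i < n \<Longrightarrow> m i \<in> borel_measurable (vecs i)"
 shows "(\<integral>\<^sup>+x. ennreal (tilt n D (\<lambda>i. m i (restrict x {..<i})) x) \<partial>gauss n D) = 1"
 using assms
proof (induction n)
 case 0
 show ?case
  using prob_space.emeasure_space_1[OF prob_space_gauss[of 0]] by (simp add: gauss_def tilt_def)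
next
 case (Suc n)
 let ?N = "density lborel (normal_density 0 (sqrt (D n)))"
 interpret N: prob_space ?N using D by (intro prob_space_normal_density) auto
 have [measurable]: "(\<lambda>x. m i (restrict x {..<i})) \<in> borel_measurable (vecs (Suc n))" if "i < Suc n" for i
  by (rule measurable_compose[OF measurable_restrict_subset Suc.prems]) (use that in auto)
 have [measurable]: "(\<lambda>x. tilt (Suc n) D (\<lambda>i. m i (restrict x {..<i})) x) \<in> borel_measurable (vecs (Suc n))"
  unfolding tilt_def by measurable
 have "(\<integral>\<^sup>+x. ennreal (tilt (Suc n) D (\<lambda>i. m i (restrict x {..<i})) x) \<partial>gauss (Suc n) D)
  = (\<integral>\<^sup>+x. (\<integral>\<^sup>+y. ennreal (tilt (Suc n) D (\<lambda>i. m i (restrict (x(n := y)) {..<i})) (x(n := y))) \<partial>?N) \<partial>gauss n D)"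
  by (rule nn_integral_gauss_Suc) measurable
 also have "... = (\<integral>\<^sup>+x. ennreal (tilt n D (\<lambda>i. m i (restrict x {..<i})) x) \<partial>gauss n D)"
 proof (rule nn_integral_cong)
  fix x
  define a where "a = m n (restrict x {..<n})"
  have r: "restrict (x(n := y)) {..<i} = restrict x {..<i}" if "i \<le> n" for i y
   using that by (auto simp: restrict_def fun_eq_iff)
  have t: "tilt (Suc n) D (\<lambda>i. m i (restrict (x(n := y)) {..<i})) (x(n := y))
    = tilt n D (\<lambda>i. m i (restrict x {..<i})) x * exp (a * y / D n - a^2 / (2 * D n))" for y
   unfolding tilt_Suc using r
   by (subst tilt_cong[of n _ "\<lambda>i. m i (restrict x {..<i})" "x(n := y)" x]) (auto simp: a_def)
  have p: "0 \<le> tilt n D (\<lambda>i. m i (restrict x {..<i})) x" by (simp add: tilt_def)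
  have "(\<integral>\<^sup>+y. ennreal (tilt (Suc n) D (\<lambda>i. m i (restrict (x(n := y)) {..<i})) (x(n := y))) \<partial>?N)
    = ennreal (tilt n D (\<lambda>i. m i (restrict x {..<i})) x) * (\<integral>\<^sup>+y. 1 * ennreal (exp (a * y / D n - a^2 / (2 * D n))) \<partial>?N)"
   unfolding t using p by (subst nn_integral_cmult[symmetric]) (auto simp: ennreal_mult)
  also have "(\<integral>\<^sup>+y. 1 * ennreal (exp (a * y / D n - a^2 / (2 * D n))) \<partial>?N) = (\<integral>\<^sup>+y. 1 \<partial>?N)"
   by (rule normal_tilt[OF D]) auto
  also have "... = 1" using N.emeasure_space_1 by simp
  finally show "(\<integral>\<^sup>+y. ennreal (tilt (Suc n) D (\<lambda>i. m i (restrict (x(n := y)) {..<i})) (x(n := y))) \<partial>?N)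
    = ennreal (tilt n D (\<lambda>i. m i (restrict x {..<i})) x)" by (simp only: mult_1_right)
 qed
 also have "... = 1" by (rule Suc.IH) (use Suc.prems in auto)
 finally show ?case .
qed

text \<open>The constant is the divergence of the shifted from the centred Gaussian vector. It is
  reached by applying \<open>ln x \<le> x - 1\<close> to a single ratio \<open>a\<close> of mean 1,
  so that no divergence has to be formed.\<close>

lemma gauss_cameron_martin_dv:
 assumes M: "prob_space M" and X[measurable]: "X \<in> measurable M (vecs n)"
  and lawX: "distr M (vecs n) X = gauss n D"
  and X0: "\<And>i. i < n \<Longrightarrow> integrable M (\<lambda>w. X w i)" "\<And>i. i < n \<Longrightarrow> (LINT w|M. X w i) = 0"
  and f[measurable]: "f \<in> borel_measurable (vecs n)" and fK: "\<And>x. \<bar>f x\<bar> \<le> K"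
 shows "(LINT w|M. f (\<lambda>i\<in>{..<n}. X w i + g i)) \<le> (\<Sum>i<n. (g i)^2 / (2 * D i)) + ln (LINT w|M. exp (f (X w)))"
proof -
 interpret prob_space M by fact
 let ?PM = "PiM {..<n} (\<lambda>_. borel :: real measure)"
 define Y where "Y w = (\<lambda>i\<in>{..<n}. X w i + g i)" for w
 have [measurable]: "Y \<in> measurable M ?PM" unfolding Y_def by measurable
 have [measurable]: "tilt n D g \<in> borel_measurable ?PM" unfolding tilt_def by measurable
 have tpos: "tilt n D g x > 0" for x by (simp add: tilt_def)
 have eX: "(\<integral>\<^sup>+w. F (X w) \<partial>M) = (\<integral>\<^sup>+x. F x \<partial>gauss n D)" if "F \<in> borel_measurable ?PM" for F
  unfolding lawX[symmetric] using that by (simp add: nn_integral_distr)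
 have eY: "(\<integral>\<^sup>+w. F (Y w) \<partial>M) = (\<integral>\<^sup>+x. F x * ennreal (tilt n D g x) \<partial>gauss n D)" if [measurable]: "F \<in> borel_measurable ?PM" for F
  unfolding gauss_shift[OF that] using eX[of "\<lambda>x. F (\<lambda>i\<in>{..<n}. x i + g i)"] by (simp add: Y_def)
 have ie: "integrable M (\<lambda>w. exp (f (X w)))"
  by (rule integrable_const_bound[where B="exp K"]) (use fK in \<open>auto simp: abs_le_iff\<close>)
 have pos: "(LINT w|M. exp (f (X w))) > 0"
 proof -
  have "exp (- K) = (LINT w|M. exp (- K))" by (simp add: prob_space)
  also have "... \<le> (LINT w|M. exp (f (X w)))" using fK ie by (intro integral_mono) (auto simp: abs_le_iff minus_le_iff)
  finally show ?thesis using exp_gt_zero[of "-K"] by linarith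
 qed
 define c where "c = ln (LINT w|M. exp (f (X w)))"
 \<comment> \<open>Density of the law tilted by \<open>exp f\<close> relative to the shifted law;
   evaluated at the shifted vector \<open>Y\<close> it has mean 1.\<close>
 define a where "a x = exp (f x - c) / tilt n D g x" for x
 have [measurable]: "a \<in> borel_measurable ?PM" unfolding a_def by measurable
 have a1: "(\<integral>\<^sup>+w. ennreal (a (Y w)) \<partial>M) = 1"
 proof -
  have "(\<integral>\<^sup>+w. ennreal (a (Y w)) \<partial>M) = (\<integral>\<^sup>+x. ennreal (a x) * ennreal (tilt n D g x) \<partial>gauss n D)"
   by (rule eY) measurable
  also have "... = (\<integral>\<^sup>+x. ennreal (exp (f x - c)) \<partial>gauss n D)"
   using tpos by (intro nn_integral_cong) (simp add: a_def ennreal_mult'[symmetric] less_imp_neq[symmetric] less_imp_le)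
  also have "... = (\<integral>\<^sup>+w. ennreal (exp (f (X w) - c)) \<partial>M)" by (rule eX[symmetric]) measurable
  also have "... = (\<integral>\<^sup>+w. ennreal (exp (f (X w)) / exp c) \<partial>M)" by (simp add: exp_diff)
  also have "... = ennreal (LINT w|M. exp (f (X w)) / exp c)" using ie by (intro nn_integral_eq_integral) auto
  also have "... = 1" using pos by (simp add: c_def)
  finally show ?thesis .
 qed
 have ia: "integrable M (\<lambda>w. a (Y w))" "(LINT w|M. a (Y w)) = 1"
  using a1 tpos by (auto intro!: integrableI_nonneg simp: integral_eq_nn_integral a_def less_imp_le)
 define l where "l w = (\<Sum>i<n. (g i)^2 / (2 * D i) + g i * X w i / D i)" for w
 have il: "integrable M l" "(LINT w|M. l w) = (\<Sum>i<n. (g i)^2 / (2 * D i))"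
  unfolding l_def using X0 by (auto simp: Bochner_Integration.integral_sum prob_space)
 have "(LINT w|M. f (Y w)) \<le> (LINT w|M. l w + (a (Y w) - 1 + c))"
 proof (rule integral_mono)
  show "integrable M (\<lambda>w. f (Y w))"
   by (rule integrable_const_bound[where B=K]) (use fK in auto)
  show "integrable M (\<lambda>w. l w + (a (Y w) - 1 + c))" using il ia by auto
  fix w
  have "ln (tilt n D g (Y w)) = l w"
   unfolding tilt_def l_def ln_exp Y_def using D
   by (intro sum.cong) (auto simp: field_simps power2_eq_square less_imp_neq[symmetric])
  moreover have "ln (a (Y w)) \<le> a (Y w) - 1" using tpos by (intro ln_le_minus_one) (auto simp: a_def)
  moreover have "ln (a (Y w)) = f (Y w) - c - ln (tilt n D g (Y w))" using tpos[of "Y w"] by (simp add: a_def ln_div)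
  ultimately show "f (Y w) \<le> l w + (a (Y w) - 1 + c)" by linarith
 qed
 also have "... = (\<Sum>i<n. (g i)^2 / (2 * D i)) + c" using il ia by (simp add: prob_space)
 finally show ?thesis by (simp add: c_def Y_def)
qed

text \<open>Mutual information is at most the mean divergence of the conditional output law from any
  fixed output law. The fixed law has predictable means \<open>m\<close>, and \<open>d i\<close> is
  the error of predicting the signal component \<open>g i\<close> from earlier outputs;
  \<open>C\<close> bounds the mean log-likelihood ratio, whose main part is half the squared
  prediction error over \<open>D\<close>.\<close>

lemma gauss_channel_dv:
 assumes M: "prob_space M" and \<theta>[measurable]: "\<theta> \<in> measurable M S"
  and X[measurable]: "X \<in> measurable M (vecs n)"
  and joint: "distr M (S \<Otimes>\<^sub>M vecs n) (\<lambda>w. (\<theta> w, X w)) = distr M S \<theta> \<Otimes>\<^sub>M gauss n D"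
  and g[measurable]: "\<And>i. g i \<in> borel_measurable S"
  and m: "\<And>i. i < n \<Longrightarrow> m i \<in> borel_measurable (vecs i)"
 defines "Y \<equiv> (\<lambda>w. \<lambda>i\<in>{..<n}. X w i + g i (\<theta> w))"
 defines "d \<equiv> (\<lambda>i w. g i (\<theta> w) - m i (restrict (Y w) {..<i}))"
 assumes il: "integrable M (\<lambda>w. \<Sum>i<n. ((d i w)^2 / 2 + d i w * X w i) / D i)"
  and C: "(LINT w|M. (\<Sum>i<n. ((d i w)^2 / 2 + d i w * X w i) / D i)) \<le> C"
  and f[measurable]: "f \<in> borel_measurable (S \<Otimes>\<^sub>M vecs n)" and fK: "\<And>x. \<bar>f x\<bar> \<le> K"
 shows "(LINT w|M. f (\<theta> w, Y w)) \<le> C + ln (\<integral>z. exp (f z) \<partial>(distr M S \<theta> \<Otimes>\<^sub>M distr M (vecs n) Y))"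
proof -
 interpret prob_space M by fact
 let ?PM = "PiM {..<n} (\<lambda>_. borel :: real measure)"
 let ?mu = "distr M S \<theta>"
 interpret mu: prob_space ?mu by (rule prob_space_distr) simp
 interpret ga: prob_space "gauss n D" by (rule prob_space_gauss)
 interpret mg: pair_prob_space ?mu "gauss n D" ..
 have Ym[measurable]: "Y \<in> measurable M ?PM" unfolding Y_def by measurable
 interpret lY: prob_space "distr M ?PM Y" by (rule prob_space_distr) simp
 interpret mY: pair_prob_space ?mu "distr M ?PM Y" ..
 define Q where "Q = ?mu \<Otimes>\<^sub>M distr M ?PM Y"
 interpret Q: prob_space Q unfolding Q_def by unfold_locales
 have sQ[measurable_cong]: "sets Q = sets (S \<Otimes>\<^sub>M ?PM)" unfolding Q_def by (intro sets_pair_measure_cong) auto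
 \<comment> \<open>Conditional density of \<open>Y\<close> given the signal, relative to the centred
   Gaussian law.\<close>
 define \<Lambda> where "\<Lambda> z = tilt n D (\<lambda>i. g i (fst z)) (snd z)" for z
 have [measurable]: "\<Lambda> \<in> borel_measurable (S \<Otimes>\<^sub>M ?PM)" unfolding \<Lambda>_def tilt_def by measurable
 have \<Lambda>pos: "\<Lambda> z > 0" for z by (simp add: \<Lambda>_def tilt_def)
 have e1: "(\<integral>\<^sup>+w. F (\<theta> w, Y w) \<partial>M) = (\<integral>\<^sup>+x. (\<integral>\<^sup>+t. F (t, x) * ennreal (\<Lambda> (t, x)) \<partial>?mu) \<partial>gauss n D)"
  if [measurable]: "F \<in> borel_measurable (S \<Otimes>\<^sub>M ?PM)" for F
 proof -
  have "(\<integral>\<^sup>+w. F (\<theta> w, Y w) \<partial>M) = (\<integral>\<^sup>+z. F (fst z, \<lambda>i\<in>{..<n}. snd z i + g i (fst z)) \<partial>distr M (S \<Otimes>\<^sub>M ?PM) (\<lambda>w. (\<theta> w, X w)))"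
   by (subst nn_integral_distr) (simp_all add: Y_def)
  also have "... = (\<integral>\<^sup>+t. (\<integral>\<^sup>+x. F (t, \<lambda>i\<in>{..<n}. x i + g i t) \<partial>gauss n D) \<partial>?mu)"
   unfolding joint by (subst ga.nn_integral_fst[symmetric]) simp_all
  also have "... = (\<integral>\<^sup>+t. (\<integral>\<^sup>+x. F (t, x) * ennreal (\<Lambda> (t, x)) \<partial>gauss n D) \<partial>?mu)"
  proof (rule nn_integral_cong)
   fix t assume "t \<in> space ?mu"
   then have t: "t \<in> space S" by simp
   have "(\<lambda>x. F (t, x)) \<in> borel_measurable ?PM" using t by measurable
   from gauss_shift[OF this, of "\<lambda>i. g i t"]
   show "(\<integral>\<^sup>+x. F (t, \<lambda>i\<in>{..<n}. x i + g i t) \<partial>gauss n D) = (\<integral>\<^sup>+x. F (t, x) * ennreal (\<Lambda> (t, x)) \<partial>gauss n D)"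
    by (simp add: \<Lambda>_def)
  qed
  also have "... = (\<integral>\<^sup>+x. (\<integral>\<^sup>+t. F (t, x) * ennreal (\<Lambda> (t, x)) \<partial>?mu) \<partial>gauss n D)"
   by (rule mg.Fubini'[symmetric]) simp
  finally show ?thesis .
 qed
 have \<Lambda>x: "(\<lambda>t. ennreal (\<Lambda> (t, x))) \<in> borel_measurable ?mu" if "x \<in> space (gauss n D)" for x
 proof -
  have "x \<in> space ?PM" using that sets_eq_imp_space_eq[OF sets_gauss] by simp
  then show ?thesis by measurable
 qed
 \<comment> \<open>Marginal density of \<open>Y\<close>; it has no closed form and must drop out in
   the end.\<close>
 define Z where "Z x = (\<integral>\<^sup>+t. ennreal (\<Lambda> (t, x)) \<partial>?mu)" for x
 have [measurable]: "Z \<in> borel_measurable ?PM"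
  unfolding Z_def by (rule mu.borel_measurable_nn_integral) (simp cong: measurable_cong_sets)
 have e2: "(\<integral>\<^sup>+w. F (Y w) \<partial>M) = (\<integral>\<^sup>+x. F x * Z x \<partial>gauss n D)" if [measurable]: "F \<in> borel_measurable ?PM" for F
 proof -
  have "(\<integral>\<^sup>+w. F (Y w) \<partial>M) = (\<integral>\<^sup>+x. (\<integral>\<^sup>+t. F x * ennreal (\<Lambda> (t, x)) \<partial>?mu) \<partial>gauss n D)"
   using e1[of "\<lambda>z. F (snd z)"] by simp
  also have "... = (\<integral>\<^sup>+x. F x * Z x \<partial>gauss n D)"
   unfolding Z_def by (intro nn_integral_cong nn_integral_cmult \<Lambda>x)
  finally show ?thesis .
 qed
 have Zfin: "AE x in gauss n D. Z x \<noteq> \<infinity>"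
  using e2[of "\<lambda>_. 1"] emeasure_space_1 by (intro nn_integral_PInf_AE) auto
 have ZY: "AE w in M. Z (Y w) \<noteq> 0 \<and> Z (Y w) \<noteq> \<infinity>"
 proof -
  let ?A = "{x \<in> space ?PM. Z x = 0 \<or> Z x = \<infinity>}"
  have "(\<integral>\<^sup>+w. indicator ?A (Y w) \<partial>M) = (\<integral>\<^sup>+x. indicator ?A x * Z x \<partial>gauss n D)"
   by (rule e2) measurable
  also have "... = 0"
   using Zfin by (subst nn_integral_0_iff_AE) (auto elim!: eventually_mono simp: indicator_def)
  finally have "AE w in M. indicator ?A (Y w) = (0::ennreal)" by (subst (asm) nn_integral_0_iff_AE) auto
  then show ?thesis using measurable_space[OF Ym] by (auto elim!: AE_mp simp: indicator_def)
 qed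
 define r where "r x = tilt n D (\<lambda>i. m i (restrict x {..<i})) x" for x
 have mm[measurable]: "(\<lambda>x. m i (restrict x {..<i})) \<in> borel_measurable ?PM" if "i < n" for i
  by (rule measurable_compose[OF measurable_restrict_subset m]) (use that in auto)
 have [measurable]: "r \<in> borel_measurable ?PM" unfolding r_def tilt_def by measurable
 have rpos: "r x > 0" for x by (simp add: r_def tilt_def)
 have r1: "(\<integral>\<^sup>+x. ennreal (r x) \<partial>gauss n D) = 1" unfolding r_def by (rule gauss_predictable[OF m])
 have ie: "integrable Q (\<lambda>z. exp (f z))"
  by (rule Q.integrable_const_bound[where B="exp K"]) (use fK in \<open>auto simp: abs_le_iff\<close>)
 have pos: "(LINT z|Q. exp (f z)) > 0"
 proof -
  have "exp (- K) = (LINT z|Q. exp (- K))" by (simp add: Q.prob_space)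
  also have "... \<le> (LINT z|Q. exp (f z))" using fK ie by (intro integral_mono) (auto simp: abs_le_iff minus_le_iff)
  finally show ?thesis using exp_gt_zero[of "-K"] by linarith
 qed
 define c where "c = ln (LINT z|Q. exp (f z))"
 \<comment> \<open>\<open>a\<close> is the density of the product law tilted by \<open>exp f\<close>
   relative to the joint law, \<open>b\<close> that of the reference law \<open>r\<close> relative
   to the law of \<open>Y\<close>. The marginal density \<open>Z\<close> cancels in
   \<open>ln a + ln b\<close>.\<close>
 define a where "a z = exp (f z - c) * enn2real (Z (snd z)) / \<Lambda> z" for z
 define b where "b x = r x / enn2real (Z x)" for x
 have [measurable]: "a \<in> borel_measurable (S \<Otimes>\<^sub>M ?PM)" "b \<in> borel_measurable ?PM" unfolding a_def b_def by measurable
 have ab0: "a z \<ge> 0" "b x \<ge> 0" for z x using \<Lambda>pos[of z] rpos[of x] by (auto simp: a_def b_def)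
 define h where "h x = (\<integral>\<^sup>+t. ennreal (exp (f (t, x) - c)) \<partial>?mu)" for x
 have [measurable]: "h \<in> borel_measurable ?PM"
  unfolding h_def by (rule mu.borel_measurable_nn_integral) (simp cong: measurable_cong_sets)
 have a1: "(\<integral>\<^sup>+w. ennreal (a (\<theta> w, Y w)) \<partial>M) = 1"
 proof -
  have "(\<integral>\<^sup>+w. ennreal (a (\<theta> w, Y w)) \<partial>M) = (\<integral>\<^sup>+x. (\<integral>\<^sup>+t. ennreal (a (t, x)) * ennreal (\<Lambda> (t, x)) \<partial>?mu) \<partial>gauss n D)"
   by (rule e1) measurable
  also have "... = (\<integral>\<^sup>+x. (\<integral>\<^sup>+t. ennreal (exp (f (t, x) - c)) \<partial>?mu) * Z x \<partial>gauss n D)"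
  proof (rule nn_integral_cong_AE, use Zfin AE_space in eventually_elim)
   case (elim x)
   then have "x \<in> space ?PM" using sets_eq_imp_space_eq[OF sets_gauss] by simp
   then have fx: "(\<lambda>t. f (t, x)) \<in> borel_measurable ?mu" by measurable
   have "ennreal (a (t, x)) * ennreal (\<Lambda> (t, x)) = Z x * ennreal (exp (f (t, x) - c))" for t
    using \<Lambda>pos[of "(t, x)"] elim
    by (auto simp: a_def ennreal_mult'[symmetric] ennreal_mult less_top mult_ac)
   then have "(\<integral>\<^sup>+t. ennreal (a (t, x)) * ennreal (\<Lambda> (t, x)) \<partial>?mu) = (\<integral>\<^sup>+t. Z x * ennreal (exp (f (t, x) - c)) \<partial>?mu)"
    by (simp only:)
   also have "... = Z x * (\<integral>\<^sup>+t. ennreal (exp (f (t, x) - c)) \<partial>?mu)"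
    by (rule nn_integral_cmult) (use fx in measurable)
   finally show ?case by (simp only: mult.commute)
  qed
  also have "... = (\<integral>\<^sup>+w. h (Y w) \<partial>M)"
   unfolding h_def[symmetric] by (rule e2[symmetric]) measurable
  also have "... = (\<integral>\<^sup>+x. h x \<partial>distr M ?PM Y)"
   by (rule nn_integral_distr[symmetric]) measurable
  also have "... = (\<integral>\<^sup>+z. ennreal (exp (f z - c)) \<partial>Q)"
   unfolding Q_def h_def by (subst mY.nn_integral_snd[symmetric]) simp_all
  also have "... = (\<integral>\<^sup>+z. ennreal (exp (f z) / exp c) \<partial>Q)" by (simp add: exp_diff)
  also have "... = ennreal (LINT z|Q. exp (f z) / exp c)" using ie by (intro nn_integral_eq_integral) auto
  also have "... = 1" using pos by (simp add: c_def)
  finally show ?thesis .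
 qed
 have ia: "integrable M (\<lambda>w. a (\<theta> w, Y w))" "(LINT w|M. a (\<theta> w, Y w)) = 1"
  using a1 ab0 by (auto intro!: integrableI_nonneg simp: integral_eq_nn_integral)
 \<comment> \<open>An inequality, since \<open>r\<close> may charge the set where \<open>Z\<close>
   vanishes.\<close>
 have b1: "(\<integral>\<^sup>+w. ennreal (b (Y w)) \<partial>M) \<le> 1"
 proof -
  have "(\<integral>\<^sup>+w. ennreal (b (Y w)) \<partial>M) = (\<integral>\<^sup>+x. ennreal (b x) * Z x \<partial>gauss n D)"
   by (rule e2) measurable
  also have "... \<le> (\<integral>\<^sup>+x. ennreal (r x) \<partial>gauss n D)"
  proof (rule nn_integral_mono_AE, use Zfin in eventually_elim)
   case (elim x)
   then obtain z where z: "Z x = ennreal z" "z \<ge> 0" by (cases "Z x") auto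
   then show ?case using rpos[of x] by (cases "z = 0") (auto simp: b_def ennreal_mult'[symmetric] ennreal_mult''[symmetric])
  qed
  finally show ?thesis using r1 by simp
 qed
 have ib: "integrable M (\<lambda>w. b (Y w))"
  using b1 ab0 by (intro integrableI_nonneg) (auto intro: le_less_trans)
 have "ennreal (LINT w|M. b (Y w)) \<le> 1"
  using b1 ib ab0 by (subst nn_integral_eq_integral[symmetric]) auto
 then have ib1: "(LINT w|M. b (Y w)) \<le> 1" by (simp add: ennreal_le_1)
 define l where "l w = (\<Sum>i<n. ((d i w)^2 / 2 + d i w * X w i) / D i)" for w
 have "(LINT w|M. f (\<theta> w, Y w)) \<le> (LINT w|M. l w + (a (\<theta> w, Y w) - 1 + c) + (b (Y w) - 1))"
 proof (rule integral_mono_AE)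
  show "integrable M (\<lambda>w. f (\<theta> w, Y w))"
   by (rule integrable_const_bound[where B=K]) (use fK in auto)
  show "integrable M (\<lambda>w. l w + (a (\<theta> w, Y w) - 1 + c) + (b (Y w) - 1))" using il ia ib by (auto simp: l_def)
  show "AE w in M. f (\<theta> w, Y w) \<le> l w + (a (\<theta> w, Y w) - 1 + c) + (b (Y w) - 1)"
   using ZY
  proof eventually_elim
   case (elim w)
   then obtain z where z: "Z (Y w) = ennreal z" "z > 0" by (cases "Z (Y w)") (auto simp: order_less_le)
   let ?z = "(\<theta> w, Y w)"
   have a: "a ?z = exp (f ?z - c) * z / \<Lambda> ?z" "a ?z > 0" using z \<Lambda>pos[of ?z] by (auto simp: a_def)
   have b: "b (Y w) = r (Y w) / z" "b (Y w) > 0" using z rpos[of "Y w"] by (auto simp: b_def)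
   have "ln (\<Lambda> ?z) - ln (r (Y w)) = l w"
   proof -
    have *: "(g i (\<theta> w) * Y w i / D i - (g i (\<theta> w))^2 / (2 * D i)) -
      (m i (restrict (Y w) {..<i}) * Y w i / D i - (m i (restrict (Y w) {..<i}))^2 / (2 * D i))
      = ((d i w)^2 / 2 + d i w * X w i) / D i" if "i < n" for i
    proof -
     have "Y w i = X w i + g i (\<theta> w)" using that by (simp add: Y_def)
     then show ?thesis using D[of i] unfolding d_def by (simp add: field_simps power2_eq_square)
    qed
    then show ?thesis unfolding \<Lambda>_def r_def tilt_def l_def ln_exp fst_conv snd_conv sum_subtractf[symmetric]
     by (intro sum.cong refl *) simp
   qed
   moreover have "ln (a ?z) \<le> a ?z - 1" "ln (b (Y w)) \<le> b (Y w) - 1" using a b by (auto intro!: ln_le_minus_one)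
   moreover have "ln (a ?z) = f ?z - c + ln z - ln (\<Lambda> ?z)" using z \<Lambda>pos[of ?z] by (simp add: a(1) ln_div ln_mult)
   moreover have "ln (b (Y w)) = ln (r (Y w)) - ln z" using z rpos[of "Y w"] by (simp add: b(1) ln_div)
   ultimately show "f ?z \<le> l w + (a ?z - 1 + c) + (b (Y w) - 1)" by linarith
  qed
 qed
 also have "... = (LINT w|M. l w) + c + ((LINT w|M. b (Y w)) - 1)"
  using il ia ib by (simp add: prob_space l_def)
 also have "... \<le> C + c" using C ib1 by (simp add: l_def)
 finally show ?thesis by (simp add: c_def Q_def)
qed

end

section \<open>Riemann sums along partitions\<close>

lemma partition_le:
 fixes p :: "nat \<Rightarrow> real"
 assumes "\<And>i. i < n \<Longrightarrow> p i \<le> p (Suc i)" "i \<le> j" "j \<le> n"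
 shows "p i \<le> p j"
 using assms(2,3)
proof (induction j rule: dec_induct)
 case (step k) then show ?case using assms(1)[of k] by simp
qed simp

text \<open>One factor is replaced by a constant on each cell while the other is integrated exactly,
  the form in which summation by parts leaves the Riemann sums.\<close>

lemma step_sum:
 fixes p c :: "nat \<Rightarrow> real" and y h :: "real \<Rightarrow> real"
 assumes p: "\<And>i. i < n \<Longrightarrow> p i \<le> p (Suc i)"
  and y: "continuous_on {p 0..p n} y" and h: "continuous_on {p 0..p n} h"
  and K: "\<And>x. x \<in> {p 0..p n} \<Longrightarrow> \<bar>h x\<bar> \<le> K"
  and c: "\<And>i x. i < n \<Longrightarrow> x \<in> {p i..p (Suc i)} \<Longrightarrow> \<bar>c i - y x\<bar> \<le> \<epsilon>"
 shows "\<bar>(\<Sum>i<n. c i * integral {p i..p (Suc i)} h) - integral {p 0..p n} (\<lambda>x. y x * h x)\<bar> \<le> \<epsilon> * K * (p n - p 0)"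
 using assms
proof (induction n)
 case (Suc n)
 have le: "p 0 \<le> p n" "p n \<le> p (Suc n)" using partition_le[of "Suc n" p 0 n] Suc.prems(1) by auto
 have sub: "{p 0..p n} \<subseteq> {p 0..p (Suc n)}" "{p n..p (Suc n)} \<subseteq> {p 0..p (Suc n)}" using le by auto
 have IH: "\<bar>(\<Sum>i<n. c i * integral {p i..p (Suc i)} h) - integral {p 0..p n} (\<lambda>x. y x * h x)\<bar> \<le> \<epsilon> * K * (p n - p 0)"
 proof (rule Suc.IH)
  show "continuous_on {p 0..p n} y" "continuous_on {p 0..p n} h"
   using Suc.prems(2,3) sub continuous_on_subset by blast+
  show "\<bar>h x\<bar> \<le> K" if "x \<in> {p 0..p n}" for x using that sub Suc.prems(4)[of x] by blast
 qed (use Suc.prems in auto)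
 have i: "(\<lambda>x. y x * h x) integrable_on {p 0..p (Suc n)}"
  using Suc.prems by (intro integrable_continuous_interval continuous_on_mult)
 have ch: "continuous_on {p n..p (Suc n)} h" "continuous_on {p n..p (Suc n)} y"
  using Suc.prems sub continuous_on_subset by blast+
 have "c n * integral {p n..p (Suc n)} h - integral {p n..p (Suc n)} (\<lambda>x. y x * h x)
   = integral {p n..p (Suc n)} (\<lambda>x. c n * h x - y x * h x)"
  using ch by (subst hk_integral_diff)
   (auto intro!: integrable_continuous_interval continuous_intros)
 also have "norm ... \<le> integral {p n..p (Suc n)} (\<lambda>x. \<epsilon> * K)"
 proof (rule integral_norm_bound_integral)
  show "(\<lambda>x. c n * h x - y x * h x) integrable_on {p n..p (Suc n)}"
   using ch by (intro integrable_continuous_interval continuous_intros)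
  fix x assume x: "x \<in> {p n..p (Suc n)}"
  have "norm (c n * h x - y x * h x) = \<bar>c n - y x\<bar> * \<bar>h x\<bar>" by (simp add: abs_mult left_diff_distrib[symmetric])
  also have "... \<le> \<epsilon> * K" using x sub Suc.prems(5)[of n x] Suc.prems(4)[of x] by (intro mult_mono) auto
  finally show "norm (c n * h x - y x * h x) \<le> \<epsilon> * K" .
 qed auto
 also have "... = \<epsilon> * K * (gap p n)" using le by simp
 finally have "\<bar>c n * integral {p n..p (Suc n)} h - integral {p n..p (Suc n)} (\<lambda>x. y x * h x)\<bar> \<le> \<epsilon> * K * (gap p n)" by simp
 moreover have "integral {p 0..p (Suc n)} (\<lambda>x. y x * h x) = integral {p 0..p n} (\<lambda>x. y x * h x) + integral {p n..p (Suc n)} (\<lambda>x. y x * h x)"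
  using le i by (simp add: hk_integral_combine)
 ultimately show ?case using IH by (simp add: algebra_simps)
qed simp

section \<open>Wiener integrals of the drivers\<close>

text \<open>Riemann sums over \<open>[0, 2^n]\<close>, so that no integrand needs a fixed horizon.\<close>

definition wsum :: "nat \<Rightarrow> (real \<Rightarrow> real) \<Rightarrow> (real \<Rightarrow> real) \<Rightarrow> real" where
 "wsum n \<phi> y = (\<Sum>j<4^n. \<phi> (real (Suc j) / 2^n) * (y (real (Suc j) / 2^n) - y (real j / 2^n)))"

definition dint :: "nat \<Rightarrow> (real \<Rightarrow> real) \<Rightarrow> real" where
 "dint n f = (\<Sum>j<4^n. f (real (Suc j) / 2^n) / 2^n)"

text \<open>The sums sample a cell at its right end, so cutting at \<open>s\<close> keeps exactly
  the cells that end by \<open>s\<close>.\<close>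

definition cut :: "real \<Rightarrow> (real \<Rightarrow> real) \<Rightarrow> real \<Rightarrow> real" where
 "cut s g x = (if x \<le> s then g x else 0)"

lemma cut_dyadic_sum:
 assumes s: "0 \<le> s" "s \<le> 2^n"
 shows "(\<Sum>j<4^n. cut s g (real (Suc j) / 2^n) * F j) = (\<Sum>j<nat \<lfloor>s * 2^n\<rfloor>. g (real (Suc j) / 2^n) * F j)"
proof -
 define N where "N = nat \<lfloor>s * 2^n\<rfloor>"
 have N: "real (Suc j) / 2^n \<le> s \<longleftrightarrow> j < N" for j
 proof -
  have "real (Suc j) / 2^n \<le> s \<longleftrightarrow> real (Suc j) \<le> s * 2^n" by (simp add: field_simps)
  also have "... \<longleftrightarrow> int (Suc j) \<le> \<lfloor>s * 2^n\<rfloor>" by (simp add: le_floor_iff)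
  also have "... \<longleftrightarrow> j < N" unfolding N_def using s by (auto simp: Suc_le_eq zless_nat_eq_int_zless)
  finally show ?thesis .
 qed
 have "s * 2^n \<le> 2^n * 2^n" using s by (intro mult_right_mono) auto
 also have "(2::real)^n * 2^n = 4^n" by (simp add: power_mult_distrib[symmetric])
 finally have "s * 2^n \<le> real (4^n)" by simp
 then have "N \<le> 4^n" unfolding N_def using floor_mono[of "s * 2^n" "real (4^n)"] by (simp only: floor_of_nat nat_le_iff)
 then have "(\<Sum>j<N. g (real (Suc j) / 2^n) * F j) = (\<Sum>j<4^n. if j < N then g (real (Suc j) / 2^n) * F j else 0)"
  by (intro sum.mono_neutral_cong_left) auto
 also have "... = (\<Sum>j<4^n. cut s g (real (Suc j) / 2^n) * F j)"
  by (intro sum.cong refl) (simp add: cut_def N del: of_nat_Suc)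
 finally show ?thesis by (simp add: N_def)
qed

lemma dyadic_floor:
 assumes "0 \<le> s"
 defines "d \<equiv> (\<lambda>n. real (nat \<lfloor>s * 2^n\<rfloor>) / 2^n)"
 shows "0 \<le> d n" "d n \<le> s" "d \<longlonglongrightarrow> s"
proof -
 have fl: "real (nat \<lfloor>s * 2^n\<rfloor>) = real_of_int \<lfloor>s * 2^n\<rfloor>" for n using assms by simp
 show "0 \<le> d n" by (simp add: d_def)
 have le: "d n \<le> s" for n unfolding d_def fl by (simp add: field_simps)
 then show "d n \<le> s" .
 show "d \<longlonglongrightarrow> s"
 proof (rule tendsto_sandwich[of "\<lambda>n. s - (1/2)^n" _ _ "\<lambda>_. s"])
  have "s - (1/2)^n \<le> d n" for n
  proof -
   have "s * 2^n - 1 \<le> real_of_int \<lfloor>s * 2^n\<rfloor>" by linarith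
   then have "(s * 2^n - 1) / 2^n \<le> real_of_int \<lfloor>s * 2^n\<rfloor> / 2^n" by (rule divide_right_mono) simp
   then show ?thesis unfolding d_def fl by (simp add: diff_divide_distrib power_one_over)
  qed
  then show "\<forall>\<^sub>F n in sequentially. s - (1/2)^n \<le> d n" by simp
  have "(\<lambda>n. s - (1/2::real)^n) \<longlonglongrightarrow> s - 0" by (intro tendsto_diff tendsto_const LIMSEQ_power_zero) auto
  then show "(\<lambda>n. s - (1/2::real)^n) \<longlonglongrightarrow> s" by simp
 qed (use le in auto)
qed

text \<open>The sample points \<open>\<xi>\<close> are arbitrary because both ends of the cells
  occur: right ends for \<open>dint\<close>, left ends after summation by parts in
  \<open>wsum_cut\<close>.\<close>

lemma dyadic_step_lim:
 fixes y h :: "real \<Rightarrow> real"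
 assumes s: "0 \<le> s" and y: "continuous_on {0..s} y" and h: "continuous_on {0..s} h"
  and \<xi>: "\<And>n j. \<xi> n j \<in> (cell n j)"
 shows "(\<lambda>n. \<Sum>j<nat \<lfloor>s * 2^n\<rfloor>. y (\<xi> n j) * integral (cell n j) h) \<longlonglongrightarrow> integral {0..s} (\<lambda>x. y x * h x)"
proof -
 define N where "N n = nat \<lfloor>s * 2^n\<rfloor>" for n :: nat
 define d where "d n = real (N n) / 2^n" for n :: nat
 have d: "0 \<le> d n" "d n \<le> s" "d \<longlonglongrightarrow> s" for n
  using dyadic_floor[OF s] by (auto simp: d_def[abs_def] N_def)
 have "compact (h ` {0..s})" using h by (intro compact_continuous_image) auto
 then obtain K where K: "\<And>x. x \<in> {0..s} \<Longrightarrow> \<bar>h x\<bar> \<le> K" by (force dest!: compact_imp_bounded simp: bounded_iff)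
 have K0: "K \<ge> 0" using K[of 0] s by auto
 have uc: "uniformly_continuous_on {0..s} y" using y by (rule compact_uniformly_continuous) simp
 have i: "(\<lambda>x. y x * h x) integrable_on {0..s}" using y h by (intro integrable_continuous_interval continuous_on_mult)
 have l1: "(\<lambda>n. integral {0..d n} (\<lambda>x. y x * h x)) \<longlonglongrightarrow> integral {0..s} (\<lambda>x. y x * h x)"
 proof -
  have "continuous_on {0..s} (\<lambda>u. integral {0..u} (\<lambda>x. y x * h x))" by (rule indefinite_integral_continuous_1[OF i])
  then show ?thesis using d s by (auto simp: continuous_on_sequentially comp_def)
 qed
 have l2: "(\<lambda>n. (\<Sum>j<N n. y (\<xi> n j) * integral (cell n j) h) - integral {0..d n} (\<lambda>x. y x * h x)) \<longlonglongrightarrow> 0"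
 proof (rule LIMSEQ_I)
  fix r :: real assume r: "r > 0"
  \<comment> \<open>The summand 1 guards against a vanishing \<open>K * s\<close>.\<close>
  define \<epsilon> where "\<epsilon> = r / (2 * (K * s + 1))"
  have \<epsilon>: "\<epsilon> > 0" using r K0 s by (auto simp: \<epsilon>_def intro!: divide_pos_pos add_nonneg_pos)
  obtain \<delta> where \<delta>: "\<delta> > 0" "\<And>x x'. x \<in> {0..s} \<Longrightarrow> x' \<in> {0..s} \<Longrightarrow> dist x' x < \<delta> \<Longrightarrow> dist (y x') (y x) < \<epsilon>"
   using uc \<epsilon> unfolding uniformly_continuous_on_def by metis
  obtain m where m: "(1/2)^m < \<delta>" using real_arch_pow_inv[of \<delta> "1/2"] \<delta> by auto
  show "\<exists>no. \<forall>n\<ge>no. norm ((\<Sum>j<N n. y (\<xi> n j) * integral (cell n j) h) - integral {0..d n} (\<lambda>x. y x * h x) - 0) < r"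
  proof (intro exI allI impI)
   fix n assume n: "n \<ge> m"
   have p: "(1/2::real)^n < \<delta>" using m power_decreasing[OF n, of "1/2::real"] by linarith
   define p where "p j = real j / 2^n" for j
   have pN: "p (N n) = d n" "p 0 = 0" by (auto simp: p_def d_def)
   have "\<bar>(\<Sum>j<N n. y (\<xi> n j) * integral {p j..p (Suc j)} h) - integral {p 0..p (N n)} (\<lambda>x. y x * h x)\<bar> \<le> \<epsilon> * K * (p (N n) - p 0)"
   proof (rule step_sum)
    show "p i \<le> p (Suc i)" for i by (simp add: p_def divide_right_mono)
    have "{p 0..p (N n)} \<subseteq> {0..s}" using d pN by auto
    then show "continuous_on {p 0..p (N n)} y" "continuous_on {p 0..p (N n)} h" "\<And>x. x \<in> {p 0..p (N n)} \<Longrightarrow> \<bar>h x\<bar> \<le> K"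
     using y h K continuous_on_subset by (blast, blast, blast)
    fix i x assume i: "i < N n" and x: "x \<in> {p i..p (Suc i)}"
    have "p (Suc i) \<le> p (N n)" using i by (simp add: p_def divide_right_mono)
    then have "p (Suc i) \<le> s" using d(2)[of n] pN by simp
    moreover have "p i \<ge> 0" by (simp add: p_def)
    moreover have "p (Suc i) - p i = (1/2)^n" by (simp add: p_def field_simps power_one_over)
    moreover have "\<xi> n i \<in> {p i..p (Suc i)}" using \<xi> by (simp add: p_def)
    ultimately have "\<xi> n i \<in> {0..s}" "x \<in> {0..s}" "dist (\<xi> n i) x < \<delta>" using x p by (auto simp: dist_real_def)
    then have "dist (y (\<xi> n i)) (y x) < \<epsilon>" using \<delta> by blast
    then show "\<bar>y (\<xi> n i) - y x\<bar> \<le> \<epsilon>" by (simp add: dist_real_def)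
   qed
   also have "\<epsilon> * K * (p (N n) - p 0) \<le> \<epsilon> * K * s" using \<epsilon> K0 d(2)[of n] by (intro mult_left_mono) (auto simp: pN)
   also have "... < \<epsilon> * (K * s + 1) * 2"
    proof -
     have "0 \<le> \<epsilon> * (K * s)" using \<epsilon> K0 s by simp
     then show ?thesis using \<epsilon> by (simp add: algebra_simps)
    qed
   also have "... = r"
   proof -
    have "K * s + 1 > 0" using K0 s by (simp add: add_nonneg_pos)
    then show ?thesis unfolding \<epsilon>_def by (simp add: field_simps)
   qed
   finally show "norm ((\<Sum>j<N n. y (\<xi> n j) * integral (cell n j) h) - integral {0..d n} (\<lambda>x. y x * h x) - 0) < r"
    by (simp only: pN real_norm_def diff_zero) (simp add: p_def)
  qed
 qed
 show ?thesis using tendsto_add[OF l2 l1] by (simp add: N_def)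
qed

lemma dint_cut:
 assumes s: "0 \<le> s" and g: "continuous_on {0..s} g"
 shows "(\<lambda>n. dint n (cut s g)) \<longlonglongrightarrow> integral {0..s} g"
proof -
 have "(\<lambda>n. \<Sum>j<nat \<lfloor>s * 2^n\<rfloor>. g (real (Suc j) / 2^n) * integral (cell n j) (\<lambda>_. 1::real)) \<longlonglongrightarrow> integral {0..s} (\<lambda>x. g x * 1)"
  by (rule dyadic_step_lim[OF s g]) (auto simp: divide_right_mono)
 moreover have "\<forall>\<^sub>F n in sequentially. (\<Sum>j<nat \<lfloor>s * 2^n\<rfloor>. g (real (Suc j) / 2^n) * integral (cell n j) (\<lambda>_. 1::real)) = dint n (cut s g)"
  using eventually_ge_at_top[of "nat \<lceil>s\<rceil>"]
 proof eventually_elim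
  case (elim n)
  have "s \<le> real n" using elim by linarith
  also have "real n \<le> 2^n" by (rule of_nat_less_two_power[THEN less_imp_le])
  finally have sn: "s \<le> 2^n" .
  have "dint n (cut s g) = (\<Sum>j<4^n. cut s g (real (Suc j) / 2^n) * (1/2^n))" by (simp add: dint_def)
  also have "... = (\<Sum>j<nat \<lfloor>s * 2^n\<rfloor>. g (real (Suc j) / 2^n) * (1/2^n))" by (rule cut_dyadic_sum[OF s sn])
  also have "... = (\<Sum>j<nat \<lfloor>s * 2^n\<rfloor>. g (real (Suc j) / 2^n) * integral (cell n j) (\<lambda>_. 1::real))"
   by (intro sum.cong refl) (simp add: divide_right_mono diff_divide_distrib[symmetric])
  finally show ?case by simp
 qed
 ultimately show ?thesis by (simp add: tendsto_cong)
qed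

lemma sum_by_parts:
 fixes g y :: "nat \<Rightarrow> real"
 shows "(\<Sum>j<N. g (Suc j) * (y (Suc j) - y j)) = g N * y N - g 0 * y 0 - (\<Sum>j<N. y j * (g (Suc j) - g j))"
 by (induction N) (auto simp: algebra_simps)

text \<open>Summation by parts moves the increments from the path to the differentiable integrand,
  so the sums converge along every continuous path that starts at 0. The limit is the Wiener
  integral in its integrated-by-parts form.\<close>

lemma wsum_cut:
 fixes y g :: "real \<Rightarrow> real"
 assumes s: "0 \<le> s" and y: "continuous_on {0..} y" and y0: "y 0 = 0"
  and g: "\<And>x. x \<in> {0..s} \<Longrightarrow> (g has_real_derivative g' x) (at x within {0..s})"
  and g': "continuous_on {0..s} g'"
 shows "(\<lambda>n. wsum n (cut s g) y) \<longlonglongrightarrow> g s * y s - integral {0..s} (\<lambda>x. y x * g' x)"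
proof -
 define N where "N n = nat \<lfloor>s * 2^n\<rfloor>" for n :: nat
 define d where "d n = real (N n) / 2^n" for n :: nat
 have d: "0 \<le> d n" "d n \<le> s" "d \<longlonglongrightarrow> s" for n
  using dyadic_floor[OF s] by (auto simp: d_def[abs_def] N_def)
 have ys: "continuous_on {0..s} y" by (rule continuous_on_subset[OF y]) auto
 have gs: "continuous_on {0..s} g" using g by (intro DERIV_continuous_on) auto
 have "(\<lambda>n. \<Sum>j<N n. y (real j / 2^n) * integral (cell n j) g') \<longlonglongrightarrow> integral {0..s} (\<lambda>x. y x * g' x)"
  unfolding N_def by (rule dyadic_step_lim[OF s ys g']) (auto simp: divide_right_mono)
 moreover have "(\<lambda>n. g (d n) * y (d n)) \<longlonglongrightarrow> g s * y s"
  using ys gs d s by (intro tendsto_mult) (auto simp: continuous_on_sequentially comp_def)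
 ultimately have "(\<lambda>n. g (d n) * y (d n) - (\<Sum>j<N n. y (real j / 2^n) * integral (cell n j) g'))
  \<longlonglongrightarrow> g s * y s - integral {0..s} (\<lambda>x. y x * g' x)" by (intro tendsto_diff)
 moreover have "\<forall>\<^sub>F n in sequentially. g (d n) * y (d n) - (\<Sum>j<N n. y (real j / 2^n) * integral (cell n j) g') = wsum n (cut s g) y"
  using eventually_ge_at_top[of "nat \<lceil>s\<rceil>"]
 proof eventually_elim
  case (elim n)
  have "s \<le> real n" using elim by linarith
  also have "real n \<le> 2^n" by (rule of_nat_less_two_power[THEN less_imp_le])
  finally have sn: "s \<le> 2^n" .
  have i: "integral (cell n j) g' = g (real (Suc j) / 2^n) - g (real j / 2^n)" if "j < N n" for j
  proof -
   have "real (Suc j) / 2^n \<le> d n" using that by (simp add: d_def divide_right_mono)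
   then have sub: "(cell n j) \<subseteq> {0..s}" using d(2)[of n] by auto
   have "(g' has_integral g (real (Suc j) / 2^n) - g (real j / 2^n)) (cell n j)"
   proof (rule fundamental_theorem_of_calculus)
    fix x assume "x \<in> (cell n j)"
    then show "(g has_vector_derivative g' x) (at x within (cell n j))"
     using DERIV_subset[OF g[of x] sub] sub
     by (simp only: has_real_derivative_iff_has_vector_derivative[symmetric] subset_eq)
   qed (simp add: divide_right_mono)
   then show ?thesis by (rule integral_unique)
  qed
  have "wsum n (cut s g) y = (\<Sum>j<N n. g (real (Suc j) / 2^n) * (y (real (Suc j) / 2^n) - y (real j / 2^n)))"
   unfolding wsum_def N_def by (rule cut_dyadic_sum[OF s sn])
  also have "... = g (d n) * y (d n) - (\<Sum>j<N n. y (real j / 2^n) * (g (real (Suc j) / 2^n) - g (real j / 2^n)))"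
   using sum_by_parts[of "\<lambda>j. g (real j / 2^n)" "\<lambda>j. y (real j / 2^n)" "N n"] y0 by (simp add: d_def)
  also have "... = g (d n) * y (d n) - (\<Sum>j<N n. y (real j / 2^n) * integral (cell n j) g')"
   using i by simp
  finally show ?case by simp
 qed
 ultimately show ?thesis by (simp add: tendsto_cong)
qed

section \<open>Independence and Gaussian functionals of the drivers\<close>

text \<open>The product-law form is the one that Fubini and the Gaussian channel bound consume
  directly.\<close>

definition indep_pair :: "'a measure \<Rightarrow> 'b measure \<Rightarrow> ('a \<Rightarrow> 'b) \<Rightarrow> 'c measure \<Rightarrow> ('a \<Rightarrow> 'c) \<Rightarrow> bool" where
 "indep_pair M S X T Y \<longleftrightarrow> X \<in> measurable M S \<and> Y \<in> measurable M T \<and>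
  distr M (S \<Otimes>\<^sub>M T) (\<lambda>w. (X w, Y w)) = distr M S X \<Otimes>\<^sub>M distr M T Y"

lemma (in prob_space) indep_pairI:
 assumes X[measurable]: "X \<in> measurable M S" and Y[measurable]: "Y \<in> measurable M T"
  and *: "\<And>A B. A \<in> sets S \<Longrightarrow> B \<in> sets T \<Longrightarrow>
   prob ((X -` A \<inter> space M) \<inter> (Y -` B \<inter> space M)) = prob (X -` A \<inter> space M) * prob (Y -` B \<inter> space M)"
 shows "indep_pair M S X T Y"
proof -
 interpret X: prob_space "distr M S X" by (rule prob_space_distr) simp
 interpret Y: prob_space "distr M T Y" by (rule prob_space_distr) simp
 have "distr M S X \<Otimes>\<^sub>M distr M T Y = distr M (S \<Otimes>\<^sub>M T) (\<lambda>w. (X w, Y w))"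
 proof (rule pair_measure_eqI)
  fix A B assume "A \<in> sets (distr M S X)" "B \<in> sets (distr M T Y)"
  then have AB[measurable]: "A \<in> sets S" "B \<in> sets T" by auto
  have "(\<lambda>w. (X w, Y w)) -` (A \<times> B) \<inter> space M = (X -` A \<inter> space M) \<inter> (Y -` B \<inter> space M)" by auto
  then show "emeasure (distr M S X) A * emeasure (distr M T Y) B = emeasure (distr M (S \<Otimes>\<^sub>M T) (\<lambda>w. (X w, Y w))) (A \<times> B)"
   using *[OF AB] by (simp add: emeasure_distr emeasure_eq_measure ennreal_mult'[symmetric])
 qed (unfold_locales, simp cong: sets_pair_measure_cong)
 then show ?thesis using X Y by (simp add: indep_pair_def)
qed

text \<open>Phrased through the characteristic function so that \<open>c = 0\<close> is covered
  without a degenerate normal law.\<close>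

lemma (in prob_space) char_scaled_normal:
 assumes X: "distributed M lborel X (normal_density 0 \<sigma>)" and \<sigma>: "\<sigma> > 0"
 shows "char (distr M borel (\<lambda>w. c * X w)) t = of_real (exp (- (t^2 * (c^2 * \<sigma>^2)) / 2))"
proof -
 have [measurable]: "X \<in> borel_measurable M" using distributed_measurable[OF X] by simp
 have "distributed M lborel (\<lambda>x. (X x - 0) / \<sigma>) std_normal_density"
  using X normal_standard_normal_convert[OF \<sigma>, of X 0] by simp
 then have d: "distr M lborel (\<lambda>x. X x / \<sigma>) = std_normal_distribution"
  by (simp add: distributed_def)
 have "distr M borel (\<lambda>x. X x / \<sigma>) = distr M lborel (\<lambda>x. X x / \<sigma>)" by (rule distr_cong) auto
 then have d: "distr M borel (\<lambda>x. X x / \<sigma>) = std_normal_distribution" using d by simp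
 define r where "r = t * c * \<sigma>"
 have "char (distr M borel (\<lambda>w. c * X w)) t = (CLINT w|M. iexp (t * (c * X w)))"
  by (simp add: char_def integral_distr)
 also have "... = (CLINT w|M. iexp (r * (X w / \<sigma>)))"
 proof -
  have "t * (c * X w) = r * (X w / \<sigma>)" for w using \<sigma> by (simp add: r_def)
  then show ?thesis by (simp only:)
 qed
 also have "... = char (distr M borel (\<lambda>x. X x / \<sigma>)) r"
  by (simp add: char_def integral_distr)
 also have "... = of_real (exp (- (t * c * \<sigma>)\<^sup>2 / 2))" unfolding d char_std_normal_distribution r_def by simp
 finally show ?thesis by (simp add: power_mult_distrib mult_ac)
qed

lemma brownian_increments:
 assumes "standard_brownian_motion M B"
 shows "\<lbrakk>0 \<le> s; s < t\<rbrakk> \<Longrightarrow> distributed M lborel (\<lambda>w. B t w - B s w) (normal_density 0 (sqrt (t - s)))"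
  and "\<lbrakk>0 \<le> p 0; \<And>j. j < n \<Longrightarrow> p j \<le> p (Suc j)\<rbrakk> \<Longrightarrow>
   prob_space.indep_vars M (\<lambda>_. borel) (\<lambda>j w. B (p (Suc j)) w - B (p j) w) {..<n::nat}"
 using assms unfolding standard_brownian_motion_def by simp_all

lemma (in prob_space) char_wsum:
 assumes B: "standard_brownian_motion M B"
 shows "char (distr M borel (\<lambda>w. wsum n \<phi> (\<lambda>t. B t w))) t = of_real (exp (- (t^2 * dint n (\<lambda>x. \<phi> x * \<phi> x)) / 2))"
proof -
 define p where "p j = real j / 2^n" for j
 have p: "p (Suc j) - p j = 1 / 2^n" "0 \<le> p j" "p j < p (Suc j)" for j
  by (simp_all add: p_def field_simps)
 have "indep_vars (\<lambda>_. borel) (\<lambda>j w. B (p (Suc j)) w - B (p j) w) {..<4^n}"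
  using p by (intro brownian_increments(2)[OF B]) (auto intro: less_imp_le)
 then have "indep_vars (\<lambda>_. borel) (\<lambda>j w. \<phi> (p (Suc j)) * (B (p (Suc j)) w - B (p j) w)) {..<4^n}"
  by (rule indep_vars_compose2[where Y="\<lambda>j x. \<phi> (p (Suc j)) * x"]) auto
 from char_distr_sum[OF this, of t]
 have "char (distr M borel (\<lambda>w. wsum n \<phi> (\<lambda>t. B t w))) t
  = (\<Prod>j<4^n. char (distr M borel (\<lambda>w. \<phi> (p (Suc j)) * (B (p (Suc j)) w - B (p j) w))) t)"
  by (simp add: wsum_def p_def)
 also have "... = (\<Prod>j<4^n. of_real (exp (- (t^2 * ((\<phi> (p (Suc j)))^2 * (sqrt (gap p j))^2)) / 2)))"
 proof (intro prod.cong refl char_scaled_normal)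
  fix j show "distributed M lborel (\<lambda>w. B (p (Suc j)) w - B (p j) w) (normal_density 0 (sqrt (gap p j)))"
   by (rule brownian_increments(1)[OF B p(2) p(3)])
  show "0 < sqrt (gap p j)" using p by simp
 qed
 also have "... = of_real (exp (\<Sum>j<4^n. - (t^2 * ((\<phi> (p (Suc j)))^2 * (1 / 2^n))) / 2))"
  by (simp add: exp_sum p)
 also have "(\<Sum>j<4^n. - (t^2 * ((\<phi> (p (Suc j)))^2 * (1 / 2^n))) / 2) = - (t^2 * dint n (\<lambda>x. \<phi> x * \<phi> x)) / 2"
  by (simp add: dint_def p_def sum_distrib_left sum_negf[symmetric] sum_divide_distrib power2_eq_square)
 finally show ?thesis .
qed

lemma measurable_wsum:
 assumes "\<And>j. \<phi> (real (Suc j) / 2^n) \<noteq> 0 \<Longrightarrow> real (Suc j) / 2^n \<in> I \<and> real j / 2^n \<in> I"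
 shows "(\<lambda>y. wsum n \<phi> y) \<in> borel_measurable (PiM I (\<lambda>_. borel))"
 unfolding wsum_def
proof (rule borel_measurable_sum)
 fix j
 show "(\<lambda>y. \<phi> (real (Suc j) / 2^n) * (y (real (Suc j) / 2^n) - y (real j / 2^n))) \<in> borel_measurable (PiM I (\<lambda>_. borel))"
 proof (cases "\<phi> (real (Suc j) / 2^n) = 0")
  case False
  from assms[OF this] show ?thesis
   by (intro borel_measurable_times borel_measurable_diff borel_measurable_const measurable_component_singleton) auto
 qed simp
qed

lemma wsum_path: "wsum n \<phi> (path Z {0..} w) = wsum n \<phi> (\<lambda>t. Z t w)"
 by (simp add: wsum_def path_def)

lemma wsum_add: "wsum n (\<lambda>x. \<phi> x + \<psi> x) y = wsum n \<phi> y + wsum n \<psi> y"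
 by (simp add: wsum_def distrib_right sum.distrib)

lemma wsum_scale: "wsum n (\<lambda>x. c * \<phi> x) y = c * wsum n \<phi> y"
 by (simp add: wsum_def sum_distrib_left mult.assoc)

lemma wsum_zero: "wsum n (\<lambda>x. 0) y = 0"
 by (simp add: wsum_def)

lemma dint_add: "dint n (\<lambda>x. f x + g x) = dint n f + dint n g"
 by (simp add: dint_def add_divide_distrib sum.distrib)

lemma dint_scale: "dint n (\<lambda>x. c * f x) = c * dint n f"
 by (simp add: dint_def sum_distrib_left)

locale gaussian_drivers = prob_space M for M :: "'a measure" +
 fixes v0 :: "'a \<Rightarrow> real" and B Bm :: "real \<Rightarrow> 'a \<Rightarrow> real" and s0 :: real
 assumes s0: "s0 > 0"
  and v0: "distributed M lborel v0 (normal_density 0 s0)"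
  and B: "standard_brownian_motion M B" and Bm: "standard_brownian_motion M Bm"
  and indep: "indep_drivers M v0 B Bm"
begin

lemma v0_measurable[measurable]: "v0 \<in> borel_measurable M"
 using distributed_measurable[OF v0] by simp

lemma B_measurable[measurable]: "t \<ge> 0 \<Longrightarrow> B t \<in> borel_measurable M" "t \<ge> 0 \<Longrightarrow> Bm t \<in> borel_measurable M"
 using B Bm by (auto simp: standard_brownian_motion_def)

lemma path_measurable[measurable]:
 "J \<subseteq> {0..} \<Longrightarrow> path B J \<in> measurable M (path_space J)" "J \<subseteq> {0..} \<Longrightarrow> path Bm J \<in> measurable M (path_space J)"
 unfolding path_def[abs_def] by (auto intro!: measurable_restrict B_measurable)

lemma wsum_measurable[measurable]:
 "(\<lambda>w. wsum n \<phi> (\<lambda>t. B t w)) \<in> borel_measurable M" "(\<lambda>w. wsum n \<phi> (\<lambda>t. Bm t w)) \<in> borel_measurable M"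
 unfolding wsum_def by measurable

lemma char_elementary:
 "char (distr M borel (\<lambda>w. a * v0 w + wsum n \<phi> (\<lambda>t. B t w) + wsum n \<psi> (\<lambda>t. Bm t w))) t
 = of_real (exp (- (t^2 * (a * a * s0^2 + dint n (\<lambda>x. \<phi> x * \<phi> x) + dint n (\<lambda>x. \<psi> x * \<psi> x))) / 2))"
proof -
 define X where "X j w = (if j = 0 then a * v0 w else if j = 1 then wsum n \<phi> (\<lambda>t. B t w) else wsum n \<psi> (\<lambda>t. Bm t w))"
  for j :: nat and w
 have "indep_vars (\<lambda>_. borel) X {..<3}"
  unfolding indep_vars_def2
 proof (intro conjI ballI)
  show "X i \<in> borel_measurable M" for i unfolding X_def by measurable
  have wm: "wsum n \<phi> \<in> borel_measurable (path_space {0..})" for \<phi> by (rule measurable_wsum) auto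
  show "indep_sets (\<lambda>i. {X i -` A \<inter> space M |A. A \<in> sets borel}) {..<3}"
  proof (rule indep_sets_mono_sets[OF indep[unfolded indep_drivers_def]])
   fix i :: nat assume "i \<in> {..<3}"
   then consider "i = 0" | "i = 1" | "i = 2" by fastforce
   then show "{X i -` A \<inter> space M |A. A \<in> sets borel} \<subseteq>
    [sets (vimage_algebra (space M) v0 borel), sets (vimage_algebra (space M) (path B {0..}) (path_space {0..})),
     sets (vimage_algebra (space M) (path Bm {0..}) (path_space {0..}))] ! i"
   proof cases
    case 1
    have "(\<lambda>w. a * v0 w) \<in> borel_measurable (vimage_algebra (space M) v0 borel)"
     by (intro borel_measurable_times borel_measurable_const measurable_vimage_algebra1) auto
    then have "X 0 \<in> borel_measurable (vimage_algebra (space M) v0 borel)" by (simp add: X_def[abs_def])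
    from measurable_sets[OF this] show ?thesis using 1 by auto
   next
    case 2
    have "(\<lambda>w. wsum n \<phi> (path B {0..} w)) \<in> borel_measurable (vimage_algebra (space M) (path B {0..}) (path_space {0..}))"
     by (rule measurable_compose[OF measurable_vimage_algebra1 wm]) (use measurable_space[OF path_measurable(1)[of "{0..}"]] in auto)
    then have "X 1 \<in> borel_measurable (vimage_algebra (space M) (path B {0..}) (path_space {0..}))" by (simp add: X_def[abs_def] wsum_path)
    from measurable_sets[OF this] show ?thesis using 2 by auto
   next
    case 3
    have "(\<lambda>w. wsum n \<psi> (path Bm {0..} w)) \<in> borel_measurable (vimage_algebra (space M) (path Bm {0..}) (path_space {0..}))"
     by (rule measurable_compose[OF measurable_vimage_algebra1 wm]) (use measurable_space[OF path_measurable(2)[of "{0..}"]] in auto)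
    then have "X 2 \<in> borel_measurable (vimage_algebra (space M) (path Bm {0..}) (path_space {0..}))" by (simp add: X_def[abs_def] wsum_path)
    from measurable_sets[OF this] show ?thesis using 3 by auto
   qed
  qed
 qed
 from char_distr_sum[OF this, of t]
 have "char (distr M borel (\<lambda>w. \<Sum>i<3. X i w)) t = (\<Prod>i<3. char (distr M borel (X i)) t)" .
 moreover have "(\<Sum>i<3. X i w) = a * v0 w + wsum n \<phi> (\<lambda>t. B t w) + wsum n \<psi> (\<lambda>t. Bm t w)" for w
  by (simp add: X_def numeral_3_eq_3)
 moreover have "(\<Prod>i<3. char (distr M borel (X i)) t) = char (distr M borel (\<lambda>w. a * v0 w)) t *
  char (distr M borel (\<lambda>w. wsum n \<phi> (\<lambda>t. B t w))) t * char (distr M borel (\<lambda>w. wsum n \<psi> (\<lambda>t. Bm t w))) t"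
  by (simp add: X_def[abs_def] numeral_3_eq_3)
 ultimately show ?thesis
  by (simp add: char_wsum[OF B] char_wsum[OF Bm] char_scaled_normal[OF v0 s0] of_real_mult[symmetric] exp_add[symmetric]
     power2_eq_square del: of_real_mult) (simp add: field_simps)
qed

text \<open>\<open>L = a v0 + \<integral>\<phi> dB + \<integral>\<psi> dBm\<close>; the limit of \<open>qn\<close> is the covariance of two such variables.\<close>

definition rep :: "('a \<Rightarrow> real) \<Rightarrow> real \<Rightarrow> (real \<Rightarrow> real) \<Rightarrow> (real \<Rightarrow> real) \<Rightarrow> bool" where
 "rep L a \<phi> \<psi> \<longleftrightarrow> L \<in> borel_measurable M \<and>
  (AE w in M. (\<lambda>n. a * v0 w + wsum n \<phi> (\<lambda>t. B t w) + wsum n \<psi> (\<lambda>t. Bm t w)) \<longlonglongrightarrow> L w)"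

definition qn :: "nat \<Rightarrow> real \<Rightarrow> (real \<Rightarrow> real) \<Rightarrow> (real \<Rightarrow> real) \<Rightarrow> real \<Rightarrow> (real \<Rightarrow> real) \<Rightarrow> (real \<Rightarrow> real) \<Rightarrow> real" where
 "qn n a \<phi> \<psi> a' \<phi>' \<psi>' = a * a' * s0^2 + dint n (\<lambda>x. \<phi> x * \<phi>' x) + dint n (\<lambda>x. \<psi> x * \<psi>' x)"

abbreviation "qlim a f g a2 f2 g2 v \<equiv> (\<lambda>n. qn n a f g a2 f2 g2) \<longlonglongrightarrow> v"

lemma rep_measurable: "rep L a \<phi> \<psi> \<Longrightarrow> L \<in> borel_measurable M"
 by (simp add: rep_def)

lemma rep_lin:
 assumes "rep L a \<phi> \<psi>" "rep L' a' \<phi>' \<psi>'"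
 shows "rep (\<lambda>w. c * L w + c' * L' w) (c * a + c' * a') (\<lambda>x. c * \<phi> x + c' * \<phi>' x) (\<lambda>x. c * \<psi> x + c' * \<psi>' x)"
proof -
 have [measurable]: "L \<in> borel_measurable M" "L' \<in> borel_measurable M" using assms by (auto simp: rep_def)
 have 1: "AE w in M. (\<lambda>n. a * v0 w + wsum n \<phi> (\<lambda>t. B t w) + wsum n \<psi> (\<lambda>t. Bm t w)) \<longlonglongrightarrow> L w"
  "AE w in M. (\<lambda>n. a' * v0 w + wsum n \<phi>' (\<lambda>t. B t w) + wsum n \<psi>' (\<lambda>t. Bm t w)) \<longlonglongrightarrow> L' w"
  using assms by (auto simp: rep_def)
 have "AE w in M. (\<lambda>n. (c * a + c' * a') * v0 w + wsum n (\<lambda>x. c * \<phi> x + c' * \<phi>' x) (\<lambda>t. B t w)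
   + wsum n (\<lambda>x. c * \<psi> x + c' * \<psi>' x) (\<lambda>t. Bm t w)) \<longlonglongrightarrow> c * L w + c' * L' w"
  using 1
 proof eventually_elim
  case (elim w)
  from tendsto_add[OF tendsto_mult_left[OF elim(1), of c] tendsto_mult_left[OF elim(2), of c']]
  show ?case by (simp add: wsum_add wsum_scale algebra_simps)
 qed
 then show ?thesis by (simp add: rep_def)
qed

lemma rep_zero: "rep (\<lambda>_. 0) 0 (\<lambda>_. 0) (\<lambda>_. 0)"
 by (simp add: rep_def wsum_zero)

lemma rep_sum:
 assumes "finite J" "\<And>j. j \<in> J \<Longrightarrow> rep (Z j) (a j) (\<phi> j) (\<psi> j)"
 shows "rep (\<lambda>w. \<Sum>j\<in>J. c j * Z j w) (\<Sum>j\<in>J. c j * a j) (\<lambda>x. \<Sum>j\<in>J. c j * \<phi> j x) (\<lambda>x. \<Sum>j\<in>J. c j * \<psi> j x)"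
 using assms
proof (induction J rule: finite_induct)
 case empty then show ?case by (simp add: rep_zero)
next
 case (insert j J)
 have "rep (\<lambda>w. c j * Z j w + 1 * (\<Sum>j\<in>J. c j * Z j w)) (c j * a j + 1 * (\<Sum>j\<in>J. c j * a j))
  (\<lambda>x. c j * \<phi> j x + 1 * (\<Sum>j\<in>J. c j * \<phi> j x)) (\<lambda>x. c j * \<psi> j x + 1 * (\<Sum>j\<in>J. c j * \<psi> j x))"
  by (rule rep_lin) (use insert in auto)
 then show ?case using insert.hyps by simp
qed

text \<open>Bilinearity holds exactly at each level \<open>n\<close>, so covariances of linear
  combinations are computed before passing to the limit.\<close>

lemma qn_lin:
 "qn n (c * a + c' * a') (\<lambda>x. c * \<phi> x + c' * \<phi>' x) (\<lambda>x. c * \<psi> x + c' * \<psi>' x) b \<zeta> \<eta> =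
  c * qn n a \<phi> \<psi> b \<zeta> \<eta> + c' * qn n a' \<phi>' \<psi>' b \<zeta> \<eta>"
proof -
 have *: "dint n (\<lambda>x. (c * f x + c' * g x) * h x) = c * dint n (\<lambda>x. f x * h x) + c' * dint n (\<lambda>x. g x * h x)" for f g h :: "real \<Rightarrow> real"
  by (simp add: distrib_right mult.assoc dint_add dint_scale)
 have alg: "(c * a + c' * a') * b * s + (c * p + c' * q) + (c * r + c' * u) = c * (a * b * s + p + r) + c' * (a' * b * s + q + u)"
  for s p q r u :: real by (simp add: algebra_simps)
 show ?thesis unfolding qn_def * by (rule alg)
qed

lemma qn_commute: "qn n a \<phi> \<psi> b \<zeta> \<eta> = qn n b \<zeta> \<eta> a \<phi> \<psi>"
 by (simp add: qn_def mult.commute)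

lemma qn_sum:
 "qn n (\<Sum>j\<in>J. c j * a j) (\<lambda>x. \<Sum>j\<in>J. c j * \<phi> j x) (\<lambda>x. \<Sum>j\<in>J. c j * \<psi> j x) b \<zeta> \<eta> = (\<Sum>j\<in>J. c j * qn n (a j) (\<phi> j) (\<psi> j) b \<zeta> \<eta>)"
proof (induction J rule: infinite_finite_induct)
 case (insert j J)
 then show ?case using qn_lin[of n "c j" "a j" 1 "\<Sum>j\<in>J. c j * a j" "\<phi> j" "\<lambda>x. \<Sum>j\<in>J. c j * \<phi> j x" "\<psi> j" "\<lambda>x. \<Sum>j\<in>J. c j * \<psi> j x" b \<zeta> \<eta>]
  by simp
qed (simp_all add: qn_def dint_def)

text \<open>Each Riemann sum has a centred Gaussian characteristic function with variance
  \<open>qn\<close>, and almost sure convergence carries these to the limit by dominated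
  convergence. A limit variance of 0 is allowed.\<close>

lemma rep_char:
 assumes L: "rep L a \<phi> \<psi>" and q: "qlim a \<phi> \<psi> a \<phi> \<psi> v"
 shows "char (distr M borel L) t = of_real (exp (- (t^2 * v) / 2))"
proof -
 define Ln where "Ln n w = a * v0 w + wsum n \<phi> (\<lambda>t. B t w) + wsum n \<psi> (\<lambda>t. Bm t w)" for n w
 have [measurable]: "L \<in> borel_measurable M" "Ln n \<in> borel_measurable M" for n
  using L by (auto simp: rep_def Ln_def[abs_def])
 have "(\<lambda>n. CLINT w|M. iexp (t * Ln n w)) \<longlonglongrightarrow> (CLINT w|M. iexp (t * L w))"
 proof (rule integral_dominated_convergence[where w="\<lambda>_. 1"])
  show "AE w in M. (\<lambda>n. iexp (t * Ln n w)) \<longlonglongrightarrow> iexp (t * L w)"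
  proof -
   have "AE w in M. (\<lambda>n. Ln n w) \<longlonglongrightarrow> L w" using L by (simp add: rep_def Ln_def)
   then show ?thesis by eventually_elim (intro tendsto_intros)
  qed
 qed auto
 moreover have "(CLINT w|M. iexp (t * Ln n w)) = of_real (exp (- (t^2 * qn n a \<phi> \<psi> a \<phi> \<psi>) / 2))" for n
  using char_elementary[of a n \<phi> \<psi> t] unfolding qn_def Ln_def[symmetric] by (simp add: char_def integral_distr)
 moreover have "(\<lambda>n. complex_of_real (exp (- (t^2 * qn n a \<phi> \<psi> a \<phi> \<psi>) / 2))) \<longlonglongrightarrow> of_real (exp (- (t^2 * v) / 2))"
  using q by (intro tendsto_intros) auto
 ultimately have "(CLINT w|M. iexp (t * L w)) = of_real (exp (- (t^2 * v) / 2))"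
  using LIMSEQ_unique by fastforce
 then show ?thesis by (simp add: char_def integral_distr)
qed

lemma rep_cos_sin:
 assumes L: "rep L a \<phi> \<psi>" and q: "qlim a \<phi> \<psi> a \<phi> \<psi> v"
 shows "(LINT w|M. cos (L w)) = exp (- v / 2)" "(LINT w|M. sin (L w)) = 0"
proof -
 have [measurable]: "L \<in> borel_measurable M" using L by (simp add: rep_def)
 have i: "integrable M (\<lambda>w. iexp (L w))" by (rule integrable_iexp) auto
 have "(CLINT w|M. iexp (L w)) = of_real (exp (- v / 2))"
  using rep_char[OF assms, of 1] by (simp add: char_def integral_distr)
 then show "(LINT w|M. cos (L w)) = exp (- v / 2)" "(LINT w|M. sin (L w)) = 0"
  using integral_Re[OF i] integral_Im[OF i] by (simp_all add: Re_exp Im_exp)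
qed

lemma rep_normal:
 assumes L: "rep L a \<phi> \<psi>" and q: "qlim a \<phi> \<psi> a \<phi> \<psi> v" and v: "v > 0"
 shows "distr M borel L = density lborel (normal_density 0 (sqrt v))"
  and "integrable M (\<lambda>w. (L w)^2)" "(LINT w|M. (L w)^2) = v"
  and "integrable M L" "(LINT w|M. L w) = 0"
proof -
 have [measurable]: "L \<in> borel_measurable M" using L by (simp add: rep_def)
 define X where "X w = L w / sqrt v" for w
 have [measurable]: "X \<in> borel_measurable M" unfolding X_def by measurable
 have d: "distr M borel X = std_normal_distribution"
 proof (rule Levy_uniqueness)
  show "real_distribution (distr M borel X)" "real_distribution std_normal_distribution"
   by (auto intro!: real_dist_normal_dist real_distribution_distr)
  show "char (distr M borel X) = char std_normal_distribution"
  proof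
   fix t
   have "char (distr M borel X) t = char (distr M borel L) (t / sqrt v)"
    by (simp add: char_def integral_distr X_def)
   also have "... = char std_normal_distribution t"
    using v unfolding rep_char[OF L q] char_std_normal_distribution by (simp add: power_divide)
   finally show "char (distr M borel X) t = char std_normal_distribution t" .
  qed
 qed
 have LX: "L w = sqrt v * X w" for w using v by (simp add: X_def)
 have "distr M lborel X = distr M borel X" by (rule distr_cong) auto
 then have "distributed M lborel X std_normal_density" using d by (simp add: distributed_def)
 from normal_density_affine[OF this, of "sqrt v" 0]
 have "distributed M lborel L (normal_density 0 (sqrt v))" using v by (simp add: LX[abs_def])
 then have "distr M lborel L = density lborel (normal_density 0 (sqrt v))" by (simp add: distributed_def)
 moreover have "distr M lborel L = distr M borel L" by (rule distr_cong) auto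
 ultimately show "distr M borel L = density lborel (normal_density 0 (sqrt v))" by simp
 have "integrable (distr M borel X) (\<lambda>x. x^2)" "(\<integral>x. x^2 \<partial>distr M borel X) = 1"
  using std_normal_distribution_even_moments[of 1] unfolding d by simp_all
 then have "integrable M (\<lambda>w. (X w)^2)" "(LINT w|M. (X w)^2) = 1" by (simp_all add: integrable_distr_eq integral_distr)
 then show "integrable M (\<lambda>w. (L w)^2)" "(LINT w|M. (L w)^2) = v" using v by (simp_all add: LX power_mult_distrib)
 have "integrable (distr M borel X) (\<lambda>x. x^1)" "(\<integral>x. x^1 \<partial>distr M borel X) = 0"
  using integrable_std_normal_distribution_moment[of 1] integral_std_normal_distribution_moment_odd[of 1] unfolding d by simp_all
 then have "integrable M X" "(LINT w|M. X w) = 0" by (simp_all add: integrable_distr_eq integral_distr)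
 then show "integrable M L" "(LINT w|M. L w) = 0" by (simp_all add: LX[abs_def])
qed

end

context gaussian_drivers
begin

text \<open>Uncorrelated jointly Gaussian variables are independent, here one variable and a process
  with arbitrary index set. Fourier uniqueness is used twice: first to replace the process by an
  event of its path, with the frequency of \<open>X\<close> fixed, then to replace \<open>X\<close>
  by a Borel event.\<close>

lemma rep_indep:
 fixes Z :: "'i \<Rightarrow> 'a \<Rightarrow> real"
 assumes X: "rep X a \<phi> \<psi>" and Z: "\<And>r. r \<in> I \<Longrightarrow> rep (Z r) (b r) (\<zeta> r) (\<eta> r)"
  and qX: "qlim a \<phi> \<psi> a \<phi> \<psi> v"
  and qZ: "\<And>r s. r \<in> I \<Longrightarrow> s \<in> I \<Longrightarrow> convergent (\<lambda>n. qn n (b r) (\<zeta> r) (\<eta> r) (b s) (\<zeta> s) (\<eta> s))"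
  and q0: "\<And>r. r \<in> I \<Longrightarrow> (\<lambda>n. qn n a \<phi> \<psi> (b r) (\<zeta> r) (\<eta> r)) \<longlonglongrightarrow> 0"
 shows "indep_pair M borel X (PiM I (\<lambda>_. borel)) (\<lambda>w. \<lambda>r\<in>I. Z r w)"
proof -
 have Xm[measurable]: "X \<in> borel_measurable M" using X by (rule rep_measurable)
 have Zm: "Z r \<in> borel_measurable M" if "r \<in> I" for r using Z[OF that] by (rule rep_measurable)
 have ZM[measurable]: "(\<lambda>w. \<lambda>r\<in>I. Z r w) \<in> measurable M (PiM I (\<lambda>_. borel))"
  using Zm by (rule measurable_restrict)
 \<comment> \<open>The vanishing cross covariance makes the joint characteristic function of
   \<open>X\<close> and any finite combination a product; \<open>om\<close> may depend on the
   combination but not on \<open>x\<close> and \<open>y\<close>.\<close>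
 have CS: "\<exists>om. \<forall>x y. (LINT w|M. cos (x * X w + y * (\<Sum>j\<in>J. c j * Z j w))) = exp (- (x^2 * v + y^2 * om) / 2) \<and>
   (LINT w|M. sin (x * X w + y * (\<Sum>j\<in>J. c j * Z j w))) = 0"
  if J: "finite J" "J \<subseteq> I" for J c
 proof -
  let ?a = "\<Sum>j\<in>J. c j * b j" and ?f = "\<lambda>x. \<Sum>j\<in>J. c j * \<zeta> j x" and ?g = "\<lambda>x. \<Sum>j\<in>J. c j * \<eta> j x"
  have S: "rep (\<lambda>w. \<Sum>j\<in>J. c j * Z j w) ?a ?f ?g" using J Z by (intro rep_sum) auto
  have cv: "convergent (\<lambda>n. qn n ?a ?f ?g ?a ?f ?g)"
  proof -
   have "convergent (\<lambda>n. \<Sum>i\<in>J. c i * (\<Sum>j\<in>J. c j * qn n (b j) (\<zeta> j) (\<eta> j) (b i) (\<zeta> i) (\<eta> i)))"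
    using J qZ by (intro convergent_sum convergent_mult convergent_const) auto
   moreover have "qn n ?a ?f ?g ?a ?f ?g = (\<Sum>i\<in>J. c i * (\<Sum>j\<in>J. c j * qn n (b j) (\<zeta> j) (\<eta> j) (b i) (\<zeta> i) (\<eta> i)))" for n
    by (subst qn_sum, subst qn_commute, subst qn_sum) (simp add: qn_commute)
   ultimately show ?thesis by simp
  qed
  then obtain om where om: "qlim ?a ?f ?g ?a ?f ?g om" by (auto simp: convergent_def)
  have q0': "qlim ?a ?f ?g a \<phi> \<psi> 0"
  proof -
   have "(\<lambda>n. \<Sum>j\<in>J. c j * qn n (b j) (\<zeta> j) (\<eta> j) a \<phi> \<psi>) \<longlonglongrightarrow> (\<Sum>j\<in>J. c j * 0)"
    using J q0 by (intro tendsto_sum tendsto_mult tendsto_const) (auto simp: qn_commute[of _ _ _ _ a])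
   then show ?thesis unfolding qn_sum by simp
  qed
  have "(LINT w|M. cos (x * X w + y * (\<Sum>j\<in>J. c j * Z j w))) = exp (- (x^2 * v + y^2 * om) / 2) \<and>
   (LINT w|M. sin (x * X w + y * (\<Sum>j\<in>J. c j * Z j w))) = 0" for x y
  proof -
   let ?A = "x * a + y * ?a" and ?F = "\<lambda>z. x * \<phi> z + y * ?f z" and ?G = "\<lambda>z. x * \<psi> z + y * ?g z"
   have r: "rep (\<lambda>w. x * X w + y * (\<Sum>j\<in>J. c j * Z j w)) ?A ?F ?G"
    by (rule rep_lin[OF X S])
   have "(\<lambda>n. x * (x * qn n a \<phi> \<psi> a \<phi> \<psi> + y * qn n ?a ?f ?g a \<phi> \<psi>) + y * (x * qn n ?a ?f ?g a \<phi> \<psi> + y * qn n ?a ?f ?g ?a ?f ?g))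
     \<longlonglongrightarrow> x * (x * v + y * 0) + y * (x * 0 + y * om)"
    by (intro tendsto_intros qX q0' om)
   moreover have "qn n ?A ?F ?G ?A ?F ?G = x * (x * qn n a \<phi> \<psi> a \<phi> \<psi> + y * qn n ?a ?f ?g a \<phi> \<psi>) + y * (x * qn n ?a ?f ?g a \<phi> \<psi> + y * qn n ?a ?f ?g ?a ?f ?g)" for n
   proof -
    have "qn n ?A ?F ?G ?A ?F ?G = x * qn n a \<phi> \<psi> ?A ?F ?G + y * qn n ?a ?f ?g ?A ?F ?G" by (rule qn_lin)
    also have "qn n a \<phi> \<psi> ?A ?F ?G = x * qn n a \<phi> \<psi> a \<phi> \<psi> + y * qn n ?a ?f ?g a \<phi> \<psi>"
     by (subst qn_commute) (rule qn_lin)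
    also have "qn n ?a ?f ?g ?A ?F ?G = x * qn n a \<phi> \<psi> ?a ?f ?g + y * qn n ?a ?f ?g ?a ?f ?g"
     by (subst qn_commute) (rule qn_lin)
    also have "qn n a \<phi> \<psi> ?a ?f ?g = qn n ?a ?f ?g a \<phi> \<psi>" by (rule qn_commute)
    finally show ?thesis .
   qed
   ultimately have "qlim ?A ?F ?G ?A ?F ?G (x * (x * v + y * 0) + y * (x * 0 + y * om))" by (simp only:)
   also have "x * (x * v + y * 0) + y * (x * 0 + y * om) = x^2 * v + y^2 * om" by (simp add: power2_eq_square)
   finally have "qlim ?A ?F ?G ?A ?F ?G (x^2 * v + y^2 * om)" .
   from rep_cos_sin[OF r this] show ?thesis by simp
  qed
  then show ?thesis by blast
 qed
 define C where "C x = exp (- (x^2 * v) / 2)" for x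
 have CX: "(LINT w|M. cos (x * X w)) = C x" "(LINT w|M. sin (x * X w)) = 0" for x
 proof -
  obtain om where "\<forall>x y. (LINT w|M. cos (x * X w + y * (\<Sum>j\<in>{}. 0 * Z j w))) = exp (- (x^2 * v + y^2 * om) / 2) \<and>
   (LINT w|M. sin (x * X w + y * (\<Sum>j\<in>{}. 0 * Z j w))) = 0"
   using CS[of "{}" "\<lambda>_. 0"] by auto
  from this[rule_format, of x 0]
  show "(LINT w|M. cos (x * X w)) = C x" "(LINT w|M. sin (x * X w)) = 0" by (simp_all add: C_def)
 qed
 have ib: "integrable M f" if "f \<in> borel_measurable M" "\<And>x. \<bar>f x\<bar> \<le> 1" for f :: "'a \<Rightarrow> real"
  by (rule integrable_const_bound[where B=1]) (use that in auto)
 \<comment> \<open>Centring the cosine by its mean \<open>C x\<close> makes all weighted Fourier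
   integrals vanish; the sine has mean 0 already.\<close>
 have A1: "(LINT w|M. (cos (x * X w) - C x) * indicator A (\<lambda>r\<in>I. Z r w)) = 0"
 and A2: "(LINT w|M. sin (x * X w) * indicator A (\<lambda>r\<in>I. Z r w)) = 0" if A: "A \<in> sets (PiM I (\<lambda>_. borel))" for A x
 proof -
  have *: "(LINT w|M. (cos (x * X w) - C x) * cos (\<Sum>j\<in>J. c j * Z j w)) = 0 \<and>
   (LINT w|M. (cos (x * X w) - C x) * sin (\<Sum>j\<in>J. c j * Z j w)) = 0 \<and>
   (LINT w|M. sin (x * X w) * cos (\<Sum>j\<in>J. c j * Z j w)) = 0 \<and>
   (LINT w|M. sin (x * X w) * sin (\<Sum>j\<in>J. c j * Z j w)) = 0"
   if J: "finite J" "J \<subseteq> I" for J c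
  proof -
   define S where "S w = (\<Sum>j\<in>J. c j * Z j w)" for w
   have [measurable]: "S \<in> borel_measurable M" unfolding S_def using J Zm by (intro borel_measurable_sum borel_measurable_times) auto
   obtain om where om: "\<And>x y. (LINT w|M. cos (x * X w + y * S w)) = exp (- (x^2 * v + y^2 * om) / 2)"
    "\<And>x y. (LINT w|M. sin (x * X w + y * S w)) = 0" using CS[OF J, of c] unfolding S_def by blast
   have i: "integrable M (\<lambda>w. cos (x * X w + S w))" "integrable M (\<lambda>w. cos (x * X w - S w))"
    "integrable M (\<lambda>w. sin (x * X w + S w))" "integrable M (\<lambda>w. sin (x * X w - S w))"
    "integrable M (\<lambda>w. cos (S w))" "integrable M (\<lambda>w. sin (S w))"
    by (rule ib; simp)+
   have e: "exp (- (x^2 * v + om) / 2) = C x * exp (- om / 2)" by (simp add: C_def exp_add[symmetric] field_simps)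
   have E: "(LINT w|M. cos (x * X w + S w)) = C x * exp (- om / 2)" "(LINT w|M. cos (x * X w - S w)) = C x * exp (- om / 2)"
    "(LINT w|M. sin (x * X w + S w)) = 0" "(LINT w|M. sin (x * X w - S w)) = 0"
    "(LINT w|M. cos (S w)) = exp (- om / 2)" "(LINT w|M. sin (S w)) = 0"
    using om(1)[of x 1] om(1)[of x "-1"] om(2)[of x 1] om(2)[of x "-1"] om(1)[of 0 1] om(2)[of 0 1] e by simp_all
   have cc: "(cos (x * X w) - C x) * cos (S w) = (cos (x * X w + S w) + cos (x * X w - S w)) / 2 - C x * cos (S w)" for w
    by (simp add: cos_add cos_diff algebra_simps)
   have cs: "(cos (x * X w) - C x) * sin (S w) = (sin (x * X w + S w) - sin (x * X w - S w)) / 2 - C x * sin (S w)" for w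
    by (simp add: sin_add sin_diff algebra_simps)
   have sc: "sin (x * X w) * cos (S w) = (sin (x * X w + S w) + sin (x * X w - S w)) / 2" for w
    by (simp add: sin_add sin_diff algebra_simps)
   have ss: "sin (x * X w) * sin (S w) = (cos (x * X w - S w) - cos (x * X w + S w)) / 2" for w
    by (simp add: cos_add cos_diff algebra_simps)
   show ?thesis unfolding S_def[symmetric] cc cs sc ss using i E by simp
  qed
  show "(LINT w|M. (cos (x * X w) - C x) * indicator A (\<lambda>r\<in>I. Z r w)) = 0"
  proof (rule fourier_zero[OF _ Zm _ _ A])
   show "integrable M (\<lambda>w. cos (x * X w) - C x)" using ib[of "\<lambda>w. cos (x * X w)"] by simp
  qed (use * in auto)
  show "(LINT w|M. sin (x * X w) * indicator A (\<lambda>r\<in>I. Z r w)) = 0"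
  proof (rule fourier_zero[OF _ Zm _ _ A])
   show "integrable M (\<lambda>w. sin (x * X w))" by (intro ib) auto
  qed (use * in auto)
 qed
 show ?thesis
 proof (rule indep_pairI[OF Xm ZM])
  fix E :: "real set" and A :: "('i \<Rightarrow> real) set" assume E[measurable]: "E \<in> sets borel" and A[measurable]: "A \<in> sets (PiM I (\<lambda>_. borel))"
  define F where "F = (\<lambda>w. \<lambda>r\<in>I. Z r w) -` A \<inter> space M"
  have F[measurable]: "F \<in> events" unfolding F_def by measurable
  have indF: "indicator A (\<lambda>r\<in>I. Z r w) = (indicator F w :: real)" if "w \<in> space M" for w
   using that by (auto simp: F_def indicator_def)
  have iF: "integrable M (\<lambda>w. indicator F w :: real)" by (rule ib) (auto simp: indicator_def)
  have EF: "(LINT w|M. indicator F w) = prob F" by (simp add: F)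
  have "(LINT w|M. (indicator F w - prob F) * indicator E (X w)) = 0"
  proof (rule fourier_zero_1d[OF _ Xm _ _ E])
   show "integrable M (\<lambda>w. indicator F w - prob F)" using iF by simp
   fix x
   have ii: "integrable M (\<lambda>w. cos (x * X w) * indicator F w)" "integrable M (\<lambda>w. sin (x * X w) * indicator F w)"
    "integrable M (\<lambda>w. cos (x * X w))" "integrable M (\<lambda>w. sin (x * X w))"
    by (rule ib; auto simp: indicator_def)+
   have "(LINT w|M. (cos (x * X w) - C x) * indicator F w) = 0"
    using A1[OF A, of x] by (simp add: indF cong: Bochner_Integration.integral_cong)
   then have "(LINT w|M. cos (x * X w) * indicator F w) = C x * prob F"
    using ii iF EF by (simp add: left_diff_distrib)
   moreover have "(LINT w|M. (indicator F w - prob F) * cos (x * X w)) = (LINT w|M. cos (x * X w) * indicator F w - prob F * cos (x * X w))"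
    by (intro Bochner_Integration.integral_cong) (simp_all add: algebra_simps)
   ultimately show "(LINT w|M. (indicator F w - prob F) * cos (x * X w)) = 0"
    using ii CX[of x] by simp
   have "(LINT w|M. sin (x * X w) * indicator F w) = 0"
    using A2[OF A, of x] by (simp add: indF cong: Bochner_Integration.integral_cong)
   moreover have "(LINT w|M. (indicator F w - prob F) * sin (x * X w)) = (LINT w|M. sin (x * X w) * indicator F w - prob F * sin (x * X w))"
    by (intro Bochner_Integration.integral_cong) (simp_all add: algebra_simps)
   ultimately show "(LINT w|M. (indicator F w - prob F) * sin (x * X w)) = 0"
    using ii CX[of x] by simp
  qed
  moreover have "(indicator F w - prob F) * indicator E (X w) = indicator ((X -` E \<inter> space M) \<inter> F) w - prob F * indicator (X -` E \<inter> space M) w"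
   if "w \<in> space M" for w using that by (auto simp: indicator_def)
  ultimately have "(LINT w|M. indicator ((X -` E \<inter> space M) \<inter> F) w - prob F * indicator (X -` E \<inter> space M) w) = 0"
   by (simp cong: Bochner_Integration.integral_cong)
  moreover have "X -` E \<inter> space M \<in> events" by measurable
  ultimately have "prob ((X -` E \<inter> space M) \<inter> F) = prob (X -` E \<inter> space M) * prob F"
   by (subst (asm) Bochner_Integration.integral_diff) (auto simp: emeasure_eq_measure mult.commute)
  then show "prob ((X -` E \<inter> space M) \<inter> ((\<lambda>w. \<lambda>r\<in>I. Z r w) -` A \<inter> space M)) =
   prob (X -` E \<inter> space M) * prob ((\<lambda>w. \<lambda>r\<in>I. Z r w) -` A \<inter> space M)" by (simp add: F_def)
 qed
qed

definition sig :: "real set \<Rightarrow> 'a \<Rightarrow> real \<times> (real \<Rightarrow> real)" where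
 "sig J w = (v0 w, path B J w)"

lemma sig_measurable[measurable]: "J \<subseteq> {0..} \<Longrightarrow> sig J \<in> measurable M (sigs J)"
 unfolding sig_def[abs_def] by measurable

text \<open>The three generating sigma-algebras are grouped into the blocks \<open>{0, 1}\<close>
  and \<open>{2}\<close>, so that the initial value and the thermal noise form one random
  element.\<close>

lemma indep_sig_Bm: "indep_pair M (sigs {0..}) (sig {0..}) (path_space {0..}) (path Bm {0..})"
proof -
 let ?E = "\<lambda>j. [sets (vimage_algebra (space M) v0 borel), sets (vimage_algebra (space M) (path B {0..}) (path_space {0..})),
     sets (vimage_algebra (space M) (path Bm {0..}) (path_space {0..}))] ! j"
 let ?I = "\<lambda>b. if b then {0::nat, 1} else {2}"
 have "indep_sets (\<lambda>j. sigma_sets (space M) (\<Union>i\<in>?I j. ?E i)) (UNIV :: bool set)"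
 proof (rule indep_sets_collect_sigma)
  have "(\<Union>j\<in>(UNIV :: bool set). ?I j) = {..<3}" by (auto simp: UNIV_bool)
  then show "indep_sets ?E (\<Union>j\<in>(UNIV :: bool set). ?I j)" using indep unfolding indep_drivers_def by simp
  show "\<And>i j. j \<in> UNIV \<Longrightarrow> i \<in> ?I j \<Longrightarrow> Int_stable (?E i)" by (auto simp: sets.Int_stable split: if_splits)
 qed (auto simp: disjoint_family_on_def)
 then have I: "indep_sets (\<lambda>j. sigma_sets (space M) (\<Union>i\<in>?I j. ?E i)) {True, False}"
  by (simp add: UNIV_bool insert_commute)
 have "prob (a \<inter> b) = prob a * prob b"
  if "a \<in> sigma_sets (space M) (\<Union>i\<in>{0,1}. ?E i)" "b \<in> sigma_sets (space M) (\<Union>i\<in>{2}. ?E i)" for a b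
  using indep_setsD[OF I, of "{True, False}" "\<lambda>j. if j then a else b"] that by (simp add: Int_commute)
 note * = this
 show ?thesis
 proof (rule indep_pairI)
  fix A :: "(real \<times> (real \<Rightarrow> real)) set" and C :: "(real \<Rightarrow> real) set"
  assume A: "A \<in> sets (sigs {0..})" and C: "C \<in> sets (path_space {0..})"
  show "prob ((sig {0..} -` A \<inter> space M) \<inter> (path Bm {0..} -` C \<inter> space M)) = prob (sig {0..} -` A \<inter> space M) * prob (path Bm {0..} -` C \<inter> space M)"
  proof (rule *)
   have "path Bm {0..} -` C \<inter> space M \<in> sets (vimage_algebra (space M) (path Bm {0..}) (path_space {0..}))"
    using C by (rule in_vimage_algebra)
   then show "path Bm {0..} -` C \<inter> space M \<in> sigma_sets (space M) (\<Union>i\<in>{2}. ?E i)" by auto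
   let ?N = "sigma (space M) (\<Union>i\<in>{0,1}. ?E i)"
   have pw: "(\<Union>i\<in>{0,1}. ?E i) \<subseteq> Pow (space M)" using sets.sets_into_space by fastforce
   have "v0 \<in> borel_measurable ?N"
   proof (rule measurableI)
    fix D :: "real set" assume "D \<in> sets borel"
    then have "v0 -` D \<inter> space M \<in> ?E 0" by (simp add: in_vimage_algebra)
    then show "v0 -` D \<inter> space ?N \<in> sets ?N" using pw by auto
   qed simp
   moreover have "path B {0..} \<in> measurable ?N (path_space {0..})"
   proof (rule measurableI)
    fix D assume "D \<in> sets (path_space {0..})"
    then have "path B {0..} -` D \<inter> space M \<in> ?E 1" by (simp add: in_vimage_algebra)
    then show "path B {0..} -` D \<inter> space ?N \<in> sets ?N" using pw by auto
   qed (use measurable_space[OF path_measurable(1)[of "{0..}"]] pw in auto)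
   ultimately have "sig {0..} \<in> measurable ?N (sigs {0..})" unfolding sig_def[abs_def] by measurable
   from measurable_sets[OF this A] show "sig {0..} -` A \<inter> space M \<in> sigma_sets (space M) (\<Union>i\<in>{0,1}. ?E i)"
    using pw by simp
  qed
 qed auto
qed

end

section \<open>The Riccati equation\<close>

text \<open>The substitution \<open>P = V * (w' / w - 1 / \<tau>)\<close> linearises the equation to
  \<open>w'' = g^2 * w\<close>. Positive initial data keep \<open>w\<close> positive for all
  \<open>t \<ge> 0\<close>, so the solution is global.\<close>

lemma riccati_exists:
 fixes \<tau> \<beta> V :: real
 assumes "\<tau> > 0" "\<beta> > 0" "V > 0"
 shows "\<exists>P. P 0 = \<beta>^2 * \<tau> / 2 \<and>
  (\<forall>t\<ge>0. (P has_real_derivative (- 2 * P t / \<tau> + \<beta>^2 - (P t)^2 / V)) (at t within {0..}))"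
proof -
 define g where "g = sqrt (1 / \<tau>^2 + \<beta>^2 / V)"
 have g: "g > 0" "g^2 = 1 / \<tau>^2 + \<beta>^2 / V" using assms by (auto simp: g_def intro!: add_pos_pos)
 \<comment> \<open>The initial slope of \<open>w\<close> for which \<open>P 0\<close> is the
   stationary variance.\<close>
 define y0 where "y0 = \<beta>^2 * \<tau> / 2 / V + 1 / \<tau>"
 have y0: "y0 > 0" using assms by (auto simp: y0_def intro!: add_pos_pos)
 define w where "w t = cosh (g * t) + y0 / g * sinh (g * t)" for t
 define w' where "w' t = g * sinh (g * t) + y0 * cosh (g * t)" for t
 have w: "(w has_real_derivative w' t) (at t within {0..})" for t
  unfolding w_def[abs_def] w'_def using g by (auto intro!: derivative_eq_intros simp: field_simps)
 have w'': "(w' has_real_derivative g^2 * w t) (at t within {0..})" for t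
  unfolding w_def w'_def[abs_def] using g(1) by (auto intro!: derivative_eq_intros simp: field_simps power2_eq_square)
 have pos: "w t > 0" if "t \<ge> 0" for t
  unfolding w_def using that g y0 by (intro add_pos_nonneg) (auto simp: cosh_real_pos)
 define P where "P t = V * (w' t / w t - 1 / \<tau>)" for t
 show ?thesis
 proof (intro exI[of _ P] conjI allI impI)
  show "P 0 = \<beta>^2 * \<tau> / 2" using assms by (simp add: P_def w_def w'_def y0_def)
  fix t :: real assume t: "t \<ge> 0"
  have wt: "w t \<noteq> 0" using pos[OF t] by simp
  have "(P has_real_derivative V * ((g^2 * w t * w t - w' t * w' t) / (w t * w t))) (at t within {0..})"
   unfolding P_def[abs_def] using wt by (auto intro!: derivative_eq_intros w w'')
  also have "V * ((g^2 * w t * w t - w' t * w' t) / (w t * w t)) = V * (g^2 - (w' t / w t)^2)"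
   using wt by (simp add: diff_divide_distrib power2_eq_square)
  also have "... = - 2 * P t / \<tau> + \<beta>^2 - (P t)^2 / V"
  proof -
   define y where "y = w' t / w t"
   show ?thesis unfolding g(2) P_def y_def[symmetric] using assms by (simp add: field_simps power2_eq_square)
  qed
  finally show "(P has_real_derivative (- 2 * P t / \<tau> + \<beta>^2 - (P t)^2 / V)) (at t within {0..})" .
 qed
qed

lemma integral_FTC:
 fixes F f :: "real \<Rightarrow> real"
 assumes "a \<le> b" "\<And>x. x \<in> {a..b} \<Longrightarrow> (F has_real_derivative f x) (at x within {a..b})"
 shows "integral {a..b} f = F b - F a"
 using assms by (intro integral_unique fundamental_theorem_of_calculus)
  (auto simp: has_real_derivative_iff_has_vector_derivative)

section \<open>The Kalman-Bucy filter\<close>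

text \<open>The Ornstein-Uhlenbeck signal by variation of constants, with initial value
  \<open>fst \<theta>\<close> and driving path \<open>snd \<theta>\<close>. The \<open>lim\<close>
  makes it a total measurable function of the path up to \<open>t\<close>.\<close>

definition ou :: "real \<Rightarrow> real \<Rightarrow> real \<Rightarrow> real \<times> (real \<Rightarrow> real) \<Rightarrow> real" where
 "ou \<tau> \<beta> t \<theta> = exp (- t / \<tau>) * fst \<theta> + \<beta> * lim (\<lambda>n. wsum n (cut t (\<lambda>s. exp (- (t - s) / \<tau>))) (snd \<theta>))"

locale kalman =
 fixes \<tau> \<beta> V :: real and P :: "real \<Rightarrow> real"
 assumes \<tau>: "\<tau> > 0" and \<beta>: "\<beta> > 0" and V: "V > 0"
  and P0: "P 0 = \<beta>^2 * \<tau> / 2"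
  and P_ode: "\<And>t. t \<ge> 0 \<Longrightarrow> (P has_real_derivative (- 2 * P t / \<tau> + \<beta>^2 - (P t)^2 / V)) (at t within {0..})"
begin

definition "dP t = - 2 * P t / \<tau> + \<beta>^2 - (P t)^2 / V"
definition "decay t = 1 / \<tau> + P t / V"
definition "gain t = P t / sqrt V"
text \<open>Propagator of the filter error from \<open>s\<close> to \<open>t\<close>, with
  \<open>decay\<close> as its rate. \<open>\<kappa> t s\<close> is the weight that the filter at
  \<open>t\<close> gives to the observation increment at \<open>s\<close>, and
  \<open>\<kappa>'\<close> is its derivative in \<open>s\<close>.\<close>

definition "\<Phi> t s = exp (integral {0..s} decay - integral {0..t} decay)"
definition "\<kappa> t s = \<Phi> t s * gain s"
definition "\<kappa>' t s = \<Phi> t s * (decay s * gain s + dP s / sqrt V)"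

lemma P_deriv: "0 \<le> s \<Longrightarrow> S \<subseteq> {0..} \<Longrightarrow> (P has_real_derivative dP s) (at s within S)"
 using P_ode[of s] unfolding dP_def by (rule DERIV_subset)

lemma P_cont: "continuous_on {0..} P"
 by (rule DERIV_continuous_on) (use P_deriv in auto)

lemma cont_on_nonneg: "S \<subseteq> {0..} \<Longrightarrow> continuous_on S P"
 using P_cont continuous_on_subset by blast

lemma decay_cont: "S \<subseteq> {0..} \<Longrightarrow> continuous_on S decay"
 unfolding decay_def[abs_def] using V by (intro continuous_intros cont_on_nonneg) auto

lemma gain_cont: "S \<subseteq> {0..} \<Longrightarrow> continuous_on S gain"
 unfolding gain_def[abs_def] using V by (intro continuous_intros cont_on_nonneg) auto

lemma dP_cont: "S \<subseteq> {0..} \<Longrightarrow> continuous_on S dP"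
 unfolding dP_def[abs_def] using V \<tau> by (intro continuous_intros cont_on_nonneg) auto

lemma gain_deriv: "0 \<le> s \<Longrightarrow> S \<subseteq> {0..} \<Longrightarrow> (gain has_real_derivative dP s / sqrt V) (at s within S)"
 unfolding gain_def[abs_def] by (rule DERIV_cdivide[OF P_deriv])

lemma decay_P: "decay s * P s = \<beta>^2 - P s / \<tau> - dP s"
 by (simp add: decay_def dP_def power2_eq_square algebra_simps)

lemma \<Phi>_deriv: "s \<in> {0..t} \<Longrightarrow> (\<Phi> t' has_real_derivative decay s * \<Phi> t' s) (at s within {0..t})"
proof -
 assume s: "s \<in> {0..t}"
 have "((\<lambda>s. integral {0..s} decay) has_real_derivative decay s) (at s within {0..t})"
  by (rule integral_has_real_derivative[OF decay_cont s]) auto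
 then show ?thesis unfolding \<Phi>_def[abs_def] by (auto intro!: derivative_eq_intros)
qed

lemma \<Phi>_cont: "continuous_on {0..t} (\<Phi> t')"
 by (rule DERIV_continuous_on[OF \<Phi>_deriv])

lemma \<Phi>_refl [simp]: "\<Phi> t t = 1"
 by (simp add: \<Phi>_def)

lemma \<Phi>_pos: "\<Phi> t s > 0"
 by (simp add: \<Phi>_def)

lemma \<kappa>_deriv: "s \<in> {0..t} \<Longrightarrow> (\<kappa> t' has_real_derivative \<kappa>' t' s) (at s within {0..t})"
 unfolding \<kappa>_def[abs_def] \<kappa>'_def
 by (rule DERIV_cong[OF DERIV_mult[OF \<Phi>_deriv gain_deriv]]) (auto simp: algebra_simps)

lemma \<kappa>'_cont: "continuous_on {0..t} (\<kappa>' t')"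
 unfolding \<kappa>'_def[abs_def] using V
 by (intro continuous_intros \<Phi>_cont decay_cont gain_cont dP_cont) auto

lemma \<kappa>_cont: "continuous_on {0..t} (\<kappa> t')"
 by (rule DERIV_continuous_on[OF \<kappa>_deriv])

text \<open>By the Riccati equation, \<open>\<Phi> t q * P q * exp (- (t - q) / \<tau>)\<close> is
  an antiderivative in \<open>q\<close>. The left side is the covariance of the filter error with
  the signal at \<open>t\<close>: the share of the initial value, then that of the thermal
  noise.\<close>

lemma cov_error_signal:
 assumes "0 \<le> t"
 shows "\<Phi> t 0 * exp (- t / \<tau>) * P 0 + integral {0..t} (\<lambda>q. \<beta> * \<Phi> t q * (\<beta> * exp (- (t - q) / \<tau>))) = P t"
proof -
 have "integral {0..t} (\<lambda>q. \<beta> * \<Phi> t q * (\<beta> * exp (- (t - q) / \<tau>)))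
  = \<Phi> t t * P t * exp (- (t - t) / \<tau>) - \<Phi> t 0 * P 0 * exp (- (t - 0) / \<tau>)"
  using assms
 proof (rule integral_FTC)
  fix q assume q: "q \<in> {0..t}"
  show "((\<lambda>q. \<Phi> t q * P q * exp (- (t - q) / \<tau>)) has_real_derivative \<beta> * \<Phi> t q * (\<beta> * exp (- (t - q) / \<tau>))) (at q within {0..t})"
  proof (rule DERIV_cong)
   let ?e = "exp (- (t - q) / \<tau>)"
   show "((\<lambda>q. \<Phi> t q * P q * exp (- (t - q) / \<tau>)) has_real_derivative
     (decay q * \<Phi> t q * P q + \<Phi> t q * dP q) * ?e + \<Phi> t q * P q * (?e * (1 / \<tau>))) (at q within {0..t})"
    using q \<tau> by (auto intro!: derivative_eq_intros \<Phi>_deriv P_deriv simp: algebra_simps)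
   have "(decay q * \<Phi> t q * P q + \<Phi> t q * dP q) * ?e + \<Phi> t q * P q * (?e * (1 / \<tau>)) = \<Phi> t q * ?e * (decay q * P q + dP q + P q / \<tau>)"
    by (simp add: algebra_simps)
   then show "(decay q * \<Phi> t q * P q + \<Phi> t q * dP q) * ?e + \<Phi> t q * P q * (?e * (1 / \<tau>)) = \<beta> * \<Phi> t q * (\<beta> * ?e)"
    unfolding decay_P by (simp add: power2_eq_square)
  qed
 qed
 then show ?thesis by (simp add: mult.commute mult.left_commute)
qed

text \<open>The covariance of the error at \<open>t\<close> with an observation at
  \<open>r \<le> t\<close>. The antiderivative carries the factor
  \<open>1 - exp (- (r - q) / \<tau>)\<close>, which vanishes at \<open>q = r\<close>, so its lower
  boundary term alone remains and cancels the share of the initial value.\<close>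

lemma cov_error_observation:
 assumes "0 \<le> r" "r \<le> t"
 shows "\<Phi> t 0 * (\<tau> / sqrt V * (1 - exp (- r / \<tau>))) * P 0
  + integral {0..r} (\<lambda>q. \<beta> * \<Phi> t q * (\<tau> * \<beta> / sqrt V * (1 - exp (- (r - q) / \<tau>)))) - integral {0..r} (\<lambda>q. \<kappa> t q) = 0"
proof -
 have c: "continuous_on {0..r} (\<Phi> t)" "continuous_on {0..r} (\<kappa> t)" by (rule \<Phi>_cont \<kappa>_cont)+
 have "integral {0..r} (\<lambda>q. \<beta> * \<Phi> t q * (\<tau> * \<beta> / sqrt V * (1 - exp (- (r - q) / \<tau>)))) - integral {0..r} (\<lambda>q. \<kappa> t q)
  = integral {0..r} (\<lambda>q. \<beta> * \<Phi> t q * (\<tau> * \<beta> / sqrt V * (1 - exp (- (r - q) / \<tau>))) - \<kappa> t q)"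
  using c V \<tau> by (intro hk_integral_diff[symmetric] integrable_continuous_interval continuous_intros) auto
 also have "... = \<tau> / sqrt V * \<Phi> t r * P r * (1 - exp (- (r - r) / \<tau>)) - \<tau> / sqrt V * \<Phi> t 0 * P 0 * (1 - exp (- (r - 0) / \<tau>))"
  using assms(1)
 proof (rule integral_FTC)
  fix q assume q: "q \<in> {0..r}"
  show "((\<lambda>q. \<tau> / sqrt V * \<Phi> t q * P q * (1 - exp (- (r - q) / \<tau>))) has_real_derivative
    \<beta> * \<Phi> t q * (\<tau> * \<beta> / sqrt V * (1 - exp (- (r - q) / \<tau>))) - \<kappa> t q) (at q within {0..r})"
  proof (rule DERIV_cong)
   let ?e = "exp (- (r - q) / \<tau>)" and ?c = "\<tau> / sqrt V"
   show "((\<lambda>q. ?c * \<Phi> t q * P q * (1 - exp (- (r - q) / \<tau>))) has_real_derivative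
     ?c * ((decay q * \<Phi> t q * P q + \<Phi> t q * dP q) * (1 - ?e) - \<Phi> t q * P q * (?e * (1 / \<tau>)))) (at q within {0..r})"
   proof -
    have "((\<lambda>q. \<Phi> t q * P q * (1 - exp (- (r - q) / \<tau>))) has_real_derivative
     (decay q * \<Phi> t q * P q + \<Phi> t q * dP q) * (1 - ?e) - \<Phi> t q * P q * (?e * (1 / \<tau>))) (at q within {0..r})"
     using q \<tau> by (auto intro!: derivative_eq_intros \<Phi>_deriv P_deriv simp: algebra_simps)
    from DERIV_cmult[OF this, of ?c] show ?thesis by (simp only: mult.assoc)
   qed
   have "(decay q * \<Phi> t q * P q + \<Phi> t q * dP q) * (1 - ?e) - \<Phi> t q * P q * (?e * (1 / \<tau>))
    = \<Phi> t q * ((decay q * P q + dP q) * (1 - ?e) - P q / \<tau> * ?e)"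
    by (simp add: algebra_simps)
   also have "... = \<Phi> t q * (\<beta>^2 * (1 - ?e) - P q / \<tau>)" unfolding decay_P by (simp add: algebra_simps)
   finally have *: "(decay q * \<Phi> t q * P q + \<Phi> t q * dP q) * (1 - ?e) - \<Phi> t q * P q * (?e * (1 / \<tau>))
    = \<Phi> t q * (\<beta>^2 * (1 - ?e) - P q / \<tau>)" .
   show "?c * ((decay q * \<Phi> t q * P q + \<Phi> t q * dP q) * (1 - ?e) - \<Phi> t q * P q * (?e * (1 / \<tau>)))
    = \<beta> * \<Phi> t q * (\<tau> * \<beta> / sqrt V * (1 - ?e)) - \<kappa> t q"
   proof -
    define c where "c = sqrt V"
    have "c > 0" using V by (simp add: c_def)
    then show ?thesis unfolding * \<kappa>_def gain_def c_def[symmetric] using \<tau> by (simp add: field_simps power2_eq_square)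
   qed
  qed
 qed
 also have "... = - (\<Phi> t 0 * (\<tau> / sqrt V * (1 - exp (- r / \<tau>))) * P 0)" by simp
 finally show ?thesis by linarith
qed

text \<open>\<open>(\<Phi> t q)^2 * P q\<close> is an antiderivative of the two noise contributions,
  and it equals \<open>P t\<close> at \<open>q = t\<close>.\<close>

lemma var_error:
 assumes "0 \<le> t"
 shows "(\<Phi> t 0)^2 * P 0 + integral {0..t} (\<lambda>q. (\<beta> * \<Phi> t q)^2) + integral {0..t} (\<lambda>q. (\<kappa> t q)^2) = P t"
proof -
 have c: "continuous_on {0..t} (\<Phi> t)" "continuous_on {0..t} (\<kappa> t)" by (rule \<Phi>_cont \<kappa>_cont)+
 have "integral {0..t} (\<lambda>q. (\<beta> * \<Phi> t q)^2) + integral {0..t} (\<lambda>q. (\<kappa> t q)^2) = integral {0..t} (\<lambda>q. (\<beta> * \<Phi> t q)^2 + (\<kappa> t q)^2)"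
  using c by (intro hk_integral_add[symmetric] integrable_continuous_interval continuous_intros)
 also have "... = (\<Phi> t t)^2 * P t - (\<Phi> t 0)^2 * P 0"
  using assms
 proof (rule integral_FTC)
  fix q assume q: "q \<in> {0..t}"
  show "((\<lambda>q. (\<Phi> t q)^2 * P q) has_real_derivative (\<beta> * \<Phi> t q)^2 + (\<kappa> t q)^2) (at q within {0..t})"
  proof (rule DERIV_cong)
   show "((\<lambda>q. (\<Phi> t q)^2 * P q) has_real_derivative 2 * (\<Phi> t q * (decay q * \<Phi> t q)) * P q + (\<Phi> t q)^2 * dP q) (at q within {0..t})"
    using q by (auto intro!: derivative_eq_intros \<Phi>_deriv P_deriv)
   have "2 * (\<Phi> t q * (decay q * \<Phi> t q)) * P q + (\<Phi> t q)^2 * dP q = (\<Phi> t q)^2 * (2 * (decay q * P q) + dP q)"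
    by (simp add: algebra_simps power2_eq_square)
   also have "2 * (decay q * P q) + dP q = \<beta>^2 + (P q)^2 / V"
    by (simp add: decay_def dP_def algebra_simps power2_eq_square)
   also have "(\<Phi> t q)^2 * (\<beta>^2 + (P q)^2 / V) = (\<beta> * \<Phi> t q)^2 + (\<kappa> t q)^2"
    using V by (simp add: \<kappa>_def gain_def power_mult_distrib power_divide algebra_simps)
   finally show "2 * (\<Phi> t q * (decay q * \<Phi> t q)) * P q + (\<Phi> t q)^2 * dP q = (\<beta> * \<Phi> t q)^2 + (\<kappa> t q)^2" .
  qed
 qed
 finally show ?thesis by simp
qed

text \<open>Read off from the variance identity: all summands are nonnegative and the one of the
  initial value is positive.\<close>

lemma P_pos: "0 \<le> t \<Longrightarrow> P t > 0"
proof -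
 assume t: "0 \<le> t"
 have c: "continuous_on {0..t} (\<Phi> t)" "continuous_on {0..t} (\<kappa> t)" by (rule \<Phi>_cont \<kappa>_cont)+
 have "(\<Phi> t 0)^2 * P 0 > 0" using \<Phi>_pos[of t 0] \<beta> \<tau> by (simp add: P0)
 moreover have "integral {0..t} (\<lambda>q. (\<beta> * \<Phi> t q)^2) \<ge> 0" "integral {0..t} (\<lambda>q. (\<kappa> t q)^2) \<ge> 0"
  using c by (auto intro!: hk_integral_nonneg integrable_continuous_interval continuous_intros)
 ultimately show ?thesis using var_error[OF t] by linarith
qed

text \<open>The linear equation expresses the integral of the signal through the signal itself, so
  the noiseless observation needs no integration over the path.\<close>

definition obs :: "real \<Rightarrow> real \<times> (real \<Rightarrow> real) \<Rightarrow> real" where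
 "obs t \<theta> = \<tau> / sqrt V * (fst \<theta> + \<beta> * snd \<theta> t - ou \<tau> \<beta> t \<theta>)"

definition hat :: "real \<Rightarrow> (real \<Rightarrow> real) \<Rightarrow> real" where
 "hat t y = lim (\<lambda>n. wsum n (cut t (\<kappa> t)) y)"

context
 fixes x :: real and b :: "real \<Rightarrow> real"
 assumes b: "continuous_on {0..} b" and b0: "b 0 = 0"
begin

lemma b_cont: "S \<subseteq> {0..} \<Longrightarrow> continuous_on S b"
 using b continuous_on_subset by blast

lemma ou_lim:
 assumes t: "0 \<le> t"
 shows "(\<lambda>n. wsum n (cut t (\<lambda>s. exp (- (t - s) / \<tau>))) b) \<longlonglongrightarrow> b t - integral {0..t} (\<lambda>s. b s * (exp (- (t - s) / \<tau>) / \<tau>))"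
proof -
 have "(\<lambda>n. wsum n (cut t (\<lambda>s. exp (- (t - s) / \<tau>))) b) \<longlonglongrightarrow> exp (- (t - t) / \<tau>) * b t - integral {0..t} (\<lambda>s. b s * (exp (- (t - s) / \<tau>) / \<tau>))"
 proof (rule wsum_cut[OF t b b0])
  show "((\<lambda>s. exp (- (t - s) / \<tau>)) has_real_derivative exp (- (t - s) / \<tau>) / \<tau>) (at s within {0..t})" for s
   using \<tau> by (auto intro!: derivative_eq_intros)
  show "continuous_on {0..t} (\<lambda>s. exp (- (t - s) / \<tau>) / \<tau>)" using \<tau> by (intro continuous_intros) auto
 qed
 then show ?thesis by simp
qed

text \<open>The signal minus \<open>\<beta> * b t\<close>: with the rough part removed, the rest is
  differentiable and calculus applies.\<close>

definition "z t = exp (- t / \<tau>) * (x - \<beta> / \<tau> * integral {0..t} (\<lambda>s. b s * exp (s / \<tau>)))"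

lemma ou_z: "0 \<le> t \<Longrightarrow> ou \<tau> \<beta> t (x, b) = z t + \<beta> * b t"
proof -
 assume t: "0 \<le> t"
 have "integral {0..t} (\<lambda>s. b s * (exp (- (t - s) / \<tau>) / \<tau>)) = integral {0..t} (\<lambda>s. exp (- t / \<tau>) / \<tau> * (b s * exp (s / \<tau>)))"
 proof (rule hk_integral_cong)
  fix s
  have "exp (- (t - s) / \<tau>) = exp (- t / \<tau>) * exp (s / \<tau>)"
   by (simp add: exp_add[symmetric] diff_divide_distrib)
  then show "b s * (exp (- (t - s) / \<tau>) / \<tau>) = exp (- t / \<tau>) / \<tau> * (b s * exp (s / \<tau>))" by simp
 qed
 also have "... = exp (- t / \<tau>) / \<tau> * integral {0..t} (\<lambda>s. b s * exp (s / \<tau>))" by simp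
 finally have i: "integral {0..t} (\<lambda>s. b s * (exp (- (t - s) / \<tau>) / \<tau>)) = exp (- t / \<tau>) / \<tau> * integral {0..t} (\<lambda>s. b s * exp (s / \<tau>))" .
 show ?thesis unfolding ou_def fst_conv snd_conv limI[OF ou_lim[OF t]] i z_def by (simp add: algebra_simps)
qed

lemma z_deriv: "s \<in> {0..t} \<Longrightarrow> (z has_real_derivative - ou \<tau> \<beta> s (x, b) / \<tau>) (at s within {0..t})"
proof -
 assume s: "s \<in> {0..t}"
 have "((\<lambda>t. integral {0..t} (\<lambda>s. b s * exp (s / \<tau>))) has_real_derivative b s * exp (s / \<tau>)) (at s within {0..t})"
  using \<tau> by (intro integral_has_real_derivative[OF _ s] continuous_intros b_cont) auto
 then have "(z has_real_derivative - (1 / \<tau>) * z s - exp (- s / \<tau>) * (\<beta> / \<tau> * (b s * exp (s / \<tau>)))) (at s within {0..t})"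
  unfolding z_def[abs_def] using \<tau> by (auto intro!: derivative_eq_intros simp: field_simps)
 moreover have "- (1 / \<tau>) * z s - exp (- s / \<tau>) * (\<beta> / \<tau> * (b s * exp (s / \<tau>))) = - ou \<tau> \<beta> s (x, b) / \<tau>"
  using s \<tau> by (simp add: ou_z exp_minus field_simps)
 ultimately show ?thesis by simp
qed

lemma z_cont: "continuous_on {0..t} z"
 by (rule DERIV_continuous_on[OF z_deriv])

lemma z_0: "z 0 = x"
 by (simp add: z_def)

lemma ou_cont: "continuous_on {0..t} (\<lambda>s. ou \<tau> \<beta> s (x, b))"
proof -
 have "continuous_on {0..t} (\<lambda>s. z s + \<beta> * b s)" by (intro continuous_intros z_cont b_cont) auto
 then show ?thesis by (rule continuous_on_eq) (simp add: ou_z)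
qed

lemma ou_eq: "0 \<le> t \<Longrightarrow> ou \<tau> \<beta> t (x, b) = x + \<beta> * b t - integral {0..t} (\<lambda>s. ou \<tau> \<beta> s (x, b)) / \<tau>"
proof -
 assume t: "0 \<le> t"
 have "integral {0..t} (\<lambda>s. - ou \<tau> \<beta> s (x, b) / \<tau>) = z t - z 0" by (rule integral_FTC[OF t z_deriv])
 then show ?thesis using ou_z[OF t] by (simp add: z_0)
qed

lemma obs_z: "0 \<le> t \<Longrightarrow> obs t (x, b) = \<tau> / sqrt V * (x - z t)"
 by (simp add: obs_def ou_z)

lemma obs_deriv: "s \<in> {0..t} \<Longrightarrow> ((\<lambda>s. obs s (x, b)) has_real_derivative ou \<tau> \<beta> s (x, b) / sqrt V) (at s within {0..t})"
proof -
 assume s: "s \<in> {0..t}"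
 have "((\<lambda>s. \<tau> / sqrt V * (x - z s)) has_real_derivative ou \<tau> \<beta> s (x, b) / sqrt V) (at s within {0..t})"
  using \<tau> V by (auto intro!: derivative_eq_intros z_deriv[OF s] simp: field_simps)
 then show ?thesis
  by (rule has_field_derivative_transform_within[OF _ zero_less_one s]) (simp add: obs_z)
qed

lemma obs_cont: "continuous_on {0..} (\<lambda>s. obs s (x, b))"
 unfolding continuous_on_eq_continuous_within
proof
 fix s :: real assume "s \<in> {0..}"
 then have s: "s \<in> {0..s+1}" by auto
 have "continuous (at s within {0..s+1}) (\<lambda>s. obs s (x, b))"
  using obs_deriv[OF s] by (rule DERIV_continuous)
 moreover have "at s within {0..} = at s within {0..s+1}"
  by (rule at_within_nhd[of s "{..<s+1}"]) auto
 ultimately show "continuous (at s within {0..}) (\<lambda>s. obs s (x, b))" by simp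
qed

lemma obs_0: "obs 0 (x, b) = 0"
 by (simp add: obs_z z_0)

lemma obs_integral: "0 \<le> t \<Longrightarrow> obs t (x, b) = integral {0..t} (\<lambda>s. ou \<tau> \<beta> s (x, b)) / sqrt V"
 using integral_FTC[of 0 t "\<lambda>s. obs s (x, b)" "\<lambda>s. ou \<tau> \<beta> s (x, b) / sqrt V"] obs_deriv by (simp add: obs_0)

lemma hat_lim:
 assumes y: "continuous_on {0..} y" "y 0 = 0" and t: "0 \<le> t"
 shows "(\<lambda>n. wsum n (cut t (\<kappa> t)) y) \<longlonglongrightarrow> gain t * y t - integral {0..t} (\<lambda>s. y s * \<kappa>' t s)"
 using wsum_cut[OF t y, of "\<kappa> t" "\<kappa>' t"] \<kappa>_deriv \<kappa>'_cont by (simp add: \<kappa>_def)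

lemma hat_eq:
 assumes "continuous_on {0..} y" "y 0 = 0" "0 \<le> t"
 shows "hat t y = gain t * y t - integral {0..t} (\<lambda>s. y s * \<kappa>' t s)"
 using hat_lim[OF assms] by (simp add: hat_def limI)

text \<open>The products of \<open>\<Phi> t\<close> with \<open>z\<close> and of
  \<open>\<kappa> t\<close> with the noiseless observation are differentiated and integrated over
  \<open>{0..t}\<close>. The terms with the signal cancel because \<open>decay - 1 / \<tau>\<close>
  equals \<open>gain / sqrt V\<close>, which leaves the error as a functional of the initial value
  and the noises alone.\<close>

lemma error_identity:
 assumes w: "continuous_on {0..} w" "w 0 = 0" and t: "0 \<le> t"
 shows "ou \<tau> \<beta> t (x, b) - hat t (\<lambda>s. obs s (x, b) + w s)
  = \<Phi> t 0 * x + \<beta> * (b t - integral {0..t} (\<lambda>s. b s * (decay s * \<Phi> t s))) - (gain t * w t - integral {0..t} (\<lambda>s. w s * \<kappa>' t s))"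
proof -
 let ?u = "\<lambda>s. ou \<tau> \<beta> s (x, b)" and ?H = "\<lambda>s. obs s (x, b)"
 have H: "continuous_on {0..t} ?H" by (rule continuous_on_subset[OF obs_cont]) auto
 have wc: "continuous_on {0..t} w" by (rule continuous_on_subset[OF w(1)]) auto
 have pc: "continuous_on {0..t} P" "continuous_on {0..t} decay" "continuous_on {0..t} b"
  by (rule cont_on_nonneg decay_cont b_cont, auto)+
 note cs = \<Phi>_cont[of t t] z_cont[of t] ou_cont[of t] H wc pc \<kappa>'_cont[of t t] \<kappa>_cont[of t t]
 have 1: "integral {0..t} (\<lambda>s. decay s * \<Phi> t s * z s + \<Phi> t s * (- ?u s / \<tau>)) = \<Phi> t t * z t - \<Phi> t 0 * z 0"
  by (rule integral_FTC[OF t], rule DERIV_cong[OF DERIV_mult[OF \<Phi>_deriv z_deriv]]) (auto simp: algebra_simps)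
 have 2: "integral {0..t} (\<lambda>s. \<kappa>' t s * ?H s + \<kappa> t s * (?u s / sqrt V)) = \<kappa> t t * ?H t - \<kappa> t 0 * ?H 0"
  by (rule integral_FTC[OF t], rule DERIV_cong[OF DERIV_mult[OF \<kappa>_deriv obs_deriv]]) (auto simp: algebra_simps)
 have 3: "decay s * \<Phi> t s * z s + \<Phi> t s * (- ?u s / \<tau>) - (\<kappa>' t s * ?H s + \<kappa> t s * (?u s / sqrt V))
   = - (\<beta> * (b s * (decay s * \<Phi> t s))) - ?H s * \<kappa>' t s" if "s \<in> {0..t}" for s
 proof -
  have z: "z s = ?u s - \<beta> * b s" using that by (simp add: ou_z)
  have k: "\<kappa> t s * (?u s / sqrt V) = \<Phi> t s * (P s / V) * ?u s" using V by (simp add: \<kappa>_def gain_def)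
  show ?thesis unfolding z k decay_def using V \<tau> by (simp add: field_simps)
 qed
 have "(\<Phi> t t * z t - \<Phi> t 0 * z 0) - (\<kappa> t t * ?H t - \<kappa> t 0 * ?H 0)
  = integral {0..t} (\<lambda>s. (decay s * \<Phi> t s * z s + \<Phi> t s * (- ?u s / \<tau>)) - (\<kappa>' t s * ?H s + \<kappa> t s * (?u s / sqrt V)))"
  unfolding 1[symmetric] 2[symmetric] using V \<tau>
  by (intro hk_integral_diff[symmetric] integrable_continuous_interval continuous_intros cs) auto
 also have "... = integral {0..t} (\<lambda>s. - (\<beta> * (b s * (decay s * \<Phi> t s))) - ?H s * \<kappa>' t s)"
  by (rule hk_integral_cong) (rule 3)
 also have "... = - \<beta> * integral {0..t} (\<lambda>s. b s * (decay s * \<Phi> t s)) - integral {0..t} (\<lambda>s. ?H s * \<kappa>' t s)"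
  by (subst hk_integral_diff)
   ((intro integrable_continuous_interval continuous_intros cs)+, simp)
 finally have "z t - \<Phi> t 0 * x - gain t * ?H t = - \<beta> * integral {0..t} (\<lambda>s. b s * (decay s * \<Phi> t s)) - integral {0..t} (\<lambda>s. ?H s * \<kappa>' t s)"
  by (simp add: obs_0 z_0 \<kappa>_def)
 moreover have "hat t (\<lambda>s. ?H s + w s) = gain t * (?H t + w t) - integral {0..t} (\<lambda>s. (?H s + w s) * \<kappa>' t s)"
  using w t by (intro hat_eq continuous_on_add obs_cont) (simp_all add: obs_0)
 moreover have "integral {0..t} (\<lambda>s. (?H s + w s) * \<kappa>' t s) = integral {0..t} (\<lambda>s. ?H s * \<kappa>' t s) + integral {0..t} (\<lambda>s. w s * \<kappa>' t s)"
  unfolding distrib_right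
  by (intro hk_integral_add integrable_continuous_interval continuous_intros cs)
 moreover have "?u t = z t + \<beta> * b t" by (rule ou_z[OF t])
 ultimately show ?thesis by (simp add: algebra_simps)
qed

end

end

context gaussian_drivers
begin

lemma rep_moments:
 assumes L: "rep L a \<phi> \<psi>" and q: "qlim a \<phi> \<psi> a \<phi> \<psi> v"
 shows "integrable M (\<lambda>w. (L w)^2)" "(LINT w|M. (L w)^2) = v" "integrable M L" "(LINT w|M. L w) = 0"
proof -
 have [measurable]: "L \<in> borel_measurable M" using L by (rule rep_measurable)
 have "qn n a \<phi> \<psi> a \<phi> \<psi> \<ge> 0" for n
  unfolding qn_def dint_def by (intro add_nonneg_nonneg sum_nonneg divide_nonneg_nonneg) auto
 then have "v \<ge> 0" using q by (intro LIMSEQ_le_const[OF q]) auto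
 then consider "v > 0" | "v = 0" by linarith
 then have "integrable M (\<lambda>w. (L w)^2) \<and> (LINT w|M. (L w)^2) = v \<and> integrable M L \<and> (LINT w|M. L w) = 0"
 proof cases
  case 1
  then show ?thesis using rep_normal[OF L q] by simp
 next
  case 2
  have "distr M borel L = distr M borel (\<lambda>_. 0)"
  proof (rule Levy_uniqueness)
   show "char (distr M borel L) = char (distr M borel (\<lambda>_. 0))"
   proof
    fix x
    have "char (distr M borel (\<lambda>_. 0)) x = 1" by (simp add: char_def integral_distr prob_space del: distr_const)
    then show "char (distr M borel L) x = char (distr M borel (\<lambda>_. 0)) x" using rep_char[OF L q, of x] 2 by (simp del: distr_const)
   qed
   show "real_distribution (distr M borel L)" "real_distribution (distr M borel (\<lambda>_. 0))"
    by (rule real_distribution_distr; simp)+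
  qed
  then have "emeasure (distr M borel L) {0} = emeasure (distr M borel (\<lambda>_. 0)) {0::real}" by simp
  then have "prob (L -` {0} \<inter> space M) = 1"
   by (simp add: emeasure_distr prob_space emeasure_eq_measure del: distr_const)
  then have "AE w in M. L w = 0" using AE_prob_1[of "L -` {0} \<inter> space M"] by auto
  then have "AE w in M. (L w)^2 = 0" "AE w in M. L w = 0" by auto
  then show ?thesis using 2 by (auto simp: integrable_cong_AE[where g="\<lambda>_. 0"] intro!: integral_eq_zero_AE)
 qed
 then show "integrable M (\<lambda>w. (L w)^2)" "(LINT w|M. (L w)^2) = v" "integrable M L" "(LINT w|M. L w) = 0" by auto
qed

text \<open>Polarisation: covariances follow from the variances of \<open>L + L'\<close> and
  \<open>L - L'\<close>.\<close>

lemma rep_cov: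
 assumes L: "rep L a \<phi> \<psi>" and L': "rep L' a' \<phi>' \<psi>'"
  and q: "qlim a \<phi> \<psi> a \<phi> \<psi> v" and q': "qlim a' \<phi>' \<psi>' a' \<phi>' \<psi>' (v')"
  and w: "qlim a \<phi> \<psi> a' \<phi>' \<psi>' w"
 shows "integrable M (\<lambda>x. L x * L' x)" "(\<integral>x. L x * L' x \<partial>M) = w"
proof -
 have *: "integrable M (\<lambda>x. (1 * L x + c * L' x)^2)" "(\<integral>x. (1 * L x + c * L' x)^2 \<partial>M) = v + 2 * c * w + c^2 * v'" for c
 proof -
  let ?A = "1 * a + c * a'" and ?F = "\<lambda>x. 1 * \<phi> x + c * \<phi>' x" and ?G = "\<lambda>x. 1 * \<psi> x + c * \<psi>' x"
  have "qn n ?A ?F ?G ?A ?F ?G = 1 * (1 * qn n a \<phi> \<psi> a \<phi> \<psi> + c * qn n a \<phi> \<psi> a' \<phi>' \<psi>') + c * (1 * qn n a \<phi> \<psi> a' \<phi>' \<psi>' + c * qn n a' \<phi>' \<psi>' a' \<phi>' \<psi>')" for n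
  proof -
   have "qn n a \<phi> \<psi> ?A ?F ?G = 1 * qn n a \<phi> \<psi> a \<phi> \<psi> + c * qn n a \<phi> \<psi> a' \<phi>' \<psi>'"
    by (subst qn_commute, subst qn_lin) (simp only: qn_commute)
   moreover have "qn n a' \<phi>' \<psi>' ?A ?F ?G = 1 * qn n a \<phi> \<psi> a' \<phi>' \<psi>' + c * qn n a' \<phi>' \<psi>' a' \<phi>' \<psi>'"
    by (subst qn_commute, subst qn_lin) (simp only: qn_commute)
   ultimately show ?thesis by (subst qn_lin) (simp only:)
  qed
  moreover have "(\<lambda>n. 1 * (1 * qn n a \<phi> \<psi> a \<phi> \<psi> + c * qn n a \<phi> \<psi> a' \<phi>' \<psi>') + c * (1 * qn n a \<phi> \<psi> a' \<phi>' \<psi>' + c * qn n a' \<phi>' \<psi>' a' \<phi>' \<psi>'))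
   \<longlonglongrightarrow> 1 * (1 * v + c * w) + c * (1 * w + c * v')" by (intro tendsto_intros q q' w)
  ultimately have l: "qlim ?A ?F ?G ?A ?F ?G (1 * (1 * v + c * w) + c * (1 * w + c * v'))" by (simp only:)
  show "integrable M (\<lambda>x. (1 * L x + c * L' x)^2)" by (rule rep_moments(1)[OF rep_lin[OF L L'] l])
  show "(\<integral>x. (1 * L x + c * L' x)^2 \<partial>M) = v + 2 * c * w + c^2 * v'"
   using rep_moments(2)[OF rep_lin[OF L L'] l] by (simp add: algebra_simps power2_eq_square)
 qed
 have p: "L x * L' x = ((1 * L x + 1 * L' x)^2 - (1 * L x + (-1) * L' x)^2) / 4" for x
  by (simp add: power2_eq_square algebra_simps)
 show "integrable M (\<lambda>x. L x * L' x)" unfolding p using *(1)[of 1] *(1)[of "-1"] by simp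
 show "(\<integral>x. L x * L' x \<partial>M) = w" unfolding p using *(1)[of 1] *(1)[of "-1"] *(2)[of 1] *(2)[of "-1"]
  by (subst integral_divide_zero, subst Bochner_Integration.integral_diff) simp_all
qed

end

lemma measurable_lim_wsum_cut:
 assumes "{0..s} \<subseteq> I"
 shows "(\<lambda>y. lim (\<lambda>n. wsum n (cut s g) y)) \<in> borel_measurable (path_space I)"
proof (rule borel_measurable_lim_metric, rule measurable_wsum)
 fix j n assume "cut s g (real (Suc j) / 2^n) \<noteq> 0"
 then have "real (Suc j) / 2^n \<le> s" by (auto simp: cut_def split: if_splits)
 moreover have "real j / 2^n \<le> real (Suc j) / 2^n" by (simp add: divide_right_mono)
 ultimately have "real (Suc j) / 2^n \<in> {0..s}" "real j / 2^n \<in> {0..s}" by auto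
 then show "real (Suc j) / 2^n \<in> I \<and> real j / 2^n \<in> I" using assms by blast
qed

lemma wsum_cut_cong:
 assumes "\<And>r. 0 \<le> r \<Longrightarrow> r \<le> s \<Longrightarrow> y r = y' r"
 shows "wsum n (cut s g) y = wsum n (cut s g) y'"
 unfolding wsum_def
proof (intro sum.cong refl)
 fix j
 show "cut s g (real (Suc j) / 2^n) * (y (real (Suc j) / 2^n) - y (real j / 2^n)) = cut s g (real (Suc j) / 2^n) * (y' (real (Suc j) / 2^n) - y' (real j / 2^n))"
 proof (cases "real (Suc j) / 2^n \<le> s")
  case True
  moreover have "real j / 2^n \<le> real (Suc j) / 2^n" by (simp add: divide_right_mono)
  ultimately have "real j / 2^n \<le> s" by simp
  then show ?thesis using True assms[of "real (Suc j) / 2^n"] assms[of "real j / 2^n"] by simp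
 qed (simp add: cut_def)
qed

lemma measurable_ou:
 assumes "{0..s} \<subseteq> I" shows "ou \<tau> \<beta> s \<in> borel_measurable (sigs I)"
proof -
 note [measurable] = measurable_lim_wsum_cut[OF assms]
 show ?thesis unfolding ou_def by measurable
qed

lemma ou_cong:
 assumes "fst \<theta> = fst \<theta>'" "\<And>r. 0 \<le> r \<Longrightarrow> r \<le> s \<Longrightarrow> snd \<theta> r = snd \<theta>' r"
 shows "ou \<tau> \<beta> s \<theta> = ou \<tau> \<beta> s \<theta>'"
proof -
 have "wsum n (cut s g) (snd \<theta>) = wsum n (cut s g) (snd \<theta>')" for n g by (rule wsum_cut_cong[OF assms(2)])
 then show ?thesis using assms(1) by (simp add: ou_def)
qed

context kalman
begin

lemma measurable_obs:
 assumes "{0..s} \<subseteq> I" "0 \<le> s" shows "obs s \<in> borel_measurable (sigs I)"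
proof -
 note [measurable] = measurable_ou[OF assms(1)]
 have "s \<in> I" using assms by auto
 then show ?thesis unfolding obs_def by measurable
qed

lemma obs_cong:
 assumes "fst \<theta> = fst \<theta>'" "\<And>r. 0 \<le> r \<Longrightarrow> r \<le> s \<Longrightarrow> snd \<theta> r = snd \<theta>' r" "0 \<le> s"
 shows "obs s \<theta> = obs s \<theta>'"
 using ou_cong[of \<theta> \<theta>' s] assms by (simp add: obs_def)

lemma measurable_hat:
 assumes "{0..s} \<subseteq> I" shows "hat s \<in> borel_measurable (path_space I)"
 unfolding hat_def[abs_def] by (rule measurable_lim_wsum_cut[OF assms])

lemma hat_cong:
 assumes "\<And>r. 0 \<le> r \<Longrightarrow> r \<le> s \<Longrightarrow> y r = y' r" shows "hat s y = hat s y'"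
proof -
 have "wsum n (cut s g) y = wsum n (cut s g) y'" for n g by (rule wsum_cut_cong[OF assms])
 then show ?thesis by (simp add: hat_def)
qed

end

section \<open>The uncontrolled channel\<close>

lemma cut_mult: "cut s f x * cut r g x = cut (min s r) (\<lambda>x. f x * g x) x"
 by (simp add: cut_def)

locale kalman_drivers = gaussian_drivers M v0 B Bm s0 + kalman \<tau> \<beta> V P
 for M :: "'a measure" and v0 B Bm s0 \<tau> \<beta> V P +
 assumes s0P: "s0^2 = \<beta>^2 * \<tau> / 2"
begin

text \<open>Coefficients of \<open>v0\<close> and integrands against \<open>B\<close> and
  \<open>Bm\<close> in the representations below: \<open>hc\<close>, \<open>hf\<close> for the
  noiseless observation, \<open>uf\<close> for the signal, \<open>ef\<close>, \<open>eg\<close> for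
  the filter error.\<close>

abbreviation "hc t \<equiv> \<tau> / sqrt V * (1 - exp (- t / \<tau>))"
abbreviation "hf t \<equiv> cut t (\<lambda>s. \<tau> * \<beta> / sqrt V * (1 - exp (- (t - s) / \<tau>)))"
abbreviation "uf t \<equiv> cut t (\<lambda>s. \<beta> * exp (- (t - s) / \<tau>))"
abbreviation "ef t \<equiv> cut t (\<lambda>s. \<beta> * \<Phi> t s)"
abbreviation "eg t \<equiv> cut t (\<lambda>s. (- 1) * \<kappa> t s)"
abbreviation "nul t \<equiv> cut t (\<lambda>_. 0)"
abbreviation "one t \<equiv> cut t (\<lambda>_. 1)"

lemma s0P0: "s0^2 = P 0"
 by (simp add: P0 s0P)

text \<open>Uncontrolled signal, noiseless observation, observation, filter and filter error. They
  are evaluated on full driver paths, though each uses the drivers up to its time only.\<close>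

definition u :: "real \<Rightarrow> 'a \<Rightarrow> real" where "u t w = ou \<tau> \<beta> t (sig {0..} w)"
definition H :: "real \<Rightarrow> 'a \<Rightarrow> real" where "H t w = obs t (sig {0..} w)"
definition Ys :: "real \<Rightarrow> 'a \<Rightarrow> real" where "Ys t w = H t w + Bm t w"
definition uh :: "real \<Rightarrow> 'a \<Rightarrow> real" where "uh t w = hat t (\<lambda>s. Ys s w)"
definition er :: "real \<Rightarrow> 'a \<Rightarrow> real" where "er t w = u t w - uh t w"

definition good :: "'a \<Rightarrow> bool" where
 "good w \<longleftrightarrow> continuous_on {0..} (\<lambda>t. B t w) \<and> B 0 w = 0 \<and> continuous_on {0..} (\<lambda>t. Bm t w) \<and> Bm 0 w = 0"

lemma AE_good: "AE w in M. good w"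
 using B Bm unfolding good_def standard_brownian_motion_def by auto

lemma u_sig: "{0..t} \<subseteq> J \<Longrightarrow> u t w = ou \<tau> \<beta> t (sig J w)" "u t w = ou \<tau> \<beta> t (v0 w, \<lambda>s. B s w)"
 unfolding u_def by (rule ou_cong; force simp: sig_def path_def)+

lemma H_sig: "0 \<le> t \<Longrightarrow> {0..t} \<subseteq> J \<Longrightarrow> H t w = obs t (sig J w)" "0 \<le> t \<Longrightarrow> H t w = obs t (v0 w, \<lambda>s. B s w)"
 unfolding H_def by (rule obs_cong; force simp: sig_def path_def)+

lemma uH_measurable[measurable]: "u t \<in> borel_measurable M" "0 \<le> t \<Longrightarrow> H t \<in> borel_measurable M"
proof -
 show "u t \<in> borel_measurable M"
  unfolding u_def[abs_def] by (rule measurable_compose[OF sig_measurable measurable_ou]) auto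
 show "0 \<le> t \<Longrightarrow> H t \<in> borel_measurable M"
  unfolding H_def[abs_def] by (rule measurable_compose[OF sig_measurable measurable_obs]) auto
qed

lemma Ys_measurable[measurable]: "0 \<le> t \<Longrightarrow> Ys t \<in> borel_measurable M"
 unfolding Ys_def[abs_def] by measurable

lemma path_Ys_measurable[measurable]: "J \<subseteq> {0..} \<Longrightarrow> path Ys J \<in> measurable M (path_space J)"
 unfolding path_def[abs_def] by (auto intro!: measurable_restrict)

lemma uh_path: "{0..t} \<subseteq> J \<Longrightarrow> uh t w = hat t (path Ys J w)"
 unfolding uh_def by (rule hat_cong) (force simp: path_def)

lemma uh_measurable[measurable]: "uh t \<in> borel_measurable M"
proof -
 have "(\<lambda>w. hat t (path Ys {0..} w)) \<in> borel_measurable M"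
  by (rule measurable_compose[OF path_Ys_measurable measurable_hat]) auto
 then show ?thesis using uh_path[of t "{0..}"] by (simp cong: measurable_cong)
qed

lemma er_measurable[measurable]: "er t \<in> borel_measurable M"
 unfolding er_def[abs_def] by measurable

lemma good_Ys: "good w \<Longrightarrow> continuous_on {0..} (\<lambda>s. Ys s w)" "good w \<Longrightarrow> Ys 0 w = 0"
proof -
 assume g: "good w"
 then have b: "continuous_on {0..} (\<lambda>t. B t w)" "B 0 w = 0" by (auto simp: good_def)
 have "continuous_on {0..} (\<lambda>s. obs s (v0 w, \<lambda>s. B s w) + Bm s w)"
  using g by (intro continuous_on_add obs_cont b) (auto simp: good_def)
 then show "continuous_on {0..} (\<lambda>s. Ys s w)"
  by (rule continuous_on_eq) (simp add: Ys_def H_sig(2))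
 show "Ys 0 w = 0" using g obs_0[OF b, of "v0 w"] by (simp add: Ys_def H_sig(2) good_def)
qed

lemma rep_v0: "rep v0 1 (nul t) (nul t)"
 by (simp add: rep_def wsum_def cut_def)

lemma rep_B: assumes t: "0 \<le> t" shows "rep (B t) 0 (one t) (nul t)"
proof -
 have "AE w in M. (\<lambda>n. 0 * v0 w + wsum n (one t) (\<lambda>t. B t w) + wsum n (nul t) (\<lambda>t. Bm t w)) \<longlonglongrightarrow> B t w"
  using AE_good
 proof eventually_elim
  case (elim w)
  have "(\<lambda>n. wsum n (one t) (\<lambda>t. B t w)) \<longlonglongrightarrow> 1 * B t w - integral {0..t} (\<lambda>s. B s w * 0)"
   by (rule wsum_cut[OF t]) (use elim in \<open>auto simp: good_def\<close>)
  moreover have "wsum n (nul t) y = 0" for n y by (simp add: wsum_def cut_def)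
  ultimately show ?case by simp
 qed
 then show ?thesis using t by (simp add: rep_def)
qed

lemma rep_Bm: assumes t: "0 \<le> t" shows "rep (Bm t) 0 (nul t) (one t)"
proof -
 have "AE w in M. (\<lambda>n. 0 * v0 w + wsum n (nul t) (\<lambda>t. B t w) + wsum n (one t) (\<lambda>t. Bm t w)) \<longlonglongrightarrow> Bm t w"
  using AE_good
 proof eventually_elim
  case (elim w)
  have "(\<lambda>n. wsum n (one t) (\<lambda>t. Bm t w)) \<longlonglongrightarrow> 1 * Bm t w - integral {0..t} (\<lambda>s. Bm s w * 0)"
   by (rule wsum_cut[OF t]) (use elim in \<open>auto simp: good_def\<close>)
  moreover have "wsum n (nul t) y = 0" for n y by (simp add: wsum_def cut_def)
  ultimately show ?case by simp
 qed
 then show ?thesis using t by (simp add: rep_def)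
qed

lemma wsum_cut_scale: "wsum n (cut t (\<lambda>s. c * g s)) y = c * wsum n (cut t g) y"
 by (simp add: wsum_def cut_def sum_distrib_left mult.assoc) (intro sum.cong, auto)

lemma rep_u: assumes t: "0 \<le> t"
 shows "rep (u t) (exp (- t / \<tau>)) (uf t) (nul t)"
proof -
 have "AE w in M. (\<lambda>n. exp (- t / \<tau>) * v0 w + wsum n (uf t) (\<lambda>t. B t w) + wsum n (nul t) (\<lambda>t. Bm t w)) \<longlonglongrightarrow> u t w"
  using AE_good
 proof eventually_elim
  case (elim w)
  then have b: "continuous_on {0..} (\<lambda>t. B t w)" "B 0 w = 0" by (auto simp: good_def)
  note l = ou_lim[OF b t]
  have "(\<lambda>n. exp (- t / \<tau>) * v0 w + \<beta> * wsum n (cut t (\<lambda>s. exp (- (t - s) / \<tau>))) (\<lambda>t. B t w)) \<longlonglongrightarrow> u t w"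
   unfolding u_sig(2) ou_def fst_conv snd_conv limI[OF l] by (intro tendsto_intros l)
  moreover have "wsum n (nul t) y = 0" for n y by (simp add: wsum_def cut_def)
  ultimately show ?case by (simp add: wsum_cut_scale)
 qed
 then show ?thesis by (simp add: rep_def)
qed

lemma rep_H: assumes t: "0 \<le> t"
 shows "rep (H t) (hc t) (hf t) (nul t)"
proof -
 have "rep (\<lambda>w. \<tau> / sqrt V * (1 * v0 w + \<beta> * B t w) + (- (\<tau> / sqrt V)) * u t w)
  (\<tau> / sqrt V * (1 * 1 + \<beta> * 0) + (- (\<tau> / sqrt V)) * exp (- t / \<tau>))
  (\<lambda>x. \<tau> / sqrt V * (1 * nul t x + \<beta> * one t x) + (- (\<tau> / sqrt V)) * uf t x)
  (\<lambda>x. \<tau> / sqrt V * (1 * nul t x + \<beta> * nul t x) + (- (\<tau> / sqrt V)) * nul t x)"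
  by (intro rep_lin rep_v0 rep_B rep_u t)
 moreover have "(\<lambda>w. \<tau> / sqrt V * (1 * v0 w + \<beta> * B t w) + (- (\<tau> / sqrt V)) * u t w) = H t"
  using t by (simp add: fun_eq_iff H_sig(2) u_sig(2) obs_def algebra_simps)
 moreover have "(\<lambda>x. \<tau> / sqrt V * (1 * nul t x + \<beta> * one t x) + (- (\<tau> / sqrt V)) * uf t x) =
  hf t"
  by (simp add: fun_eq_iff cut_def algebra_simps)
 moreover have "(\<lambda>x. \<tau> / sqrt V * (1 * nul t x + \<beta> * nul t x) + (- (\<tau> / sqrt V)) * nul t x) = nul t"
  by (simp add: fun_eq_iff cut_def)
 moreover have "\<tau> / sqrt V * (1 * 1 + \<beta> * 0) + (- (\<tau> / sqrt V)) * exp (- t / \<tau>) = hc t"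
  by (simp add: algebra_simps)
 ultimately show ?thesis by (simp only:)
qed

lemma rep_Ys: assumes t: "0 \<le> t"
 shows "rep (Ys t) (hc t) (hf t) (one t)"
proof -
 have "rep (\<lambda>w. 1 * H t w + 1 * Bm t w) (1 * (hc t) + 1 * 0)
  (\<lambda>x. 1 * hf t x + 1 * nul t x)
  (\<lambda>x. 1 * nul t x + 1 * one t x)"
  by (intro rep_lin rep_H rep_Bm t)
 moreover have "(\<lambda>w. 1 * H t w + 1 * Bm t w) = Ys t" by (simp add: fun_eq_iff Ys_def)
 moreover have "(\<lambda>x. 1 * hf t x + 1 * nul t x) = hf t"
  "(\<lambda>x. 1 * nul t x + 1 * one t x) = cut t (\<lambda>_. 1 :: real)"
  by (simp_all add: fun_eq_iff cut_def)
 ultimately show ?thesis by simp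
qed

text \<open>The error identity gives the error as a combination of integrated-by-parts expressions;
  \<open>wsum_cut\<close> read backwards identifies them as Wiener integrals of the propagator and
  of the filter weights.\<close>

lemma rep_er: assumes t: "0 \<le> t"
 shows "rep (er t) (\<Phi> t 0) (ef t) (eg t)"
proof -
 have "AE w in M. (\<lambda>n. \<Phi> t 0 * v0 w + wsum n (ef t) (\<lambda>t. B t w) + wsum n (eg t) (\<lambda>t. Bm t w)) \<longlonglongrightarrow> er t w"
  using AE_good
 proof eventually_elim
  case (elim w)
  then have b: "continuous_on {0..} (\<lambda>t. B t w)" "B 0 w = 0" and w: "continuous_on {0..} (\<lambda>t. Bm t w)" "Bm 0 w = 0"
   by (auto simp: good_def)
  have dc: "continuous_on {0..t} (\<lambda>s. decay s * \<Phi> t s)" by (intro continuous_on_mult decay_cont \<Phi>_cont) auto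
  have l1: "(\<lambda>n. wsum n (cut t (\<Phi> t)) (\<lambda>t. B t w)) \<longlonglongrightarrow> \<Phi> t t * B t w - integral {0..t} (\<lambda>s. B s w * (decay s * \<Phi> t s))"
   by (rule wsum_cut[OF t b \<Phi>_deriv dc])
  have l2: "(\<lambda>n. wsum n (cut t (\<kappa> t)) (\<lambda>t. Bm t w)) \<longlonglongrightarrow> \<kappa> t t * Bm t w - integral {0..t} (\<lambda>s. Bm s w * \<kappa>' t s)"
   by (rule wsum_cut[OF t w \<kappa>_deriv \<kappa>'_cont])
  have "uh t w = hat t (\<lambda>s. obs s (v0 w, \<lambda>s. B s w) + Bm s w)"
   unfolding uh_def by (rule hat_cong) (simp add: Ys_def H_sig(2))
  then have "er t w = \<Phi> t 0 * v0 w + \<beta> * (\<Phi> t t * B t w - integral {0..t} (\<lambda>s. B s w * (decay s * \<Phi> t s)))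
    + (- 1) * (\<kappa> t t * Bm t w - integral {0..t} (\<lambda>s. Bm s w * \<kappa>' t s))"
   using error_identity[OF b w t, of "v0 w"] by (simp add: er_def u_sig(2) \<kappa>_def)
  then show ?case unfolding wsum_cut_scale by (simp only:) (intro tendsto_intros l1 l2)
 qed
 then show ?thesis by (simp add: rep_def)
qed

lemma qn_cut:
 assumes "0 \<le> s" "0 \<le> r" "continuous_on {0..min s r} (\<lambda>x. f x * f' x)" "continuous_on {0..min s r} (\<lambda>x. g x * g' x)"
 shows "qlim a (cut s f) (cut s g) a' (cut r f') (cut r g') (a * a' * s0^2 + integral {0..min s r} (\<lambda>x. f x * f' x) + integral {0..min s r} (\<lambda>x. g x * g' x))"
 unfolding qn_def cut_mult by (intro tendsto_intros dint_cut assms) (use assms in auto)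

lemma qn_er_er: assumes t: "0 \<le> t"
 shows "qlim (\<Phi> t 0) (ef t) (eg t) (\<Phi> t 0) (ef t) (eg t) (P t)"
proof -
 have "qlim (\<Phi> t 0) (ef t) (eg t) (\<Phi> t 0) (ef t) (eg t) (\<Phi> t 0 * \<Phi> t 0 * s0^2 + integral {0..min t t} (\<lambda>s. \<beta> * \<Phi> t s * (\<beta> * \<Phi> t s)) + integral {0..min t t} (\<lambda>s. (- 1) * \<kappa> t s * ((- 1) * \<kappa> t s)))"
  by (intro qn_cut t continuous_on_mult continuous_on_const \<Phi>_cont \<kappa>_cont)
 moreover have "\<Phi> t 0 * \<Phi> t 0 * s0^2 + integral {0..min t t} (\<lambda>s. \<beta> * \<Phi> t s * (\<beta> * \<Phi> t s)) + integral {0..min t t} (\<lambda>s. (- 1) * \<kappa> t s * ((- 1) * \<kappa> t s)) = P t"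
  using var_error[OF t] unfolding s0P0 by (simp add: power2_eq_square)
 ultimately show ?thesis by (simp only:)
qed

lemma qn_er_Ys: assumes r: "0 \<le> r" "r \<le> t"
 shows "qlim (\<Phi> t 0) (ef t) (eg t)
  (hc r) (hf r) (one r) 0"
proof -
 have "qlim (\<Phi> t 0) (ef t) (eg t)
  (hc r) (hf r) (one r) (\<Phi> t 0 * (hc r) * s0^2 + integral {0..min t r} (\<lambda>s. \<beta> * \<Phi> t s * (\<tau> * \<beta> / sqrt V * (1 - exp (- (r - s) / \<tau>))))
   + integral {0..min t r} (\<lambda>s. (- 1) * \<kappa> t s * 1))"
  using r V \<tau> by (intro qn_cut continuous_intros \<Phi>_cont \<kappa>_cont) auto
 also have "min t r = r" using r by simp
 also have "integral {0..r} (\<lambda>s. (- 1) * \<kappa> t s * 1) = - integral {0..r} (\<lambda>s. \<kappa> t s)" by simp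
 finally show ?thesis using cov_error_observation[OF r] by (simp add: s0P0)
qed

lemma qn_er_u: assumes t: "0 \<le> t"
 shows "qlim (\<Phi> t 0) (ef t) (eg t)
  (exp (- t / \<tau>)) (uf t) (nul t) (P t)"
proof -
 have "qlim (\<Phi> t 0) (ef t) (eg t)
  (exp (- t / \<tau>)) (uf t) (nul t) (\<Phi> t 0 * exp (- t / \<tau>) * s0^2 + integral {0..min t t} (\<lambda>s. \<beta> * \<Phi> t s * (\<beta> * exp (- (t - s) / \<tau>)))
   + integral {0..min t t} (\<lambda>s. (- 1) * \<kappa> t s * 0))"
  using t \<tau> by (intro qn_cut continuous_intros \<Phi>_cont \<kappa>_cont) auto
 then show ?thesis using cov_error_signal[OF t] by (simp add: s0P0)
qed

text \<open>Stationarity: for this initial variance the decaying and the accumulated part add up to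
  a constant.\<close>

lemma qn_u_u: assumes t: "0 \<le> t"
 shows "qlim (exp (- t / \<tau>)) (uf t) (nul t)
  (exp (- t / \<tau>)) (uf t) (nul t) (s0^2)"
proof -
 have "qlim (exp (- t / \<tau>)) (uf t) (nul t)
  (exp (- t / \<tau>)) (uf t) (nul t) (exp (- t / \<tau>) * exp (- t / \<tau>) * s0^2 + integral {0..min t t} (\<lambda>s. \<beta> * exp (- (t - s) / \<tau>) * (\<beta> * exp (- (t - s) / \<tau>)))
   + integral {0..min t t} (\<lambda>s. 0 * 0))"
  using t \<tau> by (intro qn_cut continuous_intros) auto
 moreover have i: "integral {0..t} (\<lambda>s. \<beta> * exp (- (t - s) / \<tau>) * (\<beta> * exp (- (t - s) / \<tau>)))
  = \<beta>^2 * \<tau> / 2 * (exp (- (t - t) / \<tau>) * exp (- (t - t) / \<tau>)) - \<beta>^2 * \<tau> / 2 * (exp (- (t - 0) / \<tau>) * exp (- (t - 0) / \<tau>))"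
  using \<tau> by (intro integral_FTC[OF t]) (auto intro!: derivative_eq_intros simp: power2_eq_square)
 have "exp (- t / \<tau>) * exp (- t / \<tau>) * s0^2 + integral {0..min t t} (\<lambda>s. \<beta> * exp (- (t - s) / \<tau>) * (\<beta> * exp (- (t - s) / \<tau>)))
   + integral {0..min t t} (\<lambda>s. 0 * 0) = s0^2"
  unfolding s0P min.idem i by simp
 ultimately show ?thesis by (simp only:)
qed

lemma qn_Ys_Ys: assumes "0 \<le> s" "0 \<le> r"
 shows "convergent (\<lambda>n. qn n (hc s) (hf s) (one s)
  (hc r) (hf r) (one r))"
 unfolding convergent_def
 by (rule exI, rule qn_cut[OF assms]) (use \<tau> V in \<open>auto intro!: continuous_intros\<close>)

text \<open>Orthogonality to each earlier observation becomes independence of the whole observation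
  path by Gaussianity, which makes \<open>uh\<close> the conditional mean of the uncontrolled
  signal.\<close>

lemma er_indep: assumes t: "0 \<le> t"
 shows "indep_pair M borel (er t) (path_space {0..t}) (path Ys {0..t})"
 unfolding path_def[abs_def]
 by (rule rep_indep[OF rep_er[OF t] rep_Ys qn_er_er[OF t] qn_Ys_Ys qn_er_Ys]) auto

lemma er_moments: assumes t: "0 \<le> t"
 shows "integrable M (\<lambda>w. (er t w)^2)" "(LINT w|M. (er t w)^2) = P t" "integrable M (er t)" "(LINT w|M. er t w) = 0"
 using rep_moments[OF rep_er[OF t] qn_er_er[OF t]] by auto

end

section \<open>Observation increments and innovations\<close>

definition band :: "real \<Rightarrow> real \<Rightarrow> (real \<Rightarrow> real) \<Rightarrow> real \<Rightarrow> real" where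
 "band p q g x = (if p < x \<and> x \<le> q then g x else 0)"

lemma dint_band:
 assumes "0 \<le> p" "p \<le> q" and g: "continuous_on {0..q} g"
 shows "(\<lambda>n. dint n (band p q g)) \<longlonglongrightarrow> integral {p..q} g"
proof -
 have eq: "band p q g = (\<lambda>x. cut q g x + (-1) * cut p g x)" using assms by (auto simp: band_def cut_def fun_eq_iff)
 have "continuous_on {0..p} g" using assms by (auto intro: continuous_on_subset)
 then have "(\<lambda>n. dint n (cut q g) + (-1) * dint n (cut p g)) \<longlonglongrightarrow> integral {0..q} g + (-1) * integral {0..p} g"
  by (intro tendsto_intros dint_cut g) (use assms in auto)
 moreover have "integral {0..q} g = integral {0..p} g + integral {p..q} g"
  by (rule hk_integral_combine[symmetric])
   (use assms in \<open>auto intro!: integrable_continuous_interval\<close>)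
 ultimately show ?thesis unfolding eq dint_add dint_scale by simp
qed

text \<open>The lower bound to second order shows that replacing \<open>coef d\<close> by
  \<open>d\<close> costs only a quadratic error per cell.\<close>

lemma one_minus_exp_bounds:
 fixes x :: real
 assumes "0 \<le> x"
 shows "0 \<le> 1 - exp (- x)" "1 - exp (- x) \<le> x" "x - x^2 / 2 \<le> 1 - exp (- x)"
proof -
 show "0 \<le> 1 - exp (- x)" "1 - exp (- x) \<le> x" using assms exp_ge_add_one_self[of "- x"] by auto
 have "(\<lambda>x. x - x^2 / 2 + exp (- x)) x \<le> (\<lambda>x. x - x^2 / 2 + exp (- x)) (0::real)"
 proof (rule DERIV_nonpos_imp_nonincreasing[OF assms])
  fix y :: real assume "0 \<le> y" "y \<le> x"
  have "((\<lambda>x. x - x^2 / 2 + exp (- x)) has_real_derivative 1 - y - exp (- y)) (at y)"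
   by (auto intro!: derivative_eq_intros)
  moreover have "1 - y - exp (- y) \<le> 0" using exp_ge_add_one_self[of "- y"] by simp
  ultimately show "\<exists>d. ((\<lambda>x. x - x^2 / 2 + exp (- x)) has_real_derivative d) (at y) \<and> d \<le> 0" by blast
 qed
 then show "x - x^2 / 2 \<le> 1 - exp (- x)" by simp
qed

context kalman_drivers
begin

text \<open>\<open>inn\<close> is the part of an observation increment that is independent of signal and
 observations up to \<open>p\<close>; \<open>eps\<close> is the innovation.\<close>

definition "coef d = \<tau> * (1 - exp (- d / \<tau>))"

definition inn :: "real \<Rightarrow> real \<Rightarrow> 'a \<Rightarrow> real" where
 "inn p q w = (Ys q w - Ys p w) - coef (q - p) / sqrt V * u p w"

definition eps :: "real \<Rightarrow> real \<Rightarrow> 'a \<Rightarrow> real" where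
 "eps p q w = (Ys q w - Ys p w) - coef (q - p) / sqrt V * uh p w"

text \<open>Weight with which thermal noise injected at time \<open>x\<close> shows up in the
  observation at \<open>q\<close>.\<close>

definition bg :: "real \<Rightarrow> real \<Rightarrow> real" where
 "bg q x = \<tau> * \<beta> / sqrt V * (1 - exp (- (q - x) / \<tau>))"

abbreviation "xa p q \<equiv> 1 * 0 + coef (q - p) / sqrt V * \<Phi> p 0"
abbreviation "xf p q \<equiv> \<lambda>x. 1 * band p q (bg q) x + coef (q - p) / sqrt V * ef p x"
abbreviation "xg p q \<equiv> \<lambda>x. 1 * band p q (\<lambda>_. 1) x + coef (q - p) / sqrt V * eg p x"

definition "var_inn p q = integral {p..q} (\<lambda>x. bg q x * bg q x) + (q - p)"
definition "var_eps p q = (coef (q - p) / sqrt V)^2 * P p + var_inn p q"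

lemma bg_cont: "continuous_on S (bg q)"
 unfolding bg_def using \<tau> V by (intro continuous_intros) auto

lemma coef_bounds: "0 \<le> d \<Longrightarrow> 0 \<le> coef d" "0 \<le> d \<Longrightarrow> coef d \<le> d" "0 \<le> d \<Longrightarrow> d - d^2 / (2 * \<tau>) \<le> coef d"
proof -
 assume d: "0 \<le> d"
 then have x: "0 \<le> d / \<tau>" using \<tau> by simp
 show "0 \<le> coef d" using one_minus_exp_bounds(1)[OF x] \<tau> by (simp add: coef_def)
 have "\<tau> * (1 - exp (- (d / \<tau>))) \<le> \<tau> * (d / \<tau>)" using one_minus_exp_bounds(2)[OF x] \<tau> by (intro mult_left_mono) auto
 then show "coef d \<le> d" using \<tau> by (simp add: coef_def)
 have "\<tau> * (d / \<tau> - (d / \<tau>)^2 / 2) \<le> \<tau> * (1 - exp (- (d / \<tau>)))" using one_minus_exp_bounds(3)[OF x] \<tau> by (intro mult_left_mono) auto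
 moreover have "\<tau> * (d / \<tau> - (d / \<tau>)^2 / 2) = d - d^2 / (2 * \<tau>)" using \<tau> by (simp add: field_simps power2_eq_square)
 ultimately show "d - d^2 / (2 * \<tau>) \<le> coef d" by (simp add: coef_def)
qed

lemma bg_bounds: assumes "p \<le> x" "x \<le> q"
 shows "0 \<le> bg q x * bg q x" "bg q x * bg q x \<le> \<beta>^2 / V * (q - p)^2"
proof -
 have "coef (q - x) \<le> q - x" "0 \<le> coef (q - x)" using assms coef_bounds by auto
 then have c: "0 \<le> coef (q - x)" "coef (q - x) \<le> q - p" using assms by auto
 have "bg q x * bg q x = \<beta>^2 / V * (coef (q - x))^2"
  using V by (simp add: bg_def coef_def power2_eq_square)
 moreover have "(coef (q - x))^2 \<le> (q - p)^2" using c by (intro power_mono) auto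
 then have "\<beta>^2 / V * (coef (q - x))^2 \<le> \<beta>^2 / V * (q - p)^2" using V by (intro mult_left_mono) auto
 ultimately show "bg q x * bg q x \<le> \<beta>^2 / V * (q - p)^2" by (simp only:)
qed simp

text \<open>The thermal noise arriving within a cell adds only a third-order term to the variance of
  the measurement noise, negligible after summation over a partition.\<close>

lemma var_inn_bounds: assumes "p \<le> q"
 shows "q - p \<le> var_inn p q" "var_inn p q \<le> (q - p) + \<beta>^2 / V * (q - p)^2 * (q - p)"
proof -
 have i: "(\<lambda>x. bg q x * bg q x) integrable_on {p..q}"
  by (intro integrable_continuous_interval continuous_on_mult bg_cont)
 have "0 \<le> integral {p..q} (\<lambda>x. bg q x * bg q x)"
  by (rule hk_integral_nonneg[OF i]) simp
 then show "q - p \<le> var_inn p q" by (simp add: var_inn_def)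
 have "integral {p..q} (\<lambda>x. bg q x * bg q x) \<le> integral {p..q} (\<lambda>x. \<beta>^2 / V * (q - p)^2)"
  by (rule integral_le[OF i]) (use bg_bounds in auto)
 then show "var_inn p q \<le> (q - p) + \<beta>^2 / V * (q - p)^2 * (q - p)"
  using assms by (simp add: var_inn_def mult.commute mult.left_commute)
qed

text \<open>By the semigroup property of the exponential, noise from before \<open>p\<close> reaches
  the increment only through the signal at \<open>p\<close>; subtracting that multiple leaves
  integrands supported on the cell.\<close>

lemma rep_inn:
 assumes p: "0 \<le> p" "p \<le> q"
 shows "rep (inn p q) 0 (band p q (bg q)) (band p q (\<lambda>_. 1))"
proof -
 let ?c = "coef (q - p) / sqrt V"
 have q: "0 \<le> q" using p by simp
 have "rep (\<lambda>x. 1 * (1 * Ys q x + (-1) * Ys p x) + (- ?c) * u p x)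
  (1 * (1 * (hc q) + (-1) * (hc p)) + (- ?c) * exp (- p / \<tau>))
  (\<lambda>x. 1 * (1 * hf q x + (-1) * hf p x)
    + (- ?c) * uf p x)
  (\<lambda>x. 1 * (1 * one q x + (-1) * one p x) + (- ?c) * nul p x)"
  by (intro rep_lin rep_Ys rep_u p q)
 moreover have "(\<lambda>x. 1 * (1 * Ys q x + (-1) * Ys p x) + (- ?c) * u p x) = inn p q"
  by (simp add: fun_eq_iff inn_def)
 moreover have e: "exp (- (q - x) / \<tau>) = exp (- (q - p) / \<tau>) * exp (- (p - x) / \<tau>)" for x
  by (simp add: exp_add[symmetric] add_divide_distrib[symmetric])
 have "1 * (1 * (hc q) + (-1) * (hc p)) + (- ?c) * exp (- p / \<tau>) = 0"
  using e[of 0] V by (simp add: coef_def field_simps)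
 moreover have "(\<lambda>x. 1 * (1 * hf q x + (-1) * hf p x)
    + (- ?c) * uf p x) = band p q (bg q)"
 proof
  fix x
  consider "x \<le> p" | "p < x" "x \<le> q" | "q < x" by linarith
  then show "1 * (1 * hf q x + (-1) * hf p x)
    + (- ?c) * uf p x = band p q (bg q) x"
  proof cases
   case 1
   define y where "y = exp (- (p - x) / \<tau>)"
   define w where "w = exp (- (q - p) / \<tau>)"
   define c where "c = sqrt V"
   have "c \<noteq> 0" using V by (simp add: c_def)
   then have "\<tau> * \<beta> / c * (1 - exp (- (q - x) / \<tau>)) - \<tau> * \<beta> / c * (1 - exp (- (p - x) / \<tau>))
     - \<tau> * (1 - exp (- (q - p) / \<tau>)) / c * (\<beta> * exp (- (p - x) / \<tau>)) = 0"
    unfolding e[of x] y_def[symmetric] w_def[symmetric] by (simp add: field_simps)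
   then show ?thesis using 1 p unfolding cut_def band_def coef_def c_def by simp
  qed (use p in \<open>auto simp: cut_def band_def bg_def\<close>)
 qed
 moreover have "(\<lambda>x. 1 * (1 * one q x + (-1) * one p x) + (- ?c) * nul p x) = band p q (\<lambda>_. 1)"
  using p by (auto simp: cut_def band_def fun_eq_iff)
 ultimately show ?thesis by (simp only:)
qed

lemma qn_inn_inn:
 assumes "0 \<le> p" "p \<le> q"
 shows "qlim 0 (band p q (bg q)) (band p q (\<lambda>_. 1)) 0 (band p q (bg q)) (band p q (\<lambda>_. 1)) (var_inn p q)"
proof -
 have m: "(\<lambda>x. band p q f x * band p q g x) = band p q (\<lambda>x. f x * g x)" for f g by (auto simp: band_def)
 have "(\<lambda>n. 0 * 0 * s0^2 + dint n (band p q (\<lambda>x. bg q x * bg q x)) + dint n (band p q (\<lambda>x. 1 * 1)))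
  \<longlonglongrightarrow> 0 * 0 * s0^2 + integral {p..q} (\<lambda>x. bg q x * bg q x) + integral {p..q} (\<lambda>x. 1 * 1)"
  by (intro tendsto_intros dint_band assms continuous_on_mult bg_cont continuous_on_const)
 then show ?thesis using assms by (simp add: qn_def m var_inn_def)
qed

lemma qn_band_cut: "r \<le> p \<Longrightarrow> qn n 0 (band p q f) (band p q g) a (cut r f') (cut r g') = 0"
proof -
 assume "r \<le> p"
 then have "(\<lambda>x. band p q f x * cut r h x) = (\<lambda>x. 0)" for f h by (auto simp: band_def cut_def)
 then show ?thesis by (simp add: qn_def dint_def)
qed

lemma eps_inn: "eps p q w = 1 * inn p q w + coef (q - p) / sqrt V * er p w"
 by (simp add: eps_def inn_def er_def algebra_simps)

lemma rep_eps:
 assumes "0 \<le> p" "p \<le> q"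
 shows "rep (eps p q) (xa p q)
  (xf p q)
  (xg p q)"
 unfolding eps_inn[abs_def] by (intro rep_lin rep_inn rep_er assms)

text \<open>\<open>inn\<close> uses noise after \<open>p\<close> only, while the error at
  \<open>p\<close> uses the initial value and noise up to \<open>p\<close>, so the cross terms
  vanish exactly at every level \<open>n\<close>.\<close>

lemma qn_eps:
 assumes p: "0 \<le> p" "p \<le> q"
 shows "qlim (xa p q)
  (xf p q)
  (xg p q)
  (xa p q)
  (xf p q)
  (xg p q) (var_eps p q)"
 (is "qlim ?a ?f ?g ?a ?f ?g _")
 and "qlim (\<Phi> p 0) (ef p) (eg p)
  (xa p q)
  (xf p q)
  (xg p q) (coef (q - p) / sqrt V * P p)"
proof -
 let ?c = "coef (q - p) / sqrt V"
 let ?ea = "\<Phi> p 0" and ?ef = "ef p" and ?eg = "eg p"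
 let ?bf = "band p q (bg q)" and ?bg = "band p q (\<lambda>_. 1)"
 have 1: "qn n 0 ?bf ?bg ?ea ?ef ?eg = 0" for n by (rule qn_band_cut) (rule order_refl)
 have 2: "qn n ?ea ?ef ?eg 0 ?bf ?bg = 0" for n by (subst qn_commute) (rule 1)
 have e: "qn n ?ea ?ef ?eg ?a ?f ?g = ?c * qn n ?ea ?ef ?eg ?ea ?ef ?eg" for n
  by (subst qn_commute, subst qn_lin) (simp only: 1 2 mult_1_left mult_zero_right add_0_left add_0_right)
 have i: "qn n 0 ?bf ?bg ?a ?f ?g = qn n 0 ?bf ?bg 0 ?bf ?bg" for n
  by (subst qn_commute, subst qn_lin) (simp only: 1 2 mult_1_left mult_zero_right add_0_left add_0_right)
 have "qn n ?a ?f ?g ?a ?f ?g = qn n 0 ?bf ?bg 0 ?bf ?bg + ?c * (?c * qn n ?ea ?ef ?eg ?ea ?ef ?eg)" for n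
  by (subst qn_lin, subst e, subst i) (rule arg_cong2[where f="(+)"], simp_all only: mult_1)
 moreover have "(\<lambda>n. qn n 0 ?bf ?bg 0 ?bf ?bg + ?c * (?c * qn n ?ea ?ef ?eg ?ea ?ef ?eg)) \<longlonglongrightarrow> var_inn p q + ?c * (?c * P p)"
  by (intro tendsto_intros qn_inn_inn qn_er_er p)
 ultimately show "qlim ?a ?f ?g ?a ?f ?g (var_eps p q)"
  by (simp add: var_eps_def power2_eq_square add.commute mult.assoc)
 show "qlim ?ea ?ef ?eg ?a ?f ?g (?c * P p)"
  unfolding e by (intro tendsto_intros qn_er_er p)
qed

lemma qn_eps_Ys:
 assumes p: "0 \<le> p" "p \<le> q" and r: "0 \<le> r" "r \<le> p"
 shows "qlim (xa p q)
  (xf p q)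
  (xg p q)
  (hc r) (hf r) (one r) 0"
 unfolding qn_lin qn_band_cut[OF r(2)]
 using tendsto_mult_left[OF qn_er_Ys[OF r], of "coef (q - p) / sqrt V"] by simp

lemma var_eps_pos: "0 \<le> p \<Longrightarrow> p < q \<Longrightarrow> var_eps p q > 0"
 using var_inn_bounds(1)[of p q] P_pos[of p] unfolding var_eps_def
 by (intro add_nonneg_pos) auto

lemma eps_indep:
 assumes p: "0 \<le> p" "p \<le> q"
 shows "indep_pair M borel (eps p q) (path_space {0..p}) (path Ys {0..p})"
 unfolding path_def[abs_def]
 by (rule rep_indep[OF rep_eps[OF p] rep_Ys qn_eps(1)[OF p] qn_Ys_Ys qn_eps_Ys[OF p]]) auto

lemma eps_distr: "0 \<le> p \<Longrightarrow> p < q \<Longrightarrow> distr M borel (eps p q) = density lborel (normal_density 0 (sqrt (var_eps p q)))"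
 by (rule rep_normal(1)[OF rep_eps qn_eps(1) var_eps_pos]) auto

lemma er_eps:
 assumes p: "0 \<le> p" "p \<le> q"
 shows "integrable M (\<lambda>w. er p w * eps p q w)" "(LINT w|M. er p w * eps p q w) = coef (q - p) / sqrt V * P p"
 using rep_cov[OF rep_er[OF p(1)] rep_eps[OF p] qn_er_er[OF p(1)] qn_eps(1)[OF p] qn_eps(2)[OF p]] by auto

text \<open>The innovation as a functional of the observation path, so that it can be evaluated on a
  path independent of the signal.\<close>

definition epsf :: "real \<Rightarrow> real \<Rightarrow> (real \<Rightarrow> real) \<Rightarrow> real" where
 "epsf p q y = (y q - y p) - coef (q - p) / sqrt V * hat p y"

lemma measurable_epsf: "0 \<le> p \<Longrightarrow> p \<le> q \<Longrightarrow> {0..q} \<subseteq> I \<Longrightarrow> epsf p q \<in> borel_measurable (path_space I)"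
proof -
 assume *: "0 \<le> p" "p \<le> q" "{0..q} \<subseteq> I"
 then have "{0..p} \<subseteq> I" "p \<in> I" "q \<in> I" by auto
 note [measurable] = measurable_hat[OF this(1)]
 show ?thesis unfolding epsf_def[abs_def] using \<open>p \<in> I\<close> \<open>q \<in> I\<close> by measurable
qed

lemma epsf_path: "0 \<le> p \<Longrightarrow> p \<le> q \<Longrightarrow> {0..q} \<subseteq> I \<Longrightarrow> epsf p q (path Ys I w) = eps p q w"
proof -
 assume *: "0 \<le> p" "p \<le> q" "{0..q} \<subseteq> I"
 then have "{0..p} \<subseteq> I" "p \<in> I" "q \<in> I" by auto
 then show ?thesis using uh_path[of p I w] by (simp add: epsf_def eps_def path_def)
qed

text \<open>Log-likelihood ratio of the increments given the signal values \<open>x i\<close> against the increments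
 alone, with \<open>var_eps\<close> for the conditional variance so that its exponential has mean exactly 1.\<close>

definition psi :: "nat \<Rightarrow> (nat \<Rightarrow> real) \<Rightarrow> (nat \<Rightarrow> real) \<Rightarrow> (real \<Rightarrow> real) \<Rightarrow> real" where
 "psi n p x y = (\<Sum>i<n. (x i - hat (p i) y) / sqrt V * epsf (p i) (p (Suc i)) y
   - ((x i - hat (p i) y) / sqrt V)^2 * var_eps (p i) (p (Suc i)) / 2)"

lemma measurable_psi:
 assumes p: "0 \<le> p 0" "\<And>i. i < n \<Longrightarrow> p i < p (Suc i)" "{0..p n} \<subseteq> I"
 shows "(\<lambda>z. psi n p (fst z) (snd z)) \<in> borel_measurable (vecs n \<Otimes>\<^sub>M path_space I)"
proof -
 have le: "p i \<le> p j" if "i \<le> j" "j \<le> n" for i j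
  by (rule partition_le[of n p i j]) (use that p in \<open>auto intro: less_imp_le\<close>)
 have [measurable]: "hat (p i) \<in> borel_measurable (path_space I)" "epsf (p i) (p (Suc i)) \<in> borel_measurable (path_space I)"
  if "i < n" for i
 proof -
  have "0 \<le> p i" "p i \<le> p (Suc i)" "p (Suc i) \<le> p n" using le[of 0 i] le[of i "Suc i"] le[of "Suc i" n] that p by auto
  then show "hat (p i) \<in> borel_measurable (path_space I)" "epsf (p i) (p (Suc i)) \<in> borel_measurable (path_space I)"
   using p(3) by (auto intro!: measurable_hat measurable_epsf)
 qed
 show ?thesis unfolding psi_def by measurable
qed

text \<open>The signal values \<open>x\<close> are held fixed while the observation varies, as under
  the product law. Given the observations up to \<open>p n\<close>, the last innovation is an
  independent Gaussian with variance \<open>var_eps\<close>, and its exponential factor integrates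
  to 1.\<close>

lemma psi_exp:
 assumes p: "0 \<le> p 0" "\<And>i. i < n \<Longrightarrow> p i < p (Suc i)"
 shows "(\<integral>\<^sup>+w. ennreal (exp (psi n p x (path Ys {0..p n} w))) \<partial>M) = 1"
 using assms
proof (induction n)
 case 0
 then show ?case by (simp add: psi_def emeasure_space_1)
next
 case (Suc n)
 have le: "p i \<le> p j" if "i \<le> j" "j \<le> Suc n" for i j
  by (rule partition_le[of "Suc n" p i j]) (use that Suc.prems in \<open>auto intro: less_imp_le\<close>)
 have pn: "0 \<le> p n" "p n < p (Suc n)" using le[of 0 n] Suc.prems by auto
 let ?T = "path_space {0..p n}" and ?Y = "path Ys {0..p n}"
 let ?S = "var_eps (p n) (p (Suc n))"
 have S: "?S > 0" using var_eps_pos pn by simp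
 define a where "a y = (x n - hat (p n) y) / sqrt V" for y
 have [measurable]: "a \<in> borel_measurable ?T"
  unfolding a_def using measurable_hat[of "p n" "{0..p n}"] by measurable
 have Fm[measurable]: "(\<lambda>y. exp (psi n p x y)) \<in> borel_measurable ?T"
 proof -
  have "(\<lambda>y. (restrict x {..<n}, y)) \<in> measurable ?T (vecs n \<Otimes>\<^sub>M ?T)"
   by (intro measurable_Pair measurable_const measurable_ident_sets) (auto simp: space_PiM)
  from measurable_compose[OF this measurable_psi[of p n "{0..p n}"]]
  have "(\<lambda>y. psi n p (restrict x {..<n}) y) \<in> borel_measurable ?T" using Suc.prems by simp
  then show ?thesis by (simp add: psi_def)
 qed
 have ih: "(\<integral>\<^sup>+w. ennreal (exp (psi n p x (?Y w))) \<partial>M) = 1" by (rule Suc.IH) (use Suc.prems in auto)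
 have eY[measurable]: "eps (p n) (p (Suc n)) \<in> borel_measurable M" "?Y \<in> measurable M ?T"
  and ind: "distr M (borel \<Otimes>\<^sub>M ?T) (\<lambda>w. (eps (p n) (p (Suc n)) w, ?Y w)) = distr M borel (eps (p n) (p (Suc n))) \<Otimes>\<^sub>M distr M ?T ?Y"
  using eps_indep[of "p n" "p (Suc n)"] pn by (auto simp: indep_pair_def)
 let ?D = "distr M borel (eps (p n) (p (Suc n)))"
 interpret D: prob_space ?D by (rule prob_space_distr) simp
 interpret Y: prob_space "distr M ?T ?Y" by (rule prob_space_distr) simp
 interpret DY: pair_prob_space ?D "distr M ?T ?Y" ..
 define G where "G z = ennreal (exp (psi n p x (snd z))) * ennreal (exp (a (snd z) * fst z - (a (snd z))^2 * ?S / 2))" for z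
 have Gm[measurable]: "G \<in> borel_measurable (borel \<Otimes>\<^sub>M ?T)" unfolding G_def by measurable
 have "psi (Suc n) p x (path Ys {0..p (Suc n)} w) = psi n p x (?Y w) + (a (?Y w) * eps (p n) (p (Suc n)) w - (a (?Y w))^2 * ?S / 2)" for w
 proof -
  have h: "hat (p i) (path Ys {0..p (Suc n)} w) = hat (p i) (?Y w)" if "i \<le> n" for i
  proof -
   have "p i \<le> p n" "p i \<le> p (Suc n)" using le that by auto
   then show ?thesis using uh_path[of "p i" "{0..p (Suc n)}" w] uh_path[of "p i" "{0..p n}" w] by simp
  qed
  have e: "epsf (p i) (p (Suc i)) (path Ys {0..p (Suc n)} w) = eps (p i) (p (Suc i)) w" if "i \<le> n" for i
   by (rule epsf_path) (use le[of 0 i] le[of i "Suc i"] le[of "Suc i" "Suc n"] that Suc.prems in auto)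
  have e': "epsf (p i) (p (Suc i)) (?Y w) = eps (p i) (p (Suc i)) w" if "i < n" for i
   by (rule epsf_path) (use le[of 0 i] le[of i "Suc i"] le[of "Suc i" n] that Suc.prems in auto)
  show ?thesis unfolding psi_def a_def by (simp add: h e e')
 qed
 then have "(\<integral>\<^sup>+w. ennreal (exp (psi (Suc n) p x (path Ys {0..p (Suc n)} w))) \<partial>M) = (\<integral>\<^sup>+w. G (eps (p n) (p (Suc n)) w, ?Y w) \<partial>M)"
  by (simp add: G_def exp_add ennreal_mult)
 also have "... = (\<integral>\<^sup>+z. G z \<partial>distr M (borel \<Otimes>\<^sub>M ?T) (\<lambda>w. (eps (p n) (p (Suc n)) w, ?Y w)))"
  by (rule nn_integral_distr[symmetric]) measurable
 also have "... = (\<integral>\<^sup>+y. (\<integral>\<^sup>+e. G (e, y) \<partial>?D) \<partial>distr M ?T ?Y)"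
  unfolding ind by (subst DY.nn_integral_snd[symmetric]) simp_all
 also have "... = (\<integral>\<^sup>+y. ennreal (exp (psi n p x y)) \<partial>distr M ?T ?Y)"
 proof (rule nn_integral_cong)
  fix y
  have "(\<integral>\<^sup>+e. G (e, y) \<partial>?D) = ennreal (exp (psi n p x y)) * (\<integral>\<^sup>+e. 1 * ennreal (exp (a y * ?S * e / ?S - (a y * ?S)^2 / (2 * ?S))) \<partial>?D)"
  proof -
   have "a y * ?S * e / ?S - (a y * ?S)^2 / (2 * ?S) = a y * e - (a y)^2 * ?S / 2" for e
    using S by (simp add: field_simps power2_eq_square)
   then show ?thesis unfolding G_def fst_conv snd_conv by (subst nn_integral_cmult[symmetric]) auto
  qed
  also have "(\<integral>\<^sup>+e. 1 * ennreal (exp (a y * ?S * e / ?S - (a y * ?S)^2 / (2 * ?S))) \<partial>?D) = (\<integral>\<^sup>+e. 1 \<partial>?D)"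
   unfolding eps_distr[OF pn] by (rule normal_tilt[OF S]) auto
  also have "... = 1" using D.emeasure_space_1 by simp
  finally show "(\<integral>\<^sup>+e. G (e, y) \<partial>?D) = ennreal (exp (psi n p x y))" by simp
 qed
 also have "... = (\<integral>\<^sup>+w. ennreal (exp (psi n p x (?Y w))) \<partial>M)"
  by (rule nn_integral_distr) measurable
 finally show ?case using ih by simp
qed

end

section \<open>Partitions, expected path integrals and the lower bound\<close>

definition is_part :: "nat \<Rightarrow> (nat \<Rightarrow> real) \<Rightarrow> real \<Rightarrow> real \<Rightarrow> bool" where
 "is_part n p t \<delta> \<longleftrightarrow> p 0 = 0 \<and> p n = t \<and> (\<forall>i<n. p i < p (Suc i) \<and> p (Suc i) - p i \<le> \<delta>)"

lemma is_part_le: "is_part n p t \<delta> \<Longrightarrow> i \<le> j \<Longrightarrow> j \<le> n \<Longrightarrow> p i \<le> p j"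
 by (rule partition_le[of n p]) (auto simp: is_part_def less_imp_le)

lemma is_part_less: "is_part n p t \<delta> \<Longrightarrow> i < j \<Longrightarrow> j \<le> n \<Longrightarrow> p i < p j"
proof -
 assume *: "is_part n p t \<delta>" "i < j" "j \<le> n"
 then have "p i < p (Suc i)" by (simp add: is_part_def)
 also have "p (Suc i) \<le> p j" using * by (intro is_part_le[of n p t \<delta>]) auto
 finally show ?thesis .
qed

lemma is_part_range: "is_part n p t \<delta> \<Longrightarrow> i \<le> n \<Longrightarrow> 0 \<le> p i \<and> p i \<le> t"
 using is_part_le[of n p t \<delta> 0 i] is_part_le[of n p t \<delta> i n] by (auto simp: is_part_def)

lemma is_part_sum: "is_part n p t \<delta> \<Longrightarrow> (\<Sum>i<n. p (Suc i) - p i) = t"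
 by (simp add: is_part_def sum_lessThan_telescope)

lemma is_part_exists:
 assumes F: "finite F" "F \<subseteq> {0..t}" and t: "0 \<le> t" and \<delta>: "\<delta> > 0"
 shows "\<exists>n p. is_part n p t \<delta> \<and> F \<subseteq> p ` {..n}"
proof -
 obtain m :: nat where m: "t / \<delta> < real m" using reals_Archimedean2 by blast
 have m0: "m > 0" using m t \<delta> by (cases m) (auto simp: field_simps not_less)
 define h where "h = t / real m"
 have h: "0 \<le> h" "h \<le> \<delta>" "real m * h = t" using m m0 t \<delta> by (auto simp: h_def field_simps)
 \<comment> \<open>For \<open>t = 0\<close> all grid points collapse to 0 and the partition has no
   cells.\<close>
 define G where "G = F \<union> {0, t} \<union> (\<lambda>k. real k * h) ` {..m}"
 have G: "finite G" "G \<subseteq> {0..t}"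
 proof -
  have "real k * h \<le> t" if "k \<le> m" for k using h that by (metis mult_right_mono of_nat_mono)
  then show "finite G" "G \<subseteq> {0..t}" using F t h by (auto simp: G_def)
 qed
 define xs where "xs = sorted_list_of_set G"
 have xs: "set xs = G" "sorted_wrt (<) xs" using G by (auto simp: xs_def)
 have len: "length xs > 0" using xs(1) by (cases xs) (auto simp: G_def)
 define p where "p i = xs ! i" for i
 define n where "n = length xs - 1"
 have less: "p i < p j" if "i < j" "j \<le> n" for i j
  using sorted_wrt_nth_less[OF xs(2) that(1)] that len by (simp add: p_def n_def)
 have le: "p i \<le> p j" if "i \<le> j" "j \<le> n" for i j using less[of i j] that by (cases "i = j") auto
 have "{..n} = {0..<length xs}" using len unfolding n_def by (cases "length xs") auto
 then have rng: "p ` {..n} = G" using nth_image[of "length xs" xs] xs(1) by (simp add: p_def[abs_def])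
 have p0: "p 0 = 0"
 proof -
  have "0 \<in> p ` {..n}" unfolding rng by (simp add: G_def)
  then obtain i where "i \<le> n" "p i = 0" by auto
  moreover have "p 0 \<in> G" using rng by auto
  ultimately show ?thesis using le[of 0 i] G(2) by auto
 qed
 have pn: "p n = t"
 proof -
  have "t \<in> p ` {..n}" unfolding rng by (simp add: G_def)
  then obtain i where "i \<le> n" "p i = t" by auto
  moreover have "p n \<in> G" using rng by auto
  ultimately show ?thesis using le[of i n] G(2) by auto
 qed
 have gap: "p (Suc i) - p i \<le> \<delta>" if i: "i < n" for i
 proof (rule ccontr)
  assume "\<not> p (Suc i) - p i \<le> \<delta>"
  then have big: "p i + h < p (Suc i)" using h by simp
  have "p i \<in> G" "p (Suc i) \<in> G" using rng i by auto
  then have b: "0 \<le> p i" "p (Suc i) \<le> t" using G(2) by auto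
  have hpos: "h > 0"
  proof (rule ccontr)
   assume "\<not> h > 0" then have "t = 0" using h by auto
   then show False using b big h by auto
  qed
  \<comment> \<open>The first grid point beyond \<open>p i\<close>; a gap larger than
    \<open>h\<close> would place it strictly between neighbours.\<close>
  define k where "k = nat \<lfloor>p i / h\<rfloor> + 1"
  have fl: "real k = real_of_int \<lfloor>p i / h\<rfloor> + 1" using b hpos by (simp add: k_def)
  then have "p i / h < real k" "real k \<le> p i / h + 1" by linarith+
  then have k: "p i < real k * h" "real k * h \<le> p i + h" using hpos by (simp_all add: field_simps)
  then have "real k * h < real m * h" using big b h by linarith
  then have "k \<le> m" using hpos by simp
  then have "real k * h \<in> p ` {..n}" unfolding rng by (auto simp: G_def)
  then obtain j where j: "j \<le> n" "p j = real k * h" by auto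
  have "i < j" using j k le[of j i] i by (cases "j \<le> i") auto
  moreover have "j < Suc i" using j k big le[of "Suc i" j] i by (cases "Suc i \<le> j") auto
  ultimately show False by simp
 qed
 have "is_part n p t \<delta>" using p0 pn less gap by (auto simp: is_part_def)
 moreover have "F \<subseteq> p ` {..n}" unfolding rng by (auto simp: G_def)
 ultimately show ?thesis by blast
qed

lemma riemann_sum:
 assumes g: "continuous_on {0..t} g" and t: "0 \<le> t" and e: "e > 0"
 shows "\<exists>\<delta>>0. \<forall>n p. is_part n p t \<delta> \<longrightarrow> \<bar>(\<Sum>i<n. (gap p i) * g (p i)) - integral {0..t} g\<bar> \<le> e"
proof -
 have "uniformly_continuous_on {0..t} g" using g by (rule compact_uniformly_continuous) simp
 moreover have "e / (t + 1) > 0" using e t by simp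
 ultimately obtain d where d: "d > 0" "\<And>x x'. x \<in> {0..t} \<Longrightarrow> x' \<in> {0..t} \<Longrightarrow> dist x' x < d \<Longrightarrow> dist (g x') (g x) < e / (t + 1)"
  unfolding uniformly_continuous_on_def by metis
 show ?thesis
 proof (intro exI[of _ "d / 2"] conjI allI impI)
  fix n p assume p: "is_part n p t (d / 2)"
  have "\<bar>(\<Sum>i<n. g (p i) * integral {p i..p (Suc i)} (\<lambda>_. 1)) - integral {p 0..p n} (\<lambda>x. g x * 1)\<bar> \<le> e / (t + 1) * 1 * (p n - p 0)"
  proof (rule step_sum)
   show "p i \<le> p (Suc i)" if "i < n" for i using p that by (auto simp: is_part_def less_imp_le)
   show "continuous_on {p 0..p n} g" using p g by (simp add: is_part_def)
   fix i x assume i: "i < n" and x: "x \<in> {p i..p (Suc i)}"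
   have "0 \<le> p i" "p (Suc i) \<le> t" using is_part_range[OF p, of i] is_part_range[OF p, of "Suc i"] i by auto
   then have "p i \<in> {0..t}" "x \<in> {0..t}" "dist (p i) x < d" using x p i d(1) by (auto simp: is_part_def dist_real_def)
   then have "dist (g (p i)) (g x) < e / (t + 1)" using d(2) by blast
   then show "\<bar>g (p i) - g x\<bar> \<le> e / (t + 1)" by (simp add: dist_real_def)
  qed auto
  also have "e / (t + 1) * 1 * (p n - p 0) \<le> e" using p t e by (simp add: is_part_def field_simps)
  also have "(\<Sum>i<n. g (p i) * integral {p i..p (Suc i)} (\<lambda>_. 1)) = (\<Sum>i<n. (gap p i) * g (p i))"
   using p by (intro sum.cong) (auto simp: is_part_def less_imp_le)
  finally show "\<bar>(\<Sum>i<n. (gap p i) * g (p i)) - integral {0..t} g\<bar> \<le> e" using p by (simp add: is_part_def)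
 qed (use d in auto)
qed

text \<open>Tonelli for a process that is continuous only almost surely. The path integral itself
  need not be measurable, so a measurable \<open>g\<close> that agrees with it almost everywhere is
  returned.\<close>

lemma (in prob_space) nn_expectation_integral_le:
 fixes X :: "real \<Rightarrow> 'a \<Rightarrow> real"
 assumes ab: "a \<le> b" and X: "\<And>s. s \<in> {a..b} \<Longrightarrow> X s \<in> borel_measurable M" and X0: "\<And>s w. 0 \<le> X s w"
  and cont: "AE w in M. continuous_on {a..b} (\<lambda>s. X s w)"
  and c: "\<And>s. s \<in> {a..b} \<Longrightarrow> (\<integral>\<^sup>+w. ennreal (X s w) \<partial>M) \<le> ennreal c" and c0: "0 \<le> c"
 shows "\<exists>g\<in>borel_measurable M. (AE w in M. ennreal (integral {a..b} (\<lambda>s. X s w)) = g w) \<and> (\<integral>\<^sup>+w. g w \<partial>M) \<le> ennreal (c * (b - a))"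
proof -
 obtain N where N: "N \<in> null_sets M" "\<And>w. w \<in> space M \<Longrightarrow> w \<notin> N \<Longrightarrow> continuous_on {a..b} (\<lambda>s. X s w)"
  using cont by (elim AE_E3) auto
 \<comment> \<open>Clamping the time to \<open>{a..b}\<close> and zeroing the process on
   \<open>N\<close> gives paths that are continuous at every sample point and over all times, as
   joint measurability requires.\<close>
 define cl where "cl s = max a (min b s)" for s
 have cl: "cl s \<in> {a..b}" "s \<in> {a..b} \<Longrightarrow> cl s = s" for s using ab by (auto simp: cl_def)
 define X' where "X' s w = (if w \<in> N then 0 else X (cl s) w)" for s w
 have [measurable]: "N \<in> sets M" using N by auto
 have X'm: "X' s \<in> borel_measurable M" for s unfolding X'_def using X[OF cl(1)[of s]] by measurable
 have X'c: "continuous_on UNIV (\<lambda>s. X' s w)" if "w \<in> space M" for w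
 proof (cases "w \<in> N")
  case False
  have "continuous_on UNIV (\<lambda>s. X (cl s) w)"
   by (rule continuous_on_compose2[OF N(2)[OF that False]]) (use cl in \<open>auto simp: cl_def[abs_def] intro!: continuous_intros\<close>)
  then show ?thesis using False by (simp add: X'_def)
 qed (simp add: X'_def)
 have "(\<lambda>(s, w). indicator {0..} s * X' (s + a) w) \<in> borel_measurable (borel \<Otimes>\<^sub>M M)"
  by (rule borel_measurable_joint[OF X'm continuous_on_compose2[OF X'c]]) (auto intro!: continuous_intros)
 then have "(\<lambda>z. (\<lambda>(s, w). indicator {0..} s * X' (s + a) w) (fst z - a, snd z)) \<in> borel_measurable (borel \<Otimes>\<^sub>M M)"
  by (rule measurable_compose[rotated]) measurable
 then have "(\<lambda>z. indicator {a..b} (fst z) * (indicator {0..} (fst z - a) * X' (fst z) (snd z))) \<in> borel_measurable (borel \<Otimes>\<^sub>M M)"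
  by (intro borel_measurable_times[of "\<lambda>z. indicator {a..b} (fst z)"]) (auto simp: case_prod_beta)
 moreover have "indicator {a..b} (fst z) * (indicator {0..} (fst z - a) * X' (fst z) (snd z)) = indicator {a..b} (fst z) * X' (fst z) (snd z)" for z
  by (auto simp: indicator_def)
 ultimately have jm: "(\<lambda>z. indicator {a..b} (fst z) * X' (fst z) (snd z)) \<in> borel_measurable (borel \<Otimes>\<^sub>M M)" by simp
 then have jm': "(\<lambda>z. ennreal (indicator {a..b} (fst z) * X' (fst z) (snd z))) \<in> borel_measurable (lborel \<Otimes>\<^sub>M M)"
  by (simp cong: measurable_cong_sets)
 interpret pair_sigma_finite lborel M ..
 define g where "g w = (\<integral>\<^sup>+s. ennreal (indicator {a..b} s * X' s w) \<partial>lborel)" for w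
 have gm: "g \<in> borel_measurable M"
  unfolding g_def using lborel.borel_measurable_nn_integral_fst[OF measurable_compose[OF measurable_pair_swap' jm']] by (simp add: case_prod_beta)
 have ae: "AE w in M. ennreal (integral {a..b} (\<lambda>s. X s w)) = g w"
 proof -
  have "AE w in M. w \<notin> N" using N(1) by (rule AE_not_in)
  then show ?thesis unfolding g_def
   using AE_space
  proof eventually_elim
   case (elim w)
   have c: "continuous_on {a..b} (\<lambda>s. X s w)" by (rule N(2)) (use elim in auto)
   have si: "set_integrable lborel {a..b} (\<lambda>s. X s w)" by (rule borel_integrable_atLeastAtMost'[OF c])
   have "integral {a..b} (\<lambda>s. X s w) = (LINT s:{a..b}|lborel. X s w)" using set_borel_integral_eq_integral(2)[OF si] by simp
   also have "ennreal ... = (\<integral>\<^sup>+s. ennreal (indicator {a..b} s *\<^sub>R X s w) \<partial>lborel)"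
    unfolding set_lebesgue_integral_def using si X0
    by (intro nn_integral_eq_integral[symmetric]) (auto simp: set_integrable_def)
   also have "... = (\<integral>\<^sup>+s. ennreal (indicator {a..b} s * X' s w) \<partial>lborel)"
    using elim cl(2) by (intro nn_integral_cong) (auto simp: X'_def indicator_def)
   finally show ?case .
  qed
 qed
 have "(\<integral>\<^sup>+w. g w \<partial>M) = (\<integral>\<^sup>+s. (\<integral>\<^sup>+w. ennreal (indicator {a..b} s * X' s w) \<partial>M) \<partial>lborel)"
  unfolding g_def using Fubini'[of "\<lambda>s w. ennreal (indicator {a..b} s * X' s w)"] jm' by (simp add: case_prod_beta)
 also have "... \<le> (\<integral>\<^sup>+s. ennreal c * indicator {a..b} s \<partial>lborel)"
 proof (rule nn_integral_mono)
  fix s :: real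
  show "(\<integral>\<^sup>+w. ennreal (indicator {a..b} s * X' s w) \<partial>M) \<le> ennreal c * indicator {a..b} s"
  proof (cases "s \<in> {a..b}")
   case True
   have "(\<integral>\<^sup>+w. ennreal (indicator {a..b} s * X' s w) \<partial>M) \<le> (\<integral>\<^sup>+w. ennreal (X s w) \<partial>M)"
    using True cl(2)[OF True] X0 by (intro nn_integral_mono) (auto simp: X'_def)
   then show ?thesis using c[OF True] True by (auto intro: order_trans)
  qed simp
 qed
 also have "... = ennreal (c * (b - a))" using ab c0 by (simp add: nn_integral_cmult_indicator ennreal_mult)
 finally show ?thesis using gm ae by blast
qed

context prob_space
begin

definition L2 :: "('a \<Rightarrow> real) \<Rightarrow> bool" where
 "L2 f \<longleftrightarrow> f \<in> borel_measurable M \<and> integrable M (\<lambda>w. (f w)^2)"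

lemma L2_mult: assumes "L2 f" "L2 g" shows "integrable M (\<lambda>w. f w * g w)"
proof (rule Bochner_Integration.integrable_bound)
 show "integrable M (\<lambda>w. (f w)^2 + (g w)^2)" using assms by (auto simp: L2_def)
 have "\<bar>x * y\<bar> \<le> x^2 + y^2" for x y :: real
 proof -
  have "0 \<le> \<bar>x\<bar> * \<bar>y\<bar>" "2 * \<bar>x\<bar> * \<bar>y\<bar> \<le> x^2 + y^2" using sum_squares_bound[of "\<bar>x\<bar>" "\<bar>y\<bar>"] by auto
  then show ?thesis unfolding abs_mult by linarith
 qed
 then show "AE w in M. norm (f w * g w) \<le> norm ((f w)^2 + (g w)^2)" by auto
qed (use assms in \<open>auto simp: L2_def\<close>)

lemma L2_lin: assumes "L2 f" "L2 g" shows "L2 (\<lambda>w. c * f w + d * g w)"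
proof -
 have "(c * f w + d * g w)^2 = c^2 * (f w)^2 + 2 * c * d * (f w * g w) + d^2 * (g w)^2" for w
  by (simp add: power2_eq_square algebra_simps)
 then show ?thesis using assms L2_mult[OF assms] by (auto simp: L2_def)
qed

lemma L2_sum: assumes "\<And>i. i \<in> A \<Longrightarrow> L2 (f i)" shows "L2 (\<lambda>w. \<Sum>i\<in>A. c i * f i w)"
 using assms
proof (induction A rule: infinite_finite_induct)
 case (insert i A)
 then have "L2 (\<lambda>w. c i * f i w + 1 * (\<Sum>i\<in>A. c i * f i w))" by (intro L2_lin) auto
 then show ?case using insert by simp
qed (simp_all add: L2_def)

end

context kalman_drivers
begin

lemma rep_L2: "rep L a \<phi> \<psi> \<Longrightarrow> (\<lambda>n. qn n a \<phi> \<psi> a \<phi> \<psi>) \<longlonglongrightarrow> v \<Longrightarrow> L2 L"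
 using rep_moments(1) rep_measurable by (auto simp: L2_def)

lemma L2_er: "0 \<le> t \<Longrightarrow> L2 (er t)" by (rule rep_L2[OF rep_er qn_er_er])
lemma L2_u: "0 \<le> t \<Longrightarrow> L2 (u t)" by (rule rep_L2[OF rep_u qn_u_u])

lemma L2_Ys: "0 \<le> t \<Longrightarrow> L2 (Ys t)"
 using qn_Ys_Ys[of t t] rep_L2[OF rep_Ys] by (auto simp: convergent_def)

lemma L2_uh: "0 \<le> t \<Longrightarrow> L2 (uh t)"
 using L2_lin[OF L2_u L2_er, of t t 1 "-1"] by (simp add: er_def)

text \<open>With the true signal in the first slot, each term is the product of filter error and
  innovation minus a multiple of the squared error, and both have known means.\<close>

lemma psi_expectation:
 assumes p: "is_part n p t \<delta>"
 shows "integrable M (\<lambda>w. psi n p (\<lambda>i. u (p i) w) (path Ys {0..t} w))"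
  "(LINT w|M. psi n p (\<lambda>i. u (p i) w) (path Ys {0..t} w))
  = (\<Sum>i<n. coef (gap p i) / V * P (p i) - P (p i) / V * var_eps (p i) (p (Suc i)) / 2)"
proof -
 have r: "0 \<le> p i" "p i \<le> p (Suc i)" "p (Suc i) \<le> t" "p i \<le> t" if "i < n" for i
  using is_part_range[OF p, of i] is_part_range[OF p, of "Suc i"] is_part_le[OF p, of i "Suc i"] that by auto
 have eq: "psi n p (\<lambda>i. u (p i) w) (path Ys {0..t} w)
  = (\<Sum>i<n. er (p i) w * eps (p i) (p (Suc i)) w / sqrt V - (er (p i) w)^2 / V * var_eps (p i) (p (Suc i)) / 2)" for w
  unfolding psi_def
 proof (intro sum.cong refl)
  fix i assume "i \<in> {..<n}"
  then have i: "i < n" by simp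
  have "hat (p i) (path Ys {0..t} w) = uh (p i) w" using uh_path[of "p i" "{0..t}" w] r[OF i] by simp
  moreover have "epsf (p i) (p (Suc i)) (path Ys {0..t} w) = eps (p i) (p (Suc i)) w"
   by (rule epsf_path) (use r[OF i] in auto)
  ultimately show "(u (p i) w - hat (p i) (path Ys {0..t} w)) / sqrt V * epsf (p i) (p (Suc i)) (path Ys {0..t} w) -
    ((u (p i) w - hat (p i) (path Ys {0..t} w)) / sqrt V)^2 * var_eps (p i) (p (Suc i)) / 2
   = er (p i) w * eps (p i) (p (Suc i)) w / sqrt V - (er (p i) w)^2 / V * var_eps (p i) (p (Suc i)) / 2"
   using V by (simp add: er_def power_divide)
 qed
 have i: "integrable M (\<lambda>w. er (p i) w * eps (p i) (p (Suc i)) w)" "integrable M (\<lambda>w. (er (p i) w)^2)" if "i < n" for i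
  using er_eps(1) er_moments(1) r[OF that] by auto
 show "integrable M (\<lambda>w. psi n p (\<lambda>i. u (p i) w) (path Ys {0..t} w))"
  unfolding eq using i by (intro Bochner_Integration.integrable_sum) auto
 show "(LINT w|M. psi n p (\<lambda>i. u (p i) w) (path Ys {0..t} w))
  = (\<Sum>i<n. coef (gap p i) / V * P (p i) - P (p i) / V * var_eps (p i) (p (Suc i)) / 2)"
  unfolding eq
 proof (subst Bochner_Integration.integral_sum)
  show "(\<Sum>i<n. \<integral>w. er (p i) w * eps (p i) (p (Suc i)) w / sqrt V - (er (p i) w)^2 / V * var_eps (p i) (p (Suc i)) / 2 \<partial>M)
   = (\<Sum>i<n. coef (gap p i) / V * P (p i) - P (p i) / V * var_eps (p i) (p (Suc i)) / 2)"
  proof (intro sum.cong refl)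
   fix j assume "j \<in> {..<n}"
   then have j: "j < n" by simp
   have "(LINT w|M. er (p j) w * eps (p j) (p (Suc j)) w / sqrt V - (er (p j) w)^2 / V * var_eps (p j) (p (Suc j)) / 2)
    = coef (gap p j) / sqrt V * P (p j) / sqrt V - P (p j) / V * var_eps (p j) (p (Suc j)) / 2"
    using i[OF j] er_eps(2)[OF r(1,2)[OF j]] er_moments(2)[OF r(1)[OF j]] by simp
   then show "(LINT w|M. er (p j) w * eps (p j) (p (Suc j)) w / sqrt V - (er (p j) w)^2 / V * var_eps (p j) (p (Suc j)) / 2)
    = coef (gap p j) / V * P (p j) - P (p j) / V * var_eps (p j) (p (Suc j)) / 2" using V by simp
  qed
 qed (use i in auto)
qed

lemma P_bounded: "0 \<le> t \<Longrightarrow> \<exists>K>0. \<forall>s\<in>{0..t}. P s \<le> K"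
proof -
 assume "0 \<le> t"
 have "compact (P ` {0..t})" by (intro compact_continuous_image cont_on_nonneg) auto
 then obtain K where K: "\<And>s. s \<in> {0..t} \<Longrightarrow> \<bar>P s\<bar> \<le> K" by (force dest!: compact_imp_bounded simp: bounded_iff)
 show ?thesis by (intro exI[of _ "\<bar>K\<bar> + 1"]) (use K in force)
qed

text \<open>To first order in the cell length \<open>D\<close>, the cross term contributes
  \<open>D * P / V\<close> and the square takes half of it back; what remains is quadratic in
  \<open>D\<close>.\<close>

lemma psi_lower:
 assumes t: "0 \<le> t" and e: "e > 0"
 shows "\<exists>n p \<delta>. is_part n p t \<delta> \<and> 1 / (2 * V) * integral {0..t} P - e \<le> (LINT w|M. psi n p (\<lambda>i. u (p i) w) (path Ys {0..t} w))"
proof -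
 obtain Pm where Pm: "Pm > 0" "\<And>s. s \<in> {0..t} \<Longrightarrow> P s \<le> Pm" using P_bounded[OF t] by auto
 \<comment> \<open>One summand per source of quadratic error: \<open>coef D\<close> falling short of
   \<open>D\<close>, the share of the filter error in \<open>var_eps\<close>, and the excess of
   \<open>var_inn\<close> over \<open>D\<close>.\<close>
 define K where "K = Pm / (2 * \<tau> * V) + Pm * Pm / (2 * V * V) + Pm * (\<beta>^2 / V) / (2 * V)"
 have K: "K > 0" unfolding K_def using Pm \<tau> V by (intro add_pos_nonneg) auto
 \<comment> \<open>The tolerance \<open>V * e\<close> becomes \<open>e / 2\<close> after division by
   \<open>2 * V\<close>; the other half of \<open>e\<close> is spent on the quadratic
   errors.\<close>
 obtain d where d: "d > 0" "\<And>n p. is_part n p t d \<Longrightarrow> \<bar>(\<Sum>i<n. gap p i * P (p i)) - integral {0..t} P\<bar> \<le> V * e"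
  using riemann_sum[OF cont_on_nonneg t, of "V * e"] V e by auto
 define \<delta> where "\<delta> = min (min d 1) (e / (2 * K * (t + 1)))"
 have \<delta>: "\<delta> > 0" "\<delta> \<le> d" "\<delta> \<le> 1" "\<delta> \<le> e / (2 * K * (t + 1))" using d e K t by (auto simp: \<delta>_def)
 obtain n p where p: "is_part n p t \<delta>" using is_part_exists[of "{}" t \<delta>] t \<delta> by auto
 then have pd: "is_part n p t d" using \<delta>(2) by (force simp: is_part_def)
 have tm: "gap p i * P (p i) / (2 * V) - (gap p i) * \<delta> * K
   \<le> coef (gap p i) / V * P (p i) - P (p i) / V * var_eps (p i) (p (Suc i)) / 2" if i: "i < n" for i
 proof -
  define D where "D = p (Suc i) - p i"
  define Q where "Q = P (p i)"
  have D: "0 < D" "D \<le> \<delta>" "D \<le> 1" using p i \<delta> by (auto simp: D_def is_part_def)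
  have r: "0 \<le> p i" "p i \<le> t" using is_part_range[OF p, of i] i by auto
  then have Q: "0 < Q" "Q \<le> Pm" using P_pos Pm by (auto simp: Q_def)
  have c: "D - D^2 / (2 * \<tau>) \<le> coef D" "0 \<le> coef D" "coef D \<le> D" using coef_bounds[of D] D by auto
  have v: "var_eps (p i) (p (Suc i)) \<le> D^2 / V * Q + (D + \<beta>^2 / V * D^2)"
  proof -
   have "(coef D / sqrt V)^2 * Q \<le> D^2 / V * Q"
    using c Q V by (intro mult_right_mono) (auto simp: power_divide intro!: divide_right_mono power_mono)
   moreover have "\<beta>^2 / V * D^2 * D \<le> \<beta>^2 / V * D^2 * 1" using D V by (intro mult_left_mono) auto
   then have "var_inn (p i) (p (Suc i)) \<le> D + \<beta>^2 / V * D^2"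
    using var_inn_bounds(2)[of "p i" "p (Suc i)"] D by (simp add: D_def)
   ultimately show ?thesis by (simp add: var_eps_def D_def Q_def)
  qed
  have "D * Q / (2 * V) - D * D * K \<le> (D - D^2 / (2 * \<tau>)) / V * Q - Q / V * (D^2 / V * Q + (D + \<beta>^2 / V * D^2)) / 2"
  proof -
   have "(D - D^2 / (2 * \<tau>)) / V * Q - Q / V * (D^2 / V * Q + (D + \<beta>^2 / V * D^2)) / 2
     = D * Q / (2 * V) - D * D * (Q / (2 * \<tau> * V) + Q * Q / (2 * V * V) + Q * (\<beta>^2 / V) / (2 * V))"
    using \<tau> V by (simp add: field_simps power2_eq_square)
   moreover have "Q / (2 * \<tau> * V) + Q * Q / (2 * V * V) + Q * (\<beta>^2 / V) / (2 * V) \<le> K"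
    unfolding K_def using Q V \<tau> by (intro add_mono divide_right_mono mult_mono) auto
   then have "D * D * (Q / (2 * \<tau> * V) + Q * Q / (2 * V * V) + Q * (\<beta>^2 / V) / (2 * V)) \<le> D * D * K"
    using D by (intro mult_left_mono) auto
   ultimately show ?thesis by linarith
  qed
  also have "... \<le> coef D / V * Q - Q / V * var_eps (p i) (p (Suc i)) / 2"
  proof (rule diff_mono)
   show "(D - D^2 / (2 * \<tau>)) / V * Q \<le> coef D / V * Q" using c Q V by (intro mult_right_mono divide_right_mono) auto
   show "Q / V * var_eps (p i) (p (Suc i)) / 2 \<le> Q / V * (D^2 / V * Q + (D + \<beta>^2 / V * D^2)) / 2"
    using v Q V by (intro divide_right_mono mult_left_mono) auto
  qed
  finally have 1: "D * Q / (2 * V) - D * D * K \<le> coef D / V * Q - Q / V * var_eps (p i) (p (Suc i)) / 2" .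
  have "D * D * K \<le> D * \<delta> * K" using D K by (intro mult_right_mono mult_left_mono) auto
  then show ?thesis using 1 unfolding D_def Q_def by linarith
 qed
 have "(\<Sum>i<n. gap p i * P (p i) / (2 * V) - (gap p i) * \<delta> * K)
  \<le> (\<Sum>i<n. coef (gap p i) / V * P (p i) - P (p i) / V * var_eps (p i) (p (Suc i)) / 2)"
  by (intro sum_mono tm) auto
 also have "(\<Sum>i<n. gap p i * P (p i) / (2 * V) - (gap p i) * \<delta> * K)
  = (\<Sum>i<n. gap p i * P (p i)) / (2 * V) - t * \<delta> * K"
  using is_part_sum[OF p] by (simp only: sum_subtractf sum_divide_distrib[symmetric] sum_distrib_right[symmetric])
 finally have 1: "(\<Sum>i<n. gap p i * P (p i)) / (2 * V) - t * \<delta> * K \<le> (LINT w|M. psi n p (\<lambda>i. u (p i) w) (path Ys {0..t} w))"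
  by (simp only: psi_expectation(2)[OF p])
 have "(integral {0..t} P - V * e) / (2 * V) \<le> (\<Sum>i<n. gap p i * P (p i)) / (2 * V)"
  using d(2)[OF pd] V by (intro divide_right_mono) auto
 moreover have "(integral {0..t} P - V * e) / (2 * V) = 1 / (2 * V) * integral {0..t} P - e / 2" using V by (simp add: field_simps)
 moreover have "t * \<delta> * K \<le> e / 2"
 proof -
  have "t * \<delta> * K \<le> (t + 1) * (e / (2 * K * (t + 1))) * K" using t K \<delta> e by (intro mult_mono) auto
  also have "... = e / 2" using t K by (simp add: field_simps add_pos_nonneg add_nonneg_eq_0_iff)
  finally show ?thesis .
 qed
 ultimately show ?thesis using 1 p by (intro exI[of _ n] exI[of _ p] exI[of _ \<delta>]) linarith
qed

end

section \<open>Discretisation of the filter\<close>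

text \<open>Cauchy-Schwarz, from the nonnegative integral of the squared deviation of
  \<open>f\<close> from its mean \<open>m\<close>.\<close>

lemma integral_square_le:
 fixes f :: "real \<Rightarrow> real"
 assumes "a < b" and f: "continuous_on {a..b} f"
 shows "(integral {a..b} f)^2 \<le> (b - a) * integral {a..b} (\<lambda>x. (f x)^2)"
proof -
 define m where "m = integral {a..b} f / (b - a)"
 have mI: "m * (b - a) = integral {a..b} f" using assms(1) by (simp add: m_def)
 have "0 \<le> integral {a..b} (\<lambda>x. (f x - m)^2)"
  using f by (intro hk_integral_nonneg integrable_continuous_interval continuous_intros) auto
 also have "... = integral {a..b} (\<lambda>x. (f x)^2 - 2 * m * f x + m^2)"
  by (intro hk_integral_cong) (simp add: power2_eq_square algebra_simps)
 also have "... = integral {a..b} (\<lambda>x. (f x)^2 - 2 * m * f x) + integral {a..b} (\<lambda>x. m^2)"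
  using f by (intro hk_integral_add integrable_continuous_interval continuous_intros)
 also have "integral {a..b} (\<lambda>x. (f x)^2 - 2 * m * f x) = integral {a..b} (\<lambda>x. (f x)^2) - 2 * m * integral {a..b} f"
  using f by (subst hk_integral_diff) (auto intro!: integrable_continuous_interval continuous_intros)
 also have "integral {a..b} (\<lambda>x. m^2) = m^2 * (b - a)" using assms by simp
 finally have "0 \<le> integral {a..b} (\<lambda>x. (f x)^2) - m * integral {a..b} f"
  using mI by (simp add: power2_eq_square mult.assoc)
 then have "0 \<le> (b - a) * (integral {a..b} (\<lambda>x. (f x)^2) - m * integral {a..b} f)" using assms by simp
 then show ?thesis by (simp add: right_diff_distrib mI[symmetric] power2_eq_square mult_ac)
qed

lemma integral_partition:
 fixes f :: "real \<Rightarrow> real" and p :: "nat \<Rightarrow> real"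
 assumes "\<And>i. i < n \<Longrightarrow> p i \<le> p (Suc i)" "continuous_on {p 0..p n} f"
 shows "integral {p 0..p n} f = (\<Sum>i<n. integral {p i..p (Suc i)} f)"
 using assms
proof (induction n)
 case (Suc n)
 have le: "p 0 \<le> p n" "p n \<le> p (Suc n)" using partition_le[of "Suc n" p 0 n] Suc.prems(1) by auto
 have "continuous_on {p 0..p n} f" using Suc.prems(2) le by (auto intro: continuous_on_subset)
 then have "integral {p 0..p n} f = (\<Sum>i<n. integral {p i..p (Suc i)} f)" using Suc by auto
 moreover have "integral {p 0..p (Suc n)} f = integral {p 0..p n} f + integral {p n..p (Suc n)} f"
  by (rule hk_integral_combine[symmetric])
   (use le Suc.prems in \<open>auto intro!: integrable_continuous_interval\<close>)
 ultimately show ?case by simp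
qed simp

lemma sum_by_parts_left:
 fixes g y :: "nat \<Rightarrow> real"
 shows "(\<Sum>j<N. g j * (y (Suc j) - y j)) = g N * y N - g 0 * y 0 - (\<Sum>j<N. y (Suc j) * (g (Suc j) - g j))"
 by (induction N) (auto simp: algebra_simps)

context kalman_drivers
begin

lemma \<Phi>_le_1: assumes "0 \<le> s" "s \<le> t" shows "\<Phi> t s \<le> 1"
proof -
 have i: "decay integrable_on {a..b}" if "0 \<le> a" for a b
  using that by (intro integrable_continuous_interval decay_cont) auto
 have "integral {0..t} decay = integral {0..s} decay + integral {s..t} decay"
  by (rule hk_integral_combine[symmetric]) (use assms i in auto)
 moreover have "0 \<le> integral {s..t} decay"
 proof (rule hk_integral_nonneg[OF i[OF assms(1)]])
  show "0 \<le> decay x" if "x \<in> {s..t}" for x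
   using P_pos[of x] that assms \<tau> V by (simp add: decay_def add_nonneg_nonneg less_imp_le)
 qed
 ultimately show ?thesis by (simp add: \<Phi>_def)
qed

text \<open>The bound has to be uniform in the filtering time \<open>q\<close> as well, because each
  partition point has its own filter weights; the propagator being at most 1 gives this.\<close>

lemma \<kappa>'_bounded: assumes "0 \<le> t" shows "\<exists>K>0. \<forall>q s. 0 \<le> s \<and> s \<le> q \<and> q \<le> t \<longrightarrow> \<bar>\<kappa>' q s\<bar> \<le> K"
proof -
 have "continuous_on {0..t} (\<lambda>s. decay s * gain s + dP s / sqrt V)"
  using V by (intro continuous_intros decay_cont gain_cont dP_cont) auto
 then have "compact ((\<lambda>s. decay s * gain s + dP s / sqrt V) ` {0..t})" by (intro compact_continuous_image) auto
 then obtain K where K: "\<And>s. s \<in> {0..t} \<Longrightarrow> \<bar>decay s * gain s + dP s / sqrt V\<bar> \<le> K"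
  by (force dest!: compact_imp_bounded simp: bounded_iff)
 show ?thesis
 proof (intro exI[of _ "\<bar>K\<bar> + 1"] conjI allI impI)
  fix q s assume *: "0 \<le> s \<and> s \<le> q \<and> q \<le> t"
  have "\<bar>\<kappa>' q s\<bar> = \<Phi> q s * \<bar>decay s * gain s + dP s / sqrt V\<bar>"
   using \<Phi>_pos[of q s] by (simp add: \<kappa>'_def abs_mult)
  also have "... \<le> 1 * K" using * \<Phi>_le_1[of s q] \<Phi>_pos[of q s] K[of s] by (intro mult_mono) auto
  finally show "\<bar>\<kappa>' q s\<bar> \<le> \<bar>K\<bar> + 1" by simp
 qed auto
qed

lemma inn_moments:
 assumes "0 \<le> p" "p \<le> q"
 shows "L2 (inn p q)" "(LINT w|M. (inn p q w)^2) = var_inn p q"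
 using rep_L2[OF rep_inn qn_inn_inn] rep_moments(2)[OF rep_inn qn_inn_inn] assms by auto

lemma band_old_cov:
 assumes W: "rep W 0 (band p q f) (band p q g)" "qlim 0 (band p q f) (band p q g) 0 (band p q f) (band p q g) v"
  and p: "0 \<le> p"
 shows "(\<integral>x. W x * u p x \<partial>M) = 0" "\<And>r. 0 \<le> r \<Longrightarrow> r \<le> p \<Longrightarrow> (\<integral>x. W x * Ys r x \<partial>M) = 0"
proof -
 show "(\<integral>x. W x * u p x \<partial>M) = 0"
  by (rule rep_cov(2)[OF W(1) rep_u[OF p] W(2) qn_u_u[OF p]]) (simp add: qn_band_cut)
 fix r assume r: "0 \<le> r" "r \<le> p"
 obtain w where "qlim (hc r) (hf r) (one r)
  (hc r) (hf r) (one r) w"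
  using qn_Ys_Ys[OF r(1) r(1)] unfolding convergent_def by blast
 from rep_cov(2)[OF W(1) rep_Ys[OF r(1)] W(2) this, of 0] show "(\<integral>x. W x * Ys r x \<partial>M) = 0"
  using qn_band_cut[OF r(2)] by simp
qed

lemma er_Ys: assumes r: "0 \<le> r" "r \<le> t" shows "(\<integral>x. er t x * Ys r x \<partial>M) = 0"
proof -
 obtain w where "qlim (hc r) (hf r) (one r)
  (hc r) (hf r) (one r) w"
  using qn_Ys_Ys[OF r(1) r(1)] unfolding convergent_def by blast
 then show ?thesis using r by (intro rep_cov(2)[OF rep_er rep_Ys qn_er_er _ qn_er_Ys[OF r]]) auto
qed

lemma er_uh: assumes t: "0 \<le> t" shows "(LINT w|M. er t w * uh t w) = 0"
proof -
 have "(LINT w|M. er t w * u t w) = P t"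
  by (rule rep_cov(2)[OF rep_er[OF t] rep_u[OF t] qn_er_er[OF t] qn_u_u[OF t] qn_er_u[OF t]])
 moreover have "er t w * uh t w = er t w * u t w - (er t w)^2" for w by (simp add: er_def algebra_simps power2_eq_square)
 ultimately show ?thesis using L2_mult[OF L2_er L2_u, OF t t] er_moments[OF t] by simp
qed

text \<open>The fresh part is uncorrelated with the signal at \<open>p\<close>, so second moments
  add; the drift contributes a term quadratic in the length, one factor of which is bounded by
  \<open>t\<close>.\<close>

lemma Ys_increment:
 assumes "0 \<le> p" "p \<le> q" "q \<le> t"
 shows "(LINT w|M. (Ys q w - Ys p w)^2) \<le> (1 + \<beta>^2 / V * t^2 + s0^2 / V * t) * (q - p)"
proof -
 define d where "d = q - p"
 have d: "0 \<le> d" "d \<le> t" using assms by (auto simp: d_def)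
 let ?c = "coef d / sqrt V"
 have eq: "(Ys q w - Ys p w)^2 = (inn p q w)^2 + 2 * ?c * (inn p q w * u p w) + ?c^2 * (u p w)^2" for w
  by (simp add: inn_def d_def power2_eq_square algebra_simps)
 have "(LINT w|M. (Ys q w - Ys p w)^2) = var_inn p q + ?c^2 * s0^2"
  unfolding eq
  using inn_moments[OF assms(1,2)] L2_mult[OF inn_moments(1)[OF assms(1,2)] L2_u[OF assms(1)]]
   band_old_cov(1)[OF rep_inn qn_inn_inn, OF assms(1,2) assms(1,2) assms(1)]
   rep_moments(1,2)[OF rep_u qn_u_u, OF assms(1) assms(1)]
  by (simp add: L2_def)
 also have "... \<le> (d + \<beta>^2 / V * t^2 * d) + s0^2 / V * t * d"
 proof (rule add_mono)
  have "d^2 \<le> t^2" using d by (intro power_mono) auto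
  then have "\<beta>^2 / V * d^2 * d \<le> \<beta>^2 / V * t^2 * d" using d V by (intro mult_right_mono mult_left_mono) auto
  then show "var_inn p q \<le> d + \<beta>^2 / V * t^2 * d" using var_inn_bounds(2)[OF assms(2)] by (simp add: d_def)
  have "(coef d)^2 \<le> d * d" using coef_bounds[OF d(1)] by (simp add: power2_eq_square mult_mono)
  also have "... \<le> t * d" using d by (intro mult_right_mono) auto
  finally have "(coef d)^2 * (s0^2 / V) \<le> t * d * (s0^2 / V)" using V by (intro mult_right_mono) auto
  then show "?c^2 * s0^2 \<le> s0^2 / V * t * d" using V by (simp add: power_divide mult_ac)
 qed
 finally show ?thesis by (simp add: d_def algebra_simps)
qed

text \<open>The filter at \<open>p i\<close> computed from the increments alone, as the predictor of the discrete channel.\<close>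

definition uhp :: "(nat \<Rightarrow> real) \<Rightarrow> nat \<Rightarrow> 'a \<Rightarrow> real" where
 "uhp p i w = (\<Sum>j<i. \<kappa> (p i) (p j) * (1 * Ys (p (Suc j)) w + (-1) * Ys (p j) w))"

text \<open>Summation by parts turns filter and discrete filter into integrals of the path and of
  its right-end step approximation against \<open>\<kappa>'\<close>. Cauchy-Schwarz is applied
  inside each cell and then over the cells, which leaves a bound linear in squared increments, ready
  for expectations.\<close>

lemma uhp_path_error:
 assumes g: "good w" and p: "is_part n p t \<delta>" and i: "i \<le> n"
  and K: "K > 0" "\<And>q s. 0 \<le> s \<and> s \<le> q \<and> q \<le> t \<Longrightarrow> \<bar>\<kappa>' q s\<bar> \<le> K"
 shows "(uh (p i) w - uhp p i w)^2 \<le> K^2 * t * (\<Sum>j<i. integral {p j..p (Suc j)} (\<lambda>s. (Ys (p (Suc j)) w - Ys s w)^2))"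
proof -
 define q where "q = p i"
 define y where "y s = Ys s w" for s
 have y: "continuous_on {0..} y" "y 0 = 0" using good_Ys[OF g] by (auto simp: y_def[abs_def])
 have p0: "p 0 = 0" using p by (simp add: is_part_def)
 have q: "0 \<le> q" "q \<le> t" using is_part_range[OF p i] by (auto simp: q_def)
 have lt: "p j < p (Suc j)" "0 \<le> p j" "p (Suc j) \<le> q" if "j < i" for j
  using is_part_less[OF p, of j "Suc j"] is_part_range[OF p, of j] is_part_le[OF p, of "Suc j" i] that i by (auto simp: q_def)
 have yc: "continuous_on {p j..p (Suc j)} y" "continuous_on {p j..p (Suc j)} (\<kappa>' q)" if "j < i" for j
  using lt[OF that] by (auto intro: continuous_on_subset[OF y(1)] continuous_on_subset[OF \<kappa>'_cont[of q]])
 have cq: "continuous_on {p 0..p i} (\<lambda>s. y s * \<kappa>' q s)"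
  unfolding p0 q_def[symmetric] by (intro continuous_on_mult \<kappa>'_cont continuous_on_subset[OF y(1)]) auto
 have uh: "uh q w = gain q * y q - (\<Sum>j<i. integral {p j..p (Suc j)} (\<lambda>s. y s * \<kappa>' q s))"
  using hat_eq[OF y y q(1)] integral_partition[of i p, OF _ cq] lt
  by (simp add: uh_def y_def[abs_def] p0 q_def[symmetric] less_imp_le)
 have k: "\<kappa> q (p (Suc j)) - \<kappa> q (p j) = integral {p j..p (Suc j)} (\<kappa>' q)" if "j < i" for j
 proof (rule integral_FTC[symmetric])
  fix s assume s: "s \<in> {p j..p (Suc j)}"
  have sub: "{p j..p (Suc j)} \<subseteq> {0..q}" using lt[OF that] by auto
  show "(\<kappa> q has_real_derivative \<kappa>' q s) (at s within {p j..p (Suc j)})"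
   using DERIV_subset[OF \<kappa>_deriv sub] s sub by blast
 qed (use lt[OF that] in auto)
 have "uhp p i w = (\<Sum>j<i. \<kappa> q (p j) * (y (p (Suc j)) - y (p j)))" by (simp add: uhp_def q_def y_def)
 also have "... = \<kappa> q q * y q - (\<Sum>j<i. y (p (Suc j)) * (\<kappa> q (p (Suc j)) - \<kappa> q (p j)))"
  using sum_by_parts_left[of "\<lambda>j. \<kappa> q (p j)" "\<lambda>j. y (p j)" i] y(2) p0 by (simp add: q_def)
 also have "... = gain q * y q - (\<Sum>j<i. y (p (Suc j)) * integral {p j..p (Suc j)} (\<kappa>' q))"
  using k by (simp add: \<kappa>_def)
 finally have "uh q w - uhp p i w = (\<Sum>j<i. y (p (Suc j)) * integral {p j..p (Suc j)} (\<kappa>' q) - integral {p j..p (Suc j)} (\<lambda>s. y s * \<kappa>' q s))"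
  by (simp add: uh sum_subtractf)
 then have "\<bar>uh q w - uhp p i w\<bar> \<le> (\<Sum>j<i. \<bar>y (p (Suc j)) * integral {p j..p (Suc j)} (\<kappa>' q) - integral {p j..p (Suc j)} (\<lambda>s. y s * \<kappa>' q s)\<bar>)"
  by (simp add: sum_abs)
 also have "... \<le> (\<Sum>j<i. K * (sqrt (gap p j) * sqrt (integral {p j..p (Suc j)} (\<lambda>s. (y (p (Suc j)) - y s)^2))))"
 proof (rule sum_mono)
  fix j assume "j \<in> {..<i}"
  then have j: "j < i" by simp
  let ?I = "{p j..p (Suc j)}" and ?f = "\<lambda>s. \<bar>y (p (Suc j)) - y s\<bar>"
  have c: "continuous_on ?I ?f" using yc[OF j] by (intro continuous_intros)
  have e1: "y (p (Suc j)) * integral ?I (\<kappa>' q) - integral ?I (\<lambda>s. y s * \<kappa>' q s) = integral ?I (\<lambda>s. y (p (Suc j)) * \<kappa>' q s - y s * \<kappa>' q s)"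
   using yc[OF j] by (subst hk_integral_diff) (auto intro!: integrable_continuous_interval continuous_intros)
  have e2: "norm (integral ?I (\<lambda>s. y (p (Suc j)) * \<kappa>' q s - y s * \<kappa>' q s)) \<le> integral ?I (\<lambda>s. K * ?f s)"
  proof (rule integral_norm_bound_integral)
   show "(\<lambda>s. y (p (Suc j)) * \<kappa>' q s - y s * \<kappa>' q s) integrable_on ?I" "(\<lambda>s. K * ?f s) integrable_on ?I"
    using yc[OF j] by (intro integrable_continuous_interval continuous_intros; simp)+
   fix s assume s: "s \<in> ?I"
   have "\<bar>\<kappa>' q s\<bar> \<le> K" using K(2)[of s q] lt[OF j] s q by auto
   then have "\<bar>\<kappa>' q s\<bar> * ?f s \<le> K * ?f s" by (intro mult_right_mono) auto
   moreover have "norm (y (p (Suc j)) * \<kappa>' q s - y s * \<kappa>' q s) = \<bar>\<kappa>' q s\<bar> * ?f s"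
    unfolding abs_mult[symmetric] real_norm_def by (rule arg_cong[where f=abs]) (simp only: left_diff_distrib right_diff_distrib mult.commute)
   ultimately show "norm (y (p (Suc j)) * \<kappa>' q s - y s * \<kappa>' q s) \<le> K * ?f s" by (simp only:)
  qed
  have e3: "integral ?I (\<lambda>s. K * ?f s) = K * integral ?I ?f" by (rule hk_integral_mult_right)
  have "(\<lambda>s. (?f s)^2) = (\<lambda>s. (y (p (Suc j)) - y s)^2)" by simp
  then have "integral ?I ?f \<le> sqrt ((gap p j) * integral ?I (\<lambda>s. (y (p (Suc j)) - y s)^2))"
   using real_le_rsqrt[OF integral_square_le[OF lt(1)[OF j] c]] by (simp only:)
  then have "K * integral ?I ?f \<le> K * (sqrt (gap p j) * sqrt (integral ?I (\<lambda>s. (y (p (Suc j)) - y s)^2)))"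
   using K(1) by (simp only: real_sqrt_mult mult_left_mono less_imp_le)
  then show "\<bar>y (p (Suc j)) * integral ?I (\<kappa>' q) - integral ?I (\<lambda>s. y s * \<kappa>' q s)\<bar>
   \<le> K * (sqrt (gap p j) * sqrt (integral ?I (\<lambda>s. (y (p (Suc j)) - y s)^2)))"
   using e2 unfolding e1 e3 real_norm_def by (rule order_trans[rotated])
 qed
 also have "... = K * (\<Sum>j<i. sqrt (gap p j) * sqrt (integral {p j..p (Suc j)} (\<lambda>s. (y (p (Suc j)) - y s)^2)))"
  by (simp add: sum_distrib_left)
 finally have "\<bar>uh q w - uhp p i w\<bar>^2 \<le> (K * (\<Sum>j<i. sqrt (gap p j) * sqrt (integral {p j..p (Suc j)} (\<lambda>s. (y (p (Suc j)) - y s)^2))))^2"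
  by (rule power_mono) simp
 also have "... \<le> K^2 * ((\<Sum>j<i. (sqrt (gap p j))^2) * (\<Sum>j<i. (sqrt (integral {p j..p (Suc j)} (\<lambda>s. (y (p (Suc j)) - y s)^2)))^2))"
  unfolding power_mult_distrib by (intro mult_left_mono Cauchy_Schwarz_ineq_sum) simp
 also have "(\<Sum>j<i. (sqrt (gap p j))^2) = q"
  using lt sum_lessThan_telescope[of p i] by (simp add: p0 q_def less_imp_le)
 also have "(\<Sum>j<i. (sqrt (integral {p j..p (Suc j)} (\<lambda>s. (y (p (Suc j)) - y s)^2)))^2) = (\<Sum>j<i. integral {p j..p (Suc j)} (\<lambda>s. (y (p (Suc j)) - y s)^2))"
  using yc by (intro sum.cong refl real_sqrt_pow2 hk_integral_nonneg integrable_continuous_interval continuous_intros) auto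
 also have "K^2 * (q * (\<Sum>j<i. integral {p j..p (Suc j)} (\<lambda>s. (y (p (Suc j)) - y s)^2))) \<le> K^2 * (t * (\<Sum>j<i. integral {p j..p (Suc j)} (\<lambda>s. (y (p (Suc j)) - y s)^2)))"
  using q yc by (intro mult_left_mono mult_right_mono sum_nonneg hk_integral_nonneg integrable_continuous_interval continuous_intros) auto
 finally show ?thesis by (simp add: q_def y_def mult.assoc)
qed

lemma L2_uhp: "is_part n p t \<delta> \<Longrightarrow> i \<le> n \<Longrightarrow> L2 (uhp p i)"
 unfolding uhp_def[abs_def]
 by (intro L2_sum L2_lin L2_Ys) (use is_part_range in force)+

text \<open>The mean square of an observation increment is at most linear in its length, so the
  squared path error has mean of order \<open>\<delta>\<close>, with a constant independent of the
  partition and of \<open>i\<close>.\<close>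

lemma uhp_error:
 assumes t: "0 \<le> t"
 shows "\<exists>K\<ge>0. \<forall>n p \<delta> i. is_part n p t \<delta> \<longrightarrow> i \<le> n \<longrightarrow> \<delta> \<ge> 0 \<longrightarrow> (LINT w|M. (uh (p i) w - uhp p i w)^2) \<le> K * \<delta>"
proof -
 obtain Kk where Kk: "Kk > 0" "\<And>q s. 0 \<le> s \<and> s \<le> q \<and> q \<le> t \<Longrightarrow> \<bar>\<kappa>' q s\<bar> \<le> Kk" using \<kappa>'_bounded[OF t] by blast
 define K2 where "K2 = 1 + \<beta>^2 / V * t^2 + s0^2 / V * t"
 have K2: "K2 \<ge> 0" using V t by (simp add: K2_def add_nonneg_nonneg)
 show ?thesis
 proof (intro exI[of _ "Kk^2 * t * (K2 * t)"] conjI allI impI)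
  show "0 \<le> Kk^2 * t * (K2 * t)" using t K2 by simp
  fix n p \<delta> i assume p: "is_part n p t \<delta>" and i: "i \<le> n" and \<delta>: "0 \<le> (\<delta>::real)"
  have q: "0 \<le> p i" using is_part_range[OF p i] by simp
  have lt: "p j < p (Suc j)" "0 \<le> p j" "p (Suc j) \<le> t" "p (Suc j) - p j \<le> \<delta>" if "j < i" for j
   using is_part_less[OF p, of j "Suc j"] is_part_range[OF p, of j] is_part_range[OF p, of "Suc j"] p that i by (auto simp: is_part_def)
  have c: "AE w in M. continuous_on {p j..p (Suc j)} (\<lambda>s. (Ys (p (Suc j)) w - Ys s w)^2)" if "j < i" for j
   using AE_good
  proof eventually_elim
   case (elim w)
   then show ?case using lt[OF that] by (intro continuous_intros continuous_on_subset[OF good_Ys(1)]) auto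
  qed
  define J where "J j w = integral {p j..p (Suc j)} (\<lambda>s. (Ys (p (Suc j)) w - Ys s w)^2)" for j w
  have J: "\<exists>g\<in>borel_measurable M. (AE w in M. ennreal (J j w) = g w) \<and> (\<integral>\<^sup>+w. g w \<partial>M) \<le> ennreal (K2 * \<delta> * (gap p j))" if j: "j < i" for j
   unfolding J_def
  proof (rule nn_expectation_integral_le[OF _ _ _ c[OF j]])
   fix s assume s: "s \<in> {p j..p (Suc j)}"
   then have s0: "0 \<le> s" "s \<le> p (Suc j)" "p (Suc j) - s \<le> \<delta>" "0 \<le> p (Suc j)" using lt[OF j] by auto
   then have [measurable]: "Ys s \<in> borel_measurable M" "Ys (p (Suc j)) \<in> borel_measurable M" by auto
   show "(\<lambda>w. (Ys (p (Suc j)) w - Ys s w)^2) \<in> borel_measurable M" by measurable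
   have "L2 (\<lambda>w. 1 * Ys (p (Suc j)) w + (-1) * Ys s w)" by (intro L2_lin L2_Ys s0)
   then have "(\<integral>\<^sup>+w. ennreal ((Ys (p (Suc j)) w - Ys s w)^2) \<partial>M) = ennreal (LINT w|M. (Ys (p (Suc j)) w - Ys s w)^2)"
    by (intro nn_integral_eq_integral) (auto simp: L2_def)
   also have "... \<le> ennreal (K2 * (p (Suc j) - s))"
    unfolding K2_def by (rule ennreal_leI[OF Ys_increment]) (use s0 lt[OF j] in auto)
   also have "... \<le> ennreal (K2 * \<delta>)" using K2 s0 by (intro ennreal_leI mult_left_mono) auto
   finally show "(\<integral>\<^sup>+w. ennreal ((Ys (p (Suc j)) w - Ys s w)^2) \<partial>M) \<le> ennreal (K2 * \<delta>)" .
  qed (use K2 \<delta> lt[OF j] in auto)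
  obtain g where g: "\<And>j. j < i \<Longrightarrow> g j \<in> borel_measurable M" "\<And>j. j < i \<Longrightarrow> AE w in M. ennreal (J j w) = g j w"
    "\<And>j. j < i \<Longrightarrow> (\<integral>\<^sup>+w. g j w \<partial>M) \<le> ennreal (K2 * \<delta> * (gap p j))"
   using J by metis
  have gJ: "AE w in M. \<forall>j\<in>{..<i}. ennreal (J j w) = g j w" using g(2) by (intro AE_finite_allI) auto
  have L: "L2 (\<lambda>w. 1 * uh (p i) w + (-1) * uhp p i w)" by (intro L2_lin L2_uh q L2_uhp[OF p i])
  have "ennreal (LINT w|M. (uh (p i) w - uhp p i w)^2) = (\<integral>\<^sup>+w. ennreal ((uh (p i) w - uhp p i w)^2) \<partial>M)"
   using L by (intro nn_integral_eq_integral[symmetric]) (auto simp: L2_def)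
  also have "... \<le> (\<integral>\<^sup>+w. ennreal (Kk^2 * t) * (\<Sum>j<i. g j w) \<partial>M)"
  proof (rule nn_integral_mono_AE)
   show "AE w in M. ennreal ((uh (p i) w - uhp p i w)^2) \<le> ennreal (Kk^2 * t) * (\<Sum>j<i. g j w)"
    using AE_good gJ
   proof eventually_elim
    case (elim w)
    have J0: "0 \<le> J j w" if "j < i" for j
     unfolding J_def using lt[OF that] elim
     by (intro hk_integral_nonneg integrable_continuous_interval continuous_intros continuous_on_subset[OF good_Ys(1)]) auto
    have "ennreal ((uh (p i) w - uhp p i w)^2) \<le> ennreal (Kk^2 * t * (\<Sum>j<i. J j w))"
     unfolding J_def by (rule ennreal_leI[OF uhp_path_error[OF elim(1) p i Kk]])
    also have "... = ennreal (Kk^2 * t) * (\<Sum>j<i. ennreal (J j w))"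
     using J0 t sum_ennreal[of "{..<i}" "\<lambda>j. J j w"] by (subst ennreal_mult) (auto intro!: sum_nonneg)
    finally show ?case using elim(2) by simp
   qed
  qed
  also have "... \<le> ennreal (Kk^2 * t) * (\<Sum>j<i. ennreal (K2 * \<delta> * (gap p j)))"
   using g by (subst nn_integral_cmult, simp, subst nn_integral_sum, simp) (intro mult_left_mono sum_mono; simp)
  also have "(\<Sum>j<i. ennreal (K2 * \<delta> * (gap p j))) = ennreal (\<Sum>j<i. K2 * \<delta> * (gap p j))"
   using K2 \<delta> lt by (intro sum_ennreal) (simp add: less_imp_le)
  also have "ennreal (Kk^2 * t) * ennreal (\<Sum>j<i. K2 * \<delta> * (gap p j)) = ennreal (Kk^2 * t * (\<Sum>j<i. K2 * \<delta> * (gap p j)))"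
   using t K2 \<delta> lt by (intro ennreal_mult[symmetric] sum_nonneg mult_nonneg_nonneg) (auto simp: less_imp_le)
  finally have "(LINT w|M. (uh (p i) w - uhp p i w)^2) \<le> Kk^2 * t * (\<Sum>j<i. K2 * \<delta> * (gap p j))"
   by (rule ennreal_le_iff[THEN iffD1, rotated]) (use t K2 \<delta> lt in \<open>intro mult_nonneg_nonneg sum_nonneg; simp add: less_imp_le\<close>)
  also have "(\<Sum>j<i. K2 * \<delta> * (gap p j)) = K2 * \<delta> * p i"
   using sum_lessThan_telescope[of p i] p by (simp add: sum_distrib_left[symmetric] is_part_def)
  also have "Kk^2 * t * (K2 * \<delta> * p i) \<le> Kk^2 * t * (K2 * \<delta> * t)"
   using t K2 \<delta> is_part_range[OF p i] by (intro mult_left_mono) auto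
  finally show "(LINT w|M. (uh (p i) w - uhp p i w)^2) \<le> Kk^2 * t * (K2 * t) * \<delta>" by (simp add: mult_ac)
 qed
qed

end

section \<open>Product laws and Brownian increments\<close>

lemma (in prob_space) indep_pair_compose:
 assumes ind: "indep_pair M S X T Y" and f[measurable]: "f \<in> measurable S S'" and g[measurable]: "g \<in> measurable T T'"
 shows "indep_pair M S' (\<lambda>w. f (X w)) T' (\<lambda>w. g (Y w))"
proof -
 have [measurable]: "X \<in> measurable M S" "Y \<in> measurable M T"
  and j: "distr M (S \<Otimes>\<^sub>M T) (\<lambda>w. (X w, Y w)) = distr M S X \<Otimes>\<^sub>M distr M T Y" using ind by (auto simp: indep_pair_def)
 have sf: "sigma_finite_measure (distr (distr M T Y) T' g)"
  by (intro prob_space_imp_sigma_finite prob_space.prob_space_distr[OF prob_space_distr]) auto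
 have "distr M (S' \<Otimes>\<^sub>M T') (\<lambda>w. (f (X w), g (Y w))) = distr (distr M S X \<Otimes>\<^sub>M distr M T Y) (S' \<Otimes>\<^sub>M T') (\<lambda>(x, y). (f x, g y))"
  unfolding j[symmetric] by (subst distr_distr) (auto simp: comp_def)
 also have "... = distr (distr M S X) S' f \<Otimes>\<^sub>M distr (distr M T Y) T' g"
  by (rule pair_measure_distr[symmetric]) (use sf in auto)
 finally show ?thesis by (simp add: indep_pair_def distr_distr comp_def)
qed

lemma (in prob_space) pair_distr_compose:
 assumes X[measurable]: "X \<in> measurable M S" and Y[measurable]: "Y \<in> measurable M T"
  and f[measurable]: "f \<in> measurable S S'" and g[measurable]: "g \<in> measurable T T'"
 shows "distr (distr M S X \<Otimes>\<^sub>M distr M T Y) (S' \<Otimes>\<^sub>M T') (\<lambda>z. (f (fst z), g (snd z)))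
  = distr M S' (\<lambda>w. f (X w)) \<Otimes>\<^sub>M distr M T' (\<lambda>w. g (Y w))"
proof -
 have sf: "sigma_finite_measure (distr (distr M T Y) T' g)"
  by (intro prob_space_imp_sigma_finite prob_space.prob_space_distr[OF prob_space_distr]) auto
 have "distr (distr M S X) S' f \<Otimes>\<^sub>M distr (distr M T Y) T' g = distr (distr M S X \<Otimes>\<^sub>M distr M T Y) (S' \<Otimes>\<^sub>M T') (\<lambda>(x, y). (f x, g y))"
  by (rule pair_measure_distr) (use sf in auto)
 then show ?thesis by (simp add: distr_distr comp_def case_prod_beta')
qed

text \<open>Handles partitions without cells, whose increment vectors live on a one-point
  space.\<close>

lemma prob_PiM_empty_eqI:
 assumes "prob_space P" "prob_space Q" "sets P = sets (PiM {} F)" "sets Q = sets (PiM {} F)"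
 shows "P = Q"
proof (rule measure_eqI)
 fix A assume "A \<in> sets P"
 then have "A = {} \<or> A = space P" "space Q = space P"
  using assms sets_eq_imp_space_eq[OF assms(3)] sets_eq_imp_space_eq[OF assms(4)] sets.sets_into_space[of A P] by (auto simp: space_PiM_empty)
 then show "emeasure P A = emeasure Q A"
  using prob_space.emeasure_space_1[OF assms(1)] prob_space.emeasure_space_1[OF assms(2)] by auto
qed (use assms in simp)

lemma (in prob_space) brownian_increments_gauss:
 assumes W: "standard_brownian_motion M W" and p: "0 \<le> p 0" "\<And>i. i < n \<Longrightarrow> p i < p (Suc i)"
  and D: "\<And>i. D i > 0" "\<And>i. i < n \<Longrightarrow> D i = p (Suc i) - p i"
 shows "distr M (vecs n) (\<lambda>w. \<lambda>i\<in>{..<n}. W (p (Suc i)) w - W (p i) w) = gauss n D"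
  and "i < n \<Longrightarrow> (\<lambda>w. W (p (Suc i)) w - W (p i) w) \<in> borel_measurable M"
  and "i < n \<Longrightarrow> integrable M (\<lambda>w. W (p (Suc i)) w - W (p i) w)"
  and "i < n \<Longrightarrow> (LINT w|M. W (p (Suc i)) w - W (p i) w) = 0"
proof -
 have p0: "0 \<le> p i" if "i \<le> n" for i
  using partition_le[of n p 0 i] p that by (force intro: less_imp_le)
 have d: "distributed M lborel (\<lambda>w. W (p (Suc i)) w - W (p i) w) (normal_density 0 (sqrt (D i)))" if "i < n" for i
  using brownian_increments(1)[OF W p0 p(2)] that D(2) by simp
 then show rv: "i < n \<Longrightarrow> (\<lambda>w. W (p (Suc i)) w - W (p i) w) \<in> borel_measurable M" for i
  using distributed_measurable by fastforce
 show "i < n \<Longrightarrow> integrable M (\<lambda>w. W (p (Suc i)) w - W (p i) w)"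
  using distributed_integrable[OF d[of i], of "\<lambda>x. x"] D(1)[of i] integrable_normal_moment[of "sqrt (D i)" 0 1] by simp
 show "i < n \<Longrightarrow> (LINT w|M. W (p (Suc i)) w - W (p i) w) = 0"
  using normal_distributed_expectation[OF _ d[of i]] D(1)[of i] by simp
 let ?X = "\<lambda>i w. W (p (Suc i)) w - W (p i) w"
 show "distr M (vecs n) (\<lambda>w. \<lambda>i\<in>{..<n}. ?X i w) = gauss n D"
 proof (cases "n = 0")
  case True
  then show ?thesis
   by (intro prob_PiM_empty_eqI[where F="\<lambda>_::nat. borel :: real measure"] prob_space_distr prob_space_gauss D(1))
    (auto simp: sets_gauss intro!: measurable_restrict)
 next
  case False
  have "indep_vars (\<lambda>_. borel) ?X {..<n}"
   by (rule brownian_increments(2)[where p=p, OF W p(1)]) (simp add: less_imp_le p(2))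
  then have "distr M (vecs n) (\<lambda>w. \<lambda>i\<in>{..<n}. ?X i w) = PiM {..<n} (\<lambda>i. distr M borel (?X i))"
   using False rv by (subst (asm) indep_vars_iff_distr_eq_PiM') auto
  also have "... = gauss n D"
   unfolding gauss_def
  proof (intro PiM_cong refl)
   fix i assume i: "i \<in> {..<n}"
   have "distr M borel (?X i) = distr M lborel (?X i)" by (rule distr_cong) auto
   also have "... = density lborel (normal_density 0 (sqrt (D i)))" using d[of i] i by (simp add: distributed_def)
   finally show "distr M borel (?X i) = density lborel (normal_density 0 (sqrt (D i)))" .
  qed
  finally show ?thesis .
 qed
qed

section \<open>From partitions to paths\<close>

text \<open>Projection to the times in \<open>F\<close> inside the same path space: forgotten values
  are set to 0. This is the form of \<open>\<rho>\<close> in \<open>dv_extend\<close>.\<close>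

definition froz :: "real set \<Rightarrow> real set \<Rightarrow> (real \<Rightarrow> real) \<Rightarrow> real \<Rightarrow> real" where
 "froz I F y = (\<lambda>s\<in>I. if s \<in> F then y s else 0)"

lemma measurable_froz[measurable]: "froz I F \<in> measurable (path_space I) (path_space I)"
 unfolding froz_def[abs_def]
proof (rule measurable_restrict)
 fix s assume s: "s \<in> I"
 then have [measurable]: "(\<lambda>y. y s) \<in> borel_measurable (path_space I)" by (intro measurable_component_singleton)
 show "(\<lambda>y. if s \<in> F then y s else 0) \<in> borel_measurable (path_space I)" by (cases "s \<in> F") auto
qed

text \<open>Coordinate \<open>s\<close> does not change under \<open>froz I {s}\<close>, so every
  coordinate is measurable for the sigma-algebra generated by the invariant sets; hence so is the
  identity.\<close>

lemma froz_generates: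
 fixes S :: "'s measure" and I :: "real set"
 defines "N \<equiv> S \<Otimes>\<^sub>M path_space I"
 shows "sets N \<subseteq> sigma_sets (space N) {A \<in> sets N. \<exists>F. finite F \<and> F \<subseteq> I \<and> (\<forall>z\<in>space N. (fst z, froz I F (snd z)) \<in> A \<longleftrightarrow> z \<in> A)}"
  (is "_ \<subseteq> sigma_sets _ ?A")
proof -
 have [measurable_cong]: "sets N = sets (S \<Otimes>\<^sub>M path_space I)" by (simp add: N_def)
 have \<rho>m: "(\<lambda>z. (fst z, froz I F (snd z))) \<in> measurable N N" for F unfolding N_def by measurable
 have A: "?A \<subseteq> Pow (space N)" using sets.space_closed[of N] by blast
 have sp: "space (sigma (space N) ?A) = space N" by (rule space_measure_of[OF A])
 have in_sets: "B \<in> sets (sigma (space N) ?A)" if "B \<in> ?A" for B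
  unfolding sets_measure_of[OF A] using that by (rule sigma_sets.Basic)
 have "fst \<in> measurable (sigma (space N) ?A) S"
 proof (rule measurableI)
  fix B assume B: "B \<in> sets S"
  have "fst -` B \<inter> space N \<in> ?A"
   using measurable_space[OF \<rho>m[of "{}"]] measurable_sets[OF measurable_fst[of S "path_space I"] B]
   by (intro CollectI conjI exI[of _ "{}"]) (auto simp: N_def)
  then show "fst -` B \<inter> space (sigma (space N) ?A) \<in> sets (sigma (space N) ?A)" unfolding sp by (rule in_sets)
 qed (use sp in \<open>auto simp: N_def space_pair_measure\<close>)
 moreover have "snd \<in> measurable (sigma (space N) ?A) (path_space I)"
 proof (rule measurable_PiM_single')
  fix s assume s: "s \<in> I"
  show "(\<lambda>z. snd z s) \<in> borel_measurable (sigma (space N) ?A)"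
  proof (rule measurableI)
   fix B :: "real set" assume B: "B \<in> sets borel"
   have "(\<lambda>z. snd z s) \<in> borel_measurable N"
    unfolding N_def by (rule measurable_compose[OF measurable_snd measurable_component_singleton[OF s]])
   then have 1: "(\<lambda>z. snd z s) -` B \<inter> space N \<in> sets N" using B by (rule measurable_sets)
   have 2: "\<forall>z\<in>space N. (fst z, froz I {s} (snd z)) \<in> (\<lambda>z. snd z s) -` B \<inter> space N \<longleftrightarrow> z \<in> (\<lambda>z. snd z s) -` B \<inter> space N"
   proof
    fix z assume z: "z \<in> space N"
    have "froz I {s} (snd z) s = snd z s" using s by (simp add: froz_def)
    then show "(fst z, froz I {s} (snd z)) \<in> (\<lambda>z. snd z s) -` B \<inter> space N \<longleftrightarrow> z \<in> (\<lambda>z. snd z s) -` B \<inter> space N"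
     using z measurable_space[OF \<rho>m z, of "{s}"] by simp
   qed
   have "(\<lambda>z. snd z s) -` B \<inter> space N \<in> ?A"
    using s by (intro CollectI conjI exI[of _ "{s}"] 1 2) auto
   then show "(\<lambda>z. snd z s) -` B \<inter> space (sigma (space N) ?A) \<in> sets (sigma (space N) ?A)" unfolding sp by (rule in_sets)
  qed simp
 qed (use sp in \<open>auto simp: N_def space_pair_measure space_PiM\<close>)
 ultimately have "(\<lambda>z. z) \<in> measurable (sigma (space N) ?A) (S \<Otimes>\<^sub>M path_space I)"
  by (intro measurable_pair) (simp_all add: comp_def)
 note idm = this[folded N_def]
 show ?thesis
 proof
  fix B assume B: "B \<in> sets N"
  have "(\<lambda>z. z) -` B \<inter> space N \<in> sets (sigma (space N) ?A)" using measurable_sets[OF idm B] unfolding sp .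
  moreover have "(\<lambda>z. z) -` B \<inter> space N = B" using sets.sets_into_space[OF B] by auto
  ultimately show "B \<in> sigma_sets (space N) ?A" unfolding sets_measure_of[OF A] by simp
 qed
qed

lemma partition_index:
 assumes "F \<subseteq> p ` {..n}"
 obtains \<iota> :: "real \<Rightarrow> nat" where "\<And>s. s \<in> F \<Longrightarrow> \<iota> s \<le> n" "\<And>s. s \<in> F \<Longrightarrow> p (\<iota> s) = s"
proof -
 have "\<forall>s\<in>F. \<exists>i\<le>n. p i = s" using assms by blast
 then show ?thesis using that by metis
qed

text \<open>Rebuilds the values at the times in \<open>F\<close> from increments;
  \<open>\<iota> s\<close> is meant as the index of \<open>s\<close> in the partition.\<close>

definition cumul :: "real set \<Rightarrow> real set \<Rightarrow> (real \<Rightarrow> nat) \<Rightarrow> (nat \<Rightarrow> real) \<Rightarrow> real \<Rightarrow> real" where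
 "cumul I F \<iota> x = (\<lambda>s\<in>I. if s \<in> F then (\<Sum>j<\<iota> s. x j) else 0)"

lemma measurable_cumul:
 assumes "\<And>s. s \<in> F \<Longrightarrow> \<iota> s \<le> n" shows "cumul I F \<iota> \<in> measurable (vecs n) (path_space I)"
 unfolding cumul_def[abs_def]
proof (rule measurable_restrict)
 fix s
 show "(\<lambda>x. if s \<in> F then (\<Sum>j<\<iota> s. x j) else 0 :: real) \<in> borel_measurable (vecs n)"
 proof (cases "s \<in> F")
  case True
  then have "\<iota> s \<le> n" using assms by blast
  have "(\<lambda>x. \<Sum>j<\<iota> s. x j :: real) \<in> borel_measurable (vecs n)"
   by (rule borel_measurable_sum[where f="\<lambda>j x. x j"], rule measurable_component_singleton) (use \<open>\<iota> s \<le> n\<close> in auto)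
  then show ?thesis using True by simp
 qed simp
qed

lemma cumul_increments:
 assumes \<iota>: "\<And>s. s \<in> F \<Longrightarrow> \<iota> s \<le> n" "\<And>s. s \<in> F \<Longrightarrow> p (\<iota> s) = s" and y: "y (p 0) = 0"
 shows "cumul I F \<iota> (\<lambda>i\<in>{..<n}. y (p (Suc i)) - y (p i)) = froz I F y"
proof -
 have "(\<Sum>j<\<iota> s. (\<lambda>i\<in>{..<n}. y (p (Suc i)) - y (p i)) j) = y s" if "s \<in> F" for s
 proof -
  have "(\<Sum>j<\<iota> s. (\<lambda>i\<in>{..<n}. y (p (Suc i)) - y (p i)) j) = (\<Sum>j<\<iota> s. y (p (Suc j)) - y (p j))"
   using \<iota>(1)[OF that] by (intro sum.cong) auto
  also have "... = y (p (\<iota> s)) - y (p 0)" by (rule sum_lessThan_telescope)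
  finally show ?thesis using \<iota>(2)[OF that] y by simp
 qed
 then show ?thesis by (auto simp: cumul_def froz_def fun_eq_iff)
qed

text \<open>The reference expectation lives on a second space \<open>M'\<close>, because one
  application compares with the product law on pairs of sample points and another with unshifted
  noise on the space itself. The slack \<open>e\<close> in \<open>H\<close> leaves room for the
  discretisation error of a partition through \<open>F\<close>.\<close>

lemma path_dv:
 fixes C :: real and Y :: "real \<Rightarrow> 'a \<Rightarrow> real" and Y' :: "real \<Rightarrow> 'b \<Rightarrow> real"
 assumes M: "prob_space M" "prob_space M'" and \<theta>[measurable]: "\<theta> \<in> measurable M S" "\<theta>' \<in> measurable M' S"
  and Y: "\<And>s. s \<in> I \<Longrightarrow> Y s \<in> borel_measurable M" "\<And>s. s \<in> I \<Longrightarrow> Y' s \<in> borel_measurable M'"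
  and Y0: "AE w in M. Y 0 w = 0" "AE w in M'. Y' 0 w = 0"
  and H: "\<And>F e. finite F \<Longrightarrow> F \<subseteq> I \<Longrightarrow> e > 0 \<Longrightarrow> \<exists>n p. p 0 = 0 \<and> p ` {..n} \<subseteq> I \<and> F \<subseteq> p ` {..n} \<and>
    (\<forall>f K. f \<in> borel_measurable (S \<Otimes>\<^sub>M vecs n) \<longrightarrow> (\<forall>z. \<bar>f z\<bar> \<le> K) \<longrightarrow>
      (LINT w|M. f (\<theta> w, incs n p Y w)) \<le> C + e + ln (LINT w|M'. exp (f (\<theta>' w, incs n p Y' w))))"
  and f[measurable]: "f \<in> borel_measurable (S \<Otimes>\<^sub>M path_space I)" and fK: "\<And>z. \<bar>f z\<bar> \<le> K"
 shows "(LINT w|M. f (\<theta> w, path Y I w)) \<le> C + ln (LINT w|M'. exp (f (\<theta>' w, path Y' I w)))"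
proof -
 let ?T = "path_space I" and ?N = "S \<Otimes>\<^sub>M path_space I"
 let ?z = "\<lambda>w. (\<theta> w, path Y I w)" and ?z' = "\<lambda>w. (\<theta>' w, path Y' I w)"
 have [measurable]: "path Y I \<in> measurable M ?T" "path Y' I \<in> measurable M' ?T"
  unfolding path_def[abs_def] using Y by (auto intro!: measurable_restrict)
 define \<rho> where "\<rho> F z = (fst z, froz I F (snd z))" for F and z :: "'c \<times> (real \<Rightarrow> real)"
 have \<rho>m[measurable]: "\<rho> F \<in> measurable ?N ?N" for F unfolding \<rho>_def[abs_def] by measurable
 have dv: "(LINT w|M. h (\<rho> F (?z w))) \<le> C + ln (LINT w|M'. exp (h (\<rho> F (?z' w))))"
  if F: "finite F" "F \<subseteq> I" and h[measurable]: "h \<in> borel_measurable ?N" and hK: "\<And>z. \<bar>h z\<bar> \<le> Kh" for F Kh and h :: "'c \<times> (real \<Rightarrow> real) \<Rightarrow> real"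
 proof (rule field_le_epsilon)
  fix e :: real assume "e > 0"
  then obtain n p where p: "p 0 = 0" "p ` {..n} \<subseteq> I" "F \<subseteq> p ` {..n}"
   and dv: "\<forall>f K. f \<in> borel_measurable (S \<Otimes>\<^sub>M vecs n) \<longrightarrow> (\<forall>z. \<bar>f z\<bar> \<le> K) \<longrightarrow>
      (LINT w|M. f (\<theta> w, incs n p Y w)) \<le> C + e + ln (LINT w|M'. exp (f (\<theta>' w, incs n p Y' w)))"
   using H[OF F] by blast
  obtain \<iota> where \<iota>: "\<And>s. s \<in> F \<Longrightarrow> \<iota> s \<le> n" "\<And>s. s \<in> F \<Longrightarrow> p (\<iota> s) = s" using partition_index[OF p(3)] by blast
  let ?\<sigma> = "cumul I F \<iota>"
  note [measurable] = measurable_cumul[where F=F and \<iota>=\<iota> and I=I, OF \<iota>(1)]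
  have ci: "?\<sigma> (incs n p Z w) = froz I F (path Z I w)" if "Z 0 w = 0" for w and Z :: "real \<Rightarrow> 'd \<Rightarrow> real"
   using cumul_increments[where y="\<lambda>s. Z s w" and F=F and \<iota>=\<iota> and p=p and n=n and I=I, OF \<iota>] that p(1) F(2)
   by (auto simp: froz_def path_def fun_eq_iff)
  have [measurable]: "incs n p Y \<in> measurable M (vecs n)" "incs n p Y' \<in> measurable M' (vecs n)"
   using p(2) by (auto intro!: measurable_restrict borel_measurable_diff Y)
  have "(LINT w|M. h (\<theta> w, ?\<sigma> (incs n p Y w))) \<le> C + e + ln (LINT w|M'. exp (h (\<theta>' w, ?\<sigma> (incs n p Y' w))))"
   using dv[rule_format, of "\<lambda>z. h (fst z, ?\<sigma> (snd z))" Kh] hK by simp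
  moreover have "(LINT w|M. h (\<theta> w, ?\<sigma> (incs n p Y w))) = (LINT w|M. h (\<rho> F (?z w)))"
  proof (rule integral_cong_AE)
   show "AE w in M. h (\<theta> w, ?\<sigma> (incs n p Y w)) = h (\<rho> F (?z w))" using Y0(1) by eventually_elim (simp add: ci \<rho>_def)
  qed measurable
  moreover have "(LINT w|M'. exp (h (\<theta>' w, ?\<sigma> (incs n p Y' w)))) = (LINT w|M'. exp (h (\<rho> F (?z' w))))"
  proof (rule integral_cong_AE)
   show "AE w in M'. exp (h (\<theta>' w, ?\<sigma> (incs n p Y' w))) = exp (h (\<rho> F (?z' w)))" using Y0(2) by eventually_elim (simp add: ci \<rho>_def)
  qed measurable
  ultimately show "(LINT w|M. h (\<rho> F (?z w))) \<le> C + ln (LINT w|M'. exp (h (\<rho> F (?z' w)))) + e" by simp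
 qed
 have "(\<integral>z. f z \<partial>distr M ?N ?z) \<le> C + ln (\<integral>z. exp (f z) \<partial>distr M' ?N ?z')"
 proof (rule dv_extend[where \<rho>=\<rho> and N="?N" and I=I, OF _ _ _ _ \<rho>m _ froz_generates[of S I, folded \<rho>_def] _ f fK])
  show "prob_space (distr M ?N ?z)" "prob_space (distr M' ?N ?z')" by (rule prob_space.prob_space_distr[OF M(1)] prob_space.prob_space_distr[OF M(2)]; simp)+
  show "\<rho> F (\<rho> F' z) = \<rho> F z" if "F \<subseteq> F'" for F F' z using that by (auto simp: \<rho>_def froz_def fun_eq_iff restrict_def)
  fix F :: "real set" and Kh and h :: "'c \<times> (real \<Rightarrow> real) \<Rightarrow> real" assume *: "finite F" "F \<subseteq> I" "h \<in> borel_measurable ?N" "\<And>z. \<bar>h z\<bar> \<le> Kh"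
  show "(\<integral>z. h (\<rho> F z) \<partial>distr M ?N ?z) \<le> C + ln (\<integral>z. exp (h (\<rho> F z)) \<partial>distr M' ?N ?z')"
   using dv[OF *] *(3) by (simp add: integral_distr)
 qed simp_all
 then show ?thesis by (simp add: integral_distr)
qed

lemma (in prob_space) pair_distr_eq:
 assumes "X \<in> measurable M S" "Y \<in> measurable M T"
 shows "distr M S X \<Otimes>\<^sub>M distr M T Y = distr (M \<Otimes>\<^sub>M M) (S \<Otimes>\<^sub>M T) (\<lambda>z. (X (fst z), Y (snd z)))"
 using pair_measure_distr[OF assms prob_space_imp_sigma_finite[OF prob_space_distr[OF assms(2)]]] by (simp add: case_prod_beta')

section \<open>Upper bound for the uncontrolled channel\<close>

context kalman_drivers
begin

lemma uhp_orth:
 assumes p: "is_part n p t \<delta>" and i: "i \<le> n" and W: "L2 W"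
  and 0: "\<And>r. 0 \<le> r \<Longrightarrow> r \<le> p i \<Longrightarrow> (LINT w|M. W w * Ys r w) = 0"
 shows "(LINT w|M. W w * uhp p i w) = 0"
proof -
 have r: "0 \<le> p j" "p j \<le> p (Suc j)" "p (Suc j) \<le> p i" "p j \<le> p i" if "j < i" for j
  using is_part_range[OF p, of j] is_part_le[OF p, of j "Suc j"] is_part_le[OF p, of "Suc j" i] is_part_le[OF p, of j i] that i by auto
 have eq: "W w * uhp p i w = (\<Sum>j<i. \<kappa> (p i) (p j) * (W w * Ys (p (Suc j)) w - W w * Ys (p j) w))" for w
  unfolding uhp_def sum_distrib_left by (intro sum.cong) (auto simp: algebra_simps)
 have int: "integrable M (\<lambda>w. W w * Ys (p (Suc j)) w)" "integrable M (\<lambda>w. W w * Ys (p j) w)" if "j < i" for j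
  using r[OF that] by (intro L2_mult W L2_Ys; simp)+
 have z: "(LINT w|M. \<kappa> (p i) (p j) * (W w * Ys (p (Suc j)) w - W w * Ys (p j) w)) = 0" if "j < i" for j
  using int[OF that] r[OF that] 0[of "p j"] 0[of "p (Suc j)"] by simp
 show ?thesis unfolding eq
  by (subst Bochner_Integration.integral_sum) (use int in \<open>auto simp only: lessThan_iff z sum.neutral_const intro!: sum.neutral Bochner_Integration.integrable_diff integrable_mult_right\<close>)
qed

text \<open>\<open>d\<close> is the sum of \<open>inn - X\<close>, the thermal noise arriving within
  the cell, and \<open>a\<close> times the prediction error \<open>u - uhp\<close>. The two are
  orthogonal to each other and to the measurement noise \<open>X\<close>; the prediction error
  splits, again orthogonally, into filter error and discretisation error.\<close>

lemma channel_moments: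
 assumes p: "is_part n p t \<delta>" and i: "i < n"
 defines "q \<equiv> p (Suc i)"
 defines "a \<equiv> coef (q - p i) / sqrt V"
 defines "X \<equiv> (\<lambda>w. Bm q w - Bm (p i) w)"
 defines "d \<equiv> (\<lambda>w. H q w - H (p i) w - a * uhp p i w)"
 shows "integrable M (\<lambda>w. (d w)^2)" "integrable M (\<lambda>w. d w * X w)" "(LINT w|M. d w * X w) = 0"
  "(LINT w|M. (d w)^2) = var_inn (p i) q - (q - p i) + a^2 * (P (p i) + (LINT w|M. (uh (p i) w - uhp p i w)^2))"
proof -
 have r: "0 \<le> p i" "p i \<le> q" "0 \<le> q" "i \<le> n"
  using is_part_range[OF p, of i] is_part_range[OF p, of "Suc i"] is_part_le[OF p, of i "Suc i"] i by (auto simp: q_def)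
 have repX: "rep X 0 (band (p i) q (\<lambda>_. 0)) (band (p i) q (\<lambda>_. 1))"
 proof -
  have "rep (\<lambda>w. 1 * Bm q w + (-1) * Bm (p i) w) (1 * 0 + (-1) * 0)
   (\<lambda>x. 1 * nul q x + (-1) * cut (p i) (\<lambda>_. 0) x) (\<lambda>x. 1 * one q x + (-1) * cut (p i) (\<lambda>_. 1) x)"
   by (intro rep_lin rep_Bm r)
  moreover have "(\<lambda>x. 1 * nul q x + (-1) * cut (p i) (\<lambda>_. 0) x) = band (p i) q (\<lambda>_. 0)"
   "(\<lambda>x. 1 * one q x + (-1) * cut (p i) (\<lambda>_. 1) x) = band (p i) q (\<lambda>_. 1)"
   using r by (auto simp: cut_def band_def fun_eq_iff)
  ultimately show ?thesis by (simp add: X_def)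
 qed
 have bm: "(\<lambda>x. band (p i) q f x * band (p i) q g x) = band (p i) q (\<lambda>x. f x * g x)" for f g by (auto simp: band_def)
 have qXX: "qlim 0 (band (p i) q (\<lambda>_. 0)) (band (p i) q (\<lambda>_. 1)) 0 (band (p i) q (\<lambda>_. 0)) (band (p i) q (\<lambda>_. 1)) (q - p i)"
  and qIX: "qlim 0 (band (p i) q (bg q)) (band (p i) q (\<lambda>_. 1)) 0 (band (p i) q (\<lambda>_. 0)) (band (p i) q (\<lambda>_. 1)) (q - p i)"
 proof -
  have "(\<lambda>n. 0 * 0 * s0^2 + dint n (band (p i) q (\<lambda>x. f x * 0)) + dint n (band (p i) q (\<lambda>x. 1 * 1)))
   \<longlonglongrightarrow> 0 * 0 * s0^2 + integral {p i..q} (\<lambda>x. f x * 0) + integral {p i..q} (\<lambda>x. 1 * 1)" for f :: "real \<Rightarrow> real"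
   by (intro tendsto_intros dint_band r) auto
  then show "qlim 0 (band (p i) q (\<lambda>_. 0)) (band (p i) q (\<lambda>_. 1)) 0 (band (p i) q (\<lambda>_. 0)) (band (p i) q (\<lambda>_. 1)) (q - p i)"
   "qlim 0 (band (p i) q (bg q)) (band (p i) q (\<lambda>_. 1)) 0 (band (p i) q (\<lambda>_. 0)) (band (p i) q (\<lambda>_. 1)) (q - p i)"
   using r by (simp_all add: qn_def bm)
 qed
 let ?I = "inn (p i) q" and ?Z = "\<lambda>w. u (p i) w - uhp p i w" and ?e = "\<lambda>w. uh (p i) w - uhp p i w"
 have LX: "L2 X" by (rule rep_L2[OF repX qXX])
 have LI: "L2 ?I" by (rule inn_moments(1)[OF r(1,2)])
 have Lu: "L2 (uhp p i)" by (rule L2_uhp[OF p r(4)])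
 have LZ: "L2 ?Z" using L2_lin[OF L2_u[OF r(1)] Lu, of 1 "-1"] by simp
 have Le: "L2 ?e" using L2_lin[OF L2_uh[OF r(1)] Lu, of 1 "-1"] by simp
 have deq: "d w = ?I w - X w + a * ?Z w" for w
  by (simp add: d_def inn_def Ys_def X_def a_def algebra_simps)
 have "L2 (\<lambda>w. 1 * (1 * ?I w + (-1) * X w) + a * ?Z w)" by (intro L2_lin LI LX LZ)
 then have Ld: "L2 d" by (simp add: deq[abs_def])
 then show "integrable M (\<lambda>w. (d w)^2)" by (simp add: L2_def)
 show "integrable M (\<lambda>w. d w * X w)" by (rule L2_mult[OF Ld LX])
 have XX: "(LINT w|M. (X w)^2) = q - p i" by (rule rep_moments(2)[OF repX qXX])
 have IX: "(LINT w|M. ?I w * X w) = q - p i"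
  by (rule rep_cov(2)[OF rep_inn[OF r(1,2)] repX qn_inn_inn[OF r(1,2)] qXX qIX])
 have X0: "(LINT w|M. X w * ?Z w) = 0"
  using band_old_cov(1)[OF repX qXX r(1)] uhp_orth[OF p r(4) LX band_old_cov(2)[OF repX qXX r(1)]]
   L2_mult[OF LX L2_u[OF r(1)]] L2_mult[OF LX Lu] by (simp add: right_diff_distrib)
 have I0: "(LINT w|M. ?I w * ?Z w) = 0"
  using band_old_cov(1)[OF rep_inn qn_inn_inn, OF r(1,2) r(1,2) r(1)]
   uhp_orth[OF p r(4) LI band_old_cov(2)[OF rep_inn qn_inn_inn, OF r(1,2) r(1,2) r(1)]]
   L2_mult[OF LI L2_u[OF r(1)]] L2_mult[OF LI Lu] by (simp add: right_diff_distrib)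
 have e0: "(LINT w|M. er (p i) w * ?e w) = 0"
  using er_uh[OF r(1)] uhp_orth[OF p r(4) L2_er[OF r(1)] er_Ys]
   L2_mult[OF L2_er[OF r(1)] L2_uh[OF r(1)]] L2_mult[OF L2_er[OF r(1)] Lu] by (simp add: right_diff_distrib)
 have ZZ: "(LINT w|M. (?Z w)^2) = P (p i) + (LINT w|M. (?e w)^2)"
 proof -
  have "(?Z w)^2 = (er (p i) w)^2 + 2 * (er (p i) w * ?e w) + (?e w)^2" for w
   by (simp add: er_def power2_eq_square algebra_simps)
  then show ?thesis using e0 er_moments[OF r(1)] L2_mult[OF L2_er[OF r(1)] Le] Le by (simp add: L2_def)
 qed
 have s: "integrable M (\<lambda>w. (?I w)^2)" "integrable M (\<lambda>w. (X w)^2)" "integrable M (\<lambda>w. (?Z w)^2)"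
  "integrable M (\<lambda>w. ?I w * X w)" "integrable M (\<lambda>w. X w * ?Z w)" "integrable M (\<lambda>w. ?I w * ?Z w)"
  using LI LX LZ L2_mult[OF LI LX] L2_mult[OF LX LZ] L2_mult[OF LI LZ] by (auto simp: L2_def)
 have dX: "d w * X w = ?I w * X w - (X w)^2 + a * (X w * ?Z w)" for w
  by (simp add: deq power2_eq_square algebra_simps)
 show "(LINT w|M. d w * X w) = 0" unfolding dX using s IX XX X0 by simp
 have dd: "(d w)^2 = (?I w)^2 + (X w)^2 - 2 * (?I w * X w) + a^2 * (?Z w)^2 + 2 * a * (?I w * ?Z w) - 2 * a * (X w * ?Z w)" for w
  by (simp add: deq power2_eq_square algebra_simps)
 show "(LINT w|M. (d w)^2) = var_inn (p i) q - (q - p i) + a^2 * (P (p i) + (LINT w|M. (?e w)^2))"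
  unfolding dd using s inn_moments(2)[OF r(1,2)] XX IX ZZ I0 X0 by simp
qed

text \<open>Given the signal path, the observation increments are independent Gaussians whose means
  are the increments of \<open>obs\<close>, and the reference law predicts them through
  \<open>uhp\<close>. The excess over the Riemann sum is of order \<open>\<delta>\<close>, with a
  constant independent of the partition.\<close>

lemma channel_dv_partition:
 assumes t: "0 \<le> t"
 shows "\<exists>K\<ge>0. \<forall>n p \<delta> f Kf. is_part n p t \<delta> \<longrightarrow> 0 \<le> \<delta> \<longrightarrow> f \<in> borel_measurable (sigs {0..t} \<Otimes>\<^sub>M vecs n) \<longrightarrow> (\<forall>z. \<bar>f z\<bar> \<le> Kf) \<longrightarrow>
  (LINT w|M. f (sig {0..t} w, incs n p Ys w))
   \<le> ((\<Sum>i<n. gap p i * P (p i)) / (2 * V) + K * \<delta>)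
    + ln (\<integral>z. exp (f z) \<partial>(distr M (sigs {0..t}) (sig {0..t}) \<Otimes>\<^sub>M
      distr M (vecs n) (\<lambda>w. incs n p Ys w)))"
proof -
 obtain Ke where Ke: "Ke \<ge> 0" "\<And>n p \<delta> i. is_part n p t \<delta> \<Longrightarrow> i \<le> n \<Longrightarrow> \<delta> \<ge> 0 \<Longrightarrow> (LINT w|M. (uh (p i) w - uhp p i w)^2) \<le> Ke * \<delta>"
  using uhp_error[OF t] by metis
 \<comment> \<open>\<open>\<beta>^2\<close> comes from the third-order excess of
   \<open>var_inn\<close>, \<open>Ke\<close> from the discretised filter; the factor
   \<open>t\<close> is the total length of the cells.\<close>
 define K where "K = t * ((\<beta>^2 + Ke) / (2 * V))"
 have K: "K \<ge> 0" using Ke(1) V t by (simp add: K_def)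
 show ?thesis
 proof (intro exI[of _ K] conjI allI impI K)
  fix n p \<delta> and f :: "(real \<times> (real \<Rightarrow> real)) \<times> (nat \<Rightarrow> real) \<Rightarrow> real" and Kf :: real
  assume p: "is_part n p t \<delta>" and \<delta>: "0 \<le> \<delta>"
   and f: "f \<in> borel_measurable (sigs {0..t} \<Otimes>\<^sub>M vecs n)" and fK: "\<forall>z. \<bar>f z\<bar> \<le> Kf"
  let ?S = "sigs {0..t} :: (real \<times> (real \<Rightarrow> real)) measure"
  let ?Pn = "PiM {..<n} (\<lambda>_. borel :: real measure)"
  have r: "0 \<le> p i" "p i < p (Suc i)" "p (Suc i) \<le> t" "p i \<le> t" "0 \<le> p (Suc i)" if "i < n" for i
   using is_part_range[OF p, of i] is_part_range[OF p, of "Suc i"] is_part_less[OF p, of i "Suc i"] that by auto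
  \<comment> \<open>Indices beyond the partition get variance 1, since the Gaussian product measures
    are set up with positive variances at every index.\<close>
  define D where "D i = (if i < n then p (Suc i) - p i else 1)" for i
  have D: "\<And>i. D i > 0" "\<And>i. i < n \<Longrightarrow> D i = p (Suc i) - p i" using r by (auto simp: D_def)
  have p0: "0 \<le> p 0" using p by (simp add: is_part_def)
  define X where "X w = (\<lambda>i\<in>{..<n}. Bm (p (Suc i)) w - Bm (p i) w)" for w
  note BG = brownian_increments_gauss[where p=p and n=n and D=D, OF Bm p0 r(2) D]
  have Xm[measurable]: "X \<in> measurable M ?Pn" unfolding X_def using BG(2) by (intro measurable_restrict) simp
  have sm[measurable]: "sig {0..t} \<in> measurable M ?S" by (rule sig_measurable) auto
  have joint: "distr M (?S \<Otimes>\<^sub>M ?Pn) (\<lambda>w. (sig {0..t} w, X w)) = distr M ?S (sig {0..t}) \<Otimes>\<^sub>M gauss n D"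
  proof -
   have "indep_pair M ?S (\<lambda>w. (\<lambda>\<theta>. (fst \<theta>, restrict (snd \<theta>) {0..t})) (sig {0..} w)) ?Pn (\<lambda>w. (\<lambda>y. \<lambda>i\<in>{..<n}. y (p (Suc i)) - y (p i)) (path Bm {0..} w))"
   proof (rule indep_pair_compose[OF indep_sig_Bm])
    show "(\<lambda>\<theta>. (fst \<theta>, restrict (snd \<theta>) {0..t})) \<in> measurable (sigs {0..}) ?S"
     by (intro measurable_Pair measurable_fst measurable_compose[OF measurable_snd] measurable_restrict_subset) auto
    show "(\<lambda>y. \<lambda>i\<in>{..<n}. y (p (Suc i)) - y (p i)) \<in> measurable (path_space {0..}) ?Pn"
     using r by (intro measurable_restrict borel_measurable_diff measurable_component_singleton) auto
   qed
   moreover have "(\<lambda>w. (\<lambda>\<theta>. (fst \<theta>, restrict (snd \<theta>) {0..t})) (sig {0..} w)) = sig {0..t}"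
    by (auto simp: sig_def path_def fun_eq_iff)
   moreover have "(\<lambda>w. (\<lambda>y. \<lambda>i\<in>{..<n}. y (p (Suc i)) - y (p i)) (path Bm {0..} w)) = X"
    using r by (auto simp: X_def path_def fun_eq_iff restrict_def)
   moreover have "distr M ?Pn X = gauss n D" using BG(1) by (simp add: X_def[abs_def])
   ultimately show ?thesis by (simp add: indep_pair_def)
  qed
  define c where "c i = coef (gap p i) / sqrt V" for i
  define g where "g i \<theta> = (if i < n then obs (p (Suc i)) \<theta> - obs (p i) \<theta> else 0)" for i \<theta>
  have gm: "g i \<in> borel_measurable ?S" for i
  proof (cases "i < n")
   case True
   then show ?thesis unfolding g_def[abs_def] using r[OF True] by (auto intro!: borel_measurable_diff measurable_obs)
  qed (simp add: g_def[abs_def])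
  \<comment> \<open>The predictor of increment \<open>i\<close>, written on the vector of earlier
    increments, so that predictability is visible in its domain.\<close>
  define m where "m i y = c i * (\<Sum>j<i. \<kappa> (p i) (p j) * y j)" for i and y :: "nat \<Rightarrow> real"
  have mm: "m i \<in> borel_measurable (vecs i)" for i unfolding m_def by measurable
  define Y where "Y w = (\<lambda>i\<in>{..<n}. X w i + g i (sig {0..t} w))" for w
  have gH: "g i (sig {0..t} w) = H (p (Suc i)) w - H (p i) w" if "i < n" for i w
   using that r[OF that] H_sig(1)[of "p i" "{0..t}" w] H_sig(1)[of "p (Suc i)" "{0..t}" w] by (simp add: g_def)
  have Yi: "Y w i = Ys (p (Suc i)) w - Ys (p i) w" if "i < n" for i w
   using that gH[OF that] by (simp add: Y_def X_def Ys_def)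
  have Yeq: "Y = (\<lambda>w. incs n p Ys w)"
   using Yi by (auto simp: fun_eq_iff Y_def)
  define d where "d i w = g i (sig {0..t} w) - m i (restrict (Y w) {..<i})" for i w
  have deq: "d i = (\<lambda>w. H (p (Suc i)) w - H (p i) w - c i * uhp p i w)" if i: "i < n" for i
  proof
   fix w
   have "(\<Sum>j<i. \<kappa> (p i) (p j) * restrict (Y w) {..<i} j) = uhp p i w"
    unfolding uhp_def using i Yi by (intro sum.cong) auto
   then show "d i w = H (p (Suc i)) w - H (p i) w - c i * uhp p i w" by (simp add: d_def m_def gH[OF i])
  qed
  note mom = channel_moments[OF p, folded c_def]
  have dX: "integrable M (\<lambda>w. ((d i w)^2 / 2 + d i w * X w i) / D i)"
   "(LINT w|M. ((d i w)^2 / 2 + d i w * X w i) / D i) \<le> D i * P (p i) / (2 * V) + D i * ((\<beta>^2 + Ke) / (2 * V)) * \<delta>" if i: "i < n" for i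
  proof -
   have Xi: "X w i = Bm (p (Suc i)) w - Bm (p i) w" for w using i by (simp add: X_def)
   have i1: "integrable M (\<lambda>w. (d i w)^2)" "integrable M (\<lambda>w. d i w * X w i)" "(LINT w|M. d i w * X w i) = 0"
    using mom(1-3)[OF i] by (simp_all add: deq[OF i] Xi)
   show "integrable M (\<lambda>w. ((d i w)^2 / 2 + d i w * X w i) / D i)" using i1 by simp
   let ?e = "\<integral>w. (uh (p i) w - uhp p i w)^2 \<partial>M"
   have e: "0 \<le> ?e" "?e \<le> Ke * \<delta>" using Ke(2)[OF p _ \<delta>, of i] i by auto
   have Di: "D i = p (Suc i) - p i" "0 < D i" "D i \<le> \<delta>" "D i \<le> t" using D i p r[OF i] by (auto simp: is_part_def)
   have "(LINT w|M. (d i w)^2) = var_inn (p i) (p (Suc i)) - D i + (c i)^2 * (P (p i) + ?e)"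
    using mom(4)[OF i] by (simp add: deq[OF i] Di)
   also have "... \<le> \<beta>^2 / V * (D i)^2 * D i + (D i)^2 / V * (P (p i) + Ke * \<delta>)"
   proof (intro add_mono mult_mono)
    show "var_inn (p i) (p (Suc i)) - D i \<le> \<beta>^2 / V * (D i)^2 * D i" using var_inn_bounds(2)[of "p i" "p (Suc i)"] Di by simp
    show "(c i)^2 \<le> (D i)^2 / V"
     using coef_bounds[of "D i"] Di V by (auto simp: c_def power_divide intro!: divide_right_mono power_mono)
   qed (use e V P_pos[OF r(1)[OF i]] in \<open>auto simp: less_imp_le\<close>)
   also have "... \<le> \<beta>^2 / V * (D i * D i * \<delta>) + (D i)^2 / V * P (p i) + (D i)^2 / V * (Ke * \<delta>)"
   proof -
    have "D i * D i * D i \<le> D i * D i * \<delta>" using Di by (intro mult_mono) auto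
    then have "\<beta>^2 / V * (D i * D i * D i) \<le> \<beta>^2 / V * (D i * D i * \<delta>)" by (rule mult_left_mono) (use V in auto)
    then show ?thesis by (simp add: power2_eq_square ring_distribs mult.assoc)
   qed
   finally have *: "(LINT w|M. (d i w)^2) \<le> \<beta>^2 / V * (D i * D i * \<delta>) + (D i)^2 / V * P (p i) + (D i)^2 / V * (Ke * \<delta>)" .
   have "(LINT w|M. ((d i w)^2 / 2 + d i w * X w i) / D i) = (LINT w|M. (d i w)^2) / (2 * D i)" using i1 by simp
   also have "... \<le> (\<beta>^2 / V * (D i * D i * \<delta>) + (D i)^2 / V * P (p i) + (D i)^2 / V * (Ke * \<delta>)) / (2 * D i)"
    using * Di by (intro divide_right_mono) auto
   also have "... = D i * P (p i) / (2 * V) + D i * ((\<beta>^2 + Ke) / (2 * V)) * \<delta>"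
    using Di V by (simp add: field_simps power2_eq_square)
   finally show "(LINT w|M. ((d i w)^2 / 2 + d i w * X w i) / D i) \<le> D i * P (p i) / (2 * V) + D i * ((\<beta>^2 + Ke) / (2 * V)) * \<delta>" .
  qed
  have "(LINT w|M. f (sig {0..t} w, Y w)) \<le> ((\<Sum>i<n. gap p i * P (p i)) / (2 * V) + K * \<delta>) + ln (\<integral>z. exp (f z) \<partial>(distr M ?S (sig {0..t}) \<Otimes>\<^sub>M distr M ?Pn Y))"
   unfolding Y_def[abs_def]
  proof (rule gauss_channel_dv[OF D(1) prob_space_axioms sm Xm joint gm mm _ _ f])
   note dd = d_def[unfolded Y_def, symmetric]
   show "integrable M (\<lambda>w. \<Sum>i<n. ((g i (sig {0..t} w) - m i (restrict (\<lambda>i\<in>{..<n}. X w i + g i (sig {0..t} w)) {..<i}))^2 / 2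
     + (g i (sig {0..t} w) - m i (restrict (\<lambda>i\<in>{..<n}. X w i + g i (sig {0..t} w)) {..<i})) * X w i) / D i)"
    unfolding dd using dX(1) by (intro Bochner_Integration.integrable_sum) auto
   have "(LINT w|M. (\<Sum>i<n. ((d i w)^2 / 2 + d i w * X w i) / D i)) = (\<Sum>i<n. \<integral>w. ((d i w)^2 / 2 + d i w * X w i) / D i \<partial>M)"
    using dX(1) by (intro Bochner_Integration.integral_sum) auto
   also have "... \<le> (\<Sum>i<n. D i * P (p i) / (2 * V) + D i * ((\<beta>^2 + Ke) / (2 * V)) * \<delta>)" using dX(2) by (intro sum_mono) auto
   also have "... = (\<Sum>i<n. D i * P (p i)) / (2 * V) + (\<Sum>i<n. D i) * ((\<beta>^2 + Ke) / (2 * V)) * \<delta>"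
    by (simp only: sum.distrib sum_divide_distrib sum_distrib_right)
   also have "(\<Sum>i<n. D i) = t" using is_part_sum[OF p] D(2) by simp
   also have "(\<Sum>i<n. D i * P (p i)) = (\<Sum>i<n. gap p i * P (p i))" using D(2) by simp
   finally show "(LINT w|M. (\<Sum>i<n. ((g i (sig {0..t} w) - m i (restrict (\<lambda>i\<in>{..<n}. X w i + g i (sig {0..t} w)) {..<i}))^2 / 2
     + (g i (sig {0..t} w) - m i (restrict (\<lambda>i\<in>{..<n}. X w i + g i (sig {0..t} w)) {..<i})) * X w i) / D i))
    \<le> (\<Sum>i<n. gap p i * P (p i)) / (2 * V) + K * \<delta>"
    unfolding dd by (simp add: K_def)
   show "\<And>x. \<bar>f x\<bar> \<le> Kf" using fK by blast
  qed
  then show "(LINT w|M. f (sig {0..t} w, incs n p Ys w))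
   \<le> ((\<Sum>i<n. gap p i * P (p i)) / (2 * V) + K * \<delta>)
    + ln (\<integral>z. exp (f z) \<partial>(distr M (sigs {0..t}) (sig {0..t}) \<Otimes>\<^sub>M
      distr M (vecs n) (\<lambda>w. incs n p Ys w)))"
   unfolding Yeq .
 qed
qed

text \<open>Pairs of independent sample points realise the product law. The mesh is chosen after
  \<open>e\<close>, half of which pays for the Riemann sum and half for the discretised
  filter.\<close>

lemma sig_channel_dv:
 assumes t: "0 \<le> t" and f: "f \<in> borel_measurable (sigs {0..t} \<Otimes>\<^sub>M path_space {0..t})" and fK: "\<And>z. \<bar>f z\<bar> \<le> K"
 shows "(LINT w|M. f (sig {0..t} w, path Ys {0..t} w)) \<le> 1 / (2 * V) * integral {0..t} P
  + ln (\<integral>z. exp (f z) \<partial>(distr M (sigs {0..t}) (sig {0..t}) \<Otimes>\<^sub>M distr M (path_space {0..t}) (path Ys {0..t})))"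
proof -
 let ?S = "sigs {0..t} :: (real \<times> (real \<Rightarrow> real)) measure" and ?T = "path_space {0..t}" and ?MM = "M \<Otimes>\<^sub>M M"
 interpret MM: pair_prob_space M M ..
 have sm[measurable]: "sig {0..t} \<in> measurable M ?S" and ym[measurable]: "path Ys {0..t} \<in> measurable M ?T" by auto
 have "(LINT w|M. f (sig {0..t} w, path Ys {0..t} w)) \<le> 1 / (2 * V) * integral {0..t} P
   + ln (LINT z|?MM. exp (f (sig {0..t} (fst z), path (\<lambda>s z. Ys s (snd z)) {0..t} z)))"
 proof (rule path_dv[OF prob_space_axioms MM.prob_space_axioms sm measurable_compose[OF measurable_fst sm] _ _ _ _ _ f fK])
  have Y0: "AE w in M. Ys 0 w = 0" using AE_good by eventually_elim (rule good_Ys)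
  then show "AE w in M. Ys 0 w = 0" .
  show "AE z in ?MM. Ys 0 (snd z) = 0" by (rule MM.AE_pair_measure) (use Y0 in auto)
  fix F and e :: real assume F: "finite F" "F \<subseteq> {0..t}" and e: "e > 0"
  obtain Kc where Kc: "Kc \<ge> 0" and dv: "\<And>n p \<delta> f Kf. is_part n p t \<delta> \<Longrightarrow> 0 \<le> \<delta> \<Longrightarrow> f \<in> borel_measurable (?S \<Otimes>\<^sub>M vecs n) \<Longrightarrow> (\<And>z. \<bar>f z\<bar> \<le> Kf) \<Longrightarrow>
    (LINT w|M. f (sig {0..t} w, incs n p Ys w)) \<le> ((\<Sum>i<n. gap p i * P (p i)) / (2 * V) + Kc * \<delta>)
     + ln (\<integral>z. exp (f z) \<partial>(distr M ?S (sig {0..t}) \<Otimes>\<^sub>M distr M (vecs n) (incs n p Ys)))"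
   using channel_dv_partition[OF t] by (elim exE conjE) (rule that; blast)
  obtain d where d: "d > 0" "\<And>n p. is_part n p t d \<Longrightarrow> \<bar>(\<Sum>i<n. gap p i * P (p i)) - integral {0..t} P\<bar> \<le> V * e"
   using riemann_sum[OF cont_on_nonneg t, of "V * e"] V e by auto
  define \<delta> where "\<delta> = min d (e / (2 * (Kc + 1)))"
  have \<delta>: "\<delta> > 0" "\<delta> \<le> d" "\<delta> \<le> e / (2 * (Kc + 1))" using d e Kc by (auto simp: \<delta>_def)
  obtain n p where p: "is_part n p t \<delta>" and Fp: "F \<subseteq> p ` {..n}" using is_part_exists[OF F t \<delta>(1)] by auto
  then have pd: "is_part n p t d" using \<delta>(2) by (force simp: is_part_def)
  have "(\<Sum>i<n. gap p i * P (p i)) / (2 * V) \<le> (integral {0..t} P + V * e) / (2 * V)"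
   using d(2)[OF pd] V by (intro divide_right_mono) auto
  moreover have "(integral {0..t} P + V * e) / (2 * V) = 1 / (2 * V) * integral {0..t} P + e / 2" using V by (simp add: field_simps)
  moreover have "Kc * \<delta> \<le> (Kc + 1) * (e / (2 * (Kc + 1)))" using Kc \<delta> by (intro mult_mono) auto
  moreover have "... = e / 2" using Kc by (simp add: field_simps)
  ultimately have le: "(\<Sum>i<n. gap p i * P (p i)) / (2 * V) + Kc * \<delta> \<le> 1 / (2 * V) * integral {0..t} P + e" by linarith
  have im[measurable]: "incs n p Ys \<in> measurable M (vecs n)"
   using is_part_range[OF p] by (intro measurable_restrict borel_measurable_diff Ys_measurable) auto
  have "(LINT w|M. h (sig {0..t} w, incs n p Ys w)) \<le> 1 / (2 * V) * integral {0..t} P + e + ln (LINT z|?MM. exp (h (sig {0..t} (fst z), incs n p Ys (snd z))))"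
   if h[measurable]: "h \<in> borel_measurable (?S \<Otimes>\<^sub>M vecs n)" and hK: "\<forall>z. \<bar>h z\<bar> \<le> Kh" for h Kh
  proof -
   have "(\<integral>z. exp (h z) \<partial>(distr M ?S (sig {0..t}) \<Otimes>\<^sub>M distr M (vecs n) (incs n p Ys))) = (LINT z|?MM. exp (h (sig {0..t} (fst z), incs n p Ys (snd z))))"
    unfolding pair_distr_eq[OF sm im] by (rule integral_distr) measurable
   then show ?thesis using dv[OF p _ h, of Kh] \<delta>(1) hK le by fastforce
  qed
  then show "\<exists>n p. p 0 = 0 \<and> p ` {..n} \<subseteq> {0..t} \<and> F \<subseteq> p ` {..n} \<and>
    (\<forall>f K. f \<in> borel_measurable (?S \<Otimes>\<^sub>M vecs n) \<longrightarrow> (\<forall>z. \<bar>f z\<bar> \<le> K) \<longrightarrow>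
      (LINT w|M. f (sig {0..t} w, incs n p Ys w)) \<le> 1 / (2 * V) * integral {0..t} P + e + ln (LINT w|?MM. exp (f (sig {0..t} (fst w), incs n p (\<lambda>s z. Ys s (snd z)) w))))"
   using p Fp is_part_range[OF p] by (intro exI[of _ n] exI[of _ p]) (force simp: is_part_def)
 qed auto
 also have "(LINT z|?MM. exp (f (sig {0..t} (fst z), path (\<lambda>s z. Ys s (snd z)) {0..t} z)))
   = (\<integral>z. exp (f z) \<partial>(distr M ?S (sig {0..t}) \<Otimes>\<^sub>M distr M ?T (path Ys {0..t})))"
  unfolding pair_distr_eq[OF sm ym] using f by (subst integral_distr) (auto simp: path_def)
 finally show ?thesis .
qed

end

section \<open>Shifts of Brownian motion\<close>

text \<open>The shift has slope at most \<open>K\<close> up to \<open>t\<close> and is constant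
  afterwards, which the increments of \<open>min s t\<close> encode. Its energy is then at most
  \<open>K^2 * t\<close>, uniformly over partitions, so the Gaussian bound passes to the whole half
  line.\<close>

lemma (in prob_space) brownian_shift_dv:
 assumes W: "standard_brownian_motion M W" and t: "0 \<le> t"
  and \<eta>0: "\<eta> 0 = 0" and \<eta>: "\<And>r s. 0 \<le> r \<Longrightarrow> r \<le> s \<Longrightarrow> \<bar>\<eta> s - \<eta> r\<bar> \<le> K * (min s t - min r t)" and K: "0 \<le> K"
  and f: "f \<in> borel_measurable (path_space {0..})" and fK: "\<And>y. \<bar>f y\<bar> \<le> Kf"
 shows "(LINT w|M. f (path (\<lambda>s w. W s w + \<eta> s) {0..} w)) \<le> K^2 * t / 2 + ln (LINT w|M. exp (f (path W {0..} w)))"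
proof -
 have W': "\<And>s. s \<in> {0..} \<Longrightarrow> W s \<in> borel_measurable M" "AE w in M. W 0 w = 0" using W by (auto simp: standard_brownian_motion_def)
 have "(LINT w|M. f (snd ((), path (\<lambda>s w. W s w + \<eta> s) {0..} w))) \<le> K^2 * t / 2 + ln (LINT w|M. exp (f (snd ((), path W {0..} w))))"
 proof (rule path_dv[where S="count_space UNIV" and f="\<lambda>z. f (snd z)" and K=Kf, OF prob_space_axioms prob_space_axioms])
  fix F :: "real set" and e :: real assume F: "finite F" "F \<subseteq> {0..}" and e: "e > 0"
  \<comment> \<open>The partition must reach \<open>t\<close> as well as all times in
    \<open>F\<close>.\<close>
  define T where "T = Max (insert t F)"
  have T: "t \<le> T" "F \<subseteq> {0..T}" using F by (auto simp: T_def)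
  then obtain n p where p: "is_part n p T 1" and Fp: "F \<subseteq> p ` {..n}" using is_part_exists[OF F(1), of T 1] t by auto
  have r: "0 \<le> p i" "p i < p (Suc i)" if "i < n" for i
   using is_part_range[OF p, of i] is_part_less[OF p, of i "Suc i"] that by auto
  have p0: "p 0 = 0" using p by (simp add: is_part_def)
  then have p00: "0 \<le> p 0" by simp
  define D where "D i = (if i < n then gap p i else 1)" for i
  have D: "\<And>i. D i > 0" "\<And>i. i < n \<Longrightarrow> D i = gap p i" using r by (auto simp: D_def)
  note BG = brownian_increments_gauss[where p=p and n=n and D=D, OF W p00 r(2) D]
  have Xm: "incs n p W \<in> measurable M (vecs n)" using BG(2) by (intro measurable_restrict) simp
  define g where "g i = \<eta> (p (Suc i)) - \<eta> (p i)" for i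
  have ig: "incs n p (\<lambda>s w. W s w + \<eta> s) w = (\<lambda>i\<in>{..<n}. incs n p W w i + g i)" for w by (auto simp: g_def fun_eq_iff)
  have "(\<Sum>i<n. (g i)^2 / (2 * D i)) \<le> (\<Sum>i<n. K^2 / 2 * (min (p (Suc i)) t - min (p i) t))"
  proof (rule sum_mono)
   fix i assume "i \<in> {..<n}"
   then have i: "i < n" by simp
   define m where "m = min (p (Suc i)) t - min (p i) t"
   have m: "0 \<le> m" "m \<le> D i" using r(2)[OF i] D(2)[OF i] by (auto simp: m_def min_def)
   have "\<bar>g i\<bar> \<le> K * m" using \<eta>[of "p i" "p (Suc i)"] r[OF i] by (simp add: g_def m_def)
   then have "(g i)^2 \<le> (K * m)^2" using power_mono[of "\<bar>g i\<bar>" "K * m" 2] by simp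
   also have "... = K^2 * m * m" by (simp add: power2_eq_square)
   also have "... \<le> K^2 * m * D i" using m by (intro mult_left_mono) auto
   finally have "(g i)^2 / (2 * D i) \<le> K^2 * m * D i / (2 * D i)" using D(1)[of i] by (intro divide_right_mono) auto
   then show "(g i)^2 / (2 * D i) \<le> K^2 / 2 * (min (p (Suc i)) t - min (p i) t)" using D(1)[of i] by (simp add: m_def)
  qed
  also have "(\<Sum>i<n. K^2 / 2 * (min (p (Suc i)) t - min (p i) t)) = K^2 / 2 * (\<Sum>i<n. min (p (Suc i)) t - min (p i) t)" by (simp only: sum_distrib_left)
  also have "(\<Sum>i<n. min (p (Suc i)) t - min (p i) t) = t"
   using sum_lessThan_telescope[of "\<lambda>i. min (p i) t" n] p p0 T t by (simp add: is_part_def min_def)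
  finally have gD: "(\<Sum>i<n. (g i)^2 / (2 * D i)) \<le> K^2 * t / 2 + e" using e by simp
  have "(LINT w|M. h ((), incs n p (\<lambda>s w. W s w + \<eta> s) w)) \<le> K^2 * t / 2 + e + ln (LINT w|M. exp (h ((), incs n p W w)))"
   if h[measurable]: "h \<in> borel_measurable (count_space UNIV \<Otimes>\<^sub>M vecs n)" and hK: "\<forall>z. \<bar>h z\<bar> \<le> Kh" for h Kh
  proof -
   have "(LINT w|M. h ((), \<lambda>i\<in>{..<n}. incs n p W w i + g i)) \<le> (\<Sum>i<n. (g i)^2 / (2 * D i)) + ln (LINT w|M. exp (h ((), incs n p W w)))"
    by (rule gauss_cameron_martin_dv[where f="\<lambda>x. h ((), x)", OF D(1) prob_space_axioms Xm]) (use BG(1,3,4) hK in auto)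
   then show ?thesis unfolding ig using gD by linarith
  qed
  then show "\<exists>n p. p 0 = 0 \<and> p ` {..n} \<subseteq> {0..} \<and> F \<subseteq> p ` {..n} \<and>
    (\<forall>f K'. f \<in> borel_measurable (count_space UNIV \<Otimes>\<^sub>M vecs n) \<longrightarrow> (\<forall>z. \<bar>f z\<bar> \<le> K') \<longrightarrow>
      (LINT w|M. f ((), incs n p (\<lambda>s w. W s w + \<eta> s) w)) \<le> K^2 * t / 2 + e + ln (LINT w|M. exp (f ((), incs n p W w))))"
   using Fp p0 is_part_range[OF p] by (intro exI[of _ n] exI[of _ p] conjI allI impI) (assumption | blast)+
 qed (use W' \<eta>0 f fK in auto)
 then show ?thesis by simp
qed

text \<open>Applied to \<open>c\<close> times the indicator of \<open>A\<close>, the variational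
  inequality bounds \<open>c\<close> times the probability that the shifted path lies in
  \<open>A\<close> by a constant independent of \<open>c\<close>.\<close>

lemma (in prob_space) brownian_shift_null:
 assumes W: "standard_brownian_motion M W" and t: "0 \<le> t"
  and \<eta>: "\<eta> 0 = 0" "\<And>r s. 0 \<le> r \<Longrightarrow> r \<le> s \<Longrightarrow> \<bar>\<eta> s - \<eta> r\<bar> \<le> K * (min s t - min r t)" "0 \<le> K"
  and A[measurable]: "A \<in> sets (path_space {0..})" and N: "AE w in M. path W {0..} w \<notin> A"
 shows "AE w in M. path (\<lambda>s w. W s w + \<eta> s) {0..} w \<notin> A"
proof -
 let ?W' = "path (\<lambda>s w. W s w + \<eta> s) {0..}"
 have Wm: "W s \<in> borel_measurable M" if "0 \<le> s" for s using W that by (simp add: standard_brownian_motion_def)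
 have m[measurable]: "path W {0..} \<in> measurable M (path_space {0..})" "?W' \<in> measurable M (path_space {0..})"
  unfolding path_def[abs_def] using Wm by (auto intro!: measurable_restrict)
 define q where "q = prob (?W' -` A \<inter> space M)"
 have "c * q \<le> K^2 * t / 2" if c: "c > 0" for c
 proof -
  have "(LINT w|M. c * indicator A (?W' w)) \<le> K^2 * t / 2 + ln (LINT w|M. exp (c * indicator A (path W {0..} w)))"
   by (rule brownian_shift_dv[OF W t \<eta>, where Kf=c]) (use c in \<open>auto simp: indicator_def\<close>)
  also have "(LINT w|M. exp (c * indicator A (path W {0..} w))) = (LINT w|M. 1)"
  proof (rule integral_cong_AE)
   show "AE w in M. exp (c * indicator A (path W {0..} w)) = 1" using N by eventually_elim simp
  qed simp_all
  also have "(LINT w|M. c * indicator A (?W' w)) = c * (LINT w|M. indicator (?W' -` A \<inter> space M) w)"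
   by (subst integral_mult_right_zero[symmetric], rule Bochner_Integration.integral_cong) (auto simp: indicator_def)
  finally show ?thesis by (simp add: q_def prob_space)
 qed
 moreover have "0 \<le> q" by (simp add: q_def)
 ultimately have "q = 0"
 proof (rule_tac ccontr)
  assume *: "\<And>c. c > 0 \<Longrightarrow> c * q \<le> K^2 * t / 2" "0 \<le> q" "q \<noteq> 0"
  then have "q > 0" by simp
  have "0 \<le> K^2 * t / 2" using t by simp
  then have "(K^2 * t / 2 + 1) / q * q \<le> K^2 * t / 2" using \<open>q > 0\<close> by (intro *(1)) (simp add: add_nonneg_pos)
  then show False using \<open>q > 0\<close> by simp
 qed
 then have "emeasure M (?W' -` A \<inter> space M) = 0" by (simp add: q_def emeasure_eq_measure)
 then have "?W' -` A \<inter> space M \<in> null_sets M" by auto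
 then show ?thesis using AE_space by (auto dest!: AE_not_in elim!: eventually_elim2)
qed

section \<open>The controlled system\<close>

definition prim :: "(real \<Rightarrow> real) \<Rightarrow> real \<Rightarrow> real" where
 "prim \<zeta> t = (LBINT s:{0..t}. \<zeta> s)"

lemma set_integrable_mono_nonneg:
 "set_integrable lborel {0..t} \<zeta> \<Longrightarrow> 0 \<le> s \<Longrightarrow> s \<le> t \<Longrightarrow> set_integrable lborel {0..s::real} (\<zeta> :: real \<Rightarrow> real)"
 by (rule set_integrable_subset) auto

lemma prim_integral: "set_integrable lborel {0..t} \<zeta> \<Longrightarrow> prim \<zeta> t = integral {0..t} \<zeta>"
 unfolding prim_def by (rule set_borel_integral_eq_integral)

lemma prim_cont:
 assumes "\<And>t. 0 \<le> t \<Longrightarrow> set_integrable lborel {0..t} \<zeta>"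
 shows "continuous_on {0..} (prim \<zeta>)" "prim \<zeta> 0 = 0"
proof -
 have "continuous_on {0..<t} (prim \<zeta>)" if "0 \<le> t" for t
 proof -
  have "\<zeta> integrable_on {0..t}" using assms[OF that] by (rule set_borel_integral_eq_integral)
  then have "continuous_on {0..t} (\<lambda>s. integral {0..s} \<zeta>)" by (rule indefinite_integral_continuous_1)
  moreover have "integral {0..s} \<zeta> = prim \<zeta> s" if "s \<in> {0..t}" for s
   using that assms[of s] by (simp add: prim_integral)
  ultimately have "continuous_on {0..t} (prim \<zeta>)" by (rule continuous_on_eq)
  then show ?thesis by (rule continuous_on_subset) auto
 qed
 note c = this
 show "continuous_on {0..} (prim \<zeta>)"
  unfolding continuous_on_eq_continuous_within
 proof
  fix x :: real assume x: "x \<in> {0..}"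
  then have "continuous (at x within {0..<x+1}) (prim \<zeta>)" using c[of "x+1"] by (auto simp: continuous_on_eq_continuous_within)
  moreover have "at x within {0..<x+1} = at x within {0..}"
   by (rule at_within_nhd[where S="{..<x+1}"]) auto
  ultimately show "continuous (at x within {0..}) (prim \<zeta>)" by simp
 qed
 show "prim \<zeta> 0 = 0" using assms[of 0] by (simp add: prim_integral)
qed

lemma prim_continuous: "0 \<le> t \<Longrightarrow> continuous_on {0..} v \<Longrightarrow> set_integrable lborel {0..t} v \<and> prim v t = integral {0..t} v"
 using borel_integrable_atLeastAtMost'[OF continuous_on_subset, of "{0..}" v 0 t] by (auto simp: prim_integral)

text \<open>The integral of \<open>w\<close> times \<open>exp (c * s)\<close> has derivative 0, so
  it stays at its initial value 0.\<close>

lemma volterra_zero: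
 fixes w :: "real \<Rightarrow> real"
 assumes w: "continuous_on {0..} w" and eq: "\<And>t. 0 \<le> t \<Longrightarrow> w t = - c * integral {0..t} w" and t: "0 \<le> t"
 shows "w t = 0"
proof -
 have d: "((\<lambda>s. integral {0..s} w * exp (c * s)) has_real_derivative 0) (at s within {0..t})" if s: "s \<in> {0..t}" for s
 proof -
  have "continuous_on {0..t} w" by (rule continuous_on_subset[OF w]) auto
  from integral_has_real_derivative[OF this s]
  have "((\<lambda>s. integral {0..s} w * exp (c * s)) has_real_derivative w s * exp (c * s) + integral {0..s} w * (exp (c * s) * c)) (at s within {0..t})"
   by (auto intro!: derivative_eq_intros)
  moreover have "w s * exp (c * s) + integral {0..s} w * (exp (c * s) * c) = 0" using eq[of s] s by (simp add: algebra_simps)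
  ultimately show ?thesis by simp
 qed
 have "integral {0..t} (\<lambda>_. 0) = integral {0..t} w * exp (c * t) - integral {0..0} w * exp (c * 0)"
  by (rule integral_FTC[OF t d])
 then show ?thesis using eq[OF t] by simp
qed

context kalman
begin

lemma ou_continuous: "continuous_on {0..} b \<Longrightarrow> b 0 = 0 \<Longrightarrow> continuous_on {0..} (\<lambda>s. ou \<tau> \<beta> s (x, b))"
proof -
 assume b: "continuous_on {0..} b" "b 0 = 0"
 have "continuous_on {0..} (\<lambda>s. x + \<beta> * b s - sqrt V * obs s (x, b) / \<tau>)"
  using \<tau> by (intro continuous_intros obs_cont b) auto
 moreover have "x + \<beta> * b s - sqrt V * obs s (x, b) / \<tau> = ou \<tau> \<beta> s (x, b)" for s using \<tau> V by (simp add: obs_def)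
 ultimately show ?thesis by simp
qed

lemma ou_unique:
 assumes b: "continuous_on {0..} b" "b 0 = 0" and v: "continuous_on {0..} v"
  and eq: "\<And>t. 0 \<le> t \<Longrightarrow> v t = x + \<beta> * b t - integral {0..t} v / \<tau>" and t: "0 \<le> t"
 shows "v t = ou \<tau> \<beta> t (x, b)"
proof -
 note oc = ou_continuous[OF b, of x]
 have "v t - ou \<tau> \<beta> t (x, b) = 0"
 proof (rule volterra_zero[where w="\<lambda>t. v t - ou \<tau> \<beta> t (x, b)" and c="1 / \<tau>", OF continuous_on_diff[OF v oc] _ t])
  fix s :: real assume s: "0 \<le> s"
  have "integral {0..s} (\<lambda>t. v t - ou \<tau> \<beta> t (x, b)) = integral {0..s} v - integral {0..s} (\<lambda>t. ou \<tau> \<beta> t (x, b))"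
   by (rule hk_integral_diff) (auto intro!: integrable_continuous_interval continuous_on_subset[OF oc] continuous_on_subset[OF v])
  then show "v s - ou \<tau> \<beta> s (x, b) = - (1 / \<tau>) * integral {0..s} (\<lambda>t. v t - ou \<tau> \<beta> t (x, b))"
   using eq[OF s] ou_eq[OF b s, of x] by (simp add: diff_divide_distrib)
 qed
 then show ?thesis by simp
qed

lemma ou_add:
 assumes b: "continuous_on {0..} b" "b 0 = 0" "continuous_on {0..} b'" "b' 0 = 0" and t: "0 \<le> t"
 shows "ou \<tau> \<beta> t (x, \<lambda>s. b s + b' s) = ou \<tau> \<beta> t (x, b) + ou \<tau> \<beta> t (0, b')"
  "obs t (x, \<lambda>s. b s + b' s) = obs t (x, b) + obs t (0, b')"
proof -
 show 1: "ou \<tau> \<beta> t (x, \<lambda>s. b s + b' s) = ou \<tau> \<beta> t (x, b) + ou \<tau> \<beta> t (0, b')"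
 proof (rule ou_unique[symmetric, where v="\<lambda>t. ou \<tau> \<beta> t (x, b) + ou \<tau> \<beta> t (0, b')", OF _ _ _ _ t])
  show "continuous_on {0..} (\<lambda>s. b s + b' s)" "b 0 + b' 0 = 0" using b by (auto intro: continuous_on_add)
  show "continuous_on {0..} (\<lambda>t. ou \<tau> \<beta> t (x, b) + ou \<tau> \<beta> t (0, b'))" by (intro continuous_on_add ou_continuous b)
  fix s :: real assume s: "0 \<le> s"
  have "integral {0..s} (\<lambda>t. ou \<tau> \<beta> t (x, b) + ou \<tau> \<beta> t (0, b')) = integral {0..s} (\<lambda>t. ou \<tau> \<beta> t (x, b)) + integral {0..s} (\<lambda>t. ou \<tau> \<beta> t (0, b'))"
   by (intro hk_integral_add integrable_continuous_interval ou_cont b)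
  then show "ou \<tau> \<beta> s (x, b) + ou \<tau> \<beta> s (0, b') = x + \<beta> * (b s + b' s) - integral {0..s} (\<lambda>t. ou \<tau> \<beta> t (x, b) + ou \<tau> \<beta> t (0, b')) / \<tau>"
   using ou_eq[OF b(1,2) s, of x] ou_eq[OF b(3,4) s, of 0] by (simp add: add_divide_distrib algebra_simps)
 qed
 show "obs t (x, \<lambda>s. b s + b' s) = obs t (x, b) + obs t (0, b')"
  unfolding obs_def fst_conv snd_conv 1 by (simp add: algebra_simps)
qed

text \<open>By linearity a control adds the response to its own integral: the drift
  \<open>R * \<zeta>\<close> acts like the driving path
  \<open>R / (\<tau> * \<beta>) * prim \<zeta>\<close> in place of \<open>b\<close>. The equivalence
  holds path by path, so it covers feedback.\<close>

lemma system_iff: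
 fixes \<zeta> v y b w :: "real \<Rightarrow> real" and R :: real
 assumes R: "R > 0" and b: "continuous_on {0..} b" "b 0 = 0" and v: "continuous_on {0..} v"
 shows "v 0 = x \<and> (\<forall>t\<ge>0. set_integrable lborel {0..t} (\<lambda>s. R * \<zeta> s - v s) \<and>
   \<tau> * v t = \<tau> * v 0 + (LBINT s:{0..t}. R * \<zeta> s - v s) + \<tau> * \<beta> * b t \<and>
   y t = 1 / sqrt V * (LBINT s:{0..t}. v s) + w t)
  \<longleftrightarrow> (\<forall>t\<ge>0. set_integrable lborel {0..t} \<zeta> \<and>
   v t = ou \<tau> \<beta> t (x, b) + ou \<tau> \<beta> t (0, \<lambda>s. R / (\<tau> * \<beta>) * prim \<zeta> s) \<and>
   y t = obs t (x, b) + obs t (0, \<lambda>s. R / (\<tau> * \<beta>) * prim \<zeta> s) + w t)" (is "?L \<longleftrightarrow> ?R")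
proof -
 let ?c = "R / (\<tau> * \<beta>)"
 note vi = prim_continuous[OF _ v]
 \<comment> \<open>A continuous \<open>v\<close> is integrable on bounded intervals, so
   integrability of the drift and of the control are the same condition.\<close>
 have int: "set_integrable lborel {0..t} (\<lambda>s. R * \<zeta> s - v s) \<longleftrightarrow> set_integrable lborel {0..t} \<zeta>" if t: "0 \<le> t" for t
 proof
  assume "set_integrable lborel {0..t} (\<lambda>s. R * \<zeta> s - v s)"
  then have "set_integrable lborel {0..t} (\<lambda>s. (1 / R) * ((R * \<zeta> s - v s) + v s))"
   using vi[OF t] by (intro set_integrable_mult_right set_integral_add(1)) auto
  then show "set_integrable lborel {0..t} \<zeta>" using R by simp
 next
  assume "set_integrable lborel {0..t} \<zeta>"
  then show "set_integrable lborel {0..t} (\<lambda>s. R * \<zeta> s - v s)"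
   using vi[OF t] by (intro set_integral_diff(1) set_integrable_mult_right) auto
 qed
 have val: "(LBINT s:{0..t}. R * \<zeta> s - v s) = R * prim \<zeta> t - integral {0..t} v" if "0 \<le> t" "set_integrable lborel {0..t} \<zeta>" for t
  using vi[OF that(1)] that(2) by (simp add: set_integral_diff(2) prim_def)
 have *: "?L \<longleftrightarrow> ?R" if \<zeta>: "\<And>t. 0 \<le> t \<Longrightarrow> set_integrable lborel {0..t} \<zeta>"
 proof -
  let ?b' = "\<lambda>s. ?c * prim \<zeta> s"
  have b': "continuous_on {0..} ?b'" "?b' 0 = 0" by (intro continuous_on_mult_left prim_cont(1)[OF \<zeta>], simp_all add: prim_cont(2)[OF \<zeta>])
  have bb: "continuous_on {0..} (\<lambda>s. b s + ?b' s)" "b 0 + ?b' 0 = 0" using b b' by (auto intro: continuous_on_add)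
  have e: "\<beta> * ?b' t = R * prim \<zeta> t / \<tau>" for t using \<beta> by simp
  have A: "v 0 = x \<and> (\<forall>t\<ge>0. \<tau> * v t = \<tau> * v 0 + (LBINT s:{0..t}. R * \<zeta> s - v s) + \<tau> * \<beta> * b t)
   \<longleftrightarrow> (\<forall>t\<ge>0. v t = ou \<tau> \<beta> t (x, \<lambda>s. b s + ?b' s))"
  proof (intro iffI conjI allI impI)
   fix t :: real assume L: "v 0 = x \<and> (\<forall>t\<ge>0. \<tau> * v t = \<tau> * v 0 + (LBINT s:{0..t}. R * \<zeta> s - v s) + \<tau> * \<beta> * b t)" and t: "0 \<le> t"
   show "v t = ou \<tau> \<beta> t (x, \<lambda>s. b s + ?b' s)"
   proof (rule ou_unique[OF bb v _ t])
    fix s :: real assume s: "0 \<le> s"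
    then have "\<tau> * v s = \<tau> * (x + \<beta> * b s + R * prim \<zeta> s / \<tau> - integral {0..s} v / \<tau>)"
     using L val[OF s \<zeta>[OF s]] \<tau> by (simp add: algebra_simps)
    then have "v s = x + \<beta> * b s + R * prim \<zeta> s / \<tau> - integral {0..s} v / \<tau>" using \<tau> by (simp only: mult_cancel_left) simp
    then show "v s = x + \<beta> * (b s + ?b' s) - integral {0..s} v / \<tau>" by (simp only: distrib_left e add.assoc)
   qed
  next
   assume R': "\<forall>t\<ge>0. v t = ou \<tau> \<beta> t (x, \<lambda>s. b s + ?b' s)"
   have vs: "v t = x + \<beta> * (b t + ?b' t) - integral {0..t} v / \<tau>" if t: "0 \<le> t" for t
   proof -
    have "integral {0..t} v = integral {0..t} (\<lambda>s. ou \<tau> \<beta> s (x, \<lambda>s. b s + ?b' s))"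
     using R' by (intro hk_integral_cong) auto
    then show ?thesis using ou_eq[OF bb t, of x] R' t by simp
   qed
   show "v 0 = x" using vs[of 0] bb(2) by simp
   fix t :: real assume t: "0 \<le> t"
   have "v t = x + \<beta> * b t + R * prim \<zeta> t / \<tau> - integral {0..t} v / \<tau>"
    using vs[OF t] unfolding distrib_left e by simp
   then have "\<tau> * v t = \<tau> * x + R * prim \<zeta> t - integral {0..t} v + \<tau> * \<beta> * b t"
    using \<tau> by (simp only: right_diff_distrib distrib_left times_divide_eq_right) simp
   then show "\<tau> * v t = \<tau> * v 0 + (LBINT s:{0..t}. R * \<zeta> s - v s) + \<tau> * \<beta> * b t"
    using val[OF t \<zeta>[OF t]] \<open>v 0 = x\<close> by simp
  qed
  have Bq: "1 / sqrt V * (LBINT s:{0..t}. v s) = obs t (x, \<lambda>s. b s + ?b' s)"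
   if "\<forall>t\<ge>0. v t = ou \<tau> \<beta> t (x, \<lambda>s. b s + ?b' s)" "0 \<le> t" for t
  proof -
   have "integral {0..t} v = integral {0..t} (\<lambda>s. ou \<tau> \<beta> s (x, \<lambda>s. b s + ?b' s))"
    using that by (intro hk_integral_cong) auto
   then show ?thesis using obs_integral[OF bb that(2), of x] vi[OF that(2)] by (simp add: prim_def)
  qed
  show ?thesis
   using A Bq int \<zeta> ou_add[OF b b'] by (smt (verit))
 qed
 show ?thesis
 proof (cases "\<forall>t\<ge>0. set_integrable lborel {0..t} \<zeta>")
  case True then show ?thesis using * by blast
 next
  case False then show ?thesis using int by blast
 qed
qed

end

lemma continuous_path: "continuous_on {0..} (\<lambda>s. Y s w) \<Longrightarrow> continuous_on {0..} (path Y {0..} w)"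
 by (erule continuous_on_eq) (simp add: path_def)

lemma path_in_cont_path_space: "continuous_on {0..} (\<lambda>s. Y s w) \<Longrightarrow> path Y {0..} w \<in> space cont_path_space"
 using continuous_path[of Y w] by (simp add: cont_path_space_def space_restrict_space space_PiM path_def)

lemma measurable_path_cont:
 assumes "\<And>s. 0 \<le> s \<Longrightarrow> Y s \<in> borel_measurable F" "\<And>w. w \<in> space F \<Longrightarrow> continuous_on {0..} (\<lambda>s. Y s w)"
 shows "path Y {0..} \<in> measurable F cont_path_space"
 unfolding cont_path_space_def
proof (rule measurable_restrict_space2)
 show "path Y {0..} \<in> measurable F (path_space {0..})" unfolding path_def[abs_def] using assms(1) by (intro measurable_restrict) auto
 show "path Y {0..} \<in> space F \<rightarrow> {y. continuous_on {0..} y}"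
  using continuous_path[of Y] assms(2) by blast
qed

locale control_functional =
 fixes f :: "real \<Rightarrow> (real \<Rightarrow> real) \<Rightarrow> real"
 assumes f: "nonanticipative_functional f"
begin

lemma f_local:
 assumes "continuous_on {0..} (\<lambda>s. Y s w)" "continuous_on {0..} (\<lambda>s. Y' s w')" "\<And>s. 0 \<le> s \<Longrightarrow> s \<le> t \<Longrightarrow> Y s w = Y' s w'" "0 \<le> t"
 shows "f t (path Y {0..} w) = f t (path Y' {0..} w')"
proof -
 have "\<forall>s\<in>{0..t}. path Y {0..} w s = path Y' {0..} w' s" using assms(3) by (auto simp: path_def)
 then show ?thesis
  using f assms(4) path_in_cont_path_space[of Y w, OF assms(1)] path_in_cont_path_space[of Y' w', OF assms(2)]
  unfolding nonanticipative_functional_def by blast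
qed

lemma prim_local:
 assumes "continuous_on {0..} (\<lambda>s. Y s w)" "continuous_on {0..} (\<lambda>s. Y' s w')" "\<And>s. 0 \<le> s \<Longrightarrow> s \<le> t \<Longrightarrow> Y s w = Y' s w'"
 shows "prim (\<lambda>s. f s (path Y {0..} w)) t = prim (\<lambda>s. f s (path Y' {0..} w')) t"
  "set_integrable lborel {0..t} (\<lambda>s. f s (path Y {0..} w)) \<longleftrightarrow> set_integrable lborel {0..t} (\<lambda>s. f s (path Y' {0..} w'))"
proof -
 have eq: "f s (path Y {0..} w) = f s (path Y' {0..} w')" if "s \<in> {0..t}" for s
  by (rule f_local[where Y=Y and Y'=Y' and w=w and w'=w', OF assms(1,2)]) (use that in \<open>auto intro: assms(3)\<close>)
 show "prim (\<lambda>s. f s (path Y {0..} w)) t = prim (\<lambda>s. f s (path Y' {0..} w')) t"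
  unfolding prim_def by (rule set_lebesgue_integral_cong) (simp_all add: eq)
 show "set_integrable lborel {0..t} (\<lambda>s. f s (path Y {0..} w)) \<longleftrightarrow> set_integrable lborel {0..t} (\<lambda>s. f s (path Y' {0..} w'))"
  by (rule set_integrable_cong) (simp_all add: eq)
qed

lemma prim_measurable:
 assumes Y: "\<And>s. 0 \<le> s \<Longrightarrow> s \<le> t \<Longrightarrow> Y s \<in> borel_measurable F" and c: "\<And>w. w \<in> space F \<Longrightarrow> continuous_on {0..} (\<lambda>s. Y s w)" and t: "0 \<le> t"
 shows "(\<lambda>w. prim (\<lambda>s. f s (path Y {0..} w)) t) \<in> borel_measurable F"
  "{w \<in> space F. set_integrable lborel {0..t} (\<lambda>s. f s (path Y {0..} w))} \<in> sets F"
proof -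
 \<comment> \<open>Stopping the path at \<open>t\<close> changes no control value up to
   \<open>t\<close>, by non-anticipation, and makes the integrand depend only on observations that
   are \<open>F\<close>-measurable.\<close>
 define S where "S s w = Y (min s t) w" for s w
 have Sc: "continuous_on {0..} (\<lambda>s. S s w)" if "w \<in> space F" for w
  unfolding S_def by (rule continuous_on_compose2[where g="\<lambda>s. Y s w", OF c[OF that]]) (use t in \<open>auto intro!: continuous_intros\<close>)
 have Sm[measurable]: "path S {0..} \<in> measurable F cont_path_space"
  by (rule measurable_path_cont[where Y=S and F=F]) (use Sc Y t in \<open>simp_all add: S_def[abs_def]\<close>)
 have mx: "(\<lambda>z. max 0 (snd z) :: real) \<in> measurable (F \<Otimes>\<^sub>M lborel) (restrict_space borel {0..})"
  by (rule measurable_restrict_space2) auto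
 have "(\<lambda>z. (max 0 (snd z) :: real, path S {0..} (fst z))) \<in> measurable (F \<Otimes>\<^sub>M lborel) (restrict_space borel {0..} \<Otimes>\<^sub>M cont_path_space)"
  by (intro measurable_Pair mx measurable_compose[OF measurable_fst Sm])
 then have "(\<lambda>z. (\<lambda>(t, y). f t y) (max 0 (snd z), path S {0..} (fst z))) \<in> borel_measurable (F \<Otimes>\<^sub>M lborel)"
  by (rule measurable_compose) (use f in \<open>simp add: nonanticipative_functional_def\<close>)
 then have fm[measurable]: "(\<lambda>z. f (max 0 (snd z)) (path S {0..} (fst z))) \<in> borel_measurable (F \<Otimes>\<^sub>M lborel)" by simp
 define h where "h w s = indicator {0..t} s *\<^sub>R f (max 0 s) (path S {0..} w)" for w s
 have hm[measurable]: "(\<lambda>(w, s). h w s) \<in> borel_measurable (F \<Otimes>\<^sub>M lborel)"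
  unfolding h_def case_prod_beta
 proof (rule borel_measurable_scaleR[OF _ fm])
  have "indicator {0..t} \<in> borel_measurable lborel" by simp
  from measurable_compose[OF measurable_snd this]
  show "(\<lambda>z. indicator {0..t} (snd z)) \<in> borel_measurable (F \<Otimes>\<^sub>M lborel)" .
 qed
 have eq: "indicator {0..t} s *\<^sub>R f s (path Y {0..} w) = h w s" if "w \<in> space F" for w s
 proof (cases "s \<in> {0..t}")
  case True
  then have "f s (path Y {0..} w) = f s (path S {0..} w)"
   by (intro f_local[where Y=Y and Y'=S and w=w and w'=w] c Sc that) (auto simp: S_def)
  then show ?thesis using True by (simp add: h_def)
 qed (simp add: h_def)
 have "(\<lambda>w. LINT s|lborel. h w s) \<in> borel_measurable F" by (rule lborel.borel_measurable_lebesgue_integral[OF hm])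
 then show "(\<lambda>w. prim (\<lambda>s. f s (path Y {0..} w)) t) \<in> borel_measurable F"
  unfolding prim_def set_lebesgue_integral_def by (rule measurable_cong[THEN iffD1, rotated]) (simp only: eq)
 have hs: "h w \<in> borel_measurable lborel" if "w \<in> space F" for w
  using measurable_compose[OF measurable_Pair1'[OF that] hm] by simp
 have "(\<lambda>(w, s). ennreal (norm (h w s))) \<in> borel_measurable (F \<Otimes>\<^sub>M lborel)"
  using measurable_compose[OF hm, of "\<lambda>x. ennreal (norm x)" borel] by (simp add: case_prod_beta')
 from lborel.borel_measurable_nn_integral[OF this]
 have "{w \<in> space F. (\<integral>\<^sup>+s. ennreal (norm (h w s)) \<partial>lborel) < \<infinity>} \<in> sets F" by (rule borel_measurable_less) simp
 also have "{w \<in> space F. (\<integral>\<^sup>+s. ennreal (norm (h w s)) \<partial>lborel) < \<infinity>} = {w \<in> space F. set_integrable lborel {0..t} (\<lambda>s. f s (path Y {0..} w))}"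
 proof (intro Collect_cong conj_cong refl)
  fix w assume w: "w \<in> space F"
  show "(\<integral>\<^sup>+s. ennreal (norm (h w s)) \<partial>lborel) < \<infinity> \<longleftrightarrow> set_integrable lborel {0..t} (\<lambda>s. f s (path Y {0..} w))"
   unfolding set_integrable_def eq[OF w] integrable_iff_bounded using hs[OF w] by simp
 qed
 finally show "{w \<in> space F. set_integrable lborel {0..t} (\<lambda>s. f s (path Y {0..} w))} \<in> sets F" .
qed

end

locale kalman_control = kalman_drivers M v0 B Bm s0 \<tau> \<beta> V P + control_functional f
 for M :: "'a measure" and v0 B Bm s0 \<tau> \<beta> V P f +
 fixes r :: real
begin

text \<open>The controlled part of \<open>v\<close> and \<open>Y\<close>, written as the signal \<open>ou\<close>, \<open>obs\<close> driven by the
 rescaled integrated control in place of \<open>B\<close>.\<close>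

definition ctl :: "(real \<Rightarrow> 'b \<Rightarrow> real) \<Rightarrow> 'b \<Rightarrow> real \<times> (real \<Rightarrow> real)" where
 "ctl Y w = (0, \<lambda>s. r * prim (\<lambda>s. f s (path Y {0..} w)) s)"

text \<open>Sample space and sigma-algebra \<open>F\<close> are arbitrary, because the lemma serves
  adapted processes on \<open>M\<close> as well as processes on the space of driver paths.\<close>

lemma ctl_measurable:
 assumes Y: "\<And>s. 0 \<le> s \<Longrightarrow> s \<le> t \<Longrightarrow> Y s \<in> borel_measurable F" and c: "\<And>w. w \<in> space F \<Longrightarrow> continuous_on {0..} (\<lambda>s. Y s w)" and t: "0 \<le> t"
 shows "(\<lambda>w. ou \<tau> \<beta> t (ctl Y w)) \<in> borel_measurable F" "(\<lambda>w. obs t (ctl Y w)) \<in> borel_measurable F"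
proof -
 define g where "g w = (0::real, \<lambda>s\<in>{0..t}. r * prim (\<lambda>s. f s (path Y {0..} w)) s)" for w
 have g: "g \<in> measurable F (sigs {0..t})"
  unfolding g_def[abs_def]
 proof (intro measurable_Pair measurable_const measurable_restrict borel_measurable_times)
  fix s assume "s \<in> {0..t}"
  then show "(\<lambda>w. prim (\<lambda>s. f s (path Y {0..} w)) s) \<in> borel_measurable F"
   by (intro prim_measurable(1)[where Y=Y and F=F]) (auto intro: Y c)
 qed simp_all
 have "ou \<tau> \<beta> t (ctl Y w) = ou \<tau> \<beta> t (g w)" "obs t (ctl Y w) = obs t (g w)" for w
  by (intro ou_cong obs_cong t; simp add: ctl_def g_def)+
 then show "(\<lambda>w. ou \<tau> \<beta> t (ctl Y w)) \<in> borel_measurable F" "(\<lambda>w. obs t (ctl Y w)) \<in> borel_measurable F"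
  using measurable_compose[OF g measurable_ou] measurable_compose[OF g measurable_obs] t by auto
qed

lemma ctl_local:
 assumes "continuous_on {0..} (\<lambda>s. Y s w)" "continuous_on {0..} (\<lambda>s. Y' s w')" "\<And>s. 0 \<le> s \<Longrightarrow> s \<le> t \<Longrightarrow> Y s w = Y' s w'" "0 \<le> t"
 shows "obs t (ctl Y w) = obs t (ctl Y' w')"
 unfolding ctl_def by (rule obs_cong[OF _ _ assms(4)]) (simp_all add: prim_local(1)[where Y=Y and Y'=Y' and w=w and w'=w', OF assms(1,2)] assms(3))

end

section \<open>The augmented driver filtration\<close>

context gaussian_drivers
begin

abbreviation "\<F> t \<equiv> driver_filtration M v0 B Bm t"
abbreviation "drv t w \<equiv> (sig {0..t} w, path Bm {0..t} w)"

lemma driver_filtration_gen: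
 "sets (vimage_algebra (space M) v0 borel) \<union> sets (vimage_algebra (space M) (path B {0..t}) (path_space {0..t})) \<union>
    sets (vimage_algebra (space M) (path Bm {0..t}) (path_space {0..t})) \<union> null_sets M \<subseteq> Pow (space M)"
proof (intro Un_least)
 show "null_sets M \<subseteq> Pow (space M)" using sets.space_closed[of M] by (auto simp: null_sets_def)
next
 show "sets (vimage_algebra (space M) v0 borel) \<subseteq> Pow (space M)" using sets.space_closed[of "vimage_algebra (space M) v0 borel"] by (simp only: space_vimage_algebra)
 show "sets (vimage_algebra (space M) (path B {0..t}) (path_space {0..t})) \<subseteq> Pow (space M)"
  using sets.space_closed[of "vimage_algebra (space M) (path B {0..t}) (path_space {0..t})"] by (simp only: space_vimage_algebra)
 show "sets (vimage_algebra (space M) (path Bm {0..t}) (path_space {0..t})) \<subseteq> Pow (space M)"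
  using sets.space_closed[of "vimage_algebra (space M) (path Bm {0..t}) (path_space {0..t})"] by (simp only: space_vimage_algebra)
qed

lemma space_driver_filtration: "space (\<F> t) = space M"
 unfolding driver_filtration_def by (rule space_measure_of[OF driver_filtration_gen])

lemma sets_driver_filtration:
 "sets (vimage_algebra (space M) v0 borel) \<subseteq> sets (\<F> t)"
 "sets (vimage_algebra (space M) (path B {0..t}) (path_space {0..t})) \<subseteq> sets (\<F> t)"
 "sets (vimage_algebra (space M) (path Bm {0..t}) (path_space {0..t})) \<subseteq> sets (\<F> t)"
 "null_sets M \<subseteq> sets (\<F> t)"
 unfolding driver_filtration_def sets_measure_of[OF driver_filtration_gen] by (auto intro: sigma_sets.Basic)

lemma measurable_vimage_sub:
 assumes "g \<in> space M \<rightarrow> space S" "sets (vimage_algebra (space M) g S) \<subseteq> sets F" "space F = space M"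
 shows "g \<in> measurable F S"
 by (rule measurableI) (use assms in \<open>auto intro!: in_vimage_algebra\<close>)

lemma drv_measurable: assumes t: "0 \<le> t"
 shows "drv t \<in> measurable (\<F> t) (sigs {0..t} \<Otimes>\<^sub>M path_space {0..t})"
  "drv t \<in> measurable M (sigs {0..t} \<Otimes>\<^sub>M path_space {0..t})"
proof -
 have "v0 \<in> measurable (\<F> t) borel" "path B {0..t} \<in> measurable (\<F> t) (path_space {0..t})" "path Bm {0..t} \<in> measurable (\<F> t) (path_space {0..t})"
  by (rule measurable_vimage_sub[OF _ sets_driver_filtration(1) space_driver_filtration]
    measurable_vimage_sub[OF _ sets_driver_filtration(2) space_driver_filtration]
    measurable_vimage_sub[OF _ sets_driver_filtration(3) space_driver_filtration]; auto simp: path_def space_PiM)+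
 then show "drv t \<in> measurable (\<F> t) (sigs {0..t} \<Otimes>\<^sub>M path_space {0..t})"
  unfolding sig_def by measurable
 have "{0..t} \<subseteq> {0..}" by auto
 then show "drv t \<in> measurable M (sigs {0..t} \<Otimes>\<^sub>M path_space {0..t})"
  by (intro measurable_Pair sig_measurable path_measurable)
qed

text \<open>Null sets in the filtration rule out an exact factorisation through the drivers; almost
  everywhere a null set may be replaced by the empty set, and the other generators are
  preimages.\<close>

lemma driver_factor:
 fixes X :: "'a \<Rightarrow> real"
 assumes t: "0 \<le> t" and X: "X \<in> borel_measurable (\<F> t)"
 shows "\<exists>F\<in>borel_measurable (sigs {0..t} \<Otimes>\<^sub>M path_space {0..t}). AE w in M. X w = F (drv t w)"
proof (rule AE_factor[OF drv_measurable(2)[OF t] space_driver_filtration _ X])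
 let ?S = "(sigs {0..t}) \<Otimes>\<^sub>M path_space {0..t} :: ((real \<times> (real \<Rightarrow> real)) \<times> (real \<Rightarrow> real)) measure"
 note m = drv_measurable(2)[OF t]
 have v: "\<exists>E\<in>sets ?S. AE w in M. w \<in> A \<longleftrightarrow> drv t w \<in> E"
  if A: "A \<in> sets (vimage_algebra (space M) g S)" and h: "h \<in> measurable ?S S" and g: "\<And>w. g w = h (drv t w)" for A g h and S :: "'s measure"
 proof -
  have "g \<in> space M \<rightarrow> space S" using measurable_space[OF h measurable_space[OF m]] g by auto
  then obtain E where E: "E \<in> sets S" "A = g -` E \<inter> space M" using A sets_vimage_algebra2[of g "space M" S] by auto
  then have "h -` E \<inter> space ?S \<in> sets ?S" using h by (auto intro: measurable_sets)
  moreover have "AE w in M. w \<in> A \<longleftrightarrow> drv t w \<in> h -` E \<inter> space ?S"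
   using AE_space by eventually_elim (use E g measurable_space[OF m] in auto)
  ultimately show ?thesis by blast
 qed
 fix A assume "A \<in> sets (\<F> t)"
 then have "A \<in> sigma_sets (space M) (sets (vimage_algebra (space M) v0 borel) \<union> sets (vimage_algebra (space M) (path B {0..t}) (path_space {0..t})) \<union>
    sets (vimage_algebra (space M) (path Bm {0..t}) (path_space {0..t})) \<union> null_sets M)"
  unfolding driver_filtration_def sets_measure_of[OF driver_filtration_gen] .
 then show "\<exists>E\<in>sets ?S. AE w in M. w \<in> A \<longleftrightarrow> drv t w \<in> E"
 proof induction
  case (Basic A)
  then consider "A \<in> sets (vimage_algebra (space M) v0 borel)" | "A \<in> sets (vimage_algebra (space M) (path B {0..t}) (path_space {0..t}))"
   | "A \<in> sets (vimage_algebra (space M) (path Bm {0..t}) (path_space {0..t}))" | "A \<in> null_sets M" by auto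
  then show ?case
  proof cases
   case 1 show ?thesis by (rule v[OF 1, of "\<lambda>z. fst (fst z)"]) (auto simp: sig_def)
  next
   case 2 show ?thesis by (rule v[OF 2, of "\<lambda>z. snd (fst z)"]) (auto simp: sig_def)
  next
   case 3 show ?thesis by (rule v[OF 3, of snd]) auto
  next
   case 4 then show ?thesis by (intro bexI[of _ "{}"]) (auto dest: AE_not_in)
  qed
 next
  case Empty show ?case by (intro bexI[of _ "{}"]) auto
 next
  case (Compl A)
  then obtain E where E: "E \<in> sets ?S" "AE w in M. w \<in> A \<longleftrightarrow> drv t w \<in> E" by blast
  have "AE w in M. w \<in> space M - A \<longleftrightarrow> drv t w \<in> space ?S - E"
   using E(2) AE_space by eventually_elim (use measurable_space[OF m] in auto)
  then show ?case using E(1) by (intro bexI[of _ "space ?S - E"]) auto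
 next
  case (Union A)
  have "\<forall>i. \<exists>E. E \<in> sets ?S \<and> (AE w in M. w \<in> A i \<longleftrightarrow> drv t w \<in> E)" using Union.IH by blast
  then obtain E where E: "\<And>i::nat. E i \<in> sets ?S" "\<And>i. AE w in M. w \<in> A i \<longleftrightarrow> drv t w \<in> E i"
   by (auto dest!: choice)
  have "AE w in M. \<forall>i. w \<in> A i \<longleftrightarrow> drv t w \<in> E i" using E(2) by (simp add: AE_all_countable)
  then have "AE w in M. w \<in> (\<Union>i. A i) \<longleftrightarrow> drv t w \<in> (\<Union>i. E i)" by eventually_elim auto
  then show ?case using E(1) by (intro bexI[of _ "\<Union>i. E i"]) auto
 qed
qed

end

text \<open>Values on \<open>dyadics\<close> determine a continuous process, and \<open>dyadic_uc\<close> makes extendability a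
 countable, hence measurable, condition.\<close>

definition dyad :: "nat \<Rightarrow> real \<Rightarrow> real" where "dyad n s = real (nat \<lfloor>s * 2^n\<rfloor>) / 2^n"
definition dyadics :: "real set" where "dyadics = range (\<lambda>(j::nat, n::nat). real j / 2^n)"

lemma dyad: "0 \<le> s \<Longrightarrow> 0 \<le> dyad n s" "0 \<le> s \<Longrightarrow> dyad n s \<le> s" "0 \<le> s \<Longrightarrow> (\<lambda>n. dyad n s) \<longlonglongrightarrow> s" "dyad n s \<in> dyadics"
 using dyadic_floor[of s] by (auto simp: dyad_def[abs_def] dyadics_def)

lemma countable_dyadics: "countable dyadics" "q \<in> dyadics \<Longrightarrow> 0 \<le> q"
 by (auto simp: dyadics_def)

lemma continuous_dyad_lim:
 fixes y :: "real \<Rightarrow> real"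
 assumes "continuous_on {0..} y" "0 \<le> t" shows "(\<lambda>n. y (dyad n t)) \<longlonglongrightarrow> y t"
 using assms dyad(1)[of t] dyad(3)[of t] by (auto simp: continuous_on_sequentially comp_def)

definition dyadic_uc :: "(real \<Rightarrow> real) \<Rightarrow> bool" where
 "dyadic_uc x \<longleftrightarrow> (\<forall>N k :: nat. \<exists>m :: nat. \<forall>p\<in>dyadics. \<forall>q\<in>dyadics. p \<le> real N \<and> q \<le> real N \<and> \<bar>p - q\<bar> < 1 / Suc m \<longrightarrow> \<bar>x p - x q\<bar> \<le> 1 / Suc k)"

lemma continuous_dyadic_uc:
 fixes y :: "real \<Rightarrow> real"
 assumes y: "continuous_on {0..} y" and x: "\<And>q. q \<in> dyadics \<Longrightarrow> x q = y q" shows "dyadic_uc x"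
 unfolding dyadic_uc_def
proof (intro allI)
 fix N k :: nat
 have "uniformly_continuous_on {0..real N} y" by (rule compact_uniformly_continuous[OF continuous_on_subset[OF y]]) auto
 then obtain d where d: "d > 0" "\<And>p q. p \<in> {0..real N} \<Longrightarrow> q \<in> {0..real N} \<Longrightarrow> dist p q < d \<Longrightarrow> dist (y p) (y q) < 1 / Suc k"
  unfolding uniformly_continuous_on_def by (metis of_nat_0_less_iff zero_less_Suc zero_less_divide_1_iff dist_commute)
 obtain m where "1 / Suc m < d" using nat_approx_posE[OF d(1)] by auto
 then show "\<exists>m. \<forall>p\<in>dyadics. \<forall>q\<in>dyadics. p \<le> real N \<and> q \<le> real N \<and> \<bar>p - q\<bar> < 1 / Suc m \<longrightarrow> \<bar>x p - x q\<bar> \<le> 1 / Suc k"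
  using d(2) x countable_dyadics(2) by (intro exI[of _ m]) (force simp: dist_real_def less_imp_le)
qed

lemma dyadic_uc_extension:
 fixes x :: "real \<Rightarrow> real"
 assumes x: "dyadic_uc x"
 shows "0 \<le> t \<Longrightarrow> convergent (\<lambda>n. x (dyad n t))" "continuous_on {0..} (\<lambda>t. lim (\<lambda>n. x (dyad n t)))"
proof -
 \<comment> \<open>The two times may be rounded at different levels, so one estimate yields both the
   Cauchy property and the continuity of the limit.\<close>
 have key: "\<exists>d>0. \<forall>s t :: real. 0 \<le> s \<and> s \<le> real N \<and> 0 \<le> t \<and> t \<le> real N \<and> \<bar>s - t\<bar> < d \<longrightarrow> (\<exists>n0. \<forall>m\<ge>n0. \<forall>n\<ge>n0. \<bar>x (dyad m s) - x (dyad n t)\<bar> \<le> e)" if e: "e > 0" for e and N :: nat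
 proof -
  obtain k where k: "1 / Suc k < e" using nat_approx_posE[OF e] by auto
  obtain m where m: "\<And>p q. p \<in> dyadics \<Longrightarrow> q \<in> dyadics \<Longrightarrow> p \<le> real N \<Longrightarrow> q \<le> real N \<Longrightarrow> \<bar>p - q\<bar> < 1 / Suc m \<Longrightarrow> \<bar>x p - x q\<bar> \<le> 1 / Suc k"
   using x unfolding dyadic_uc_def by meson
  \<comment> \<open>A third of the modulus: two thirds bound the dyadic roundings of
    \<open>s\<close> and \<open>t\<close>, one third their distance.\<close>
  define d where "d = (1 / 3) / real (Suc m)"
  have d: "d > 0" "3 * d = 1 / Suc m" by (simp_all add: d_def field_simps del: of_nat_Suc)
  show ?thesis
  proof (intro exI[of _ d] conjI allI impI d(1))
   fix s t assume *: "0 \<le> s \<and> s \<le> real N \<and> 0 \<le> t \<and> t \<le> real N \<and> \<bar>s - t\<bar> < d"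
   obtain n1 where n1: "\<And>n. n \<ge> n1 \<Longrightarrow> \<bar>dyad n s - s\<bar> < d" using dyad(3)[of s] * d(1) by (auto simp: lim_sequentially dist_real_def)
   obtain n2 where n2: "\<And>n. n \<ge> n2 \<Longrightarrow> \<bar>dyad n t - t\<bar> < d" using dyad(3)[of t] * d(1) by (auto simp: lim_sequentially dist_real_def)
   show "\<exists>n0. \<forall>m\<ge>n0. \<forall>n\<ge>n0. \<bar>x (dyad m s) - x (dyad n t)\<bar> \<le> e"
   proof (intro exI[of _ "max n1 n2"] allI impI)
    fix i j assume "max n1 n2 \<le> i" "max n1 n2 \<le> j"
    then have "\<bar>dyad i s - s\<bar> < d" "\<bar>dyad j t - t\<bar> < d" using n1 n2 by auto
    then have "\<bar>dyad i s - dyad j t\<bar> < 1 / Suc m" using * d(2) by linarith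
    then have "\<bar>x (dyad i s) - x (dyad j t)\<bar> \<le> 1 / Suc k" using * dyad(1,2)[of s i] dyad(1,2)[of t j] by (intro m dyad(4)) auto
    then show "\<bar>x (dyad i s) - x (dyad j t)\<bar> \<le> e" using k by simp
   qed
  qed
 qed
 show conv: "convergent (\<lambda>n. x (dyad n t))" if t: "0 \<le> t" for t
  unfolding Cauchy_convergent_iff[symmetric]
 proof (rule metric_CauchyI)
  fix e :: real assume "e > 0"
  then have e: "e / 2 > 0" by simp
  obtain n0 where "\<forall>m\<ge>n0. \<forall>n\<ge>n0. \<bar>x (dyad m t) - x (dyad n t)\<bar> \<le> e / 2"
   using key[OF e, of "nat \<lceil>t\<rceil>"] t real_nat_ceiling_ge[of t] by fastforce
  then show "\<exists>M. \<forall>m\<ge>M. \<forall>n\<ge>M. dist (x (dyad m t)) (x (dyad n t)) < e"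
   using \<open>e > 0\<close> by (intro exI[of _ n0]) (force simp: dist_real_def)
 qed
 show "continuous_on {0..} (\<lambda>t. lim (\<lambda>n. x (dyad n t)))"
  unfolding continuous_on_iff
 proof (intro ballI allI impI)
  fix t e :: real assume t: "t \<in> {0..}" and "e > 0"
  then have e: "e / 2 > 0" by simp
  define N where "N = nat \<lceil>t + 1\<rceil>"
  have N: "t + 1 \<le> real N" unfolding N_def by (rule real_nat_ceiling_ge)
  obtain d where d: "d > 0" "\<forall>s r. 0 \<le> s \<and> s \<le> real N \<and> 0 \<le> r \<and> r \<le> real N \<and> \<bar>s - r\<bar> < d \<longrightarrow>
    (\<exists>n0. \<forall>m\<ge>n0. \<forall>n\<ge>n0. \<bar>x (dyad m s) - x (dyad n r)\<bar> \<le> e / 2)"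
   using key[OF e, of N] by (elim exE conjE)
  show "\<exists>d>0. \<forall>s\<in>{0..}. dist s t < d \<longrightarrow> dist (lim (\<lambda>n. x (dyad n s))) (lim (\<lambda>n. x (dyad n t))) < e"
  proof (intro exI[of _ "min d 1"] conjI ballI impI)
   show "0 < min d 1" using d by simp
   fix s :: real assume s: "s \<in> {0..}" "dist s t < min d 1"
   then have "s \<le> real N" "t \<le> real N" "\<bar>s - t\<bar> < d" using N by (auto simp: dist_real_def)
   then have "\<exists>n0. \<forall>m\<ge>n0. \<forall>n\<ge>n0. \<bar>x (dyad m s) - x (dyad n t)\<bar> \<le> e / 2" using d(2) s(1) t by simp
   then obtain n0 where n0: "\<And>n. n \<ge> n0 \<Longrightarrow> \<bar>x (dyad n s) - x (dyad n t)\<bar> \<le> e / 2" by blast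
   have "(\<lambda>n. x (dyad n s) - x (dyad n t)) \<longlonglongrightarrow> lim (\<lambda>n. x (dyad n s)) - lim (\<lambda>n. x (dyad n t))"
    using conv[of s] conv[of t] s t by (intro tendsto_diff) (auto simp: convergent_LIMSEQ_iff)
   then have "(\<lambda>n. \<bar>x (dyad n s) - x (dyad n t)\<bar>) \<longlonglongrightarrow> \<bar>lim (\<lambda>n. x (dyad n s)) - lim (\<lambda>n. x (dyad n t))\<bar>" by (rule tendsto_rabs)
   then have "\<bar>lim (\<lambda>n. x (dyad n s)) - lim (\<lambda>n. x (dyad n t))\<bar> \<le> e / 2" using n0 by (intro LIMSEQ_le_const2) auto
   then show "dist (lim (\<lambda>n. x (dyad n s))) (lim (\<lambda>n. x (dyad n t))) < e" using \<open>e > 0\<close> by (simp add: dist_real_def)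
  qed
 qed
qed

text \<open>The noiseless observation is an integral of a continuous signal. On bounded intervals
  the difference of two such observations is therefore an admissible shift of the measurement
  noise.\<close>

lemma (in kalman_drivers) H_lipschitz:
 assumes g: "good w"
 shows "\<exists>K\<ge>0. \<forall>r s. 0 \<le> r \<and> r \<le> s \<and> s \<le> N \<longrightarrow> \<bar>H s w - H r w\<bar> \<le> K * (s - r)"
proof -
 have b: "continuous_on {0..} (\<lambda>t. B t w)" "B 0 w = 0" using g by (auto simp: good_def)
 let ?o = "\<lambda>s. ou \<tau> \<beta> s (v0 w, \<lambda>s. B s w)"
 have c: "continuous_on {0..} ?o" by (rule ou_continuous[OF b])
 have "compact (?o ` {0..N})" by (intro compact_continuous_image continuous_on_subset[OF c]) auto
 then obtain K where K: "\<And>s. s \<in> {0..N} \<Longrightarrow> \<bar>?o s\<bar> \<le> K" by (force dest!: compact_imp_bounded simp: bounded_iff)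
 show ?thesis
 proof (intro exI[of _ "\<bar>K\<bar> / sqrt V"] conjI allI impI)
  show "0 \<le> \<bar>K\<bar> / sqrt V" using V by simp
  fix r s assume rs: "0 \<le> r \<and> r \<le> s \<and> s \<le> N"
  have "integral {0..s} ?o = integral {0..r} ?o + integral {r..s} ?o"
   by (rule hk_integral_combine[symmetric])
    (use rs in \<open>auto intro!: integrable_continuous_interval continuous_on_subset[OF c]\<close>)
  then have "\<bar>H s w - H r w\<bar> = \<bar>integral {r..s} ?o\<bar> / sqrt V"
   using rs V obs_integral[OF b] by (simp add: H_sig(2) diff_divide_distrib[symmetric])
  also have "... \<le> \<bar>K\<bar> * (s - r) / sqrt V"
  proof (rule divide_right_mono)
   have "norm (integral {r..s} ?o) \<le> \<bar>K\<bar> * (s - r)"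
   proof (rule integral_bound)
    show "norm (?o x) \<le> \<bar>K\<bar>" if "x \<in> {r..s}" for x using K[of x] that rs by auto
   qed (use rs in \<open>auto intro: continuous_on_subset[OF c]\<close>)
   then show "\<bar>integral {r..s} ?o\<bar> \<le> \<bar>K\<bar> * (s - r)" by simp
  qed (use V in simp)
  finally show "\<bar>H s w - H r w\<bar> \<le> \<bar>K\<bar> / sqrt V * (s - r)" by simp
 qed
qed

lemma pred_dyadics: "(\<And>q. q \<in> dyadics \<Longrightarrow> Measurable.pred N (\<lambda>x. Q x q)) \<Longrightarrow> Measurable.pred N (\<lambda>x. \<forall>q\<in>dyadics. Q x q)"
proof -
 assume *: "\<And>q. q \<in> dyadics \<Longrightarrow> Measurable.pred N (\<lambda>x. Q x q)"
 have "(\<forall>q\<in>dyadics. Q x q) \<longleftrightarrow> (\<forall>z::nat \<times> nat. Q x (real (fst z) / 2 ^ snd z))" for x by (auto simp: dyadics_def)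
 moreover have "Measurable.pred N (\<lambda>x. \<forall>z::nat \<times> nat. Q x (real (fst z) / 2 ^ snd z))"
  by (intro pred_intros_countable *) (auto simp: dyadics_def)
 ultimately show ?thesis by simp
qed

section \<open>Recovering the controlled from the uncontrolled observation\<close>

context kalman_control
begin

text \<open>The controlled system in solved form. Adaptedness is part of it, since uniqueness is
  available among adapted solutions only; every candidate built later has to be adapted.\<close>

definition solves :: "(real \<Rightarrow> 'a \<Rightarrow> real) \<Rightarrow> (real \<Rightarrow> 'a \<Rightarrow> real) \<Rightarrow> bool" where
 "solves v Y \<longleftrightarrow> (\<forall>w\<in>space M. continuous_on {0..} (\<lambda>t. v t w) \<and> continuous_on {0..} (\<lambda>t. Y t w)) \<and>
  (\<forall>t\<ge>0. v t \<in> borel_measurable (\<F> t) \<and> Y t \<in> borel_measurable (\<F> t)) \<and>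
  (AE w in M. \<forall>t\<ge>0. set_integrable lborel {0..t} (\<lambda>s. f s (path Y {0..} w)) \<and>
    v t w = u t w + ou \<tau> \<beta> t (ctl Y w) \<and> Y t w = Ys t w + obs t (ctl Y w))"

lemma ctl_path_cont:
 assumes "\<And>t. 0 \<le> t \<Longrightarrow> set_integrable lborel {0..t} (\<lambda>s. f s (path Y {0..} w))"
 shows "continuous_on {0..} (\<lambda>t. ou \<tau> \<beta> t (ctl Y w))" "continuous_on {0..} (\<lambda>t. obs t (ctl Y w))"
proof -
 have "continuous_on {0..} (\<lambda>s. r * prim (\<lambda>s. f s (path Y {0..} w)) s)" "r * prim (\<lambda>s. f s (path Y {0..} w)) 0 = 0"
  using prim_cont(1)[OF assms] prim_cont(2)[OF assms] by (auto intro: continuous_on_mult_left)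
 then show "continuous_on {0..} (\<lambda>t. ou \<tau> \<beta> t (ctl Y w))" "continuous_on {0..} (\<lambda>t. obs t (ctl Y w))"
  unfolding ctl_def by (rule ou_continuous obs_cont)+
qed

lemma adapted_signals:
 assumes t: "0 \<le> t"
 shows "u t \<in> borel_measurable (\<F> t)" "\<And>s. 0 \<le> s \<Longrightarrow> s \<le> t \<Longrightarrow> Ys s \<in> borel_measurable (\<F> t)"
proof -
 let ?S = "sigs {0..t} :: (real \<times> (real \<Rightarrow> real)) measure" and ?T = "path_space {0..t}"
 note m = drv_measurable(1)[OF t]
 have 1: "sig {0..t} \<in> measurable (\<F> t) ?S" "path Bm {0..t} \<in> measurable (\<F> t) ?T"
  using measurable_compose[OF m measurable_fst] measurable_compose[OF m measurable_snd] by simp_all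
 have "u t = (\<lambda>w. ou \<tau> \<beta> t (sig {0..t} w))" using u_sig(1)[of t "{0..t}"] by auto
 then show "u t \<in> borel_measurable (\<F> t)" using measurable_compose[OF 1(1) measurable_ou[of t "{0..t}"]] by simp
 fix s assume s: "0 \<le> s" "s \<le> t"
 have "Ys s = (\<lambda>w. obs s (sig {0..t} w) + path Bm {0..t} w s)"
  using s by (auto simp: Ys_def path_def H_sig(1)[of s "{0..t}"])
 moreover have "(\<lambda>w. obs s (sig {0..t} w)) \<in> borel_measurable (\<F> t)"
  by (rule measurable_compose[OF 1(1) measurable_obs]) (use s in auto)
 moreover have "(\<lambda>w. path Bm {0..t} w s) \<in> borel_measurable (\<F> t)"
  by (rule measurable_compose[OF 1(2) measurable_component_singleton]) (use s in auto)
 ultimately show "Ys s \<in> borel_measurable (\<F> t)" by simp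
qed

abbreviation "SIG \<equiv> sigs {0..} :: (real \<times> (real \<Rightarrow> real)) measure"
abbreviation "DRV \<equiv> SIG \<Otimes>\<^sub>M path_space {0..}"
abbreviation "drvI w \<equiv> (sig {0..} w, path Bm {0..} w)"

definition cutoff :: "real \<Rightarrow> (real \<times> (real \<Rightarrow> real)) \<times> (real \<Rightarrow> real) \<Rightarrow> (real \<times> (real \<Rightarrow> real)) \<times> (real \<Rightarrow> real)" where
 "cutoff q e = ((fst (fst e), restrict (snd (fst e)) {0..q}), restrict (snd e) {0..q})"

lemma measurable_cutoff: "cutoff q \<in> measurable DRV (sigs {0..q} \<Otimes>\<^sub>M path_space {0..q})"
 unfolding cutoff_def[abs_def]
 by (intro measurable_Pair measurable_compose[OF measurable_fst measurable_fst] measurable_compose[OF measurable_snd]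
   measurable_compose[OF measurable_compose[OF measurable_fst measurable_snd]] measurable_restrict_subset) auto

lemma cutoff_drv: "cutoff q (drvI w) = drv q w"
 by (auto simp: cutoff_def sig_def path_def fun_eq_iff)

lemma drvI_measurable: "drvI \<in> measurable M DRV"
 by (intro measurable_Pair sig_measurable path_measurable) auto

lemma drvI_law: "distr M DRV drvI = distr M SIG (sig {0..}) \<Otimes>\<^sub>M distr M (path_space {0..}) (path Bm {0..})"
 using indep_sig_Bm by (simp add: indep_pair_def)

text \<open>Initial value and thermal noise are independent of the measurement noise, so the latter
  may be drawn from an independent sample point; almost sure statements can then be read with the
  signal frozen.\<close>

lemma AE_drvI_pair:
 assumes G: "Measurable.pred DRV G" shows "(AE w in M. G (drvI w)) \<longleftrightarrow> (AE w in M. AE w' in M. G (sig {0..} w, path Bm {0..} w'))"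
proof -
 interpret MM: pair_prob_space M M ..
 have sm: "sig {0..} \<in> measurable M SIG" and bm: "path Bm {0..} \<in> measurable M (path_space {0..})"
  by (intro sig_measurable path_measurable; simp)+
 let ?h = "\<lambda>z. (sig {0..} (fst z), path Bm {0..} (snd z))"
 have hm: "?h \<in> measurable (M \<Otimes>\<^sub>M M) DRV"
  by (intro measurable_Pair measurable_compose[OF measurable_fst sm] measurable_compose[OF measurable_snd bm])
 have law: "distr M DRV drvI = distr (M \<Otimes>\<^sub>M M) DRV ?h"
  unfolding drvI_law using pair_measure_distr[OF sm bm prob_space_imp_sigma_finite[OF prob_space_distr[OF bm]]] by (simp add: case_prod_beta')
 have Gs: "{x \<in> space DRV. G x} \<in> sets DRV" using G by (simp add: pred_def)
 have "(AE w in M. G (drvI w)) \<longleftrightarrow> (AE e in distr M DRV drvI. G e)"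
  by (rule AE_distr_iff[symmetric, OF drvI_measurable Gs])
 also have "... \<longleftrightarrow> (AE z in M \<Otimes>\<^sub>M M. G (?h z))" unfolding law by (rule AE_distr_iff[OF hm Gs])
 also have "... \<longleftrightarrow> (AE w in M. AE w' in M. G (sig {0..} w, path Bm {0..} w'))"
  by (rule MM.AE_pair_iff[symmetric, of "\<lambda>x y. G (sig {0..} x, path Bm {0..} y)"])
   (use measurable_compose[OF hm G] in \<open>simp add: pred_def\<close>)
 finally show ?thesis .
qed

text \<open>\<open>Gd\<close> says that the representation \<open>Xc\<close> of \<open>Y\<close> by the drivers solves the equation. By Fubini it
 holds for a fixed signal \<open>\<theta>\<close> and almost every noise, and then also for the noise shifted by the
 difference \<open>H - g\<close> of two signals. So \<open>Ys - g\<close> in the noise slot yields a solution.\<close>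

lemma solution_determined:
 assumes sol: "solves v Y" and uniq: "\<And>v' Y'. solves v' Y' \<Longrightarrow> AE w in M. \<forall>t\<ge>0. Y' t w = Y t w"
 shows "\<exists>G. (\<forall>t\<ge>0. G t \<in> borel_measurable (path_space {0..t})) \<and> (AE w in M. \<forall>t\<ge>0. Y t w = G t (path Ys {0..t} w))"
proof -
 have Yc: "continuous_on {0..} (\<lambda>t. Y t w)" if "w \<in> space M" for w using sol that by (auto simp: solves_def)
 have "\<exists>F. 0 \<le> q \<longrightarrow> F \<in> borel_measurable (sigs {0..q} \<Otimes>\<^sub>M path_space {0..q}) \<and> (AE w in M. Y q w = F (drv q w))" for q
  using driver_factor[of q "Y q"] sol unfolding solves_def by blast
 then have "\<forall>q. \<exists>F. 0 \<le> q \<longrightarrow> F \<in> borel_measurable (sigs {0..q} \<Otimes>\<^sub>M path_space {0..q}) \<and> (AE w in M. Y q w = F (drv q w))" by blast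
 then obtain F where "\<forall>q. 0 \<le> q \<longrightarrow> F q \<in> borel_measurable (sigs {0..q} \<Otimes>\<^sub>M path_space {0..q}) \<and> (AE w in M. Y q w = F q (drv q w))"
  by (rule choice[THEN exE])
 then have F: "\<And>q. 0 \<le> q \<Longrightarrow> F q \<in> borel_measurable (sigs {0..q} \<Otimes>\<^sub>M path_space {0..q})"
  "\<And>q. 0 \<le> q \<Longrightarrow> AE w in M. Y q w = F q (drv q w)" by blast+
 define X where "X q e = F q (cutoff q e)" for q e
 have Xm: "X q \<in> borel_measurable DRV" if "q \<in> dyadics" for q
  unfolding X_def using measurable_compose[OF measurable_cutoff F(1)] countable_dyadics(2)[OF that] by auto
 have YX: "AE w in M. \<forall>q\<in>dyadics. Y q w = X q (drvI w)"
  unfolding X_def cutoff_drv by (rule AE_ball_countable[OF countable_dyadics(1), THEN iffD2]) (use F(2) countable_dyadics(2) in blast)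
 define UC where "UC e \<longleftrightarrow> dyadic_uc (\<lambda>q. X q e)" for e
 define Xc where "Xc t e = (if UC e then lim (\<lambda>n. X (dyad n t) e) else 0)" for t e
 have UCm: "Measurable.pred DRV UC"
 proof -
  have "Measurable.pred DRV (\<lambda>e. Q \<longrightarrow> \<bar>X p e - X q e\<bar> \<le> c)" if "p \<in> dyadics" "q \<in> dyadics" for p q Q and c :: real
  proof -
   note [measurable] = Xm[OF that(1)] Xm[OF that(2)]
   show ?thesis by measurable
  qed
  then show ?thesis unfolding UC_def[abs_def] dyadic_uc_def
   by (intro pred_intros_countable pred_dyadics)
 qed
 have Xcc: "continuous_on {0..} (\<lambda>t. Xc t e)" for e
  using dyadic_uc_extension(2)[of "\<lambda>q. X q e"] by (cases "UC e") (auto simp: Xc_def UC_def)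
 have Xcm: "Xc t \<in> borel_measurable DRV" for t
  unfolding Xc_def[abs_def]
  by (rule measurable_If[OF borel_measurable_lim_metric _ UCm[unfolded pred_def]]) (auto intro: Xm dyad(4))
 have YXc: "\<forall>t\<ge>0. Y t w = Xc t (drvI w)" "UC (drvI w)" if om: "w \<in> space M" "\<forall>q\<in>dyadics. Y q w = X q (drvI w)" for w
 proof -
  show uc: "UC (drvI w)" unfolding UC_def by (rule continuous_dyadic_uc[OF Yc[OF om(1)]]) (use om in auto)
  show "\<forall>t\<ge>0. Y t w = Xc t (drvI w)"
  proof (intro allI impI)
   fix t :: real assume t: "0 \<le> t"
   have "(\<lambda>n. X (dyad n t) (drvI w)) \<longlonglongrightarrow> Y t w"
    using continuous_dyad_lim[OF Yc[OF om(1)] t] om(2) dyad(4) by simp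
   then show "Y t w = Xc t (drvI w)" using uc by (simp add: Xc_def limI)
  qed
 qed
 \<comment> \<open>Integer horizons for integrability and dyadic times for the equation keep
   \<open>Gd\<close> a countable conjunction, hence measurable.\<close>
 define Gd where "Gd e \<longleftrightarrow> UC e \<and> (\<forall>N::nat. set_integrable lborel {0..real N} (\<lambda>s. f s (path Xc {0..} e))) \<and>
   (\<forall>q\<in>dyadics. Xc q e = obs q (fst e) + snd e q + obs q (ctl Xc e))" for e
 have Gdm: "Measurable.pred DRV Gd"
 proof -
  have 1: "Measurable.pred DRV (\<lambda>e. set_integrable lborel {0..real N} (\<lambda>s. f s (path Xc {0..} e)))" for N
   unfolding pred_def by (rule prim_measurable(2)[OF Xcm Xcc]) auto
  have 2: "Measurable.pred DRV (\<lambda>e. Xc q e = obs q (fst e) + snd e q + obs q (ctl Xc e))" if q: "q \<in> dyadics" for q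
  proof -
   have q0: "0 \<le> q" by (rule countable_dyadics(2)[OF q])
   have [measurable]: "(\<lambda>e. obs q (fst e)) \<in> borel_measurable DRV"
    by (rule measurable_compose[OF measurable_fst measurable_obs]) (use q0 in auto)
   have [measurable]: "(\<lambda>e. snd e q) \<in> borel_measurable DRV"
    by (rule measurable_compose[OF measurable_snd measurable_component_singleton]) (use q0 in auto)
   have [measurable]: "(\<lambda>e. obs q (ctl Xc e)) \<in> borel_measurable DRV"
    by (rule ctl_measurable(2)[OF Xcm Xcc q0])
   note [measurable] = Xcm
   show ?thesis by measurable
  qed
  show ?thesis unfolding Gd_def[abs_def]
   by (intro pred_intros_logic UCm pred_intros_countable pred_dyadics 1 2)
 qed
 have GdY: "AE w in M. Gd (drvI w)"
  using YX AE_space sol[unfolded solves_def, THEN conjunct2, THEN conjunct2]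
 proof eventually_elim
  case (elim w)
  note yx = YXc[OF elim(2,1)]
  have pe: "path Xc {0..} (drvI w) = path Y {0..} w" using yx(1) by (auto simp: path_def fun_eq_iff)
  then have "ctl Xc (drvI w) = ctl Y w" by (simp add: ctl_def)
  moreover have "Ys q w = obs q (sig {0..} w) + path Bm {0..} w q" if "0 \<le> q" for q
   using that by (simp add: Ys_def H_def path_def)
  ultimately show ?case using elim(3) yx countable_dyadics(2) by (simp add: Gd_def pe)
 qed
 have "AE w0 in M. AE w in M. Gd (sig {0..} w0, path Bm {0..} w)" using GdY unfolding AE_drvI_pair[OF Gdm] .
 then have "AE w0 in M. (AE w in M. Gd (sig {0..} w0, path Bm {0..} w)) \<and> good w0 \<and> w0 \<in> space M"
  using AE_good AE_space by eventually_elim simp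
 then have "\<exists>w0. (AE w in M. Gd (sig {0..} w0, path Bm {0..} w)) \<and> good w0 \<and> w0 \<in> space M"
  by (rule eventually_happens'[rotated]) (simp add: ae_filter_eq_bot_iff emeasure_space_1)
 then obtain w0 where om0: "AE w in M. Gd (sig {0..} w0, path Bm {0..} w)" "good w0" "w0 \<in> space M" by blast
 define \<theta> where "\<theta> = sig {0..} w0"
 have \<theta>S: "\<theta> \<in> space SIG" unfolding \<theta>_def by (rule measurable_space[OF sig_measurable om0(3)]) auto
 define g where "g s = H s w0" for s
 have gobs: "obs s \<theta> = g s" for s by (simp add: g_def H_def \<theta>_def)
 define sh where "sh h = (\<theta>, \<lambda>s\<in>{0..}. h s)" for h :: "real \<Rightarrow> real"
 \<comment> \<open>\<open>Gd\<close> is local in time: up to a horizon it depends only on the noise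
   up to that horizon. This is needed because the shift is known to have finite energy only when
   stopped at \<open>N\<close>, while the equation must hold for all times.\<close>
 have sh_local: "Gd (sh h)" if *: "\<And>N::nat. \<exists>h'. Gd (sh h') \<and> (\<forall>s. 0 \<le> s \<and> s \<le> real N \<longrightarrow> h' s = h s)" for h
 proof -
  have X1: "X q (sh h') = X q (sh h)" if "\<forall>s. 0 \<le> s \<and> s \<le> N \<longrightarrow> h' s = h s" "q \<le> N" for q N h'
  proof -
   have "restrict (snd (sh h')) {0..q} = restrict (snd (sh h)) {0..q}" using that by (auto simp: sh_def fun_eq_iff restrict_def)
   then have "cutoff q (sh h') = cutoff q (sh h)" by (simp add: cutoff_def) (simp add: sh_def)
   then show ?thesis by (simp add: X_def)
  qed
  have uc: "UC (sh h)"
   unfolding UC_def dyadic_uc_def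
  proof (intro allI)
   fix N k :: nat
   obtain h' where h': "Gd (sh h')" "\<forall>s. 0 \<le> s \<and> s \<le> real N \<longrightarrow> h' s = h s" using *[of N] by blast
   then obtain m where "\<forall>p\<in>dyadics. \<forall>q\<in>dyadics. p \<le> real N \<and> q \<le> real N \<and> \<bar>p - q\<bar> < 1 / Suc m \<longrightarrow> \<bar>X p (sh h') - X q (sh h')\<bar> \<le> 1 / Suc k"
    unfolding Gd_def UC_def dyadic_uc_def by blast
   then show "\<exists>m. \<forall>p\<in>dyadics. \<forall>q\<in>dyadics. p \<le> real N \<and> q \<le> real N \<and> \<bar>p - q\<bar> < 1 / Suc m \<longrightarrow> \<bar>X p (sh h) - X q (sh h)\<bar> \<le> 1 / Suc k"
    using X1[OF h'(2)] by (intro exI[of _ m]) simp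
  qed
  have Xc1: "Xc t (sh h') = Xc t (sh h)" if "Gd (sh h')" "\<forall>s. 0 \<le> s \<and> s \<le> N \<longrightarrow> h' s = h s" "0 \<le> t" "t \<le> N" for t N h'
  proof -
   have "X (dyad n t) (sh h') = X (dyad n t) (sh h)" for n
    using X1[OF that(2)] dyad(2)[OF that(3), of n] that(4) by simp
   then show ?thesis using uc that(1) by (simp add: Xc_def Gd_def)
  qed
  have "set_integrable lborel {0..real N} (\<lambda>s. f s (path Xc {0..} (sh h)))" for N
  proof -
   obtain h' where h': "Gd (sh h')" "\<forall>s. 0 \<le> s \<and> s \<le> real N \<longrightarrow> h' s = h s" using *[of N] by blast
   have "set_integrable lborel {0..real N} (\<lambda>s. f s (path Xc {0..} (sh h'))) \<longleftrightarrow> set_integrable lborel {0..real N} (\<lambda>s. f s (path Xc {0..} (sh h)))"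
    by (rule prim_local(2)[where Y=Xc and Y'=Xc and w="sh h'" and w'="sh h", OF Xcc Xcc]) (rule Xc1[OF h'])
   then show ?thesis using h' by (simp add: Gd_def)
  qed
  moreover have "Xc q (sh h) = obs q (fst (sh h)) + snd (sh h) q + obs q (ctl Xc (sh h))" if q: "q \<in> dyadics" for q
  proof -
   have q0: "0 \<le> q" by (rule countable_dyadics(2)[OF q])
   obtain N :: nat where N: "q \<le> N" using real_arch_simple by blast
   obtain h' where h': "Gd (sh h')" "\<forall>s. 0 \<le> s \<and> s \<le> real N \<longrightarrow> h' s = h s" using *[of N] by blast
   have "obs q (ctl Xc (sh h')) = obs q (ctl Xc (sh h))"
    by (rule ctl_local[where Y=Xc and Y'=Xc and w="sh h'" and w'="sh h", OF Xcc Xcc _ q0]) (use Xc1[OF h'] N in auto)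
   moreover have "snd (sh h') q = snd (sh h) q" "fst (sh h') = fst (sh h)" using h'(2) q0 N by (auto simp: sh_def)
   ultimately show ?thesis using h'(1) q Xc1[OF h' q0 N] by (simp add: Gd_def)
  qed
  ultimately show ?thesis using uc by (simp add: Gd_def)
 qed
 define e' where "e' w = sh (\<lambda>s. Ys s w - g s)" for w
 have "AE w in M. Gd (e' w)"
 proof -
  \<comment> \<open>For an independent pair of signal and noise this is \<open>Gd\<close> at the
    noise shifted by the difference of two noiseless observations; at the actual drivers the noise
    slot becomes \<open>Ys - g\<close>.\<close>
  define G2 where "G2 e \<longleftrightarrow> Gd (sh (\<lambda>s. snd e s + obs s (fst e) - g s))" for e
  have "(\<lambda>e. sh (\<lambda>s. snd e s + obs s (fst e) - g s)) \<in> measurable DRV DRV"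
   unfolding sh_def
   by (intro measurable_Pair measurable_const \<theta>S measurable_restrict borel_measurable_diff borel_measurable_add
     measurable_compose[OF measurable_snd measurable_component_singleton] measurable_compose[OF measurable_fst measurable_obs]) auto
  then have G2m: "Measurable.pred DRV G2" unfolding G2_def[abs_def] by (rule measurable_compose[OF _ Gdm])
  have G2e: "G2 (sig {0..} w1, path Bm {0..} w2) \<longleftrightarrow> Gd (sh (\<lambda>s. Bm s w2 + (H s w1 - g s)))" for w1 w2
  proof -
   have "sh (\<lambda>s. path Bm {0..} w2 s + obs s (sig {0..} w1) - g s) = sh (\<lambda>s. Bm s w2 + (H s w1 - g s))"
    by (auto simp: sh_def path_def H_def fun_eq_iff)
   then show ?thesis by (simp add: G2_def)
  qed
  have "AE w1 in M. AE w2 in M. G2 (sig {0..} w1, path Bm {0..} w2)"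
   using AE_good
  proof eventually_elim
   case (elim w1)
   define \<eta> where "\<eta> s = H s w1 - g s" for s
   have H0: "H 0 w = 0" if "good w" for w using that obs_0 by (simp add: H_sig(2) good_def)
   have \<eta>0: "\<eta> 0 = 0" using H0 elim om0(2) by (simp add: \<eta>_def g_def)
   have "AE w2 in M. Gd (sh (\<lambda>s. Bm s w2 + \<eta> (min s (real N))))" for N :: nat
   proof -
    obtain K1 where K1: "K1 \<ge> 0" "\<And>r s. 0 \<le> r \<and> r \<le> s \<and> s \<le> real N \<Longrightarrow> \<bar>H s w1 - H r w1\<bar> \<le> K1 * (s - r)" using H_lipschitz[OF elim] by blast
    obtain K2 where K2: "K2 \<ge> 0" "\<And>r s. 0 \<le> r \<and> r \<le> s \<and> s \<le> real N \<Longrightarrow> \<bar>H s w0 - H r w0\<bar> \<le> K2 * (s - r)" using H_lipschitz[OF om0(2)] by blast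
    define A where "A = {om \<in> space (path_space {0..}). \<not> Gd (\<theta>, om)}"
    have Am: "A \<in> sets (path_space {0..})"
    proof -
     have "Measurable.pred (path_space {0..}) (\<lambda>om. Gd (\<theta>, om))" by (rule measurable_compose[OF measurable_Pair1'[OF \<theta>S] Gdm])
     then have "Measurable.pred (path_space {0..}) (\<lambda>om. \<not> Gd (\<theta>, om))" by (rule pred_intros_logic)
     then show ?thesis unfolding A_def pred_def .
    qed
    have ps: "path Z {0..} w \<in> space (path_space {0..})" for Z :: "real \<Rightarrow> 'a \<Rightarrow> real" and w by (auto simp: path_def space_PiM)
    have "AE w2 in M. path (\<lambda>s w. Bm s w + \<eta> (min s (real N))) {0..} w2 \<notin> A"
    proof (rule brownian_shift_null[OF Bm, where t="real N" and K="K1 + K2"])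
     show "AE w in M. path Bm {0..} w \<notin> A" using om0(1) by eventually_elim (simp add: A_def \<theta>_def)
     fix r s :: real assume rs: "0 \<le> r" "r \<le> s"
     define r' s' where "r' = min r (real N)" and "s' = min s (real N)"
     have "0 \<le> r' \<and> r' \<le> s' \<and> s' \<le> real N" using rs by (auto simp: r'_def s'_def)
     from K1(2)[OF this] K2(2)[OF this]
     have "\<bar>\<eta> s' - \<eta> r'\<bar> \<le> K1 * (s' - r') + K2 * (s' - r')" unfolding \<eta>_def g_def by linarith
     then show "\<bar>\<eta> (min s (real N)) - \<eta> (min r (real N))\<bar> \<le> (K1 + K2) * (min s (real N) - min r (real N))"
      by (simp add: r'_def s'_def distrib_right)
    qed (use K1 K2 \<eta>0 Am in auto)
    then show ?thesis
    proof eventually_elim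
     case (elim w2)
     have "path (\<lambda>s w. Bm s w + \<eta> (min s (real N))) {0..} w2 = (\<lambda>s\<in>{0..}. Bm s w2 + \<eta> (min s (real N)))" by (simp add: path_def)
     then show ?case using elim ps[of "\<lambda>s w. Bm s w + \<eta> (min s (real N))" w2] by (simp add: A_def sh_def)
    qed
   qed
   then have "AE w2 in M. \<forall>N::nat. Gd (sh (\<lambda>s. Bm s w2 + \<eta> (min s (real N))))" by (simp add: AE_all_countable)
   then show ?case
   proof eventually_elim
    case (elim w2)
    show ?case unfolding G2e \<eta>_def[symmetric]
    proof (rule sh_local)
     fix N :: nat
     show "\<exists>h'. Gd (sh h') \<and> (\<forall>s. 0 \<le> s \<and> s \<le> real N \<longrightarrow> h' s = Bm s w2 + \<eta> s)"
      by (rule exI[of _ "\<lambda>s. Bm s w2 + \<eta> (min s (real N))"]) (use elim in \<open>simp add: min_def\<close>)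
    qed
   qed
  qed
  then have "AE w in M. G2 (drvI w)" by (subst AE_drvI_pair[OF G2m])
  then show ?thesis
  proof eventually_elim
   case (elim w)
   have "(\<lambda>s. Bm s w + (H s w - g s)) = (\<lambda>s. Ys s w - g s)" by (simp add: Ys_def fun_eq_iff)
   then show ?case using elim unfolding G2e by (simp only: e'_def)
  qed
 qed
 then have "AE w in M. good w \<and> Gd (e' w)" using AE_good by eventually_elim simp
 then obtain N0 where N0: "N0 \<in> null_sets M" "\<And>w. w \<in> space M \<Longrightarrow> w \<notin> N0 \<Longrightarrow> good w \<and> Gd (e' w)"
  by (elim AE_E3) auto
 \<comment> \<open>With the fixed \<open>\<theta>\<close> in the signal slot, the representation
   becomes a functional of the uncontrolled observations alone.\<close>
 define Gq where "Gq q y = F q ((fst \<theta>, restrict (snd \<theta>) {0..q}), \<lambda>s\<in>{0..q}. y s - g s)" for q y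
 have Gqm: "Gq q \<in> borel_measurable (path_space {0..t})" if "0 \<le> q" "q \<le> t" for q t
  unfolding Gq_def
 proof (rule measurable_compose[OF _ F(1)[OF that(1)]])
  have "(fst \<theta>, restrict (snd \<theta>) {0..q}) \<in> space (sigs {0..q})" by (simp add: space_pair_measure space_PiM)
  then show "(\<lambda>y. ((fst \<theta>, restrict (snd \<theta>) {0..q}), \<lambda>s\<in>{0..q}. y s - g s)) \<in> measurable (path_space {0..t}) (sigs {0..q} \<Otimes>\<^sub>M path_space {0..q})"
   by (intro measurable_Pair measurable_const measurable_restrict borel_measurable_diff measurable_component_singleton) (use that in auto)
 qed
 have XG: "X q (e' w) = Gq q (path Ys {0..t} w)" if "0 \<le> q" "q \<le> t" for q t w
 proof -
  have "restrict (snd (e' w)) {0..q} = (\<lambda>s\<in>{0..q}. path Ys {0..t} w s - g s)" using that by (auto simp: e'_def sh_def path_def fun_eq_iff)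
  moreover have "fst (e' w) = \<theta>" by (simp add: e'_def sh_def)
  ultimately show ?thesis by (simp add: X_def cutoff_def Gq_def)
 qed
 define G where "G t y = lim (\<lambda>n. Gq (dyad n t) y)" for t y
 have Gm: "G t \<in> borel_measurable (path_space {0..t})" if "0 \<le> t" for t
  unfolding G_def[abs_def] by (intro borel_measurable_lim_metric Gqm dyad that)
 \<comment> \<open>Off \<open>N0\<close> this is a functional of \<open>Ys\<close> at every sample
   point; the value 0 on \<open>N0\<close> preserves adaptedness, because the augmented filtration
   contains \<open>N0\<close>.\<close>
 define Y' where "Y' t w = (if w \<in> N0 then 0 else Xc t (e' w))" for t w
 have Y'G: "Y' t w = (if w \<in> N0 then 0 else G t (path Ys {0..t} w))" if "w \<in> space M" "0 \<le> t" for t w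
 proof (cases "w \<in> N0")
  case False
  then have "UC (e' w)" using N0(2)[OF that(1)] by (simp add: Gd_def)
  then show ?thesis using False XG[OF dyad(1,2)[OF that(2)]] by (simp add: Y'_def Xc_def G_def)
 qed (simp add: Y'_def)
 have Y'c: "continuous_on {0..} (\<lambda>t. Y' t w)" for w using Xcc by (cases "w \<in> N0") (auto simp: Y'_def)
 have Y'p: "path Y' {0..} w = path Xc {0..} (e' w)" if "w \<notin> N0" for w using that by (simp add: path_def Y'_def)
 have Y'i: "set_integrable lborel {0..t} (\<lambda>s. f s (path Y' {0..} w))" if "w \<in> space M" "w \<notin> N0" "0 \<le> t" for t w
 proof -
  obtain N :: nat where N: "t \<le> N" using real_arch_simple by blast
  have "set_integrable lborel {0..real N} (\<lambda>s. f s (path Xc {0..} (e' w)))" using N0(2)[OF that(1,2)] by (simp add: Gd_def)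
  from set_integrable_mono_nonneg[OF this that(3) N] show ?thesis unfolding Y'p[OF that(2)] .
 qed
 define v' where "v' t w = (if w \<in> N0 then 0 else u t w + ou \<tau> \<beta> t (ctl Y' w))" for t w
 have Y'eq: "Y' t w = Ys t w + obs t (ctl Y' w)" if om: "w \<in> space M" "w \<notin> N0" and t: "0 \<le> t" for t w
 proof -
  have g': "good w" "Gd (e' w)" using N0(2)[OF om] by auto
  have ctl: "ctl Y' w = ctl Xc (e' w)" by (simp add: ctl_def Y'p[OF om(2)])
  have c: "continuous_on {0..} (\<lambda>t. Ys t w + obs t (ctl Y' w))"
   by (intro continuous_on_add good_Ys(1) g' ctl_path_cont(2) Y'i om)
  have "Y' q w = Ys q w + obs q (ctl Y' w)" if q: "q \<in> dyadics" for q
  proof -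
   have "Xc q (e' w) = obs q (fst (e' w)) + snd (e' w) q + obs q (ctl Xc (e' w))" using g'(2) q by (simp add: Gd_def)
   then show ?thesis using countable_dyadics(2)[OF q] om(2) by (simp add: Y'_def ctl) (simp add: e'_def sh_def gobs)
  qed
  then have "(\<lambda>n. Y' (dyad n t) w) \<longlonglongrightarrow> Ys t w + obs t (ctl Y' w)"
   using continuous_dyad_lim[OF c t] dyad(4) by simp
  then show ?thesis using continuous_dyad_lim[OF Y'c t] LIMSEQ_unique by blast
 qed
 have "solves v' Y'"
  unfolding solves_def
 proof (intro conjI ballI allI impI)
  fix w assume om: "w \<in> space M"
  show "continuous_on {0..} (\<lambda>t. Y' t w)" by (rule Y'c)
  show "continuous_on {0..} (\<lambda>t. v' t w)"
  proof (cases "w \<in> N0")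
   case False
   have "continuous_on {0..} (\<lambda>t. ou \<tau> \<beta> t (v0 w, \<lambda>s. B s w) + ou \<tau> \<beta> t (ctl Y' w))"
    using N0(2)[OF om False] by (intro continuous_on_add ou_continuous ctl_path_cont(1) Y'i om False) (auto simp: good_def)
   then show ?thesis using False by (simp add: v'_def u_sig(2))
  qed (simp add: v'_def)
 next
  fix t :: real assume t: "0 \<le> t"
  have N0s: "N0 \<inter> space M = N0" using N0(1) sets.sets_into_space[of N0 M] by auto
  have N0m: "N0 \<in> sets (\<F> s)" for s using N0(1) sets_driver_filtration(4) by blast
  have Y'm: "Y' s \<in> borel_measurable (\<F> t)" if "0 \<le> s" "s \<le> t" for s
  proof -
   have "path Ys {0..s} \<in> measurable (\<F> t) (path_space {0..s})"
    unfolding path_def[abs_def] using adapted_signals(2)[OF t] that by (intro measurable_restrict) auto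
   from measurable_compose[OF this Gm[OF that(1)]]
   have "(\<lambda>w. if w \<in> N0 then 0 else G s (path Ys {0..s} w)) \<in> borel_measurable (\<F> t)"
    using N0m by (intro measurable_If_set) (auto simp: space_driver_filtration N0s)
   then show ?thesis by (rule measurable_cong[THEN iffD2, rotated]) (simp add: space_driver_filtration Y'G that)
  qed
  show "Y' t \<in> borel_measurable (\<F> t)" by (rule Y'm) (use t in auto)
  have "(\<lambda>w. u t w + ou \<tau> \<beta> t (ctl Y' w)) \<in> borel_measurable (\<F> t)"
   by (intro borel_measurable_add adapted_signals(1)[OF t] ctl_measurable(1)[OF Y'm Y'c t])
  then show "v' t \<in> borel_measurable (\<F> t)"
   unfolding v'_def[abs_def] using N0m by (intro measurable_If_set) (auto simp: space_driver_filtration N0s)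
 next
  have "AE w in M. w \<notin> N0" by (rule AE_not_in[OF N0(1)])
  then show "AE w in M. \<forall>t\<ge>0. set_integrable lborel {0..t} (\<lambda>s. f s (path Y' {0..} w)) \<and>
    v' t w = u t w + ou \<tau> \<beta> t (ctl Y' w) \<and> Y' t w = Ys t w + obs t (ctl Y' w)"
   using AE_space by eventually_elim (simp add: Y'i Y'eq v'_def)
 qed
 from uniq[OF this] AE_not_in[OF N0(1)] AE_space
 have "AE w in M. \<forall>t\<ge>0. Y t w = G t (path Ys {0..t} w)"
  by eventually_elim (simp add: Y'G)
 then show ?thesis using Gm by blast
qed

end

section \<open>Entropy and estimation error under control\<close>

lemma (in gaussian_drivers) sets_driver_filtration_subset: "0 \<le> t \<Longrightarrow> sets (\<F> t) \<subseteq> sets M"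
proof -
 assume t: "0 \<le> t"
 have v: "sets (vimage_algebra (space M) g S) \<subseteq> sets M" if "g \<in> measurable M S" for g and S :: "'s measure"
  using that measurable_space[OF that] by (auto simp: sets_vimage_algebra2 intro: measurable_sets)
 have "{0..t} \<subseteq> {0..}" by auto
 then have "sets (vimage_algebra (space M) v0 borel) \<union> sets (vimage_algebra (space M) (path B {0..t}) (path_space {0..t})) \<union>
    sets (vimage_algebra (space M) (path Bm {0..t}) (path_space {0..t})) \<union> null_sets M \<subseteq> sets M"
  using v[OF v0_measurable] v[OF path_measurable(1)] v[OF path_measurable(2)] by (simp add: null_sets_def)
 then show ?thesis unfolding driver_filtration_def sets_measure_of[OF driver_filtration_gen] by (rule sets.sigma_sets_subset)
qed

text \<open>Each time has its own exceptional null set; the dyadic times up to \<open>t\<close> are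
  countably many and determine a continuous path. \<open>dyad\<close> rounds down, so the
  approximating times stay inside \<open>{0..t}\<close>.\<close>

lemma AE_path_factor:
 fixes X :: "real \<Rightarrow> 'a \<Rightarrow> real"
 assumes t: "0 \<le> t" and X: "AE w in M. continuous_on {0..} (\<lambda>s. X s w)"
  and F: "\<And>s. 0 \<le> s \<Longrightarrow> s \<le> t \<Longrightarrow> \<exists>F\<in>borel_measurable S. AE w in M. X s w = F (T w)"
 shows "\<exists>K\<in>measurable S (path_space {0..t}). AE w in M. path X {0..t} w = K (T w)"
proof -
 have "\<forall>s. \<exists>F. 0 \<le> s \<and> s \<le> t \<longrightarrow> F \<in> borel_measurable S \<and> (AE w in M. X s w = F (T w))" using F by blast
 then obtain F where F: "\<forall>s. 0 \<le> s \<and> s \<le> t \<longrightarrow> F s \<in> borel_measurable S \<and> (AE w in M. X s w = F s (T w))" by (rule choice[THEN exE])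
 have "countable (dyadics \<inter> {..t})" using countable_dyadics(1) by simp
 then have ae: "AE w in M. \<forall>q\<in>dyadics \<inter> {..t}. X q w = F q (T w)"
  by (rule AE_ball_countable[THEN iffD2]) (use F countable_dyadics(2) in auto)
 define K where "K y = (\<lambda>s\<in>{0..t}. lim (\<lambda>n. F (dyad n s) y))" for y
 have "K \<in> measurable S (path_space {0..t})"
  unfolding K_def[abs_def]
 proof (intro measurable_restrict borel_measurable_lim_metric)
  fix s n assume s: "s \<in> {0..t}"
  then have "0 \<le> dyad n s" "dyad n s \<le> t" using dyad(1,2)[of s n] by auto
  then show "F (dyad n s) \<in> borel_measurable S" using F by blast
 qed
 moreover have "AE w in M. path X {0..t} w = K (T w)"
  using ae X
 proof eventually_elim
  case (elim w)
  have "X s w = lim (\<lambda>n. F (dyad n s) (T w))" if s: "s \<in> {0..t}" for s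
  proof -
   have "dyad n s \<in> dyadics \<inter> {..t}" for n using dyad(2)[of s n] dyad(4)[of n s] s by auto
   then have "(\<lambda>n. F (dyad n s) (T w)) \<longlonglongrightarrow> X s w" using continuous_dyad_lim[OF elim(2), of s] s elim(1) by simp
   then show ?thesis by (simp add: limI)
  qed
  then show ?case by (auto simp: K_def path_def fun_eq_iff)
 qed
 ultimately show ?thesis by blast
qed

context kalman_control
begin

context
 fixes v Y
 assumes sol: "solves v Y" and uniq: "\<And>v' Y'. solves v' Y' \<Longrightarrow> AE w in M. \<forall>t\<ge>0. Y' t w = Y t w"
begin

lemma Y_facts:
 shows "w \<in> space M \<Longrightarrow> continuous_on {0..} (\<lambda>t. Y t w)"
  "0 \<le> t \<Longrightarrow> v t \<in> borel_measurable M" "0 \<le> t \<Longrightarrow> Y t \<in> borel_measurable M"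
  "path Y {0..t} \<in> measurable M (path_space {0..t})"
  "AE w in M. \<forall>t\<ge>0. v t w = u t w + ou \<tau> \<beta> t (ctl Y w) \<and> Y t w = Ys t w + obs t (ctl Y w)"
proof -
 show "w \<in> space M \<Longrightarrow> continuous_on {0..} (\<lambda>t. Y t w)" using sol by (auto simp: solves_def)
 have sub: "X \<in> borel_measurable M" if "X \<in> borel_measurable (\<F> t)" "0 \<le> t" for X :: "'a \<Rightarrow> real" and t
  using measurable_mono[OF order_refl refl sets_driver_filtration_subset[OF that(2)] space_driver_filtration] that(1) by auto
 show "0 \<le> t \<Longrightarrow> v t \<in> borel_measurable M" by (rule sub[of _ t]) (use sol in \<open>simp_all add: solves_def\<close>)
 show Ym: "0 \<le> t \<Longrightarrow> Y t \<in> borel_measurable M" for t by (rule sub[of _ t]) (use sol in \<open>simp_all add: solves_def\<close>)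
 show "path Y {0..t} \<in> measurable M (path_space {0..t})"
  unfolding path_def[abs_def] using Ym by (intro measurable_restrict) auto
 show "AE w in M. \<forall>t\<ge>0. v t w = u t w + ou \<tau> \<beta> t (ctl Y w) \<and> Y t w = Ys t w + obs t (ctl Y w)"
  using sol[unfolded solves_def, THEN conjunct2, THEN conjunct2] by eventually_elim blast
qed

abbreviation "FY t \<equiv> vimage_algebra (space M) (path Y {0..t}) (path_space {0..t})"

lemma FY_measurable:
 shows "path Y {0..t} \<in> measurable (FY t) (path_space {0..t})" "subalgebra M (FY t)"
  "\<And>s. 0 \<le> s \<Longrightarrow> s \<le> t \<Longrightarrow> Y s \<in> borel_measurable (FY t)"
proof -
 show 1: "path Y {0..t} \<in> measurable (FY t) (path_space {0..t})"
  using measurable_space[OF Y_facts(4)] by (intro measurable_vimage_algebra1) auto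
 show "subalgebra M (FY t)"
  unfolding subalgebra_def using measurable_sets[OF Y_facts(4)] measurable_space[OF Y_facts(4)]
  by (auto simp: sets_vimage_algebra2)
 fix s assume s: "0 \<le> s" "s \<le> t"
 have "(\<lambda>w. path Y {0..t} w s) \<in> borel_measurable (FY t)"
  by (rule measurable_compose[OF 1 measurable_component_singleton]) (use s in auto)
 then show "Y s \<in> borel_measurable (FY t)" using s by (simp add: path_def)
qed

lemma ctl_FY: "0 \<le> s \<Longrightarrow> s \<le> t \<Longrightarrow> (\<lambda>w. ou \<tau> \<beta> s (ctl Y w)) \<in> borel_measurable (FY t)"
  "0 \<le> s \<Longrightarrow> s \<le> t \<Longrightarrow> (\<lambda>w. obs s (ctl Y w)) \<in> borel_measurable (FY t)"
 by (intro ctl_measurable FY_measurable(3) Y_facts(1); simp)+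

text \<open>The control is computed from \<open>Y\<close> itself, so its contribution can be
  subtracted.\<close>

lemma Ys_of_Y:
 assumes t: "0 \<le> t"
 shows "\<exists>K\<in>measurable (path_space {0..t}) (path_space {0..t}). AE w in M. path Ys {0..t} w = K (path Y {0..t} w)"
proof (rule AE_path_factor[OF t])
 show "AE w in M. continuous_on {0..} (\<lambda>s. Ys s w)" using AE_good by eventually_elim (rule good_Ys)
 fix s assume s: "0 \<le> s" "s \<le> t"
 have "(\<lambda>w. Y s w - obs s (ctl Y w)) \<in> borel_measurable (FY t)"
  using s by (intro borel_measurable_diff FY_measurable(3) ctl_FY(2))
 then have "\<exists>F\<in>borel_measurable (path_space {0..t}). AE w in M. Y s w - obs s (ctl Y w) = F (path Y {0..t} w)"
 proof (rule AE_factor[OF Y_facts(4), rotated 2])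
  fix A assume "A \<in> sets (FY t)"
  then obtain E where "E \<in> sets (path_space {0..t})" "A = path Y {0..t} -` E \<inter> space M"
   using measurable_space[OF Y_facts(4)] by (auto simp: sets_vimage_algebra2)
  then show "\<exists>E\<in>sets (path_space {0..t}). AE w in M. w \<in> A \<longleftrightarrow> path Y {0..t} w \<in> E" by (intro bexI[of _ E]) auto
 qed simp
 then obtain F where F: "F \<in> borel_measurable (path_space {0..t})" "AE w in M. Y s w - obs s (ctl Y w) = F (path Y {0..t} w)" by blast
 have "AE w in M. Ys s w = F (path Y {0..t} w)" using F(2) Y_facts(5) by eventually_elim (use s in auto)
 then show "\<exists>F\<in>borel_measurable (path_space {0..t}). AE w in M. Ys s w = F (path Y {0..t} w)" using F(1) by blast
qed

lemma Y_of_Ys: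
 assumes t: "0 \<le> t"
 shows "\<exists>K\<in>measurable (path_space {0..t}) (path_space {0..t}). AE w in M. path Y {0..t} w = K (path Ys {0..t} w)"
proof -
 have "\<exists>G. (\<forall>t\<ge>0. G t \<in> borel_measurable (path_space {0..t})) \<and> (AE w in M. \<forall>t\<ge>0. Y t w = G t (path Ys {0..t} w))"
  by (rule solution_determined[OF sol]) (rule uniq)
 then obtain G where G: "\<And>s. 0 \<le> s \<Longrightarrow> G s \<in> borel_measurable (path_space {0..s})" "AE w in M. \<forall>s\<ge>0. Y s w = G s (path Ys {0..s} w)" by blast
 show ?thesis
 proof (rule AE_path_factor[OF t])
  show "AE w in M. continuous_on {0..} (\<lambda>s. Y s w)" using AE_space by eventually_elim (rule Y_facts(1))
  fix s assume s: "0 \<le> s" "s \<le> t"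
  have "(\<lambda>y. G s (restrict y {0..s})) \<in> borel_measurable (path_space {0..t})"
   by (rule measurable_compose[OF measurable_restrict_subset G(1)[OF s(1)]]) (use s in auto)
  moreover have r: "restrict (path Ys {0..t} w) {0..s} = path Ys {0..s} w" for w using s by (auto simp: path_def fun_eq_iff)
  have "AE w in M. Y s w = G s (restrict (path Ys {0..t} w) {0..s})" unfolding r using G(2) by eventually_elim (use s in simp)
  ultimately show "\<exists>F\<in>borel_measurable (path_space {0..t}). AE w in M. Y s w = F (path Ys {0..t} w)"
   by (intro bexI[of _ "\<lambda>y. G s (restrict y {0..s})"])
 qed
qed

text \<open>The contribution of the control to \<open>v\<close> is known from \<open>Y\<close>;
  subtracting it, together with the filter of the recovered uncontrolled observation, leaves exactly
  the uncontrolled error. That error has mean 0 and is independent of \<open>Ys\<close>, hence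
  orthogonal to every event of \<open>Y\<close>.\<close>

lemma cond_mean_error:
 assumes t: "0 \<le> t" and vi: "integrable M (v t)"
 shows "(LINT w|M. (v t w - cond_mean M v Y t w)^2) = P t"
proof -
 obtain K where K: "K \<in> measurable (path_space {0..t}) (path_space {0..t})" "AE w in M. path Ys {0..t} w = K (path Y {0..t} w)"
  using Ys_of_Y[OF t] by blast
 obtain L where L[measurable]: "L \<in> measurable (path_space {0..t}) (path_space {0..t})" and Le: "AE w in M. path Y {0..t} w = L (path Ys {0..t} w)"
  using Y_of_Ys[OF t] by blast
 define g where "g w = ou \<tau> \<beta> t (ctl Y w) + hat t (K (path Y {0..t} w))" for w
 have gm: "g \<in> borel_measurable (FY t)"
  unfolding g_def[abs_def]
  by (intro borel_measurable_add ctl_FY t order_refl measurable_compose[OF FY_measurable(1) measurable_compose[OF K(1) measurable_hat]])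
 have vg: "AE w in M. v t w - g w = er t w"
  using Y_facts(5) K(2)
 proof eventually_elim
  case (elim w)
  have "uh t w = hat t (K (path Y {0..t} w))" using elim(2) uh_path[of t "{0..t}" w] by simp
  then show ?case using elim(1) t by (simp add: g_def er_def)
 qed
 interpret FY: finite_measure_subalgebra M "FY t" by unfold_locales (rule FY_measurable(2))
 note [measurable] = measurable_from_subalg[OF FY_measurable(2) gm] Y_facts(2)[OF t]
 have ge: "AE w in M. g w = v t w - er t w" using vg by eventually_elim simp
 have gi: "integrable M g"
  by (rule integrable_cong_AE_imp[OF Bochner_Integration.integrable_diff[OF vi er_moments(3)[OF t]] _ ]) (use ge in auto)
 have "AE w in M. real_cond_exp M (FY t) (v t) w = g w"
 proof (rule FY.real_cond_exp_charact[OF _ vi gi gm])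
  fix A assume A: "A \<in> sets (FY t)"
  then obtain E where E[measurable]: "E \<in> sets (path_space {0..t})" and AE': "A = path Y {0..t} -` E \<inter> space M"
   using measurable_space[OF Y_facts(4)] by (auto simp: sets_vimage_algebra2)
  have Am[measurable]: "A \<in> sets M" using A FY_measurable(2) by (auto simp: subalgebra_def)
  \<comment> \<open>Up to null sets the event \<open>A\<close> of \<open>Y\<close> is an event of
    \<open>Ys\<close>, where independence of the error is known.\<close>
  define h where "h y = (indicator E (L y) :: real)" for y
  have hm: "h \<in> borel_measurable (path_space {0..t})" unfolding h_def[abs_def] by measurable
  have ind: "indep_var borel (er t) borel (\<lambda>w. h (path Ys {0..t} w))"
   using indep_pair_compose[OF er_indep[OF t] measurable_ident_sets[OF refl] hm] by (simp add: indep_pair_def indep_var_distribution_eq)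
  have "(LINT w|M. er t w * h (path Ys {0..t} w)) = (LINT w|M. er t w) * (LINT w|M. h (path Ys {0..t} w))"
  proof (rule indep_var_lebesgue_integral[OF ind er_moments(3)[OF t]])
   show "integrable M (\<lambda>w. h (path Ys {0..t} w))"
    by (rule integrable_const_bound[where B=1]) (use measurable_compose[OF path_Ys_measurable hm] in \<open>auto simp: h_def indicator_def\<close>)
  qed
  then have 0: "(LINT w|M. er t w * h (path Ys {0..t} w)) = 0" using er_moments(4)[OF t] by simp
  have "(\<integral>w\<in>A. v t w \<partial>M) - (\<integral>w\<in>A. g w \<partial>M) = (\<integral>w\<in>A. v t w - g w \<partial>M)"
   by (rule set_integral_diff(2)[symmetric]) (use integrable_mult_indicator[OF Am vi] integrable_mult_indicator[OF Am gi] in \<open>simp_all add: set_integrable_def\<close>)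
  also have "... = (LINT w|M. er t w * h (path Ys {0..t} w))"
   unfolding set_lebesgue_integral_def
  proof (rule integral_cong_AE)
   show "AE w in M. indicat_real A w *\<^sub>R (v t w - g w) = er t w * h (path Ys {0..t} w)"
    using vg Le AE_space by eventually_elim (simp add: AE' h_def indicator_def)
  qed (use measurable_compose[OF path_Ys_measurable hm] in auto)
  finally show "(\<integral>w\<in>A. v t w \<partial>M) = (\<integral>w\<in>A. g w \<partial>M)" using 0 by simp
 qed
 then have "AE w in M. (v t w - cond_mean M v Y t w)^2 = (er t w)^2"
  using vg unfolding cond_mean_def by eventually_elim simp
 moreover have "cond_mean M v Y t \<in> borel_measurable M" unfolding cond_mean_def by simp
 ultimately have "(LINT w|M. (v t w - cond_mean M v Y t w)^2) = (LINT w|M. (er t w)^2)"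
  by (intro integral_cong_AE) auto
 then show ?thesis using er_moments(2)[OF t] by simp
qed

text \<open>The maps \<open>K\<close> and \<open>L\<close> between the two observation paths do not
  involve the signal, so they act on the second factor of joint and product law alike. The upper
  bound is applied to \<open>f\<close> composed with \<open>L\<close>; the test functions of the
  lower bound are composed with \<open>K\<close>.\<close>

lemma transfer_entropy_eq:
 assumes t: "0 \<le> t"
 shows "transfer_entropy M v0 B Y t = ereal (1 / (2 * V) * integral {0..t} P)"
proof -
 let ?S = "sigs {0..t} :: (real \<times> (real \<Rightarrow> real)) measure" and ?T = "path_space {0..t}"
 have sm[measurable]: "sig {0..t} \<in> measurable M ?S" and ysm[measurable]: "path Ys {0..t} \<in> measurable M ?T" by auto
 note ym[measurable] = Y_facts(4)[of t]
 obtain K where K[measurable]: "K \<in> measurable ?T ?T" and Ke: "AE w in M. path Ys {0..t} w = K (path Y {0..t} w)"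
  using Ys_of_Y[OF t] by blast
 obtain L where L[measurable]: "L \<in> measurable ?T ?T" and Le: "AE w in M. path Y {0..t} w = L (path Ys {0..t} w)"
  using Y_of_Ys[OF t] by blast
 have "transfer_entropy M v0 B Y t = mutual_info_nats M ?S ?T (sig {0..t}) (path Y {0..t})"
  by (simp add: transfer_entropy_def sig_def[abs_def])
 also have "... = ereal (1 / (2 * V) * integral {0..t} P)"
 proof (rule mutual_info_nats_eqI[OF sm ym])
  fix f and Kf :: real assume f[measurable]: "f \<in> borel_measurable (?S \<Otimes>\<^sub>M ?T)" and fK: "\<And>z. \<bar>f z\<bar> \<le> Kf"
  have law: "distr M ?T (path Y {0..t}) = distr M ?T (\<lambda>w. L (path Ys {0..t} w))"
   by (rule distr_cong_AE) (use Le in auto)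
  have Q: "distr M ?S (sig {0..t}) \<Otimes>\<^sub>M distr M ?T (path Y {0..t})
   = distr (distr M ?S (sig {0..t}) \<Otimes>\<^sub>M distr M ?T (path Ys {0..t})) (?S \<Otimes>\<^sub>M ?T) (\<lambda>z. (fst z, L (snd z)))"
   unfolding law using pair_distr_compose[OF sm ysm measurable_ident_sets[OF refl] L] by simp
  have "(LINT w|M. f (sig {0..t} w, path Y {0..t} w)) = (LINT w|M. f (sig {0..t} w, L (path Ys {0..t} w)))"
   using Le by (intro integral_cong_AE) auto
  also have "... \<le> 1 / (2 * V) * integral {0..t} P + ln (\<integral>z. exp (f (fst z, L (snd z))) \<partial>(distr M ?S (sig {0..t}) \<Otimes>\<^sub>M distr M ?T (path Ys {0..t})))"
   using sig_channel_dv[OF t, of "\<lambda>z. f (fst z, L (snd z))" Kf] fK by simp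
  also have "(\<integral>z. exp (f (fst z, L (snd z))) \<partial>(distr M ?S (sig {0..t}) \<Otimes>\<^sub>M distr M ?T (path Ys {0..t})))
   = (\<integral>z. exp (f z) \<partial>(distr M ?S (sig {0..t}) \<Otimes>\<^sub>M distr M ?T (path Y {0..t})))"
   unfolding Q by (subst integral_distr) auto
  finally show "(LINT w|M. f (sig {0..t} w, path Y {0..t} w))
   \<le> 1 / (2 * V) * integral {0..t} P + ln (\<integral>z. exp (f z) \<partial>(distr M ?S (sig {0..t}) \<Otimes>\<^sub>M distr M ?T (path Y {0..t})))" .
 next
  fix \<epsilon> :: real assume e: "\<epsilon> > 0"
  obtain n p \<delta> where p: "is_part n p t \<delta>"
   and lo: "1 / (2 * V) * integral {0..t} P - \<epsilon> \<le> (LINT w|M. psi n p (\<lambda>i. u (p i) w) (path Ys {0..t} w))"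
   using psi_lower[OF t e] by blast
  have p0: "p 0 = 0" "p n = t" "\<And>i. i < n \<Longrightarrow> p i < p (Suc i)" using p by (auto simp: is_part_def)
  \<comment> \<open>The sampled signal as a functional of initial value and thermal noise up to
    \<open>t\<close>, so that \<open>\<psi>\<close> can be evaluated under the product law.\<close>
  define x where "x \<theta> = (\<lambda>i\<in>{..<n}. ou \<tau> \<beta> (p i) \<theta>)" for \<theta>
  have xm: "x \<in> measurable ?S (vecs n)"
   unfolding x_def[abs_def] using is_part_range[OF p] by (intro measurable_restrict measurable_ou) auto
  define \<psi> where "\<psi> z = psi n p (x (fst z)) (K (snd z))" for z
  have pm: "(\<lambda>z. psi n p (fst z) (snd z)) \<in> borel_measurable (vecs n \<Otimes>\<^sub>M ?T)"
   by (rule measurable_psi) (use p0 in auto)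
  have "(\<lambda>z. (x (fst z), K (snd z))) \<in> measurable (?S \<Otimes>\<^sub>M ?T) (vecs n \<Otimes>\<^sub>M ?T)"
   by (intro measurable_Pair measurable_compose[OF measurable_fst xm] measurable_compose[OF measurable_snd K])
  from measurable_compose[OF this pm] have \<psi>m[measurable]: "\<psi> \<in> borel_measurable (?S \<Otimes>\<^sub>M ?T)" by (simp add: \<psi>_def[abs_def])
  have \<psi>e: "AE w in M. \<psi> (sig {0..t} w, path Y {0..t} w) = psi n p (\<lambda>i. u (p i) w) (path Ys {0..t} w)"
   using Ke
  proof eventually_elim
   case (elim w)
   have "x (sig {0..t} w) i = u (p i) w" if "i < n" for i
    using that is_part_range[OF p, of i] u_sig(1)[of "p i" "{0..t}" w] by (simp add: x_def)
   then show ?case using elim by (simp add: \<psi>_def psi_def)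
  qed
  have ps: "(\<lambda>w. psi n p (\<lambda>i. u (p i) w) (path Ys {0..t} w)) \<in> borel_measurable M"
   using psi_expectation(1)[OF p] by simp
  have "integrable M (\<lambda>w. \<psi> (sig {0..t} w, path Y {0..t} w))"
   by (rule integrable_cong_AE_imp[OF psi_expectation(1)[OF p]]) (use \<psi>e in auto)
  moreover have "(LINT w|M. \<psi> (sig {0..t} w, path Y {0..t} w)) = (LINT w|M. psi n p (\<lambda>i. u (p i) w) (path Ys {0..t} w))"
   using ps \<psi>e by (intro integral_cong_AE) auto
  moreover have "(\<integral>\<^sup>+z. ennreal (exp (\<psi> z)) \<partial>(distr M ?S (sig {0..t}) \<Otimes>\<^sub>M distr M ?T (path Y {0..t}))) \<le> 1"
  proof -
   interpret s: prob_space "distr M ?S (sig {0..t})" by (rule prob_space_distr) simp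
   interpret y: prob_space "distr M ?T (path Y {0..t})" by (rule prob_space_distr) simp
   have "(\<integral>\<^sup>+z. ennreal (exp (\<psi> z)) \<partial>(distr M ?S (sig {0..t}) \<Otimes>\<^sub>M distr M ?T (path Y {0..t})))
    = (\<integral>\<^sup>+\<theta>. (\<integral>\<^sup>+y. ennreal (exp (\<psi> (\<theta>, y))) \<partial>distr M ?T (path Y {0..t})) \<partial>distr M ?S (sig {0..t}))"
    by (rule y.nn_integral_fst[symmetric]) simp
   also have "... = (\<integral>\<^sup>+\<theta>. 1 \<partial>distr M ?S (sig {0..t}))"
   proof (rule nn_integral_cong)
    fix \<theta> assume \<theta>: "\<theta> \<in> space (distr M ?S (sig {0..t}))"
    then have "(\<lambda>y. \<psi> (\<theta>, y)) \<in> borel_measurable ?T" by (intro measurable_compose[OF measurable_Pair1' \<psi>m]) simp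
    then have "(\<integral>\<^sup>+y. ennreal (exp (\<psi> (\<theta>, y))) \<partial>distr M ?T (path Y {0..t})) = (\<integral>\<^sup>+w. ennreal (exp (\<psi> (\<theta>, path Y {0..t} w))) \<partial>M)"
     by (intro nn_integral_distr) auto
    also have "... = (\<integral>\<^sup>+w. ennreal (exp (psi n p (x \<theta>) (path Ys {0..p n} w))) \<partial>M)"
     using Ke by (intro nn_integral_cong_AE) (auto simp: \<psi>_def p0)
    also have "... = 1" by (rule psi_exp) (use p0 in auto)
    finally show "(\<integral>\<^sup>+y. ennreal (exp (\<psi> (\<theta>, y))) \<partial>distr M ?T (path Y {0..t})) = 1" .
   qed
   also have "... = 1" using s.emeasure_space_1 by simp
   finally show ?thesis by simp
  qed
  ultimately show "\<exists>\<psi>\<in>borel_measurable (?S \<Otimes>\<^sub>M ?T). integrable M (\<lambda>w. \<psi> (sig {0..t} w, path Y {0..t} w)) \<and>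
    (\<integral>\<^sup>+z. ennreal (exp (\<psi> z)) \<partial>(distr M ?S (sig {0..t}) \<Otimes>\<^sub>M distr M ?T (path Y {0..t}))) \<le> 1 \<and>
    1 / (2 * V) * integral {0..t} P - \<epsilon> \<le> (LINT w|M. \<psi> (sig {0..t} w, path Y {0..t} w))"
   using lo \<psi>m by (intro bexI[of _ \<psi>]) auto
 qed
 finally show ?thesis .
qed

end

end

lemma (in kalman_control) strong_solution_iff_solves:
 assumes R: "R > 0" "\<tau> = R * C" "r = R / (\<tau> * \<beta>)" "sqrt (2 * k * T * R) = \<tau> * \<beta>"
 shows "strong_solution M R C T k V v0 B Bm f v Y \<longleftrightarrow> solves v Y"
 unfolding strong_solution_def solves_def
proof (rule conj_cong[OF refl], rule conj_cong[OF refl])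
 assume "\<forall>w\<in>space M. continuous_on {0..} (\<lambda>t. v t w) \<and> continuous_on {0..} (\<lambda>t. Y t w)"
 then have c: "continuous_on {0..} (\<lambda>t. v t w)" if "w \<in> space M" for w using that by blast
 let ?L = "\<lambda>w. v 0 w = v0 w \<and> (\<forall>t\<ge>0. set_integrable lborel {0..t} (\<lambda>s. R * control f Y s w - v s w) \<and>
     R * C * v t w = R * C * v 0 w + (LBINT s:{0..t}. R * control f Y s w - v s w) + sqrt (2 * k * T * R) * B t w \<and>
     Y t w = 1 / sqrt V * (LBINT s:{0..t}. v s w) + Bm t w)"
 let ?R = "\<lambda>w. \<forall>t\<ge>0. set_integrable lborel {0..t} (\<lambda>s. f s (path Y {0..} w)) \<and>
    v t w = u t w + ou \<tau> \<beta> t (ctl Y w) \<and> Y t w = Ys t w + obs t (ctl Y w)"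
 have "AE w in M. ?L w \<longleftrightarrow> ?R w"
  using AE_good AE_space
 proof eventually_elim
  case (elim w)
  then have b: "continuous_on {0..} (\<lambda>t. B t w)" "B 0 w = 0" by (auto simp: good_def)
  show ?case
   using system_iff[OF R(1) b c[OF elim(2)], where x="v0 w" and \<zeta>="\<lambda>s. f s (path Y {0..} w)" and y="\<lambda>t. Y t w" and w="\<lambda>t. Bm t w"]
   unfolding control_def R(2)[symmetric] R(4) R(3)[symmetric] ctl_def
   by (simp add: u_sig(2) Ys_def H_sig(2) add_ac cong: imp_cong)
 qed
 then show "(AE w in M. ?L w) \<longleftrightarrow> (AE w in M. ?R w)" by (rule eventually_subst)
qed

section \<open>Physical constants and conclusion\<close>

text \<open>\<open>P\<close> is any solution of the Riccati equation with the stationary initial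
  value, and both conclusions are expressed by it. This allows inserting either an explicit solution
  or a multiple of a given \<open>Tmin\<close>.\<close>

lemma controlled_channel:
 fixes M :: "'a measure"
 assumes "prob_space M" and pos: "R > 0" "C > 0" "T > 0" "k > 0" "V > 0"
  and drivers: "distributed M lborel v0 (normal_density 0 (sqrt (k * T / C)))"
   "standard_brownian_motion M B" "standard_brownian_motion M Bm" "indep_drivers M v0 B Bm"
  and P: "P 0 = k * T / C" "\<And>t. t \<ge> 0 \<Longrightarrow> (P has_real_derivative - 2 * P t / (R * C) + 2 * k * T * R / (R * C)^2 - (P t)^2 / V) (at t within {0..})"
  and adm: "admissible_control M R C T k V v0 B Bm f" and sol: "strong_solution M R C T k V v0 B Bm f v Y" and t: "0 \<le> t"
 shows "transfer_entropy M v0 B Y t = ereal (1 / (2 * V) * integral {0..t} P)"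
  "(LBINT s:{0..t}. prob_space.expectation M (\<lambda>w. (v s w - cond_mean M v Y s w)^2)) = integral {0..t} P"
proof -
 define \<tau> where "\<tau> = R * C"
 define \<beta> where "\<beta> = sqrt (2 * k * T * R) / \<tau>"
 have \<tau>: "\<tau> > 0" using pos by (simp add: \<tau>_def)
 have \<beta>: "\<beta> > 0" using pos \<tau> by (simp add: \<beta>_def)
 have \<beta>2: "\<beta>^2 = 2 * k * T * R / \<tau>^2" using pos by (simp add: \<beta>_def power_divide)
 \<comment> \<open>The equilibrium variance \<open>k * T / C\<close> is the stationary variance of
   the uncontrolled signal.\<close>
 have bt: "\<beta>^2 * \<tau> / 2 = k * T / C" unfolding \<beta>2 \<tau>_def using pos by (simp add: power2_eq_square)
 have s0: "sqrt (k * T / C) > 0" "(sqrt (k * T / C))^2 = \<beta>^2 * \<tau> / 2"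
  unfolding bt using pos by simp_all
 interpret prob_space M by fact
 interpret kalman_control M v0 B Bm "sqrt (k * T / C)" \<tau> \<beta> V P f "R / (\<tau> * \<beta>)"
 proof unfold_locales
  show "P 0 = \<beta>^2 * \<tau> / 2" unfolding bt by (rule P(1))
  show "(P has_real_derivative - 2 * P t / \<tau> + \<beta>^2 - (P t)^2 / V) (at t within {0..})" if "0 \<le> t" for t
   using P(2)[OF that] by (simp add: \<beta>2 \<tau>_def)
  show "nonanticipative_functional f" using adm by (simp add: admissible_control_def)
 qed (fact drivers pos \<tau> \<beta> s0)+
 have "sqrt (2 * k * T * R) = \<tau> * \<beta>" using \<tau> by (simp add: \<beta>_def)
 note iff = strong_solution_iff_solves[OF pos(1) \<tau>_def refl this]
 obtain v1 Y1 where 1: "solves v1 Y1" "\<And>v' Y'. solves v' Y' \<Longrightarrow> AE w in M. \<forall>t\<ge>0. v' t w = v1 t w \<and> Y' t w = Y1 t w"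
   "\<And>t. 0 \<le> t \<Longrightarrow> (SUP s\<in>{0..t}. \<integral>\<^sup>+w. ennreal ((v1 s w)^2) \<partial>M) < \<infinity>"
  using adm unfolding admissible_control_def iff by blast
 have sv: "solves v Y" using sol iff by simp
 have uniq: "AE w in M. \<forall>t\<ge>0. Y' t w = Y t w" if "solves v' Y'" for v' Y'
  using 1(2)[OF that] 1(2)[OF sv] by eventually_elim simp
 show "transfer_entropy M v0 B Y t = ereal (1 / (2 * V) * integral {0..t} P)"
  by (rule transfer_entropy_eq[OF sv uniq t])
 \<comment> \<open>The moment bound of admissibility is known for the witness solution
   \<open>v1\<close> and is transferred to \<open>v\<close> by uniqueness.\<close>
 have vi: "integrable M (v s)" if s: "0 \<le> s" for s
 proof (rule square_integrable_imp_integrable)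
  show vm[measurable]: "v s \<in> borel_measurable M" by (rule Y_facts(2)[OF sv uniq s])
  have "(\<integral>\<^sup>+w. ennreal ((v s w)^2) \<partial>M) = (\<integral>\<^sup>+w. ennreal ((v1 s w)^2) \<partial>M)"
   using 1(2)[OF sv] by (intro nn_integral_cong_AE) (auto elim!: eventually_mono simp: s)
  also have "... \<le> (SUP s\<in>{0..s}. \<integral>\<^sup>+w. ennreal ((v1 s w)^2) \<partial>M)" using s by (intro SUP_upper) auto
  also have "... < \<infinity>" by (rule 1(3)[OF s])
  finally show "integrable M (\<lambda>w. (v s w)^2)" by (intro integrableI_bounded) auto
 qed
 have "(LBINT s:{0..t}. expectation (\<lambda>w. (v s w - cond_mean M v Y s w)^2)) = (LBINT s:{0..t}. P s)"
  by (rule set_lebesgue_integral_cong) (use cond_mean_error[OF sv uniq _ vi] in auto)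
 also have "... = integral {0..t} P"
  using prim_continuous[OF t P_cont] by (simp add: prim_def)
 finally show "(LBINT s:{0..t}. expectation (\<lambda>w. (v s w - cond_mean M v Y s w)^2)) = integral {0..t} P" .
qed

theorem mainTheorem2:
  fixes M :: "'a measure"
    and R C T k Vmeas \<tau> \<sigma> :: real
    and v0 :: "'a \<Rightarrow> real"
    and B Bm :: "real \<Rightarrow> 'a \<Rightarrow> real"
  assumes "prob_space M"
    and "R > 0" "C > 0" "T > 0" "k > 0" "Vmeas > 0"
    and "\<tau> = R * C" and "\<sigma> = 2 * k * T * R / Vmeas"
    and "distributed M lborel v0 (normal_density 0 (sqrt (k * T / C)))"
    and "standard_brownian_motion M B" and "standard_brownian_motion M Bm"
    and "indep_drivers M v0 B Bm"
  shows "(\<forall>f v Y t.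
            admissible_control M R C T k Vmeas v0 B Bm f \<and>
            strong_solution M R C T k Vmeas v0 B Bm f v Y \<and> 0 \<le> t \<longrightarrow>
              transfer_entropy M v0 B Y t =
                ereal (1 / (2 * Vmeas) *
                  (LBINT s:{0..t}. prob_space.expectation M (\<lambda>\<omega>. (v s \<omega> - cond_mean M v Y s \<omega>)\<^sup>2))) \<and>
              (\<forall>Tmin. Tmin_equation \<tau> \<sigma> T Tmin \<longrightarrow>
                1 / (2 * Vmeas) *
                  (LBINT s:{0..t}. prob_space.expectation M (\<lambda>\<omega>. (v s \<omega> - cond_mean M v Y s \<omega>)\<^sup>2))
                = \<sigma> / (4 * \<tau>) * (LBINT s:{0..t}. Tmin s / T)))
       \<and> (\<forall>f v Y f' v' Y' t.
            admissible_control M R C T k Vmeas v0 B Bm f \<and>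
            strong_solution M R C T k Vmeas v0 B Bm f v Y \<and>
            admissible_control M R C T k Vmeas v0 B Bm f' \<and>
            strong_solution M R C T k Vmeas v0 B Bm f' v' Y' \<and> 0 \<le> t \<longrightarrow>
              transfer_entropy M v0 B Y t = transfer_entropy M v0 B Y' t)"
proof -
 note pos = assms(2-6) and drivers = assms(9-12)
 note channel = controlled_channel[OF assms(1) pos drivers]
 have \<tau>: "\<tau> > 0" using pos assms(7) by simp
 have b2: "(sqrt (2 * k * T * R) / \<tau>)^2 = 2 * k * T * R / (R * C)^2" using pos assms(7) by (simp add: power_divide)
 have "sqrt (2 * k * T * R) / \<tau> > 0" using pos \<tau> by simp
 \<comment> \<open>An explicit solution is supplied because the first identity and the comparison of
   two controls are stated without any \<open>Tmin\<close>.\<close>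
 from riccati_exists[OF \<tau> this pos(5)] obtain P where
  "P 0 = (sqrt (2 * k * T * R) / \<tau>)^2 * \<tau> / 2"
  "\<And>t. t \<ge> 0 \<Longrightarrow> (P has_real_derivative - 2 * P t / \<tau> + (sqrt (2 * k * T * R) / \<tau>)^2 - (P t)^2 / Vmeas) (at t within {0..})"
  by blast
 then have P: "P 0 = k * T / C"
  "\<And>t. t \<ge> 0 \<Longrightarrow> (P has_real_derivative - 2 * P t / (R * C) + 2 * k * T * R / (R * C)^2 - (P t)^2 / Vmeas) (at t within {0..})"
  unfolding b2 using pos by (simp_all add: assms(7) power2_eq_square)
 show ?thesis
 proof (intro conjI allI impI; (elim conjE)?)
  fix f v Y and t :: real
  assume a: "admissible_control M R C T k Vmeas v0 B Bm f" "strong_solution M R C T k Vmeas v0 B Bm f v Y" "0 \<le> t"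
  show "transfer_entropy M v0 B Y t = ereal (1 / (2 * Vmeas) *
    (LBINT s:{0..t}. prob_space.expectation M (\<lambda>w. (v s w - cond_mean M v Y s w)^2)))"
   using channel[OF P a] by simp
  fix Tmin assume Tm: "Tmin_equation \<tau> \<sigma> T Tmin"
  \<comment> \<open>The error variance belonging to the temperature \<open>Tmin\<close>; it solves
    the Riccati equation, so the channel result applies with \<open>Q\<close> in the role of
    \<open>P\<close>.\<close>
  define Q where "Q s = k / C * Tmin s" for s
  have Q0: "Q 0 = k * T / C" using Tm by (simp add: Q_def Tmin_equation_def)
  have Q1: "(Q has_real_derivative - 2 * Q t / (R * C) + 2 * k * T * R / (R * C)^2 - (Q t)^2 / Vmeas) (at t within {0..})" if t': "0 \<le> t" for t
  proof -
   obtain D where D: "(Tmin has_real_derivative D) (at t within {0..})" "\<tau> * D = 2 * (T - Tmin t) - \<sigma> * (Tmin t)^2 / (2 * T)"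
    using Tm t' unfolding Tmin_equation_def by blast
   have De: "D = (2 * (T - Tmin t) - \<sigma> * (Tmin t)^2 / (2 * T)) / \<tau>" using D(2) \<tau> by (simp add: field_simps)
   have "k / C * D = - 2 * Q t / (R * C) + 2 * k * T * R / (R * C)^2 - (Q t)^2 / Vmeas"
    unfolding De using pos by (simp add: Q_def assms(7,8) field_simps power2_eq_square)
   then show ?thesis using DERIV_cmult[OF D(1), of "k / C"] by (simp add: Q_def[abs_def])
  qed
  have "continuous_on {0..} Q" using Q1 by (intro DERIV_continuous_on) auto
  then have "continuous_on {0..} (\<lambda>s. C / (k * T) * Q s)" by (rule continuous_on_mult_left)
  moreover have "C / (k * T) * Q s = Tmin s / T" for s using pos by (simp add: Q_def)
  ultimately have "(LBINT s:{0..t}. Tmin s / T) = integral {0..t} (\<lambda>s. C / (k * T) * Q s)"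
   using prim_continuous[OF a(3), of "\<lambda>s. Tmin s / T"] by (simp add: prim_def)
  then have "\<sigma> / (4 * \<tau>) * (LBINT s:{0..t}. Tmin s / T) = \<sigma> / (4 * \<tau>) * (C / (k * T)) * integral {0..t} Q" by simp
  also have "\<sigma> / (4 * \<tau>) * (C / (k * T)) = 1 / (2 * Vmeas)" using pos by (simp add: assms(7,8) field_simps)
  finally show "1 / (2 * Vmeas) * (LBINT s:{0..t}. prob_space.expectation M (\<lambda>w. (v s w - cond_mean M v Y s w)^2))
    = \<sigma> / (4 * \<tau>) * (LBINT s:{0..t}. Tmin s / T)"
   using channel(2)[OF Q0 Q1 a] by simp
 next
  fix f v Y f' v' Y' and t :: real
  assume "admissible_control M R C T k Vmeas v0 B Bm f" "strong_solution M R C T k Vmeas v0 B Bm f v Y"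
   "admissible_control M R C T k Vmeas v0 B Bm f'" "strong_solution M R C T k Vmeas v0 B Bm f' v' Y'" "0 \<le> t"
  then show "transfer_entropy M v0 B Y t = transfer_entropy M v0 B Y' t"
   using channel(1)[OF P] by metis
 qed
qed

end
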